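(* Let $n$ be a positive integer, $0<p<\infty$, and $A,B\in W^{n-1,q}(D,\mathbb{B})$ with $q>2$. Let $f\in V^{n,p}_{A,B}(D,\mathbb{B})$ have the representation $f=\sum_{k=0}^{n-1}(\widehat{z^*}+\widehat z)^k\varphi_k$ with $\varphi_k\in H_{A,B}(D,\mathbb{B})$, and suppose that for every $k$: $\bar\partial\varphi_k\in L^{q_k}(D,\mathbb{B})$ with $q_k>2$; $\varphi_k=h_k+T_{\mathbb{B}}(A\varphi_k+B\overline{\varphi_k})$ with $h_k\in Hol(D,\mathbb{B})$; and $h_k^+\in H^p_{\gamma_k}(D)$ for some $\gamma_k\in L^{\sigma_k}(D)$, where either $\sigma_k>2$, or $1<\sigma_k\le2$ and $p<\frac{\sigma_k}{2-\sigma_k}$. Then $f$ has a nontangential boundary value $f_{nt}\in L^p(\partial D,\mathbb{B})$ and $$\lim_{r\nearrow1}\int_0^{2\pi}\|f_{nt}(e^{i\theta})-f(re^{i\theta})\|_{\mathbb{B}}^p\,d\theta=0.$$ The result also holds with $q_k$ satisfying $1<q_k\le2$ (for some or all $k$), so long as $p<\frac{q_k}{2-q_k}$ for each such $k$. (Here $\frac{t}{2-t}=\infty$ if $t=2$.)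
   Context: $D$ is the open unit disk in $\mathbb{C}$, $\partial D$ the unit circle. For $u=x+iy\in\mathbb{C}$, $u^*=x-iy$; $\frac{\partial}{\partial z^*}=\frac12(\partial_x+i\partial_y)$. $\mathbb{B}$ denotes the bicomplex numbers: the commutative $\mathbb{C}$-algebra of elements $z_1+jz_2$ with $z_1,z_2\in\mathbb{C}$, $j^2=-1$, $ij=ji$. Put $p^\pm=\frac12(1\pm ij)$. Each $w=z_1+jz_2\in\mathbb{B}$ is uniquely $w=p^+w^++p^-w^-$ with $w^\pm=z_1\mp iz_2\in\mathbb{C}$ (for functions, pointwise), and $\|w\|_{\mathbb{B}}=\sqrt{(|w^+|^2+|w^-|^2)/2}$. $L^q(D,\mathbb{B})$ and $L^p(\partial D,\mathbb{B})$ consist of $\mathbb{B}$-valued functions with $\|\cdot\|_{\mathbb{B}}^q$, resp. $\|\cdot\|_{\mathbb{B}}^p$, integrable; $L^{\sigma}(D)$ is the usual complex-valued Lebesgue space. Bicomplex conjugation is $\overline{z_1+jz_2}=z_1-jz_2$, and $C(f)=\overline f$. The bicomplexification of $u=x+iy$ is $\widehat u=x+jy\in\mathbb{B}$; thus $\widehat z+\widehat{z^*}=2x$. $W^{n-1,q}(D,\mathbb{B})$ is the Sobolev space of $\mathbb{B}$-valued functions on $D$ whose components are in the usual Sobolev space $W^{n-1,q}(D)$ (with $W^{0,q}=L^q$). $\bar\partial=\frac12(\partial_x+j\partial_y)$. $Hol(D,\mathbb{B})$ is the set of $f:D\to\mathbb{B}$ with $\bar\partial f=0$, equivalently with $(f^+)^*$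 and $f^-$ ordinary holomorphic functions. For $0<p<\infty$, $\|f\|_{H^p_{\mathbb{B}}}=\sup_{0<r<1}\left(\int_0^{2\pi}\|f(re^{i\theta})\|_{\mathbb{B}}^p\,d\theta\right)^{1/p}$. $H_{A,B}(D,\mathbb{B})$ is the set of $f:D\to\mathbb{B}$ with $\bar\partial f=Af+B\overline f$. $V^{n,p}_{A,B}(D,\mathbb{B})$ is the set of $f:D\to\mathbb{B}$ with $(\bar\partial-A-BC(\cdot))^nf=0$ and $\sum_{k=0}^{n-1}\|(\bar\partial-A-BC(\cdot))^kf\|_{H^p_{\mathbb{B}}}<\infty$. For $\gamma:D\to\mathbb{C}$, $H^p_\gamma(D)$ is the set of $u:D\to\mathbb{C}$ with $\frac{\partial u}{\partial z^*}=\gamma$ and $\sup_{0<r<1}\int_0^{2\pi}|u(re^{i\theta})|^p\,d\theta<\infty$. Derivatives are understood in the weak sense, the iterates being locally integrable functions obtained successively, and solutions and iterates are taken with their continuous representatives. The bicomplex Theodorescu operator is $$T_{\mathbb{B}}(g)(z)=p^+\left(-\frac1\pi\iint_D\frac{g^+(\zeta)}{\zeta^*-z^*}\,d\xi\,d\eta\right)+p^-\left(-\frac1\pi\iint_D\frac{g^-(\zeta)}{\zeta-z}\,d\xi\,d\eta\right),\quad \zeta=\xi+i\eta.$$ A function $f$ on $D$ has nontangential boundary value $f_{nt}$ if for almost every $\theta$, $f(z)\to f_{nt}(e^{i\theta})$ as $z\to e^{i\theta}$ within every nontangential approach region (Stolz angle) at $e^{i\theta}$. *)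

theory Defs
  imports "HOL-Analysis.Analysis"
begin

text \<open>
  \<open>Bicomplex z1 z2\<close> is $z_1 + j z_2$ with $j^2 = -1$ and $ij = ji$.
\<close>

datatype bicomplex = Bicomplex (bc1: complex) (bc2: complex)

lemma bicomplex_eq_iff: "x = y \<longleftrightarrow> bc1 x = bc1 y \<and> bc2 x = bc2 y"
  by (cases x; cases y) auto

instantiation bicomplex :: comm_ring_1
begin
definition "0 = Bicomplex 0 0"
definition "1 = Bicomplex 1 0"
definition "x + y = Bicomplex (bc1 x + bc1 y) (bc2 x + bc2 y)"
definition "x - y = Bicomplex (bc1 x - bc1 y) (bc2 x - bc2 y)"
definition "- x = Bicomplex (- bc1 x) (- bc2 x)"
definition "x * y = Bicomplex (bc1 x * bc1 y - bc2 x * bc2 y) (bc1 x * bc2 y + bc2 x * bc1 y)"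
instance
  by standard
    (auto simp: bicomplex_eq_iff zero_bicomplex_def one_bicomplex_def plus_bicomplex_def
      minus_bicomplex_def uminus_bicomplex_def times_bicomplex_def algebra_simps)
end

lemma bc_sel [simp]:
  "bc1 0 = 0" "bc2 0 = 0" "bc1 1 = 1" "bc2 1 = 0"
  "bc1 (x + y) = bc1 x + bc1 y" "bc2 (x + y) = bc2 x + bc2 y"
  "bc1 (x - y) = bc1 x - bc1 y" "bc2 (x - y) = bc2 x - bc2 y"
  "bc1 (- x) = - bc1 x" "bc2 (- x) = - bc2 x"
  "bc1 (x * y) = bc1 x * bc1 y - bc2 x * bc2 y"
  "bc2 (x * y) = bc1 x * bc2 y + bc2 x * bc1 y"
  by (simp_all add: zero_bicomplex_def one_bicomplex_def plus_bicomplex_def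
      minus_bicomplex_def uminus_bicomplex_def times_bicomplex_def)

definition bplus :: "bicomplex \<Rightarrow> complex" where
  "bplus w = bc1 w - \<i> * bc2 w"

definition bminus :: "bicomplex \<Rightarrow> complex" where
  "bminus w = bc1 w + \<i> * bc2 w"

instantiation bicomplex :: real_algebra_1
begin
definition "r *\<^sub>R x = Bicomplex (r *\<^sub>R bc1 x) (r *\<^sub>R bc2 x)"
instance
  by standard (auto simp: bicomplex_eq_iff scaleR_bicomplex_def algebra_simps)
end

lemma bc_scaleR [simp]:
  "bc1 (r *\<^sub>R x) = r *\<^sub>R bc1 x" "bc2 (r *\<^sub>R x) = r *\<^sub>R bc2 x"
  by (simp_all add: scaleR_bicomplex_def)

lemma bicomplex_norm_aux:
  "((cmod (bplus w))\<^sup>2 + (cmod (bminus w))\<^sup>2) / 2 = inner (bc1 w) (bc1 w) + inner (bc2 w) (bc2 w)"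
  unfolding bplus_def bminus_def cmod_power2 inner_complex_def
  by (simp add: power2_eq_square algebra_simps)

instantiation bicomplex :: real_inner
begin
definition norm_bicomplex :: "bicomplex \<Rightarrow> real" where
  "norm w = sqrt (((cmod (bplus w))\<^sup>2 + (cmod (bminus w))\<^sup>2) / 2)"
definition inner_bicomplex :: "bicomplex \<Rightarrow> bicomplex \<Rightarrow> real" where
  "inner x y = inner (bc1 x) (bc1 y) + inner (bc2 x) (bc2 y)"
definition sgn_bicomplex :: "bicomplex \<Rightarrow> bicomplex" where
  "sgn (x::bicomplex) = x /\<^sub>R norm x"
definition dist_bicomplex :: "bicomplex \<Rightarrow> bicomplex \<Rightarrow> real" where
  "dist (x::bicomplex) y = norm (x - y)"
definition uniformity_bicomplex :: "(bicomplex \<times> bicomplex) filter" where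
  "uniformity = (INF e\<in>{0<..}. principal {(x::bicomplex, y). dist x y < e})"
definition open_bicomplex :: "bicomplex set \<Rightarrow> bool" where
  "open (U::bicomplex set) \<longleftrightarrow> (\<forall>x\<in>U. eventually (\<lambda>(x', y). x' = x \<longrightarrow> y \<in> U) uniformity)"
instance
proof
  fix x y z :: bicomplex and r :: real
  show "inner x y = inner y x" by (simp add: inner_bicomplex_def inner_commute)
  show "inner (x + y) z = inner x z + inner y z"
    by (simp add: inner_bicomplex_def inner_add_left)
  show "inner (r *\<^sub>R x) y = r * inner x y"
    by (simp add: inner_bicomplex_def algebra_simps)
  show "0 \<le> inner x x" by (simp add: inner_bicomplex_def)
  show "(inner x x = 0) = (x = 0)"
    by (simp add: inner_bicomplex_def bicomplex_eq_iff add_nonneg_eq_0_iff)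
  show "norm x = sqrt (inner x x)"
    by (simp only: norm_bicomplex_def bicomplex_norm_aux inner_bicomplex_def)
qed (simp_all only: sgn_bicomplex_def dist_bicomplex_def uniformity_bicomplex_def
      open_bicomplex_def)
end

instantiation bicomplex :: euclidean_space
begin
definition "Basis = (\<lambda>b. Bicomplex b 0) ` Basis \<union> (\<lambda>b. Bicomplex 0 b) ` Basis"
instance
proof
  show "(Basis :: bicomplex set) \<noteq> {}" "finite (Basis :: bicomplex set)"
    by (simp_all add: Basis_bicomplex_def)
  show "inner u v = (if u = v then 1 else 0)" if "u \<in> Basis" "v \<in> Basis" for u v :: bicomplex
    using that by (auto simp: Basis_bicomplex_def inner_bicomplex_def inner_Basis
        dest: nonzero_Basis split: if_splits)
  show "(\<forall>u\<in>Basis. inner x u = 0) \<longleftrightarrow> x = 0" for x :: bicomplex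
    by (simp add: Basis_bicomplex_def inner_bicomplex_def ball_Un euclidean_all_zero_iff
        bicomplex_eq_iff)
qed
end

definition bc_of_complex :: "complex \<Rightarrow> bicomplex" where
  "bc_of_complex z = Bicomplex z 0"

definition bj :: bicomplex where
  "bj = Bicomplex 0 1"

definition p_plus :: bicomplex where
  "p_plus = bc_of_complex (1/2) * (1 + bc_of_complex \<i> * bj)"

definition p_minus :: bicomplex where
  "p_minus = bc_of_complex (1/2) * (1 - bc_of_complex \<i> * bj)"

lemma bicomplex_idempotent_decomposition:
  "w = p_plus * bc_of_complex (bplus w) + p_minus * bc_of_complex (bminus w)"
  by (simp add: bicomplex_eq_iff p_plus_def p_minus_def bc_of_complex_def bj_def
      bplus_def bminus_def algebra_simps)

definition bconj :: "bicomplex \<Rightarrow> bicomplex" where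
  "bconj w = Bicomplex (bc1 w) (- bc2 w)"

definition bchat :: "complex \<Rightarrow> bicomplex" where
  "bchat u = Bicomplex (of_real (Re u)) (of_real (Im u))"

abbreviation udisc :: "complex set" where
  "udisc \<equiv> ball 0 1"

text \<open>Functions on the disc are total functions whose values outside \<open>udisc\<close> are never used.\<close>

definition Lspace :: "real \<Rightarrow> 'b::euclidean_space set \<Rightarrow> ('b \<Rightarrow> 'a::euclidean_space) set" where
  "Lspace q S = {f. f \<in> borel_measurable (lebesgue_on S) \<and>
                    integrable (lebesgue_on S) (\<lambda>x. norm (f x) powr q)}"

definition loc_integrable :: "(complex \<Rightarrow> 'a::euclidean_space) \<Rightarrow> bool" where
  "loc_integrable f \<longleftrightarrow> (\<forall>K. compact K \<and> K \<subseteq> udisc \<longrightarrow> integrable (lebesgue_on K) f)"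

definition pdx :: "(complex \<Rightarrow> real) \<Rightarrow> complex \<Rightarrow> real" where
  "pdx u z = frechet_derivative u (at z) 1"

definition pdy :: "(complex \<Rightarrow> real) \<Rightarrow> complex \<Rightarrow> real" where
  "pdy u z = frechet_derivative u (at z) \<i>"

primrec Ck :: "nat \<Rightarrow> (complex \<Rightarrow> real) \<Rightarrow> bool" where
  "Ck 0 u \<longleftrightarrow> continuous_on UNIV u"
| "Ck (Suc k) u \<longleftrightarrow> u differentiable_on UNIV \<and> Ck k (pdx u) \<and> Ck k (pdy u)"

definition test_fun :: "(complex \<Rightarrow> real) \<Rightarrow> bool" where
  "test_fun u \<longleftrightarrow> (\<forall>k. Ck k u) \<and> compact (closure {z. u z \<noteq> 0}) \<and> closure {z. u z \<noteq> 0} \<subseteq> udisc"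

text \<open>\<open>g\<close> is the weak partial derivative $\partial_x^a \partial_y^b f$ on the disc.\<close>

definition has_weak_partial ::
  "nat \<Rightarrow> nat \<Rightarrow> (complex \<Rightarrow> 'a::euclidean_space) \<Rightarrow> (complex \<Rightarrow> 'a) \<Rightarrow> bool" where
  "has_weak_partial a b f g \<longleftrightarrow> loc_integrable f \<and> loc_integrable g \<and>
     (\<forall>u. test_fun u \<longrightarrow>
        (\<integral>z. (pdx ^^ a) ((pdy ^^ b) u) z *\<^sub>R f z \<partial>lebesgue_on udisc) =
        (-1) ^ (a + b) *\<^sub>R (\<integral>z. u z *\<^sub>R g z \<partial>lebesgue_on udisc))"

definition Sobolev :: "nat \<Rightarrow> real \<Rightarrow> (complex \<Rightarrow> complex) set" where
  "Sobolev m q = {f \<in> Lspace q udisc.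
     \<forall>a b. a + b \<le> m \<longrightarrow> (\<exists>g \<in> Lspace q udisc. has_weak_partial a b f g)}"

definition Sobolev_bc :: "nat \<Rightarrow> real \<Rightarrow> (complex \<Rightarrow> bicomplex) set" where
  "Sobolev_bc m q = {f. (\<lambda>z. bc1 (f z)) \<in> Sobolev m q \<and> (\<lambda>z. bc2 (f z)) \<in> Sobolev m q}"

text \<open>
  \<open>g\<close> is $\frac12(\partial_x + e\,\partial_y) f$ in the weak sense on the disc. The operator is
  tested as a whole; the separate partial derivatives of \<open>f\<close> need not be functions.
\<close>

definition has_weak_CR ::
  "'a \<Rightarrow> (complex \<Rightarrow> 'a::{euclidean_space,real_algebra_1}) \<Rightarrow> (complex \<Rightarrow> 'a) \<Rightarrow> bool" where
  "has_weak_CR e f g \<longleftrightarrow> loc_integrable f \<and> loc_integrable g \<and>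
     (\<forall>u. test_fun u \<longrightarrow>
        (\<integral>z. (1/2) *\<^sub>R (pdx u z *\<^sub>R f z + pdy u z *\<^sub>R (e * f z)) \<partial>lebesgue_on udisc) =
        - (\<integral>z. u z *\<^sub>R g z \<partial>lebesgue_on udisc))"

abbreviation has_weak_dbar :: "(complex \<Rightarrow> bicomplex) \<Rightarrow> (complex \<Rightarrow> bicomplex) \<Rightarrow> bool" where
  "has_weak_dbar \<equiv> has_weak_CR bj"

abbreviation has_weak_dzstar :: "(complex \<Rightarrow> complex) \<Rightarrow> (complex \<Rightarrow> complex) \<Rightarrow> bool" where
  "has_weak_dzstar \<equiv> has_weak_CR \<i>"

text \<open>Intended for \<open>a > 0\<close> only, where the power of \<open>\<infinity>\<close> is \<open>\<infinity>\<close>.\<close>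

definition ennpowr :: "ennreal \<Rightarrow> real \<Rightarrow> ennreal" where
  "ennpowr x a = (if x = \<infinity> then \<infinity> else ennreal (enn2real x powr a))"

definition Hp_norm :: "real \<Rightarrow> (complex \<Rightarrow> bicomplex) \<Rightarrow> ennreal" where
  "Hp_norm p f = (SUP r\<in>{0<..<1::real}.
     ennpowr (\<integral>\<^sup>+\<theta>. ennreal (norm (f (of_real r * cis \<theta>)) powr p) \<partial>lebesgue_on {0..2*pi}) (1/p))"

definition Hol_bc :: "(complex \<Rightarrow> bicomplex) set" where
  "Hol_bc = {f. continuous_on udisc f \<and> has_weak_dbar f (\<lambda>_. 0)}"

definition H_AB :: "(complex \<Rightarrow> bicomplex) \<Rightarrow> (complex \<Rightarrow> bicomplex) \<Rightarrow> (complex \<Rightarrow> bicomplex) set" where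
  "H_AB A B = {f. continuous_on udisc f \<and> has_weak_dbar f (\<lambda>z. A z * f z + B z * bconj (f z))}"

text \<open>\<open>g\<close> is $(\overline\partial - A - B\,C(\cdot)) f$.\<close>

definition is_vekua_op ::
  "(complex \<Rightarrow> bicomplex) \<Rightarrow> (complex \<Rightarrow> bicomplex) \<Rightarrow>
   (complex \<Rightarrow> bicomplex) \<Rightarrow> (complex \<Rightarrow> bicomplex) \<Rightarrow> bool" where
  "is_vekua_op A B f g \<longleftrightarrow>
     (\<exists>d. has_weak_dbar f d \<and> (\<forall>z\<in>udisc. g z = d z - A z * f z - B z * bconj (f z)))"

text \<open>
  \<open>G k\<close> is the continuous representative of $(\overline\partial - A - B\,C(\cdot))^k f$; it is
  determined by \<open>f\<close> on the disc.
\<close>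

definition V_AB ::
  "nat \<Rightarrow> real \<Rightarrow> (complex \<Rightarrow> bicomplex) \<Rightarrow> (complex \<Rightarrow> bicomplex) \<Rightarrow>
   (complex \<Rightarrow> bicomplex) set" where
  "V_AB n p A B = {f. \<exists>G :: nat \<Rightarrow> complex \<Rightarrow> bicomplex. G 0 = f \<and>
     (\<forall>k\<le>n. continuous_on udisc (G k)) \<and>
     (\<forall>k<n. is_vekua_op A B (G k) (G (Suc k))) \<and>
     (\<forall>z\<in>udisc. G n z = 0) \<and>
     (\<Sum>k<n. Hp_norm p (G k)) < \<infinity>}"

text \<open>
  Unlike above, continuity is not imposed: for \<open>\<gamma>\<close> merely in some $L^\sigma$ with $\sigma \le 2$
  a solution need not have a continuous representative.
\<close>

definition H_gamma :: "real \<Rightarrow> (complex \<Rightarrow> complex) \<Rightarrow> (complex \<Rightarrow> complex) set" where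
  "H_gamma p \<gamma> = {u. has_weak_dzstar u \<gamma> \<and>
     (SUP r\<in>{0<..<1::real}.
        \<integral>\<^sup>+\<theta>. ennreal (cmod (u (of_real r * cis \<theta>)) powr p) \<partial>lebesgue_on {0..2*pi}) < \<infinity>}"

definition theodorescu :: "(complex \<Rightarrow> bicomplex) \<Rightarrow> complex \<Rightarrow> bicomplex" where
  "theodorescu g z =
     p_plus * bc_of_complex
       (- 1 / of_real pi * (\<integral>\<zeta>. bplus (g \<zeta>) / (cnj \<zeta> - cnj z) \<partial>lebesgue_on udisc)) +
     p_minus * bc_of_complex
       (- 1 / of_real pi * (\<integral>\<zeta>. bminus (g \<zeta>) / (\<zeta> - z) \<partial>lebesgue_on udisc))"

definition stolz :: "real \<Rightarrow> complex \<Rightarrow> complex set" where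
  "stolz \<alpha> \<zeta> = {z \<in> udisc. cmod (z - \<zeta>) < \<alpha> * (1 - cmod z)}"

definition nt_boundary_value :: "(complex \<Rightarrow> bicomplex) \<Rightarrow> (complex \<Rightarrow> bicomplex) \<Rightarrow> bool" where
  "nt_boundary_value f fnt \<longleftrightarrow>
     (AE \<theta> in lebesgue_on {0..2*pi}. \<forall>\<alpha>>1. (f \<longlongrightarrow> fnt (cis \<theta>)) (at (cis \<theta>) within stolz \<alpha> (cis \<theta>)))"

definition Lp_circle :: "real \<Rightarrow> (complex \<Rightarrow> bicomplex) set" where
  "Lp_circle p = {g. (\<lambda>\<theta>. g (cis \<theta>)) \<in> Lspace p {0..2*pi}}"

definition crit_exponent :: "real \<Rightarrow> ereal" where
  "crit_exponent t = (if t = 2 then \<infinity> else ereal (t / (2 - t)))"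

end

theory Submission
  imports Defs "HOL-Complex_Analysis.Complex_Analysis" "HOL-Real_Asymp.Real_Asymp"
begin

text \<open>
  Since $\widehat z + \widehat{z^*} = 2x$ is real with $\overline\partial(2x) = 1$, applying
  $\overline\partial - A - BC(\cdot)$ repeatedly to $f = \sum_k (2x)^k \varphi_k$ differentiates
  formally in $2x$. The system of iterates is triangular, so every $\varphi_k$ has bounded
  $p$-means on circles, and it suffices to treat a single $\varphi = h + T_{\mathbb B}(g)$ with
  $g = A\varphi + B\overline\varphi$.

  The potential of $g \in L^s$ is in $L^p$ of every circle $|z| = r$ with $r \in [1/2, 1]$, uniformly
  in $r$. Hence $(h^+)^*$ and $h^-$ are in the classical Hardy space $H^p$, so they have
  nontangential limits and their nontangential maximal functions are in $L^p$.

  When $s \le 2$ the potential of a general $g \in L^s$ has no nontangential limits. Here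
  $|g| \le a\,|\varphi|$ with $a \in L^q$, $q > 2$, and this bounds $\varphi$ on Stolz angles near the
  boundary by the maximal function of $h$ and the potential of $g$ at the vertex; the potential then converges
  at every vertex where it is finite. The same bound dominates $|\varphi(re^{i\theta})|^p$ by
  an integrable function of $\theta$, and dominated convergence gives the limit in $L^p$.
\<close>

section \<open>Test functions on the disc\<close>

text \<open>Neither convexity nor duality is at hand for p < 1, so every boundary statement is
  reduced to square means. The maximal inequality is proved in L^2 only, for a kernel whose products
  are controlled by the triangle inequality alone. For general p, |F|^(p/2) is dominated by the real
  part of a function H with bounded square means; writing F = G H^(2/p) with |G| <= 1 carries
  nontangential limits from H^2 to H^p without dividing out zeros. H is a limit of polynomials whose
  real parts approximate boundary data of dilations, so harmonic conjugates come for free. The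
  condition p < s/(2 - s) acts through the choice of exponents that make one power of 1/|z|
  integrable along circles and another one over area. The exponent q > 2 of the coefficients makes
  the potential of |A| + |B| over small discs uniformly small, which is what permits the absorption
  near a boundary point. Weak derivatives are tested against functions generated from exp(-1/t)/t^m,
  a class rich enough to contain mollifiers and approximate indicators of boxes.\<close>

definition bump :: "nat \<Rightarrow> real \<Rightarrow> real" where
  "bump m t = (if t > 0 then exp (- (1 / t)) / t ^ m else 0)"

text \<open>Prepares the derivative at 0, where the difference quotient has to vanish. With N = m +
  2, exp(1/t) dominates (1/(N t))^N, which beats t^m with two powers of t to spare.\<close>

lemma bump_le_square:
  assumes "\<bar>t\<bar> \<le> 1"
  shows "\<bar>bump m t\<bar> \<le> real (m + 2) ^ (m + 2) * t\<^sup>2"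
proof (cases "t > 0")
  case True
  let ?n = "m + 2"
  have "(1 / (real ?n * t)) ^ ?n \<le> (1 + (1 / t) / real ?n) ^ ?n"
    using True by (intro power_mono) (auto simp: field_simps)
  also have "\<dots> \<le> exp (1 / t)"
    by (rule exp_ge_one_plus_x_over_n_power_n) (use True in \<open>auto intro: order_trans[of _ 0]\<close>)
  finally have "1 / (real ?n ^ ?n * t ^ ?n) \<le> exp (1 / t)"
    by (simp only: power_divide power_mult_distrib power_one)
  then have "exp (- (1 / t)) \<le> real ?n ^ ?n * t ^ ?n"
    using le_imp_inverse_le[of "1 / (real ?n ^ ?n * t ^ ?n)" "exp (1 / t)"] True
    by (simp only: exp_minus inverse_divide div_by_1 inverse_eq_divide) simp
  then have "exp (- (1 / t)) / t ^ m \<le> (real ?n ^ ?n * t ^ ?n) / t ^ m"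
    using True by (intro divide_right_mono) auto
  also have "\<dots> = real ?n ^ ?n * t\<^sup>2"
    using True by (simp add: power_add field_simps power2_eq_square)
  finally show ?thesis using True by (simp add: bump_def)
qed (simp add: bump_def)

text \<open>The index of \<open>bump\<close> exists for this formula: differentiation stays inside
  the family, so smoothness of every order reduces to one derivative. The cases are the zero side,
  the junction at 0 and the side where the quotient is differentiated.\<close>

lemma bump_has_derivative:
  "(bump m has_real_derivative (bump (m + 2) t - real m * bump (Suc m) t)) (at t)"
proof -
  consider "t < 0" | "t = 0" | "t > 0" by linarith
  then show ?thesis
  proof cases
    case 1
    have "((\<lambda>_. 0) has_real_derivative 0) (at t)" by simp
    then have "(bump m has_real_derivative 0) (at t)"
      by (rule DERIV_cong_ev[THEN iffD1, rotated -1])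
        (use 1 in \<open>auto simp: bump_def eventually_nhds intro!: exI[of _ "{..<0}"]\<close>)
    then show ?thesis using 1 by (simp add: bump_def)
  next
    case 2
    have "((\<lambda>h. bump m h / h) \<longlongrightarrow> 0) (at 0)"
    proof (rule Lim_null_comparison)
      show "((\<lambda>h. real (m + 2) ^ (m + 2) * \<bar>h\<bar>) \<longlongrightarrow> 0) (at 0)"
        by (auto intro!: tendsto_eq_intros)
      show "\<forall>\<^sub>F h in at 0. norm (bump m h / h) \<le> real (m + 2) ^ (m + 2) * \<bar>h\<bar>"
        unfolding eventually_at
      proof (intro exI[of _ 1] conjI ballI impI)
        fix h :: real assume h: "h \<noteq> 0 \<and> dist h 0 < 1"
        then have "\<bar>bump m h\<bar> / \<bar>h\<bar> \<le> (real (m + 2) ^ (m + 2) * h\<^sup>2) / \<bar>h\<bar>"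
          by (intro divide_right_mono bump_le_square) auto
        also have "\<dots> = real (m + 2) ^ (m + 2) * \<bar>h\<bar>"
          using h by (auto simp: power2_eq_square abs_if field_simps)
        finally show "norm (bump m h / h) \<le> real (m + 2) ^ (m + 2) * \<bar>h\<bar>" by simp
      qed simp
    qed
    then show ?thesis using 2 by (simp add: DERIV_def bump_def)
  next
    case 3
    have pow: "((\<lambda>t. t ^ m) has_real_derivative (real m * t ^ m / t)) (at t)"
      using 3 DERIV_pow[of m t] by (cases m) auto
    have ex: "((\<lambda>t. exp (- (1 / t))) has_real_derivative (exp (- (1 / t)) / t\<^sup>2)) (at t)"
      using 3 by (auto intro!: derivative_eq_intros simp: field_simps power2_eq_square)
    have "((\<lambda>t. exp (- (1 / t)) / t ^ m) has_real_derivative (bump (m + 2) t - real m * bump (Suc m) t)) (at t)"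
      by (rule DERIV_cong[OF DERIV_divide[OF ex pow]])
        (use 3 in \<open>auto simp: bump_def field_simps power2_eq_square\<close>)
    then show ?thesis
      by (rule DERIV_cong_ev[THEN iffD1, rotated -1])
        (use 3 in \<open>auto simp: bump_def eventually_nhds intro!: exI[of _ "{0<..}"]\<close>)
  qed
qed

text \<open>A syntactic class, so that closure under partial derivatives is an induction over the
  way a function is built. It has no rule for subtraction or translation; later bumps are therefore
  written with \<open>+ -\<close> and \<open>(-1) *\<close>.\<close>

inductive smooth_fun :: "(complex \<Rightarrow> real) \<Rightarrow> bool" where
  const: "smooth_fun (\<lambda>_. c)"
| re: "smooth_fun Re"
| im: "smooth_fun Im"
| add: "smooth_fun u \<Longrightarrow> smooth_fun v \<Longrightarrow> smooth_fun (\<lambda>z. u z + v z)"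
| mult: "smooth_fun u \<Longrightarrow> smooth_fun v \<Longrightarrow> smooth_fun (\<lambda>z. u z * v z)"
| bump: "smooth_fun u \<Longrightarrow> smooth_fun (\<lambda>z. bump m (u z))"

lemma smooth_fun_has_derivative:
  assumes "smooth_fun u"
  shows "\<exists>p q. smooth_fun p \<and> smooth_fun q \<and>
           (\<forall>z. (u has_derivative (\<lambda>h. p z * Re h + q z * Im h)) (at z))"
  using assms
proof induction
  case (const c)
  show ?case
    by (intro exI[of _ "\<lambda>_. 0"] conjI smooth_fun.const allI) (auto intro!: derivative_eq_intros)
next
  case re
  show ?case
    by (intro exI[of _ "\<lambda>_. 1"] exI[of _ "\<lambda>_. 0"] conjI smooth_fun.const allI) (auto intro!: derivative_eq_intros)
next
  case im
  show ?case
    by (intro exI[of _ "\<lambda>_. 0"] exI[of _ "\<lambda>_. 1"] conjI smooth_fun.const allI) (auto intro!: derivative_eq_intros)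
next
  case (add u v)
  then obtain p q p' q' where *: "smooth_fun p" "smooth_fun q" "smooth_fun p'" "smooth_fun q'"
    "\<And>z. (u has_derivative (\<lambda>h. p z * Re h + q z * Im h)) (at z)"
    "\<And>z. (v has_derivative (\<lambda>h. p' z * Re h + q' z * Im h)) (at z)" by blast
  show ?case
    by (intro exI[of _ "\<lambda>z. p z + p' z"] exI[of _ "\<lambda>z. q z + q' z"] conjI smooth_fun.add allI *)
      (rule has_derivative_eq_rhs[OF has_derivative_add[OF *(5,6)]], auto simp: algebra_simps)
next
  case (mult u v)
  then obtain p q p' q' where *: "smooth_fun p" "smooth_fun q" "smooth_fun p'" "smooth_fun q'"
    "\<And>z. (u has_derivative (\<lambda>h. p z * Re h + q z * Im h)) (at z)"
    "\<And>z. (v has_derivative (\<lambda>h. p' z * Re h + q' z * Im h)) (at z)" by blast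
  show ?case
    by (intro exI[of _ "\<lambda>z. u z * p' z + p z * v z"] exI[of _ "\<lambda>z. u z * q' z + q z * v z"]
        conjI smooth_fun.add smooth_fun.mult allI * mult)
      (rule has_derivative_eq_rhs[OF has_derivative_mult[OF *(5,6)]], auto simp: algebra_simps)
next
  case (bump u m)
  then obtain p q where *: "smooth_fun p" "smooth_fun q"
    "\<And>z. (u has_derivative (\<lambda>h. p z * Re h + q z * Im h)) (at z)" by blast
  have sb: "smooth_fun (\<lambda>z. bump (m + 2) (u z) + (- real m) * bump (Suc m) (u z))"
    by (intro smooth_fun.intros bump.hyps)
  show ?case
  proof (intro exI conjI allI)
    fix z
    show "((\<lambda>z. bump m (u z)) has_derivative
      (\<lambda>h. ((bump (m + 2) (u z) + (- real m) * bump (Suc m) (u z)) * p z) * Re h +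
           ((bump (m + 2) (u z) + (- real m) * bump (Suc m) (u z)) * q z) * Im h)) (at z)"
      by (rule has_derivative_eq_rhs[OF has_derivative_compose[OF *(3)
              bump_has_derivative[unfolded has_field_derivative_def]]])
        (auto simp: algebra_simps)
  qed (intro smooth_fun.mult sb *)+
qed

lemma smooth_fun_differentiable: "smooth_fun u \<Longrightarrow> u differentiable (at z)"
  using smooth_fun_has_derivative unfolding differentiable_def by blast

lemma smooth_fun_has_derivative_pd:
  assumes "smooth_fun u"
  shows "(u has_derivative (\<lambda>h. pdx u z * Re h + pdy u z * Im h)) (at z)"
proof -
  obtain p q where d: "\<And>z. (u has_derivative (\<lambda>h. p z * Re h + q z * Im h)) (at z)"
    using smooth_fun_has_derivative[OF assms] by blast
  have "frechet_derivative u (at z) = (\<lambda>h. p z * Re h + q z * Im h)"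
    using frechet_derivative_at[OF d[of z]] by simp
  then show ?thesis using d[of z] by (simp add: pdx_def pdy_def)
qed

lemma smooth_fun_pd:
  assumes "smooth_fun u"
  shows "smooth_fun (pdx u)" "smooth_fun (pdy u)"
proof -
  obtain p q where d: "smooth_fun p" "smooth_fun q"
      "\<And>z. (u has_derivative (\<lambda>h. p z * Re h + q z * Im h)) (at z)"
    using smooth_fun_has_derivative[OF assms] by blast
  have "frechet_derivative u (at z) = (\<lambda>h. p z * Re h + q z * Im h)" for z
    using frechet_derivative_at[OF d(3)[of z]] by simp
  then have "pdx u = p" "pdy u = q" by (auto simp add: pdx_def pdy_def)
  then show "smooth_fun (pdx u)" "smooth_fun (pdy u)" using d by auto
qed

lemma smooth_fun_differentiable_on: "smooth_fun u \<Longrightarrow> u differentiable_on S"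
  using smooth_fun_differentiable differentiable_at_imp_differentiable_on by blast

lemma smooth_fun_Ck: "smooth_fun u \<Longrightarrow> Ck k u"
  by (induction k arbitrary: u)
    (auto simp: smooth_fun_pd smooth_fun_differentiable_on
      intro: differentiable_imp_continuous_on)

lemma test_fun_smooth:
  assumes "smooth_fun u" "compact K" "K \<subseteq> udisc" "\<And>z. z \<notin> K \<Longrightarrow> u z = 0"
  shows "test_fun u"
proof -
  have sub: "closure {z. u z \<noteq> 0} \<subseteq> K"
    using assms by (intro closure_minimal) (auto intro: compact_imp_closed)
  then have "compact (closure {z. u z \<noteq> 0})"
    using assms(2) by (metis closed_closure compact_Int_closed inf.absorb_iff2)
  then show ?thesis
    using assms sub by (auto simp: test_fun_def smooth_fun_Ck)
qed

text \<open>Smooth approximation of the indicator of the open box: for t > 0,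
  \<open>bump 0 (real j * t)\<close> is exp(-1/(j t)) and tends to 1 as j grows, while each factor
  is 0 on the wrong side of its face.\<close>

definition box_bump :: "nat \<Rightarrow> complex \<Rightarrow> complex \<Rightarrow> complex \<Rightarrow> real" where
  "box_bump j a b z = bump 0 (real j * (Re z + - Re a)) * bump 0 (real j * (Re b + (-1) * Re z)) *
     (bump 0 (real j * (Im z + - Im a)) * bump 0 (real j * (Im b + (-1) * Im z)))"

lemma smooth_fun_box_bump: "smooth_fun (box_bump j a b)"
  unfolding box_bump_def[abs_def] by (intro smooth_fun.intros)

lemma bump_bounds: "0 \<le> bump 0 t" "bump 0 t \<le> 1"
  by (auto simp: bump_def)

lemma box_bump_bounds: "0 \<le> box_bump j a b z" "box_bump j a b z \<le> 1"
  by (auto simp: box_bump_def bump_bounds intro!: mult_nonneg_nonneg mult_le_one)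

lemma box_bump_eq_0: "z \<notin> box a b \<Longrightarrow> box_bump j a b z = 0"
  by (auto simp: box_bump_def bump_def in_box_complex_iff not_less mult_le_0_iff zero_less_mult_iff)

lemma bump_limit: "t > 0 \<Longrightarrow> (\<lambda>j. bump 0 (real j * t)) \<longlonglongrightarrow> 1"
proof -
  assume t: "t > 0"
  have "(\<lambda>j. exp (- ((1/t) * inverse (real j)))) \<longlonglongrightarrow> exp (- ((1/t) * 0))"
    by (intro tendsto_intros lim_inverse_n)
  moreover have "\<forall>\<^sub>F j in sequentially. bump 0 (real j * t) = exp (- ((1/t) * inverse (real j)))"
    using eventually_gt_at_top[of 0] by eventually_elim (use t in \<open>auto simp: bump_def field_simps\<close>)
  ultimately show ?thesis using tendsto_cong by fastforce
qed

lemma box_bump_limit: "(\<lambda>j. box_bump j a b z) \<longlonglongrightarrow> indicat_real (box a b) z"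
proof (cases "z \<in> box a b")
  case True
  then have "(\<lambda>j. box_bump j a b z) \<longlonglongrightarrow> 1 * 1 * (1 * 1)"
    unfolding box_bump_def by (intro tendsto_mult bump_limit) (auto simp: in_box_complex_iff)
  then show ?thesis using True by simp
qed (simp add: box_bump_eq_0)

lemma test_fun_box_bump: "cbox a b \<subseteq> udisc \<Longrightarrow> test_fun (box_bump j a b)"
  by (rule test_fun_smooth[OF smooth_fun_box_bump, of "cbox a b"])
    (auto intro!: box_bump_eq_0 dest: box_subset_cbox[THEN subsetD])


section \<open>The fundamental lemma of the calculus of variations on the disc\<close>

lemma loc_integrable_scaleR:
  fixes f :: "complex \<Rightarrow> 'a::euclidean_space"
  assumes f: "loc_integrable f" and K: "compact K" "K \<subseteq> udisc"
    and v: "v \<in> borel_measurable borel" "\<And>z. \<bar>v z\<bar> \<le> C" "\<And>z. z \<notin> K \<Longrightarrow> v z = 0"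
  shows "integrable (lebesgue_on udisc) (\<lambda>z. v z *\<^sub>R f z)"
    and "(\<integral>z. v z *\<^sub>R f z \<partial>lebesgue_on udisc) = (\<integral>z. v z *\<^sub>R f z \<partial>lebesgue_on K)"
proof -
  have Kl: "K \<in> sets lebesgue" using K(1) by (simp add: borel_compact)
  have fK: "integrable (lebesgue_on K) f" using f K by (simp add: loc_integrable_def)
  have vm: "v \<in> borel_measurable (lebesgue_on K)"
    using v(1) by (simp add: borel_measurable_lebesgue_preimage_borel measurable_restrict_space1 measurable_completion)
  have "integrable (lebesgue_on K) (\<lambda>z. v z *\<^sub>R f z)"
  proof (rule Bochner_Integration.integrable_bound)
    show "integrable (lebesgue_on K) (\<lambda>z. C *\<^sub>R f z)" using fK by simp
    show "(\<lambda>z. v z *\<^sub>R f z) \<in> borel_measurable (lebesgue_on K)"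
      using vm fK by (intro borel_measurable_scaleR) auto
    show "AE z in lebesgue_on K. norm (v z *\<^sub>R f z) \<le> norm (C *\<^sub>R f z)"
      using order_trans[OF v(2) abs_ge_self] by (intro AE_I2) (auto intro!: mult_right_mono)
  qed
  then have "integrable lebesgue (\<lambda>z. indicator K z *\<^sub>R (v z *\<^sub>R f z))"
    using Kl by (simp add: integrable_restrict_space)
  moreover have ind: "(\<lambda>z. indicator K z *\<^sub>R (v z *\<^sub>R f z)) = (\<lambda>z. indicator udisc z *\<^sub>R (v z *\<^sub>R f z))"
    using K v(3) by (auto simp: fun_eq_iff indicator_def)
  ultimately show "integrable (lebesgue_on udisc) (\<lambda>z. v z *\<^sub>R f z)"
    by (simp add: integrable_restrict_space)
  show "(\<integral>z. v z *\<^sub>R f z \<partial>lebesgue_on udisc) = (\<integral>z. v z *\<^sub>R f z \<partial>lebesgue_on K)"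
    using Kl ind by (simp add: integral_restrict_space)
qed

lemma test_fun_measurable: "test_fun u \<Longrightarrow> u \<in> borel_measurable borel"
  by (auto simp: test_fun_def intro!: borel_measurable_continuous_onI dest: spec[of _ 0])

text \<open>Boxes form an intersection-stable generator of the Borel sets, so the vanishing spreads
  to all Borel sets by a Dynkin argument; \<open>f0\<close> handles complements. A Lebesgue set is
  an F-sigma set up to a null set, and the sets where f > 0 and f < 0 then finish.\<close>

lemma AE_0_if_box_integrals_0:
  fixes f :: "complex \<Rightarrow> real"
  assumes f: "integrable lebesgue f" and f0: "(\<integral>z. f z \<partial>lebesgue) = 0"
    and box0: "\<And>a b. (LINT z:box a b|lebesgue. f z) = 0"
  shows "AE z in lebesgue. f z = 0"
proof -
  have si: "set_integrable lebesgue E f" if "E \<in> sets lebesgue" for E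
    using that f unfolding set_integrable_def by (rule integrable_mult_indicator)
  have borel0: "(LINT z:E|lebesgue. f z) = 0" if "E \<in> sets borel" for E
  proof -
    have "Int_stable (range (\<lambda>(a, b). box a b :: complex set))"
      by (auto simp: Int_stable_def box_Int_box)
    moreover have "range (\<lambda>(a, b). box a b :: complex set) \<subseteq> Pow UNIV" by auto
    moreover have "E \<in> sigma_sets UNIV (range (\<lambda>(a, b). box a b))"
      using that unfolding borel_eq_box by simp
    ultimately show ?thesis
    proof (induction rule: sigma_sets_induct_disjoint)
      case (basic A)
      then show ?case using box0 by auto
    next
      case empty
      then show ?case by (simp add: set_lebesgue_integral_def)
    next
      case (compl A)
      then have "A \<in> sets borel" by (simp add: borel_eq_box)
      then have A: "A \<in> sets lebesgue" by simp
      have "(LINT z:UNIV|lebesgue. f z) = (LINT z:A|lebesgue. f z) + (LINT z:UNIV - A|lebesgue. f z)"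
        using A by (subst set_integral_Un[symmetric]) (auto intro!: si)
      then show ?case using compl f0 by (simp add: set_lebesgue_integral_def)
    next
      case (union A)
      then have "A i \<in> sets borel" for i by (auto simp: borel_eq_box)
      then have A: "A i \<in> sets lebesgue" for i by simp
      have "(LINT z:(\<Union>i. A i)|lebesgue. f z) = (\<Sum>i. LINT z:A i|lebesgue. f z)"
        by (rule lebesgue_integral_countable_add)
          (use A union in \<open>auto intro!: si simp: disjoint_family_on_def\<close>)
      then show ?case using union by simp
    qed
  qed
  have leb0: "(LINT z:E|lebesgue. f z) = 0" if E: "E \<in> sets lebesgue" for E
  proof -
    obtain C N where C: "fsigma C" "N \<in> null_sets lebesgue" "C \<union> N = E" "disjnt C N"
      using lebesgue_set_almost_fsigma[OF E] by blast
    obtain F :: "nat \<Rightarrow> complex set" where "\<And>n. closed (F n)" "C = (\<Union>n. F n)"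
      using C(1) by (auto elim!: fsigma.cases)
    then have Cb: "C \<in> sets borel"
      using sets.countable_UN[of F UNIV borel] borel_closed by blast
    have "(LINT z:E|lebesgue. f z) = (LINT z:C|lebesgue. f z)"
      unfolding set_lebesgue_integral_def
    proof (rule integral_cong_AE)
      show "AE z in lebesgue. indicator E z *\<^sub>R f z = indicator C z *\<^sub>R f z"
        using AE_not_in[OF C(2)] by eventually_elim (use C(3) in \<open>auto simp: indicator_def\<close>)
      show "(\<lambda>z. indicator E z *\<^sub>R f z) \<in> borel_measurable lebesgue"
        by (intro borel_measurable_integrable integrable_mult_indicator f E)
      show "(\<lambda>z. indicator C z *\<^sub>R f z) \<in> borel_measurable lebesgue"
        using Cb by (intro borel_measurable_integrable integrable_mult_indicator f) simp
    qed
    then show ?thesis using borel0[OF Cb] by simp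
  qed
  have m: "f \<in> borel_measurable lebesgue" using f by simp
  have "AE z in lebesgue. (if f z > 0 then f z else 0) = 0"
  proof (subst integral_nonneg_eq_0_iff_AE[symmetric])
    have E: "{z. f z > 0} \<in> sets lebesgue" using m by (simp add: borel_measurable_iff_greater)
    have "(LINT z:{z. f z > 0}|lebesgue. f z) = (\<integral>z. (if f z > 0 then f z else 0) \<partial>lebesgue)"
      unfolding set_lebesgue_integral_def by (intro Bochner_Integration.integral_cong) auto
    then show "(\<integral>z. (if f z > 0 then f z else 0) \<partial>lebesgue) = 0" using leb0[OF E] by simp
    have "integrable lebesgue (\<lambda>z. indicator {z. f z > 0} z *\<^sub>R f z)"
      using si[OF E] by (simp add: set_integrable_def)
    also have "(\<lambda>z. indicator {z. f z > 0} z *\<^sub>R f z) = (\<lambda>z. if f z > 0 then f z else 0)"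
      by (auto simp: indicator_def)
    finally show "integrable lebesgue (\<lambda>z. if f z > 0 then f z else 0)" .
  qed auto
  moreover have "AE z in lebesgue. (if f z < 0 then - f z else 0) = 0"
  proof (subst integral_nonneg_eq_0_iff_AE[symmetric])
    have E: "{z. f z < 0} \<in> sets lebesgue" using m by (simp add: borel_measurable_iff_less)
    have "(LINT z:{z. f z < 0}|lebesgue. f z) = - (\<integral>z. (if f z < 0 then - f z else 0) \<partial>lebesgue)"
      unfolding set_lebesgue_integral_def integral_minus[symmetric]
      by (intro Bochner_Integration.integral_cong) auto
    then show "(\<integral>z. (if f z < 0 then - f z else 0) \<partial>lebesgue) = 0" using leb0[OF E] by simp
    have "integrable lebesgue (\<lambda>z. - (indicator {z. f z < 0} z *\<^sub>R f z))"
      using si[OF E] by (simp add: set_integrable_def)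
    also have "(\<lambda>z. - (indicator {z. f z < 0} z *\<^sub>R f z)) = (\<lambda>z. if f z < 0 then - f z else 0)"
      by (auto simp: indicator_def)
    finally show "integrable lebesgue (\<lambda>z. if f z < 0 then - f z else 0)" .
  qed auto
  ultimately show ?thesis by eventually_elim (auto split: if_splits)
qed

text \<open>Dominated convergence along \<open>box_bump\<close>, after cutting the integrand off to
  the closed box, where it is integrable.\<close>

lemma test_fun_integral_0_imp_box:
  fixes F :: "complex \<Rightarrow> 'a::euclidean_space"
  assumes F: "loc_integrable F"
    and 0: "\<And>u. test_fun u \<Longrightarrow> (\<integral>z. u z *\<^sub>R F z \<partial>lebesgue_on udisc) = 0"
    and ab: "cbox a b \<subseteq> udisc"
  shows "(LINT z:box a b|lebesgue. F z) = 0"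
proof -
  have Fi: "integrable lebesgue (\<lambda>z. indicator (cbox a b) z *\<^sub>R F z)"
    using F ab by (simp add: loc_integrable_def integrable_restrict_space[symmetric])
  have "(\<lambda>j. \<integral>z. box_bump j a b z *\<^sub>R (indicator (cbox a b) z *\<^sub>R F z) \<partial>lebesgue) \<longlonglongrightarrow>
      (\<integral>z. indicator (box a b) z *\<^sub>R (indicator (cbox a b) z *\<^sub>R F z) \<partial>lebesgue)"
  proof (rule integral_dominated_convergence[where w = "\<lambda>z. norm (indicator (cbox a b) z *\<^sub>R F z)"])
    show "(\<lambda>z. box_bump j a b z *\<^sub>R (indicator (cbox a b) z *\<^sub>R F z)) \<in> borel_measurable lebesgue" for j
      using test_fun_measurable[OF test_fun_box_bump[OF ab, of j]]
      by (intro borel_measurable_scaleR borel_measurable_integrable[OF Fi]) (auto simp: measurable_completion)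
    show "(\<lambda>z. indicator (box a b) z *\<^sub>R (indicator (cbox a b) z *\<^sub>R F z)) \<in> borel_measurable lebesgue"
      by (intro borel_measurable_scaleR borel_measurable_integrable[OF Fi]) (auto simp: measurable_completion)
    show "integrable lebesgue (\<lambda>z. norm (indicator (cbox a b) z *\<^sub>R F z))" using Fi by (rule integrable_norm)
    show "AE z in lebesgue. (\<lambda>j. box_bump j a b z *\<^sub>R (indicator (cbox a b) z *\<^sub>R F z)) \<longlonglongrightarrow>
        indicator (box a b) z *\<^sub>R (indicator (cbox a b) z *\<^sub>R F z)"
      by (intro AE_I2 tendsto_scaleR box_bump_limit tendsto_const)
    show "AE z in lebesgue. norm (box_bump j a b z *\<^sub>R (indicator (cbox a b) z *\<^sub>R F z))
        \<le> norm (indicator (cbox a b) z *\<^sub>R F z)" for j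
      by (intro AE_I2) (use box_bump_bounds in \<open>auto simp: mult.assoc intro!: mult_left_le_one_le\<close>)
  qed
  moreover have "(\<integral>z. box_bump j a b z *\<^sub>R (indicator (cbox a b) z *\<^sub>R F z) \<partial>lebesgue) = 0" for j
  proof -
    have "(\<integral>z. box_bump j a b z *\<^sub>R (indicator (cbox a b) z *\<^sub>R F z) \<partial>lebesgue) =
        (\<integral>z. indicator udisc z *\<^sub>R (box_bump j a b z *\<^sub>R F z) \<partial>lebesgue)"
      by (intro Bochner_Integration.integral_cong refl)
        (use ab box_subset_cbox[of a b] box_bump_eq_0[of _ a b j] in \<open>auto simp: indicator_def\<close>)
    also have "\<dots> = (\<integral>z. box_bump j a b z *\<^sub>R F z \<partial>lebesgue_on udisc)"
      by (simp add: integral_restrict_space)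
    finally show ?thesis using 0[OF test_fun_box_bump[OF ab]] by simp
  qed
  ultimately have "(\<integral>z. indicator (box a b) z *\<^sub>R (indicator (cbox a b) z *\<^sub>R F z) \<partial>lebesgue) = 0"
    by (simp add: LIMSEQ_const_iff)
  moreover have "(LINT z:box a b|lebesgue. F z) =
      (\<integral>z. indicator (box a b) z *\<^sub>R (indicator (cbox a b) z *\<^sub>R F z) \<partial>lebesgue)"
    unfolding set_lebesgue_integral_def
    by (intro Bochner_Integration.integral_cong refl)
      (use box_subset_cbox[of a b] in \<open>auto simp: indicator_def\<close>)
  ultimately show ?thesis by simp
qed

lemma test_fun_integral_0_imp_AE_0:
  fixes F :: "complex \<Rightarrow> 'a::euclidean_space"
  assumes F: "loc_integrable F"
    and 0: "\<And>u. test_fun u \<Longrightarrow> (\<integral>z. u z *\<^sub>R F z \<partial>lebesgue_on udisc) = 0"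
  shows "AE z in lebesgue_on udisc. F z = 0"
proof -
  have cb: "AE z in lebesgue. z \<in> cbox c d \<longrightarrow> F z = 0" if cd: "cbox c d \<subseteq> udisc" for c d
  proof -
    have Fi: "integrable lebesgue (\<lambda>z. indicator (cbox c d) z *\<^sub>R F z)"
      using F cd by (simp add: loc_integrable_def integrable_restrict_space[symmetric])
    have Fi': "set_integrable lebesgue (box c d) F"
    proof -
      have "integrable lebesgue (\<lambda>z. indicator (box c d) z *\<^sub>R (indicator (cbox c d) z *\<^sub>R F z))"
        by (intro integrable_mult_indicator Fi) auto
      moreover have "(\<lambda>z. indicator (box c d) z *\<^sub>R (indicator (cbox c d) z *\<^sub>R F z)) =
          (\<lambda>z. indicator (box c d) z *\<^sub>R F z)"
        using box_subset_cbox[of c d] by (auto simp: indicator_def fun_eq_iff)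
      ultimately show ?thesis by (simp add: set_integrable_def)
    qed
    \<comment> \<open>Cut off to one box, each coordinate of \<open>F\<close> is integrable over the
      plane, and its integral over any other box is again an integral over a box inside the disc,
      because boxes are closed under intersection.\<close>
    have "AE z in lebesgue. indicator (box c d) z *\<^sub>R (F z \<bullet> i) = 0" if i: "i \<in> Basis" for i
    proof (rule AE_0_if_box_integrals_0)
      let ?f = "\<lambda>z. indicator (box c d) z *\<^sub>R (F z \<bullet> i)"
      have *: "(LINT z:E|lebesgue. indicator (box c d) z *\<^sub>R (F z \<bullet> i)) = (LINT z:E \<inter> box c d|lebesgue. F z) \<bullet> i"
        if "E \<in> sets lebesgue" for E
      proof -
        have "set_integrable lebesgue (E \<inter> box c d) F"
          using that by (intro set_integrable_subset[OF Fi']) auto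
        then show ?thesis
          unfolding set_lebesgue_integral_def set_integrable_def
          by (subst integral_inner_left[symmetric])
            (auto intro!: Bochner_Integration.integral_cong simp: indicator_def)
      qed
      show "integrable lebesgue ?f"
        using integrable_inner_left[OF Fi'[unfolded set_integrable_def], of i]
        by (simp only: inner_scaleR_left real_scaleR_def)
      show box: "(LINT z:box a b|lebesgue. ?f z) = 0" for a b
      proof -
        obtain a' b' where ab: "box a b \<inter> box c d = box a' b'"
          using box_Int_box[of a b c d] by blast
        have "cbox a' b' \<subseteq> cbox c d" if "box a' b' \<noteq> {}"
        proof -
          have "closure (box a' b') \<subseteq> closure (box c d)" using ab by (intro closure_mono) auto
          then show ?thesis using that ab by (metis Int_empty_right closure_box)
        qed
        then have "(LINT z:box a' b'|lebesgue. F z) = 0"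
          by (cases "box a' b' = {}") (use cd test_fun_integral_0_imp_box[OF F 0] in \<open>auto simp: set_lebesgue_integral_def\<close>)
        then show ?thesis by (subst *) (auto simp: ab)
      qed
      have "(\<integral>z. ?f z \<partial>lebesgue) = (LINT z:box c d|lebesgue. ?f z)"
        unfolding set_lebesgue_integral_def
        by (intro Bochner_Integration.integral_cong) (auto simp: indicator_def)
      then show "(\<integral>z. ?f z \<partial>lebesgue) = 0" using box by simp
    qed
    then have "AE z in lebesgue. \<forall>i\<in>Basis. indicator (box c d) z *\<^sub>R (F z \<bullet> i) = 0"
      by (intro AE_finite_allI) auto
    moreover have "AE z in lebesgue. z \<notin> cbox c d - box c d"
      using negligible_frontier_interval[of c d] by (intro AE_not_in) (simp add: negligible_iff_null_sets)
    ultimately show ?thesis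
    proof eventually_elim
      case (elim z)
      show ?case
      proof
        assume "z \<in> cbox c d"
        then have "indicator (box c d) z = (1::real)" using elim(2) by simp
        then have "\<forall>i\<in>Basis. F z \<bullet> i = 0" using elim(1) by simp
        then show "F z = 0" using euclidean_all_zero_iff by blast
      qed
    qed
  qed
  \<comment> \<open>Countably many closed boxes cover the disc, so the exceptional null sets may be
    united.\<close>
  obtain D where D: "countable D" "D \<subseteq> Pow udisc" "\<And>X. X \<in> D \<Longrightarrow> \<exists>a b. X = cbox a b" "\<Union>D = udisc"
    using open_countable_Union_open_cbox[of udisc] by (metis open_ball)
  have "AE z in lebesgue. \<forall>X\<in>D. z \<in> X \<longrightarrow> F z = 0"
  proof (subst AE_ball_countable[OF D(1)], rule ballI)
    fix X assume X: "X \<in> D"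
    obtain a b where ab: "X = cbox a b" using D(3)[OF X] by blast
    have "cbox a b \<subseteq> udisc" using D(2) X ab by blast
    from cb[OF this] show "AE z in lebesgue. z \<in> X \<longrightarrow> F z = 0" unfolding ab .
  qed
  then have "AE z in lebesgue. z \<in> udisc \<longrightarrow> F z = 0"
    by eventually_elim (use D(4) in blast)
  then show ?thesis by (subst AE_restrict_space_iff) auto
qed

text \<open>A nonempty open set is not negligible. This is how almost-everywhere identities between
  weak derivatives become identities at every point.\<close>

lemma continuous_AE_0_imp_0:
  fixes F :: "complex \<Rightarrow> 'a::euclidean_space"
  assumes F: "continuous_on udisc F" and ae: "AE z in lebesgue_on udisc. F z = 0" and z: "z \<in> udisc"
  shows "F z = 0"
proof (rule ccontr)
  assume nz: "F z \<noteq> 0"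
  have "open (udisc \<inter> F -` (- {0}))"
    using F by (intro continuous_open_preimage) auto
  moreover have "z \<in> udisc \<inter> F -` (- {0})" using z nz by auto
  ultimately have "\<not> negligible (udisc \<inter> F -` (- {0}))"
    using open_not_negligible by blast
  moreover have "negligible (udisc \<inter> F -` (- {0}))"
  proof -
    have "AE z in lebesgue. z \<in> udisc \<longrightarrow> F z = 0"
      using ae by (subst (asm) AE_restrict_space_iff) auto
    then obtain N where N: "\<And>z. z \<in> space lebesgue - N \<Longrightarrow> z \<in> udisc \<longrightarrow> F z = 0" "N \<in> null_sets lebesgue"
      by (rule AE_E3) blast
    have "negligible N" using N(2) by (simp only: negligible_iff_null_sets)
    then show ?thesis
      by (rule negligible_subset) (use N(1) in auto)
  qed
  ultimately show False by simp
qed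

section \<open>Weak Cauchy-Riemann operators\<close>

lemma frechet_derivative_eqI: "(f has_derivative f') (at z) \<Longrightarrow> frechet_derivative f (at z) = f'"
  by (rule frechet_derivative_at[symmetric])

lemma frechet_derivative_worksI:
  "f differentiable (at z) \<Longrightarrow> (f has_derivative frechet_derivative f (at z)) (at z)"
  by (simp only: frechet_derivative_works)

text \<open>The derivative of a product still contains the factors themselves, so these have to be
  demoted from \<open>Ck (Suc k)\<close> to \<open>Ck k\<close> in the induction of
  \<open>Ck_mult\<close>.\<close>

lemma Ck_SucD: "Ck (Suc k) u \<Longrightarrow> Ck k u"
proof (induction k arbitrary: u)
  case 0
  then show ?case by (simp add: differentiable_imp_continuous_on)
next
  case (Suc k)
  from Suc.prems have "u differentiable_on UNIV" "Ck (Suc k) (pdx u)" "Ck (Suc k) (pdy u)"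
    unfolding Ck.simps(2)[of "Suc k"] by blast+
  moreover from this(2,3) have "Ck k (pdx u)" "Ck k (pdy u)" by (blast intro: Suc.IH)+
  ultimately show ?case by (simp only: Ck.simps(2))
qed

lemma Ck_add:
  assumes "Ck k u" "Ck k v"
  shows "Ck k (\<lambda>z. u z + v z)"
  using assms
proof (induction k arbitrary: u v)
  case (Suc k)
  from Suc.prems have prems: "u differentiable_on UNIV" "v differentiable_on UNIV"
    "Ck k (pdx u)" "Ck k (pdx v)" "Ck k (pdy u)" "Ck k (pdy v)" by simp_all
  from prems(1,2) have d: "u differentiable (at z)" "v differentiable (at z)" for z
    by (simp_all add: differentiable_on_def)
  have "frechet_derivative (\<lambda>z. u z + v z) (at z) =
      (\<lambda>h. frechet_derivative u (at z) h + frechet_derivative v (at z) h)" for z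
    by (rule frechet_derivative_eqI[OF has_derivative_add[OF d[THEN frechet_derivative_worksI]]])
  then have "pdx (\<lambda>z. u z + v z) = (\<lambda>z. pdx u z + pdx v z)" "pdy (\<lambda>z. u z + v z) = (\<lambda>z. pdy u z + pdy v z)"
    unfolding pdx_def pdy_def by auto
  then show ?case using prems d Suc.IH by (simp add: differentiable_on_def)
qed (simp add: continuous_on_add)

lemma pd_mult:
  assumes "u differentiable (at z)" "v differentiable (at z)"
  shows "pdx (\<lambda>z. u z * v z) z = u z * pdx v z + pdx u z * v z"
    and "pdy (\<lambda>z. u z * v z) z = u z * pdy v z + pdy u z * v z"
proof -
  have "((\<lambda>z. u z * v z) has_derivative (\<lambda>h. u z * frechet_derivative v (at z) h +
      frechet_derivative u (at z) h * v z)) (at z)"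
    by (rule has_derivative_mult[OF assms[THEN frechet_derivative_worksI]])
  then have "frechet_derivative (\<lambda>z. u z * v z) (at z) =
      (\<lambda>h. u z * frechet_derivative v (at z) h + frechet_derivative u (at z) h * v z)"
    by (rule frechet_derivative_eqI)
  then show "pdx (\<lambda>z. u z * v z) z = u z * pdx v z + pdx u z * v z"
    "pdy (\<lambda>z. u z * v z) z = u z * pdy v z + pdy u z * v z"
    unfolding pdx_def pdy_def by auto
qed

lemma Ck_mult:
  assumes "Ck k u" "Ck k v"
  shows "Ck k (\<lambda>z. u z * v z)"
  using assms
proof (induction k arbitrary: u v)
  case (Suc k)
  from Suc.prems have prems: "u differentiable_on UNIV" "v differentiable_on UNIV"
    "Ck k (pdx u)" "Ck k (pdx v)" "Ck k (pdy u)" "Ck k (pdy v)" by simp_all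
  from prems(1,2) have d: "u differentiable (at z)" "v differentiable (at z)" for z
    by (simp_all add: differentiable_on_def)
  have "pdx (\<lambda>z. u z * v z) = (\<lambda>z. u z * pdx v z + pdx u z * v z)"
    "pdy (\<lambda>z. u z * v z) = (\<lambda>z. u z * pdy v z + pdy u z * v z)"
    using pd_mult d by blast+
  moreover have "Ck k (\<lambda>z. u z * pdx v z + pdx u z * v z)" "Ck k (\<lambda>z. u z * pdy v z + pdy u z * v z)"
    by (intro Ck_add Suc.IH prems Suc.prems[THEN Ck_SucD])+
  moreover have "(\<lambda>z. u z * v z) differentiable_on UNIV"
    using d by (simp add: differentiable_on_def)
  ultimately show ?case by (simp only: Ck.simps(2))
qed (simp add: continuous_on_mult)

text \<open>Lets the real factor 2x be moved from a function onto the test function.\<close>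

lemma test_fun_mult:
  assumes "test_fun u" "smooth_fun v"
  shows "test_fun (\<lambda>z. u z * v z)"
proof -
  have sub: "closure {z. u z * v z \<noteq> 0} \<subseteq> closure {z. u z \<noteq> 0}"
    by (intro closure_mono) auto
  have cu: "compact (closure {z. u z \<noteq> 0})" "closure {z. u z \<noteq> 0} \<subseteq> udisc" and Cu: "Ck k u" for k
    using assms(1) unfolding test_fun_def by blast+
  have "closure {z. u z \<noteq> 0} \<inter> closure {z. u z * v z \<noteq> 0} = closure {z. u z * v z \<noteq> 0}"
    using sub by blast
  then have "compact (closure {z. u z * v z \<noteq> 0})"
    using compact_Int_closed[OF cu(1) closed_closure[of "{z. u z * v z \<noteq> 0}"]] by (simp only:)
  moreover have "closure {z. u z * v z \<noteq> 0} \<subseteq> udisc" using sub cu(2) by (rule subset_trans)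
  moreover have "Ck k (\<lambda>z. u z * v z)" for k
    by (intro Ck_mult Cu smooth_fun_Ck assms(2))
  ultimately show ?thesis unfolding test_fun_def by blast
qed

lemma test_fun_differentiable: "test_fun u \<Longrightarrow> u differentiable (at z)"
proof -
  assume "test_fun u"
  then have "Ck (Suc 0) u" unfolding test_fun_def by blast
  then show ?thesis by (simp add: differentiable_on_def)
qed

lemma test_fun_pd_continuous:
  assumes "test_fun u"
  shows "continuous_on UNIV u" "continuous_on UNIV (pdx u)" "continuous_on UNIV (pdy u)"
proof -
  have "Ck 0 u" "Ck (Suc 0) u" using assms unfolding test_fun_def by blast+
  then show "continuous_on UNIV u" "continuous_on UNIV (pdx u)" "continuous_on UNIV (pdy u)" by auto
qed

lemma pd_outside_support:
  assumes "z \<notin> closure {z. u z \<noteq> 0}"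
  shows "u z = 0" "pdx u z = 0" "pdy u z = 0"
proof -
  let ?S = "- closure {z. u z \<noteq> 0}"
  have "((\<lambda>_. 0) has_derivative (\<lambda>_. 0)) (at z)" by simp
  then have "(u has_derivative (\<lambda>_. 0)) (at z)"
    by (rule has_derivative_transform_within_open[of _ _ _ UNIV ?S])
      (use assms closure_subset[of "{z. u z \<noteq> 0}"] in auto)
  then have "frechet_derivative u (at z) = (\<lambda>_. 0)" by (rule frechet_derivative_eqI)
  then show "pdx u z = 0" "pdy u z = 0" by (auto simp: pdx_def pdy_def)
  show "u z = 0" using assms closure_subset[of "{z. u z \<noteq> 0}"] by auto
qed

lemma test_fun_integrable:
  fixes f :: "complex \<Rightarrow> 'a::euclidean_space"
  assumes u: "test_fun u" and f: "loc_integrable f"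
  shows "integrable (lebesgue_on udisc) (\<lambda>z. u z *\<^sub>R f z)"
    and "integrable (lebesgue_on udisc) (\<lambda>z. pdx u z *\<^sub>R f z)"
    and "integrable (lebesgue_on udisc) (\<lambda>z. pdy u z *\<^sub>R f z)"
proof -
  let ?K = "closure {z. u z \<noteq> 0}"
  have K: "compact ?K" "?K \<subseteq> udisc" using u by (auto simp: test_fun_def)
  have *: "integrable (lebesgue_on udisc) (\<lambda>z. v z *\<^sub>R f z)"
    if v: "continuous_on UNIV v" "\<And>z. z \<notin> ?K \<Longrightarrow> v z = 0" for v :: "complex \<Rightarrow> real"
  proof -
    have "compact (v ` ?K)" using K(1) v(1) by (intro compact_continuous_image) (auto intro: continuous_on_subset)
    then obtain C where C: "\<And>z. z \<in> ?K \<Longrightarrow> \<bar>v z\<bar> \<le> C"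
      by (meson compact_imp_bounded bounded_real image_eqI)
    have "\<bar>v z\<bar> \<le> max 0 C" for z using C[of z] v(2)[of z] by (cases "z \<in> ?K") auto
    then show ?thesis
      by (intro loc_integrable_scaleR(1)[OF f K _ _ v(2)] borel_measurable_continuous_onI v(1)) auto
  qed
  show "integrable (lebesgue_on udisc) (\<lambda>z. u z *\<^sub>R f z)"
    by (rule *[OF test_fun_pd_continuous(1)[OF u] pd_outside_support(1)[of _ u]])
  show "integrable (lebesgue_on udisc) (\<lambda>z. pdx u z *\<^sub>R f z)"
    by (rule *[OF test_fun_pd_continuous(2)[OF u] pd_outside_support(2)[of _ u]])
  show "integrable (lebesgue_on udisc) (\<lambda>z. pdy u z *\<^sub>R f z)"
    by (rule *[OF test_fun_pd_continuous(3)[OF u] pd_outside_support(3)[of _ u]])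
qed

section \<open>Rules for local integrability and for the weak operator\<close>

lemma loc_integrable_add:
  "loc_integrable f \<Longrightarrow> loc_integrable g \<Longrightarrow> loc_integrable (\<lambda>z. f z + g z)"
  by (auto simp: loc_integrable_def)

lemma loc_integrable_diff:
  "loc_integrable f \<Longrightarrow> loc_integrable g \<Longrightarrow> loc_integrable (\<lambda>z. f z - g z)"
  by (auto simp: loc_integrable_def)

lemma loc_integrable_linear:
  "loc_integrable f \<Longrightarrow> bounded_linear L \<Longrightarrow> loc_integrable (\<lambda>z. L (f z))"
  by (auto simp: loc_integrable_def intro: integrable_bounded_linear)

lemma loc_integrable_cong:
  assumes "\<And>z. z \<in> udisc \<Longrightarrow> f z = g z"
  shows "loc_integrable f \<longleftrightarrow> loc_integrable g"
proof -
  have "integrable (lebesgue_on K) f \<longleftrightarrow> integrable (lebesgue_on K) g" if "K \<subseteq> udisc" for K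
    using that assms by (intro Bochner_Integration.integrable_cong) auto
  then show ?thesis unfolding loc_integrable_def by meson
qed

lemma loc_integrable_continuous:
  fixes f :: "complex \<Rightarrow> 'a::euclidean_space"
  assumes "continuous_on udisc f"
  shows "loc_integrable f"
proof -
  have "integrable (lebesgue_on K) f" if "compact K" "K \<subseteq> udisc" for K
  proof -
    have "integrable lborel (\<lambda>z. indicator K z *\<^sub>R f z)"
      using that assms by (intro borel_integrable_compact) (auto intro: continuous_on_subset)
    then have "integrable lebesgue (\<lambda>z. indicator K z *\<^sub>R f z)"
      by (simp only: integrable_completion borel_measurable_integrable)
    then show ?thesis using that by (subst integrable_restrict_space) (auto simp: borel_compact)
  qed
  then show ?thesis by (auto simp: loc_integrable_def)
qed

lemma has_weak_CR_D:
  assumes "has_weak_CR e f g"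
  shows "loc_integrable f" "loc_integrable g"
    and "test_fun u \<Longrightarrow> (\<integral>z. (1/2) *\<^sub>R (pdx u z *\<^sub>R f z + pdy u z *\<^sub>R (e * f z)) \<partial>lebesgue_on udisc) =
      - (\<integral>z. u z *\<^sub>R g z \<partial>lebesgue_on udisc)"
  using assms unfolding has_weak_CR_def by blast+

lemma has_weak_CR_unique:
  fixes f :: "complex \<Rightarrow> 'a::{euclidean_space,real_algebra_1}"
  assumes "has_weak_CR e f g" "has_weak_CR e f h"
  shows "AE z in lebesgue_on udisc. g z = h z"
proof -
  have li: "loc_integrable g" "loc_integrable h" using assms[THEN has_weak_CR_D(2)] .
  have "AE z in lebesgue_on udisc. g z - h z = 0"
  proof (rule test_fun_integral_0_imp_AE_0)
    fix u assume u: "test_fun u"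
    have "(\<integral>z. u z *\<^sub>R g z \<partial>lebesgue_on udisc) = (\<integral>z. u z *\<^sub>R h z \<partial>lebesgue_on udisc)"
      using has_weak_CR_D(3)[OF assms(1) u] has_weak_CR_D(3)[OF assms(2) u] by (simp only: neg_equal_iff_equal)
    then show "(\<integral>z. u z *\<^sub>R (g z - h z) \<partial>lebesgue_on udisc) = 0"
      using test_fun_integrable(1)[OF u li(1)] test_fun_integrable(1)[OF u li(2)] by (simp add: scaleR_diff_right)
  qed (intro loc_integrable_diff li)
  then show ?thesis by simp
qed

lemma has_weak_CR_cong:
  assumes "\<And>z. z \<in> udisc \<Longrightarrow> f z = f' z" "\<And>z. z \<in> udisc \<Longrightarrow> g z = g' z"
  shows "has_weak_CR e f g \<longleftrightarrow> has_weak_CR e f' g'"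
proof -
  have "(\<integral>z. (1/2) *\<^sub>R (pdx u z *\<^sub>R f z + pdy u z *\<^sub>R (e * f z)) \<partial>lebesgue_on udisc) =
      (\<integral>z. (1/2) *\<^sub>R (pdx u z *\<^sub>R f' z + pdy u z *\<^sub>R (e * f' z)) \<partial>lebesgue_on udisc)"
    "(\<integral>z. u z *\<^sub>R g z \<partial>lebesgue_on udisc) = (\<integral>z. u z *\<^sub>R g' z \<partial>lebesgue_on udisc)" for u
    using assms by (auto intro!: Bochner_Integration.integral_cong)
  then show ?thesis
    using loc_integrable_cong[OF assms(1)] loc_integrable_cong[OF assms(2)]
    unfolding has_weak_CR_def by simp
qed

lemma bounded_linear_mult_left: "bounded_linear (\<lambda>x. (e::'a::{euclidean_space,real_algebra_1}) * x)"
proof -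
  have "linear (\<lambda>x. e * x)" by (rule linearI) (simp_all add: distrib_left)
  then show ?thesis by (simp only: linear_conv_bounded_linear)
qed

lemma weak_CR_integrand_integrable:
  fixes f :: "complex \<Rightarrow> 'a::{euclidean_space,real_algebra_1}"
  assumes "test_fun u" "loc_integrable f"
  shows "integrable (lebesgue_on udisc) (\<lambda>z. (1/2) *\<^sub>R (pdx u z *\<^sub>R f z + pdy u z *\<^sub>R (e * f z)))"
proof -
  have "loc_integrable (\<lambda>z. e * f z)"
    using loc_integrable_linear[OF assms(2) bounded_linear_mult_left[of e]] .
  from test_fun_integrable(2)[OF assms] test_fun_integrable(3)[OF assms(1) this]
  have "integrable (lebesgue_on udisc) (\<lambda>z. pdx u z *\<^sub>R f z + pdy u z *\<^sub>R (e * f z))"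
    by (rule Bochner_Integration.integrable_add)
  then show ?thesis by (rule integrable_scaleR_right)
qed

lemma has_weak_CR_add:
  fixes f :: "complex \<Rightarrow> 'a::{euclidean_space,real_algebra_1}"
  assumes "has_weak_CR e f g" "has_weak_CR e f' g'"
  shows "has_weak_CR e (\<lambda>z. f z + f' z) (\<lambda>z. g z + g' z)"
proof -
  have li: "loc_integrable f" "loc_integrable f'" "loc_integrable g" "loc_integrable g'"
    using assms[THEN has_weak_CR_D(1)] assms[THEN has_weak_CR_D(2)] .
  show ?thesis
    unfolding has_weak_CR_def
  proof (intro conjI allI impI loc_integrable_add li)
    fix u assume u: "test_fun u"
    have "(\<integral>z. (1/2) *\<^sub>R (pdx u z *\<^sub>R (f z + f' z) + pdy u z *\<^sub>R (e * (f z + f' z))) \<partial>lebesgue_on udisc) =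
      (\<integral>z. (1/2) *\<^sub>R (pdx u z *\<^sub>R f z + pdy u z *\<^sub>R (e * f z)) \<partial>lebesgue_on udisc) +
      (\<integral>z. (1/2) *\<^sub>R (pdx u z *\<^sub>R f' z + pdy u z *\<^sub>R (e * f' z)) \<partial>lebesgue_on udisc)"
      by (subst Bochner_Integration.integral_add[symmetric])
        (intro weak_CR_integrand_integrable u li, intro weak_CR_integrand_integrable u li,
         rule Bochner_Integration.integral_cong, simp, simp add: algebra_simps)
    also have "\<dots> = - (\<integral>z. u z *\<^sub>R (g z + g' z) \<partial>lebesgue_on udisc)"
      unfolding has_weak_CR_D(3)[OF assms(1) u] has_weak_CR_D(3)[OF assms(2) u]
      using test_fun_integrable(1)[OF u li(3)] test_fun_integrable(1)[OF u li(4)]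
      by (simp add: scaleR_add_right)
    finally show "(\<integral>z. (1/2) *\<^sub>R (pdx u z *\<^sub>R (f z + f' z) + pdy u z *\<^sub>R (e * (f z + f' z))) \<partial>lebesgue_on udisc) =
      - (\<integral>z. u z *\<^sub>R (g z + g' z) \<partial>lebesgue_on udisc)" .
  qed
qed

text \<open>\<open>L\<close> only has to be real linear and to intertwine multiplication by
  \<open>e\<close> and \<open>e'\<close>. This covers real scaling as well as the passage to the
  idempotent components, where \<open>bj\<close> becomes the imaginary unit.\<close>

lemma has_weak_CR_linear:
  fixes f :: "complex \<Rightarrow> 'a::{euclidean_space,real_algebra_1}"
    and L :: "'a \<Rightarrow> 'b::{euclidean_space,real_algebra_1}"
  assumes L: "bounded_linear L" "\<And>w. L (e * w) = e' * L w" and f: "has_weak_CR e f g"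
  shows "has_weak_CR e' (\<lambda>z. L (f z)) (\<lambda>z. L (g z))"
proof -
  interpret L: bounded_linear L by fact
  have li: "loc_integrable f" "loc_integrable g" using f[THEN has_weak_CR_D(1)] f[THEN has_weak_CR_D(2)] .
  show ?thesis
    unfolding has_weak_CR_def
  proof (intro conjI allI impI loc_integrable_linear[OF _ L(1)] li)
    fix u assume u: "test_fun u"
    have "(\<integral>z. (1/2) *\<^sub>R (pdx u z *\<^sub>R L (f z) + pdy u z *\<^sub>R (e' * L (f z))) \<partial>lebesgue_on udisc) =
      (\<integral>z. L ((1/2) *\<^sub>R (pdx u z *\<^sub>R f z + pdy u z *\<^sub>R (e * f z))) \<partial>lebesgue_on udisc)"
      by (simp add: L.scaleR L.add L(2))
    also have "\<dots> = L (\<integral>z. (1/2) *\<^sub>R (pdx u z *\<^sub>R f z + pdy u z *\<^sub>R (e * f z)) \<partial>lebesgue_on udisc)"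
      by (intro integral_bounded_linear L(1) weak_CR_integrand_integrable u li)
    also have "\<dots> = - L (\<integral>z. u z *\<^sub>R g z \<partial>lebesgue_on udisc)"
      by (simp only: has_weak_CR_D(3)[OF f u] L.neg)
    also have "L (\<integral>z. u z *\<^sub>R g z \<partial>lebesgue_on udisc) = (\<integral>z. L (u z *\<^sub>R g z) \<partial>lebesgue_on udisc)"
      by (intro integral_bounded_linear[symmetric] L(1) test_fun_integrable u li)
    finally show "(\<integral>z. (1/2) *\<^sub>R (pdx u z *\<^sub>R L (f z) + pdy u z *\<^sub>R (e' * L (f z))) \<partial>lebesgue_on udisc) =
      - (\<integral>z. u z *\<^sub>R L (g z) \<partial>lebesgue_on udisc)" by (simp add: L.scaleR)
  qed
qed

lemma has_weak_CR_scaleR: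
  fixes f :: "complex \<Rightarrow> 'a::{euclidean_space,real_algebra_1}"
  shows "has_weak_CR e f g \<Longrightarrow> has_weak_CR e (\<lambda>z. c *\<^sub>R f z) (\<lambda>z. c *\<^sub>R g z)"
  by (rule has_weak_CR_linear[of "\<lambda>w. c *\<^sub>R w"]) (auto intro: bounded_linear_scaleR_right)

lemma has_weak_CR_0:
  "has_weak_CR e (\<lambda>z. 0::'a::{euclidean_space,real_algebra_1}) (\<lambda>z. 0)"
  by (auto simp: has_weak_CR_def loc_integrable_def)

lemma has_weak_CR_sum:
  fixes f :: "'i \<Rightarrow> complex \<Rightarrow> 'a::{euclidean_space,real_algebra_1}"
  assumes "\<And>i. i \<in> I \<Longrightarrow> has_weak_CR e (f i) (g i)"
  shows "has_weak_CR e (\<lambda>z. \<Sum>i\<in>I. f i z) (\<lambda>z. \<Sum>i\<in>I. g i z)"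
  using assms
  by (induction I rule: infinite_finite_induct) (auto intro: has_weak_CR_0 has_weak_CR_add)

lemma loc_integrable_Re_scaleR:
  fixes f :: "complex \<Rightarrow> 'a::euclidean_space"
  assumes "loc_integrable f"
  shows "loc_integrable (\<lambda>z. (2 * Re z) *\<^sub>R f z)"
  unfolding loc_integrable_def
proof (intro allI impI, elim conjE)
  fix K assume K: "compact K" "K \<subseteq> udisc"
  have fK: "integrable (lebesgue_on K) f" using assms K by (auto simp: loc_integrable_def)
  have m: "(\<lambda>z. 2 * Re z) \<in> borel_measurable (lebesgue_on K)"
    by (intro continuous_imp_measurable_on_sets_lebesgue continuous_intros) (use K in \<open>simp add: borel_compact\<close>)
  show "integrable (lebesgue_on K) (\<lambda>z. (2 * Re z) *\<^sub>R f z)"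
  proof (rule Bochner_Integration.integrable_bound)
    show "integrable (lebesgue_on K) (\<lambda>z. 2 *\<^sub>R f z)" using fK by simp
    show "(\<lambda>z. (2 * Re z) *\<^sub>R f z) \<in> borel_measurable (lebesgue_on K)"
      using m fK by (intro borel_measurable_scaleR) auto
    have "\<bar>Re z\<bar> \<le> 1" if "z \<in> K" for z
      using that K(2) abs_Re_le_cmod[of z] by (force simp: dist_norm)
    then show "AE z in lebesgue_on K. norm ((2 * Re z) *\<^sub>R f z) \<le> norm (2 *\<^sub>R f z)"
      by (intro AE_I2) (auto simp: abs_mult intro!: mult_right_mono mult_left_le_one_le)
  qed
qed

text \<open>Test against \<open>v = u * 2 Re z\<close>: half the x-derivative of 2x is 1 and its
  y-derivative vanishes, so the only correction is the integral of \<open>u\<close> times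
  \<open>f\<close>, whatever the unit \<open>e\<close> is.\<close>

lemma has_weak_CR_Re_scaleR:
  fixes f :: "complex \<Rightarrow> 'a::{euclidean_space,real_algebra_1}"
  assumes f: "has_weak_CR e f g"
  shows "has_weak_CR e (\<lambda>z. (2 * Re z) *\<^sub>R f z) (\<lambda>z. (2 * Re z) *\<^sub>R g z + f z)"
proof -
  have li: "loc_integrable f" "loc_integrable g" using f[THEN has_weak_CR_D(1)] f[THEN has_weak_CR_D(2)] .
  have sm: "smooth_fun (\<lambda>z. 2 * Re z)" by (intro smooth_fun.intros)
  have pd2: "pdx (\<lambda>z. 2 * Re z) z = 2" "pdy (\<lambda>z. 2 * Re z) z = 0" for z
  proof -
    have "((\<lambda>z. 2 * Re z) has_derivative (\<lambda>h. 2 * Re h)) (at z)"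
      by (auto intro!: derivative_eq_intros)
    then have "frechet_derivative (\<lambda>z. 2 * Re z) (at z) = (\<lambda>h. 2 * Re h)" by (rule frechet_derivative_eqI)
    then show "pdx (\<lambda>z. 2 * Re z) z = 2" "pdy (\<lambda>z. 2 * Re z) z = 0" by (auto simp: pdx_def pdy_def)
  qed
  show ?thesis
    unfolding has_weak_CR_def
  proof (intro conjI allI impI loc_integrable_add loc_integrable_Re_scaleR li)
    fix u assume u: "test_fun u"
    define v where "v = (\<lambda>z. u z * (2 * Re z))"
    have v: "test_fun v" unfolding v_def by (rule test_fun_mult[OF u sm])
    have pdv: "pdx v z = u z * 2 + pdx u z * (2 * Re z)" "pdy v z = pdy u z * (2 * Re z)" for z
      unfolding v_def
      using pd_mult[OF test_fun_differentiable[OF u, of z] smooth_fun_differentiable[OF sm, of z]]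
      by (auto simp: pd2)
    have "(\<integral>z. (1/2) *\<^sub>R (pdx u z *\<^sub>R ((2 * Re z) *\<^sub>R f z) + pdy u z *\<^sub>R (e * ((2 * Re z) *\<^sub>R f z))) \<partial>lebesgue_on udisc) =
      (\<integral>z. (1/2) *\<^sub>R (pdx v z *\<^sub>R f z + pdy v z *\<^sub>R (e * f z)) - u z *\<^sub>R f z \<partial>lebesgue_on udisc)"
      by (intro Bochner_Integration.integral_cong) (auto simp: pdv algebra_simps)
    also have "\<dots> = (\<integral>z. (1/2) *\<^sub>R (pdx v z *\<^sub>R f z + pdy v z *\<^sub>R (e * f z)) \<partial>lebesgue_on udisc) -
        (\<integral>z. u z *\<^sub>R f z \<partial>lebesgue_on udisc)"
      by (intro Bochner_Integration.integral_diff weak_CR_integrand_integrable test_fun_integrable u v li)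
    also have "(\<integral>z. (1/2) *\<^sub>R (pdx v z *\<^sub>R f z + pdy v z *\<^sub>R (e * f z)) \<partial>lebesgue_on udisc) =
        - (\<integral>z. v z *\<^sub>R g z \<partial>lebesgue_on udisc)"
      by (rule has_weak_CR_D(3)[OF f v])
    also have "- (\<integral>z. v z *\<^sub>R g z \<partial>lebesgue_on udisc) - (\<integral>z. u z *\<^sub>R f z \<partial>lebesgue_on udisc) =
        - (\<integral>z. v z *\<^sub>R g z + u z *\<^sub>R f z \<partial>lebesgue_on udisc)"
      using test_fun_integrable(1)[OF v li(2)] test_fun_integrable(1)[OF u li(1)] by simp
    also have "(\<integral>z. v z *\<^sub>R g z + u z *\<^sub>R f z \<partial>lebesgue_on udisc) =
        (\<integral>z. u z *\<^sub>R ((2 * Re z) *\<^sub>R g z + f z) \<partial>lebesgue_on udisc)"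
      by (intro Bochner_Integration.integral_cong) (auto simp: v_def algebra_simps)
    finally show "(\<integral>z. (1/2) *\<^sub>R (pdx u z *\<^sub>R ((2 * Re z) *\<^sub>R f z) + pdy u z *\<^sub>R (e * ((2 * Re z) *\<^sub>R f z))) \<partial>lebesgue_on udisc) =
      - (\<integral>z. u z *\<^sub>R ((2 * Re z) *\<^sub>R g z + f z) \<partial>lebesgue_on udisc)" .
  qed
qed

lemma has_weak_CR_Re_power_scaleR:
  fixes f :: "complex \<Rightarrow> 'a::{euclidean_space,real_algebra_1}"
  assumes f: "has_weak_CR e f g"
  shows "has_weak_CR e (\<lambda>z. (2 * Re z) ^ k *\<^sub>R f z)
    (\<lambda>z. (2 * Re z) ^ k *\<^sub>R g z + (real k * (2 * Re z) ^ (k - 1)) *\<^sub>R f z)"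
proof (induction k)
  case (Suc k)
  have "a *\<^sub>R (a ^ k *\<^sub>R x + (real k * a ^ (k - 1)) *\<^sub>R y) + a ^ k *\<^sub>R y =
      a ^ Suc k *\<^sub>R x + (real (Suc k) * a ^ (Suc k - 1)) *\<^sub>R y" for a :: real and x y :: 'a
  proof -
    have "a * (real k * a ^ (k - 1)) = real k * a ^ k" by (cases k) auto
    then show ?thesis by (simp add: scaleR_add_right scaleR_left_distrib distrib_right)
  qed
  moreover have "(2 * Re z) *\<^sub>R ((2 * Re z) ^ k *\<^sub>R f z) = (2 * Re z) ^ Suc k *\<^sub>R f z" for z by simp
  ultimately show ?case using has_weak_CR_Re_scaleR[OF Suc.IH] by (simp only:)
qed (use f in simp)

section \<open>Hardy bounds for the components\<close>

lemma bchat_add_bchat_cnj: "bchat (cnj z) + bchat z = of_real (2 * Re z)"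
  by (simp add: bicomplex_eq_iff complex_eq_iff bchat_def of_real_def)

lemma of_real_power_mult: "of_real x ^ k * (w :: 'a::real_algebra_1) = x ^ k *\<^sub>R w"
  by (simp add: scaleR_conv_of_real)

lemma linear_bconj: "linear bconj"
  by (rule linearI) (simp_all add: bconj_def bicomplex_eq_iff)

lemma continuous_scaleR_Re_power:
  fixes f :: "complex \<Rightarrow> 'a::real_normed_vector"
  shows "continuous_on S f \<Longrightarrow> continuous_on S (\<lambda>z. (c * (2 * Re z) ^ k) *\<^sub>R f z)"
  by (intro continuous_intros)

text \<open>The factors (2x)^j and the factorials are real, so \<open>bconj\<close> and the products
  with \<open>A\<close> and \<open>B\<close> pass through them and the zero-order terms cancel; only
  the derivatives of the powers survive. Uniqueness of the weak derivative gives the identity almost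
  everywhere, continuity everywhere.\<close>

lemma vekua_iterates_eq:
  assumes cont: "\<And>k. k \<le> n \<Longrightarrow> continuous_on udisc (G k)"
    and op: "\<And>k. k < n \<Longrightarrow> is_vekua_op A B (G k) (G (Suc k))"
    and phi: "\<And>k. k < n \<Longrightarrow> \<phi> k \<in> H_AB A B"
    and G0: "\<And>z. z \<in> udisc \<Longrightarrow> G 0 z = (\<Sum>k<n. (2 * Re z) ^ k *\<^sub>R \<phi> k z)"
    and m: "m < n" and z: "z \<in> udisc"
  shows "G m z = (\<Sum>k=m..<n. (fact k / fact (k - m) * (2 * Re z) ^ (k - m)) *\<^sub>R \<phi> k z)"
  using m z
proof (induction m arbitrary: z)
  case 0
  then show ?case using G0[of z] by (simp add: atLeast0LessThan)
next
  case (Suc m)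
  have mn: "m < n" using Suc.prems by simp
  let ?c = "\<lambda>k. fact k / fact (k - m) :: real"
  define g where "g = (\<lambda>k z. A z * \<phi> k z + B z * bconj (\<phi> k z))"
  define S where "S = (\<lambda>z. \<Sum>k=m..<n. ?c k *\<^sub>R ((2 * Re z) ^ (k - m) *\<^sub>R \<phi> k z))"
  define D where "D = (\<lambda>z. \<Sum>k=m..<n. ?c k *\<^sub>R ((2 * Re z) ^ (k - m) *\<^sub>R g k z +
      (real (k - m) * (2 * Re z) ^ (k - m - 1)) *\<^sub>R \<phi> k z))"
  define S' where "S' = (\<lambda>z. \<Sum>k=Suc m..<n. (fact k / fact (k - Suc m) * (2 * Re z) ^ (k - Suc m)) *\<^sub>R \<phi> k z)"
  have wphi: "has_weak_dbar (\<phi> k) (g k)" and cphi: "continuous_on udisc (\<phi> k)" if "k < n" for k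
    using phi[OF that] by (simp_all add: H_AB_def g_def)
  have SD: "has_weak_dbar S D"
    unfolding S_def D_def
    by (rule has_weak_CR_sum, rule has_weak_CR_scaleR, rule has_weak_CR_Re_power_scaleR, rule wphi) simp
  have GS: "G m z = S z" if "z \<in> udisc" for z
    using Suc.IH[OF mn that] by (simp add: S_def)
  obtain d where d: "has_weak_dbar (G m) d"
    "\<And>z. z \<in> udisc \<Longrightarrow> G (Suc m) z = d z - A z * G m z - B z * bconj (G m z)"
    using op[OF mn] unfolding is_vekua_op_def by blast
  have "has_weak_dbar S d"
    using d(1) has_weak_CR_cong[of "G m" S d d bj] GS by blast
  then have ae: "AE z in lebesgue_on udisc. d z = D z"
    using SD by (rule has_weak_CR_unique)
  have alg: "D z - A z * S z - B z * bconj (S z) = S' z" for z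
  proof -
    have bS: "bconj (S z) = (\<Sum>k=m..<n. ?c k *\<^sub>R ((2 * Re z) ^ (k - m) *\<^sub>R bconj (\<phi> k z)))"
      unfolding S_def by (simp add: linear_sum[OF linear_bconj] linear_scale[OF linear_bconj])
    have "D z - A z * S z - B z * bconj (S z) =
        (\<Sum>k=m..<n. ?c k *\<^sub>R ((real (k - m) * (2 * Re z) ^ (k - m - 1)) *\<^sub>R \<phi> k z))"
      unfolding bS unfolding S_def D_def g_def sum_distrib_left sum_subtractf[symmetric]
      by (intro sum.cong refl) (simp add: algebra_simps)
    \<comment> \<open>The term with k = m carries the factor \<open>real (k - m)\<close>, which is
      0.\<close>
    also have "\<dots> = (\<Sum>k=Suc m..<n. ?c k *\<^sub>R ((real (k - m) * (2 * Re z) ^ (k - m - 1)) *\<^sub>R \<phi> k z))"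
      using mn by (simp add: sum.atLeast_Suc_lessThan)
    also have "\<dots> = S' z"
      unfolding S'_def
    proof (intro sum.cong refl)
      fix k assume k: "k \<in> {Suc m..<n}"
      \<comment> \<open>Now k - m is Suc j, and the factor Suc j from the derivative cancels against
        fact (Suc j).\<close>
      then obtain j where j: "k = Suc (m + j)" using le_Suc_ex[of "Suc m" k] by auto
      show "?c k *\<^sub>R ((real (k - m) * (2 * Re z) ^ (k - m - 1)) *\<^sub>R \<phi> k z) =
          (fact k / fact (k - Suc m) * (2 * Re z) ^ (k - Suc m)) *\<^sub>R \<phi> k z"
        by (simp add: j field_simps del: of_nat_Suc)
    qed
    finally show ?thesis .
  qed
  have "AE z in lebesgue_on udisc. G (Suc m) z - S' z = 0"
    using ae AE_space
  proof eventually_elim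
    case (elim z)
    then have "z \<in> udisc" by simp
    then show ?case using d(2) GS alg[of z] elim(1) by simp
  qed
  moreover have "continuous_on udisc (\<lambda>z. G (Suc m) z - S' z)"
    unfolding S'_def
    by (intro continuous_on_diff continuous_on_sum continuous_scaleR_Re_power cphi cont)
      (use Suc.prems in auto)
  ultimately have "G (Suc m) z - S' z = 0"
    using continuous_AE_0_imp_0 Suc.prems(2) by blast
  then show ?case by (simp add: S'_def)
qed

text \<open>A bound on the integrals themselves, without the root 1/p of \<open>Hp_norm\<close>, so
  that sums and multiples are treated alike for all p > 0. The witness \<open>C\<close> may be
  negative, where \<open>ennreal C\<close> is 0; hence the terms \<open>max 0 C\<close> in the
  proofs.\<close>

definition circle_bounded :: "real \<Rightarrow> (complex \<Rightarrow> 'a::real_normed_vector) \<Rightarrow> bool" where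
  "circle_bounded p F \<longleftrightarrow> (\<exists>C::real. \<forall>r\<in>{0<..<1}.
     (\<integral>\<^sup>+\<theta>. ennreal (norm (F (of_real r * cis \<theta>)) powr p) \<partial>lebesgue_on {0..2*pi}) \<le> ennreal C)"

lemma circle_in_disc: "0 \<le> r \<Longrightarrow> r < 1 \<Longrightarrow> of_real r * cis \<theta> \<in> udisc"
  by (simp add: norm_mult)

lemma continuous_circle:
  fixes F :: "complex \<Rightarrow> 'a::real_normed_vector"
  assumes "continuous_on udisc F" "0 \<le> r" "r < 1"
  shows "continuous_on S (\<lambda>\<theta>. F (of_real r * cis \<theta>))"
  by (rule continuous_on_compose2[OF assms(1)])
    (use assms(2,3) circle_in_disc in \<open>auto intro!: continuous_intros\<close>)

lemma continuous_borel_measurable_circle: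
  fixes F :: "complex \<Rightarrow> 'a::euclidean_space"
  assumes "continuous_on udisc F" "0 \<le> r" "r < 1"
  shows "(\<lambda>\<theta>. F (of_real r * cis \<theta>)) \<in> borel_measurable (lebesgue_on {0..2*pi})"
  by (intro continuous_imp_measurable_on_sets_lebesgue continuous_circle assms) simp

text \<open>Holds for every p >= 0 because the larger summand alone decides; it stands in for
  convexity of t^p, which fails for p < 1.\<close>

lemma powr_add_le:
  fixes a b p :: real
  assumes "0 \<le> a" "0 \<le> b" "0 \<le> p"
  shows "(a + b) powr p \<le> 2 powr p * (a powr p + b powr p)"
proof -
  have "(a + b) powr p \<le> (2 * max a b) powr p"
    using assms by (intro powr_mono2) auto
  also have "\<dots> = 2 powr p * max a b powr p" using assms by (simp add: powr_mult)
  also have "max a b powr p \<le> a powr p + b powr p" by (cases "a \<le> b") auto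
  finally show ?thesis by simp
qed

lemma circle_bounded_add:
  fixes F G :: "complex \<Rightarrow> 'a::euclidean_space"
  assumes "circle_bounded p F" "circle_bounded p G" "continuous_on udisc F" "continuous_on udisc G" "0 \<le> p"
  shows "circle_bounded p (\<lambda>z. F z + G z)"
proof -
  let ?M = "lebesgue_on {0..2*pi}"
  obtain C D where
    C: "\<And>r. r \<in> {0<..<1} \<Longrightarrow> (\<integral>\<^sup>+\<theta>. ennreal (norm (F (of_real r * cis \<theta>)) powr p) \<partial>?M) \<le> ennreal C" and
    D: "\<And>r. r \<in> {0<..<1} \<Longrightarrow> (\<integral>\<^sup>+\<theta>. ennreal (norm (G (of_real r * cis \<theta>)) powr p) \<partial>?M) \<le> ennreal D"
    using assms(1,2) unfolding circle_bounded_def by blast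
  show ?thesis
    unfolding circle_bounded_def
  proof (intro exI[of _ "2 powr p * (max 0 C + max 0 D)"] ballI)
    fix r :: real assume r: "r \<in> {0<..<1}"
    have [measurable]: "(\<lambda>\<theta>. F (of_real r * cis \<theta>)) \<in> borel_measurable ?M"
      "(\<lambda>\<theta>. G (of_real r * cis \<theta>)) \<in> borel_measurable ?M"
      using r by (auto intro!: continuous_borel_measurable_circle assms)
    have "(\<integral>\<^sup>+\<theta>. ennreal (norm (F (of_real r * cis \<theta>) + G (of_real r * cis \<theta>)) powr p) \<partial>?M) \<le>
      (\<integral>\<^sup>+\<theta>. ennreal (2 powr p) * (ennreal (norm (F (of_real r * cis \<theta>)) powr p) +
        ennreal (norm (G (of_real r * cis \<theta>)) powr p)) \<partial>?M)"
    proof (intro nn_integral_mono)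
      fix \<theta>
      let ?a = "F (of_real r * cis \<theta>)" and ?b = "G (of_real r * cis \<theta>)"
      have "norm (?a + ?b) powr p \<le> (norm ?a + norm ?b) powr p"
        using assms(5) by (intro powr_mono2 norm_triangle_ineq) auto
      also have "\<dots> \<le> 2 powr p * (norm ?a powr p + norm ?b powr p)"
        using assms(5) by (intro powr_add_le) auto
      finally show "ennreal (norm (?a + ?b) powr p) \<le>
          ennreal (2 powr p) * (ennreal (norm ?a powr p) + ennreal (norm ?b powr p))"
        by (simp add: ennreal_mult'[symmetric] ennreal_plus[symmetric] ennreal_leI del: ennreal_plus)
    qed
    also have "\<dots> = ennreal (2 powr p) * ((\<integral>\<^sup>+\<theta>. ennreal (norm (F (of_real r * cis \<theta>)) powr p) \<partial>?M) +
        (\<integral>\<^sup>+\<theta>. ennreal (norm (G (of_real r * cis \<theta>)) powr p) \<partial>?M))"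
      by (subst nn_integral_cmult, measurable, subst nn_integral_add) measurable
    also have "\<dots> \<le> ennreal (2 powr p) * (ennreal (max 0 C) + ennreal (max 0 D))"
      by (intro mult_left_mono add_mono order_trans[OF C[OF r]] order_trans[OF D[OF r]] ennreal_leI) auto
    also have "\<dots> = ennreal (2 powr p * (max 0 C + max 0 D))"
      by (simp add: ennreal_mult'[symmetric] ennreal_plus[symmetric] del: ennreal_plus)
    finally show "(\<integral>\<^sup>+\<theta>. ennreal (norm (F (of_real r * cis \<theta>) + G (of_real r * cis \<theta>)) powr p) \<partial>?M)
        \<le> ennreal (2 powr p * (max 0 C + max 0 D))" .
  qed
qed

lemma circle_bounded_le:
  fixes F :: "complex \<Rightarrow> 'a::euclidean_space" and G :: "complex \<Rightarrow> 'b::euclidean_space"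
  assumes "circle_bounded p F" "continuous_on udisc F"
    and le: "\<And>z. z \<in> udisc \<Longrightarrow> norm (G z) \<le> c * norm (F z)" and c: "0 \<le> c" "0 \<le> p"
  shows "circle_bounded p G"
proof -
  let ?M = "lebesgue_on {0..2*pi}"
  obtain C where
    C: "\<And>r. r \<in> {0<..<1} \<Longrightarrow> (\<integral>\<^sup>+\<theta>. ennreal (norm (F (of_real r * cis \<theta>)) powr p) \<partial>?M) \<le> ennreal C"
    using assms(1) unfolding circle_bounded_def by blast
  show ?thesis
    unfolding circle_bounded_def
  proof (intro exI[of _ "c powr p * C"] ballI)
    fix r :: real assume r: "r \<in> {0<..<1}"
    have [measurable]: "(\<lambda>\<theta>. F (of_real r * cis \<theta>)) \<in> borel_measurable ?M"
      using r by (auto intro!: continuous_borel_measurable_circle assms)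
    have "(\<integral>\<^sup>+\<theta>. ennreal (norm (G (of_real r * cis \<theta>)) powr p) \<partial>?M) \<le>
      (\<integral>\<^sup>+\<theta>. ennreal (c powr p) * ennreal (norm (F (of_real r * cis \<theta>)) powr p) \<partial>?M)"
    proof (intro nn_integral_mono)
      fix \<theta>
      have "norm (G (of_real r * cis \<theta>)) powr p \<le> (c * norm (F (of_real r * cis \<theta>))) powr p"
        using c r by (intro powr_mono2 le circle_in_disc) auto
      then show "ennreal (norm (G (of_real r * cis \<theta>)) powr p) \<le>
          ennreal (c powr p) * ennreal (norm (F (of_real r * cis \<theta>)) powr p)"
        using c by (simp add: ennreal_mult'[symmetric] ennreal_leI powr_mult)
    qed
    also have "\<dots> = ennreal (c powr p) * (\<integral>\<^sup>+\<theta>. ennreal (norm (F (of_real r * cis \<theta>)) powr p) \<partial>?M)"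
      by (subst nn_integral_cmult) measurable
    also have "\<dots> \<le> ennreal (c powr p) * ennreal C"
      by (intro mult_left_mono C[OF r]) auto
    finally show "(\<integral>\<^sup>+\<theta>. ennreal (norm (G (of_real r * cis \<theta>)) powr p) \<partial>?M) \<le> ennreal (c powr p * C)"
      by (simp add: ennreal_mult')
  qed
qed

lemma Hp_norm_finite_imp_circle_bounded:
  assumes "Hp_norm p F < \<infinity>" "0 < p"
  shows "circle_bounded p F"
proof -
  let ?I = "\<lambda>r. \<integral>\<^sup>+\<theta>. ennreal (norm (F (of_real r * cis \<theta>)) powr p) \<partial>lebesgue_on {0..2*pi}"
  let ?N = "enn2real (Hp_norm p F)"
  have "?I r \<le> ennreal (?N powr p)" if r: "r \<in> {0<..<1}" for r
  proof -
    have le: "ennpowr (?I r) (1/p) \<le> Hp_norm p F"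
      unfolding Hp_norm_def using r by (intro SUP_upper)
    \<comment> \<open>\<open>ennpowr\<close> sends infinity to infinity, so a finite norm rules out
      infinite integrals. Without this, \<open>enn2real\<close> would turn infinity into 0.\<close>
    have fin: "?I r \<noteq> \<infinity>"
    proof
      assume "?I r = \<infinity>"
      then have "ennpowr (?I r) (1/p) = \<infinity>" by (simp add: ennpowr_def)
      then show False using le assms(1) by (simp add: top_unique)
    qed
    then have "ennpowr (?I r) (1/p) = ennreal (enn2real (?I r) powr (1/p))"
      by (simp add: ennpowr_def)
    then have "enn2real (?I r) powr (1/p) \<le> ?N"
      using le assms(1) by (metis enn2real_ennreal enn2real_mono infinity_ennreal_def powr_ge_zero)
    then have "(enn2real (?I r) powr (1/p)) powr p \<le> ?N powr p"
      using assms(2) by (intro powr_mono2) auto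
    then have "enn2real (?I r) \<le> ?N powr p" using assms(2) by (simp add: powr_powr)
    then show ?thesis
      using fin by (metis ennreal_enn2real_if ennreal_leI infinity_ennreal_def)
  qed
  then show ?thesis unfolding circle_bounded_def by blast
qed

lemma circle_bounded_sum:
  fixes F :: "'i \<Rightarrow> complex \<Rightarrow> 'a::euclidean_space"
  assumes "finite I" "\<And>i. i \<in> I \<Longrightarrow> circle_bounded p (F i)" "\<And>i. i \<in> I \<Longrightarrow> continuous_on udisc (F i)" "0 < p"
  shows "circle_bounded p (\<lambda>z. \<Sum>i\<in>I. F i z)"
  using assms(1-3)
proof (induction I rule: finite_induct)
  case empty
  have "circle_bounded p (\<lambda>z. 0 :: 'a)" using assms(4) by (auto simp: circle_bounded_def)
  then show ?case by simp
next
  case (insert i I)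
  have "circle_bounded p (\<lambda>z. F i z + (\<Sum>i\<in>I. F i z))"
    using insert assms(4) by (intro circle_bounded_add continuous_on_sum) simp_all
  then show ?case using insert.hyps by simp
qed

lemma V_AB_components_circle_bounded:
  assumes f: "f \<in> V_AB n p A B" and p: "0 < p"
    and rep: "\<And>z. z \<in> udisc \<Longrightarrow> f z = (\<Sum>k<n. (bchat (cnj z) + bchat z) ^ k * \<phi> k z)"
    and phi: "\<And>k. k < n \<Longrightarrow> \<phi> k \<in> H_AB A B"
    and m: "m < n"
  shows "circle_bounded p (\<phi> m)"
proof -
  obtain G where G0: "G 0 = f" and cont: "\<And>k. k \<le> n \<Longrightarrow> continuous_on udisc (G k)"
    and op: "\<And>k. k < n \<Longrightarrow> is_vekua_op A B (G k) (G (Suc k))"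
    and fin: "(\<Sum>k<n. Hp_norm p (G k)) < \<infinity>"
    using f unfolding V_AB_def by blast
  have G0': "G 0 z = (\<Sum>k<n. (2 * Re z) ^ k *\<^sub>R \<phi> k z)" if "z \<in> udisc" for z
    using rep[OF that] by (simp only: G0 bchat_add_bchat_cnj of_real_power_mult)
  have eq: "G m z = (\<Sum>k=m..<n. (fact k / fact (k - m) * (2 * Re z) ^ (k - m)) *\<^sub>R \<phi> k z)"
    if "m < n" "z \<in> udisc" for m z
    by (rule vekua_iterates_eq[OF cont op phi G0' that])
  have cphi: "continuous_on udisc (\<phi> k)" if "k < n" for k
    using phi[OF that] unfolding H_AB_def by blast
  have Gb: "circle_bounded p (G k)" if "k < n" for k
  proof (rule Hp_norm_finite_imp_circle_bounded[OF _ p])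
    show "Hp_norm p (G k) < \<infinity>"
      using fin that by (simp add: ennreal_sum_less_top)
  qed
  show ?thesis using m
  \<comment> \<open>Back substitution in a triangular system: the components of larger index are
    bounded first.\<close>
  proof (induction "n - m" arbitrary: m rule: less_induct)
    case less
    let ?R = "\<lambda>k z. (- (fact k / fact (k - m)) * (2 * Re z) ^ (k - m)) *\<^sub>R \<phi> k z"
    have Re_le: "\<bar>2 * Re z\<bar> ^ j \<le> 2 ^ j" if "z \<in> udisc" for z j
      using that abs_Re_le_cmod[of z] by (intro power_mono) auto
    have R: "circle_bounded p (?R k)" if k: "k \<in> {Suc m..<n}" for k
    proof (rule circle_bounded_le[OF less.hyps[of k]])
      show "norm (?R k z) \<le> (fact k / fact (k - m) * 2 ^ (k - m)) * norm (\<phi> k z)" if "z \<in> udisc" for z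
      proof -
        have "\<bar>- (fact k / fact (k - m)) * (2 * Re z) ^ (k - m)\<bar> \<le> fact k / fact (k - m) * 2 ^ (k - m)"
          unfolding abs_mult power_abs abs_minus_cancel
          using Re_le[OF that, of "k - m"] by (intro mult_mono) (simp_all add: abs_mult)
        then show ?thesis unfolding norm_scaleR by (rule mult_right_mono) simp
      qed
    qed (use k p cphi in auto)
    have "circle_bounded p (\<lambda>z. G m z + (\<Sum>k=Suc m..<n. ?R k z))"
      using less.prems p
      by (intro circle_bounded_add circle_bounded_sum Gb R continuous_on_sum continuous_scaleR_Re_power cphi cont) auto
    moreover have "continuous_on udisc (\<lambda>z. G m z + (\<Sum>k=Suc m..<n. ?R k z))"
      using less.prems by (intro continuous_on_add continuous_on_sum continuous_scaleR_Re_power cphi cont) auto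
    moreover have "norm (\<phi> m z) \<le> 1 * norm (G m z + (\<Sum>k=Suc m..<n. ?R k z))" if z: "z \<in> udisc" for z
    proof -
      \<comment> \<open>The diagonal coefficient is \<open>fact m\<close>, which is at least 1 and
        may be dropped from the upper bound.\<close>
      have "G m z + (\<Sum>k=Suc m..<n. ?R k z) = fact m *\<^sub>R \<phi> m z"
        using less.prems by (simp add: eq[OF less.prems z] sum.atLeast_Suc_lessThan sum_negf)
      then show ?thesis by (simp add: mult_le_cancel_right1)
    qed
    ultimately show ?case
      by (rule circle_bounded_le[where c = 1]) (use p in simp_all)
  qed
qed

section \<open>Weyl's lemma\<close>

text \<open>A radial mollifier kernel, not normalised; division by \<open>mass\<close> comes later.
  The squared modulus is spelled out through \<open>Re\<close> and \<open>Im\<close> so that the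
  rules of \<open>smooth_fun\<close> apply.\<close>

definition disc_bump :: "real \<Rightarrow> complex \<Rightarrow> real" where
  "disc_bump e v = bump 0 (e\<^sup>2 + (-1) * (Re v * Re v + Im v * Im v))"

lemma smooth_fun_disc_bump: "smooth_fun (disc_bump e)"
  unfolding disc_bump_def[abs_def] by (intro smooth_fun.intros)

lemma smooth_fun_disc_bump_diff: "smooth_fun (\<lambda>w. disc_bump e (z - w))"
proof -
  have "(\<lambda>w. disc_bump e (z - w)) = (\<lambda>w. bump 0 (e\<^sup>2 + (-1) *
    ((Re z + (-1) * Re w) * (Re z + (-1) * Re w) + (Im z + (-1) * Im w) * (Im z + (-1) * Im w))))"
    by (simp add: disc_bump_def fun_eq_iff)
  moreover have "smooth_fun (\<lambda>w. bump 0 (e\<^sup>2 + (-1) *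
    ((Re z + (-1) * Re w) * (Re z + (-1) * Re w) + (Im z + (-1) * Im w) * (Im z + (-1) * Im w))))"
    by (intro smooth_fun.intros)
  ultimately show ?thesis by simp
qed

lemma disc_bump_eq_0:
  assumes "0 \<le> e" "e \<le> cmod v"
  shows "disc_bump e v = 0"
proof -
  have "e\<^sup>2 \<le> (cmod v)\<^sup>2" using assms by (intro power_mono)
  then have "e\<^sup>2 + (-1) * (Re v * Re v + Im v * Im v) \<le> 0" using cmod_power2[of v]
    unfolding power2_eq_square[of "Re v"] power2_eq_square[of "Im v"] mult_minus1 by linarith
  then show ?thesis unfolding disc_bump_def bump_def by simp
qed

lemma disc_bump_nonneg: "0 \<le> disc_bump e v"
  by (simp add: disc_bump_def bump_def)

lemma disc_bump_0: "0 < e \<Longrightarrow> 0 < disc_bump e 0"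
  by (simp add: disc_bump_def bump_def)

lemma disc_bump_minus: "disc_bump e (- v) = disc_bump e v"
  by (simp add: disc_bump_def)

lemma smooth_fun_continuous: "smooth_fun u \<Longrightarrow> continuous_on S u"
  by (intro differentiable_imp_continuous_on smooth_fun_differentiable_on)

text \<open>The margins turn the convolution into an integral over one fixed box: for z in the disc
  of radius \<open>\<delta>\<close> about \<open>z0\<close>, the kernel centred at z has radius
  \<open>e\<close>, at most \<open>\<delta>\<close>, and vanishes outside the disc of radius
  2\<open>\<delta>\<close>, hence off the box.\<close>

locale mollify =
  fixes f :: "complex \<Rightarrow> complex" and a b z0 :: complex and \<delta> e :: real
  assumes cont: "continuous_on udisc f"
    and box: "cball z0 (2 * \<delta>) \<subseteq> cbox a b" "cbox a b \<subseteq> udisc"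
    and e: "0 < e" "e \<le> \<delta>"
begin

definition I :: "complex \<Rightarrow> complex" where
  "I z = integral (cbox a b) (\<lambda>w. disc_bump e (z - w) *\<^sub>R f w)"

lemma cont_box: "continuous_on (cbox a b) f"
  using cont box(2) by (rule continuous_on_subset)

lemma outside:
  assumes "z \<in> ball z0 \<delta>" "w \<notin> cbox a b"
  shows "e \<le> cmod (z - w)"
proof -
  have "w \<notin> cball z0 (2 * \<delta>)" using assms(2) box(1) by blast
  then have "2 * \<delta> < dist z0 w" by simp
  also have "\<dots> \<le> dist z0 z + dist z w" by (rule dist_triangle)
  finally show ?thesis using assms(1) e by (simp add: dist_norm)
qed

lemma I_has_derivative:
  assumes z: "z \<in> ball z0 \<delta>"
  shows "(I has_derivative (\<lambda>h. Re h *\<^sub>R integral (cbox a b) (\<lambda>w. pdx (disc_bump e) (z - w) *\<^sub>R f w) +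
      Im h *\<^sub>R integral (cbox a b) (\<lambda>w. pdy (disc_bump e) (z - w) *\<^sub>R f w))) (at z)"
proof -
  let ?b = "disc_bump e"
  \<comment> \<open>Differentiation under the integral by \<open>leibniz_rule\<close> takes
    derivatives as bounded linear maps; \<open>X c\<close> and \<open>Y c\<close> send h to Re h
    times c and to Im h times c.\<close>
  define X where "X = (\<lambda>c::complex. blinfun_scaleR_left c o\<^sub>L Blinfun Re)"
  define Y where "Y = (\<lambda>c::complex. blinfun_scaleR_left c o\<^sub>L Blinfun Im)"
  have X: "blinfun_apply (X c) h = Re h *\<^sub>R c" and Y: "blinfun_apply (Y c) h = Im h *\<^sub>R c" for c h
    by (simp_all add: X_def Y_def bounded_linear_Blinfun_apply bounded_linear_Re bounded_linear_Im)
  have cX: "continuous_on S X" and cY: "continuous_on S Y" for S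
    unfolding X_def Y_def
    by (intro bounded_linear.continuous_on[OF bounded_bilinear.bounded_linear_left[OF bounded_bilinear_blinfun_compose]]
        bounded_linear.continuous_on[OF bounded_linear_blinfun_scaleR_left] continuous_on_id)+
  define D where "D = (\<lambda>x w. pdx ?b (x - w) *\<^sub>R X (f w) + pdy ?b (x - w) *\<^sub>R Y (f w))"
  have cpd: "continuous_on S (pdx ?b)" "continuous_on S (pdy ?b)" "continuous_on S ?b" for S
    by (intro smooth_fun_continuous smooth_fun_pd smooth_fun_disc_bump)+
  have cD: "continuous_on (U \<times> cbox a b) (\<lambda>(x, w). D x w)" for U
    unfolding D_def case_prod_beta
    by (intro continuous_on_add continuous_on_scaleR
        continuous_on_compose2[OF cpd(1)[of UNIV]] continuous_on_compose2[OF cpd(2)[of UNIV]]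
        continuous_on_compose2[OF cX[of UNIV]] continuous_on_compose2[OF cY[of UNIV]]
        continuous_on_compose2[OF cont_box] continuous_intros) auto
  have Dint: "D x integrable_on cbox a b" for x
    unfolding D_def
    by (intro integrable_continuous continuous_on_add continuous_on_scaleR
        continuous_on_compose2[OF cpd(1)[of UNIV]] continuous_on_compose2[OF cpd(2)[of UNIV]]
        continuous_on_compose2[OF cX[of UNIV]] continuous_on_compose2[OF cY[of UNIV]]
        cont_box continuous_intros) auto
  have deriv: "((\<lambda>x. ?b (x - w) *\<^sub>R f w) has_derivative blinfun_apply (D x w)) (at x within U)" for x w U
  proof -
    have sub: "((\<lambda>x. x - w) has_derivative (\<lambda>h. h)) (at x within U)"
      by (auto intro!: derivative_eq_intros)
    have "((\<lambda>x. ?b (x - w)) has_derivative (\<lambda>h. pdx ?b (x - w) * Re h + pdy ?b (x - w) * Im h)) (at x within U)"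
      using has_derivative_compose[OF sub smooth_fun_has_derivative_pd[OF smooth_fun_disc_bump, of e "x - w"]] .
    moreover have "blinfun_apply (D x w) = (\<lambda>h. (pdx ?b (x - w) * Re h + pdy ?b (x - w) * Im h) *\<^sub>R f w)"
      by (rule ext) (simp add: D_def X Y scaleR_add_left blinfun.add_left blinfun.scaleR_left)
    ultimately show ?thesis using has_derivative_scaleR_left by (simp only:) blast
  qed
  have "((\<lambda>x. integral (cbox a b) (\<lambda>w. ?b (x - w) *\<^sub>R f w)) has_derivative
      blinfun_apply (integral (cbox a b) (D z))) (at z within ball z0 \<delta>)"
  proof (rule leibniz_rule[OF deriv _ cD z])
    show "(\<lambda>w. ?b (x - w) *\<^sub>R f w) integrable_on cbox a b" for x
      by (intro integrable_continuous continuous_on_scaleR continuous_on_compose2[OF cpd(3)[of UNIV]]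
          cont_box continuous_intros) auto
  qed (rule convex_ball)
  moreover have "blinfun_apply (integral (cbox a b) (D z)) h =
      Re h *\<^sub>R integral (cbox a b) (\<lambda>w. pdx ?b (z - w) *\<^sub>R f w) +
      Im h *\<^sub>R integral (cbox a b) (\<lambda>w. pdy ?b (z - w) *\<^sub>R f w)" for h
  proof -
    have i1: "(\<lambda>w. pdx ?b (z - w) *\<^sub>R f w) integrable_on cbox a b" "(\<lambda>w. pdy ?b (z - w) *\<^sub>R f w) integrable_on cbox a b"
      by (intro integrable_continuous continuous_on_scaleR continuous_on_compose2[OF cpd(1)[of UNIV]]
          continuous_on_compose2[OF cpd(2)[of UNIV]] cont_box continuous_intros; auto)+
    have "blinfun_apply (integral (cbox a b) (D z)) h = integral (cbox a b) (\<lambda>w. blinfun_apply (D z w) h)"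
      by (rule blinfun_apply_integral[OF Dint])
    also have "(\<lambda>w. blinfun_apply (D z w) h) =
        (\<lambda>w. Re h *\<^sub>R (pdx ?b (z - w) *\<^sub>R f w) + Im h *\<^sub>R (pdy ?b (z - w) *\<^sub>R f w))"
      by (rule ext) (simp add: D_def X Y blinfun.add_left blinfun.scaleR_left mult_ac)
    also have "integral (cbox a b) \<dots> = integral (cbox a b) (\<lambda>w. Re h *\<^sub>R (pdx ?b (z - w) *\<^sub>R f w)) +
        integral (cbox a b) (\<lambda>w. Im h *\<^sub>R (pdy ?b (z - w) *\<^sub>R f w))"
      by (intro Henstock_Kurzweil_Integration.integral_add integrable_cmul i1)
    finally show ?thesis by (simp only: Henstock_Kurzweil_Integration.integral_cmul)
  qed
  ultimately have "(I has_derivative (\<lambda>h. Re h *\<^sub>R integral (cbox a b) (\<lambda>w. pdx ?b (z - w) *\<^sub>R f w) +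
      Im h *\<^sub>R integral (cbox a b) (\<lambda>w. pdy ?b (z - w) *\<^sub>R f w))) (at z within ball z0 \<delta>)"
    unfolding I_def[abs_def] by (rule has_derivative_eq_rhs[OF _ ext])
  then show ?thesis using z by (simp add: at_within_open[of z "ball z0 \<delta>"])
qed

text \<open>Passes from the Bochner integral over the disc, in which weak derivatives are stated, to
  the gauge integral over the box, in which the convolution is differentiated.\<close>

lemma test_integral:
  assumes u: "test_fun u" and supp: "\<And>w. w \<notin> cbox a b \<Longrightarrow> u w = 0"
  shows "(\<integral>w. pdx u w *\<^sub>R f w \<partial>lebesgue_on udisc) = integral (cbox a b) (\<lambda>w. pdx u w *\<^sub>R f w)"
    and "(\<integral>w. pdy u w *\<^sub>R f w \<partial>lebesgue_on udisc) = integral (cbox a b) (\<lambda>w. pdy u w *\<^sub>R f w)"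
proof -
  have cl: "closure {w. u w \<noteq> 0} \<subseteq> cbox a b"
    using supp by (intro closure_minimal closed_cbox) blast
  have *: "(\<integral>w. v w *\<^sub>R f w \<partial>lebesgue_on udisc) = integral (cbox a b) (\<lambda>w. v w *\<^sub>R f w)"
    if v: "continuous_on UNIV v" "\<And>w. w \<notin> cbox a b \<Longrightarrow> v w = 0" for v :: "complex \<Rightarrow> real"
  proof -
    have cv: "continuous_on (cbox a b) v" using v(1) by (rule continuous_on_subset) simp
    then have "compact (v ` cbox a b)" by (intro compact_continuous_image) simp_all
    then obtain C where C: "\<And>w. w \<in> cbox a b \<Longrightarrow> \<bar>v w\<bar> \<le> C"
      by (meson compact_imp_bounded bounded_real image_eqI)
    have b: "\<bar>v w\<bar> \<le> max 0 C" for w using C[of w] v(2)[of w] by (cases "w \<in> cbox a b") auto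
    have "(\<integral>w. v w *\<^sub>R f w \<partial>lebesgue_on udisc) = (\<integral>w. v w *\<^sub>R f w \<partial>lebesgue_on (cbox a b))"
      by (rule loc_integrable_scaleR(2)[OF loc_integrable_continuous[OF cont] compact_cbox box(2)
            borel_measurable_continuous_onI[OF v(1)] b v(2)])
    also have "\<dots> = integral (cbox a b) (\<lambda>w. v w *\<^sub>R f w)"
    proof (rule integral_unique[symmetric, OF has_integral_integral_lebesgue_on])
      show "integrable (lebesgue_on (cbox a b)) (\<lambda>w. v w *\<^sub>R f w)"
        by (intro continuous_imp_integrable continuous_on_scaleR cv cont_box)
    qed simp
    finally show ?thesis .
  qed
  show "(\<integral>w. pdx u w *\<^sub>R f w \<partial>lebesgue_on udisc) = integral (cbox a b) (\<lambda>w. pdx u w *\<^sub>R f w)"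
    by (rule *[OF test_fun_pd_continuous(2)[OF u]]) (rule pd_outside_support(2), use cl in blast)
  show "(\<integral>w. pdy u w *\<^sub>R f w \<partial>lebesgue_on udisc) = integral (cbox a b) (\<lambda>w. pdy u w *\<^sub>R f w)"
    by (rule *[OF test_fun_pd_continuous(3)[OF u]]) (rule pd_outside_support(3), use cl in blast)
qed

text \<open>The kernel centred at z is itself a test function of w, and its partials in w are minus
  those of the kernel at z - w. The weak equation becomes P + i Q = 0 for the partials P and Q of
  \<open>I\<close>, which is the Cauchy-Riemann system.\<close>

lemma I_holomorphic:
  assumes f: "has_weak_dzstar f (\<lambda>_. 0)"
  shows "I holomorphic_on ball z0 \<delta>"
  unfolding holomorphic_on_open[OF open_ball]
proof
  fix z assume z: "z \<in> ball z0 \<delta>"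
  let ?b = "disc_bump e"
  define u where "u = (\<lambda>w. ?b (z - w))"
  have u0: "u w = 0" if "w \<notin> cbox a b" for w
    unfolding u_def using e outside[OF z that] by (intro disc_bump_eq_0) auto
  have u: "test_fun u"
    by (rule test_fun_smooth[of _ "cbox a b"]) (simp_all add: u_def[symmetric] smooth_fun_disc_bump_diff[of e z, folded u_def] box u0)
  have pd: "pdx u w = - pdx ?b (z - w)" "pdy u w = - pdy ?b (z - w)" for w
  proof -
    have sub: "((\<lambda>w. z - w) has_derivative (\<lambda>h. - h)) (at w)"
      by (auto intro!: derivative_eq_intros)
    have "(u has_derivative (\<lambda>h. pdx ?b (z - w) * Re (- h) + pdy ?b (z - w) * Im (- h))) (at w)"
      unfolding u_def
      using has_derivative_compose[OF sub smooth_fun_has_derivative_pd[OF smooth_fun_disc_bump, of e "z - w"]] .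
    from frechet_derivative_eqI[OF this]
    show "pdx u w = - pdx ?b (z - w)" "pdy u w = - pdy ?b (z - w)"
      by (simp_all add: pdx_def[of u] pdy_def[of u])
  qed
  define P where "P = integral (cbox a b) (\<lambda>w. pdx ?b (z - w) *\<^sub>R f w)"
  define Q where "Q = integral (cbox a b) (\<lambda>w. pdy ?b (z - w) *\<^sub>R f w)"
  have li: "loc_integrable f" by (rule loc_integrable_continuous[OF cont])
  note int = test_fun_integrable(2,3)[OF u li]
  have "0 = (\<integral>w. (1/2) *\<^sub>R (pdx u w *\<^sub>R f w + pdy u w *\<^sub>R (\<i> * f w)) \<partial>lebesgue_on udisc)"
    using has_weak_CR_D(3)[OF f u] by simp
  also have "\<dots> = (\<integral>w. (1/2) *\<^sub>R (pdx u w *\<^sub>R f w) + (\<i> / 2) * (pdy u w *\<^sub>R f w) \<partial>lebesgue_on udisc)"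
    by (intro Bochner_Integration.integral_cong) (simp_all add: scaleR_conv_of_real field_simps)
  also have "\<dots> = (1/2) *\<^sub>R (\<integral>w. pdx u w *\<^sub>R f w \<partial>lebesgue_on udisc) + (\<i> / 2) * (\<integral>w. pdy u w *\<^sub>R f w \<partial>lebesgue_on udisc)"
    by (rule trans[OF Bochner_Integration.integral_add[OF integrable_scaleR_right[OF int(1)] integrable_mult_right[OF int(2)]]])
      (simp only: integral_scaleR_right integral_mult_right_zero)
  also have "(\<integral>w. pdx u w *\<^sub>R f w \<partial>lebesgue_on udisc) = - P"
  proof -
    have "(\<integral>w. pdx u w *\<^sub>R f w \<partial>lebesgue_on udisc) = integral (cbox a b) (\<lambda>w. pdx u w *\<^sub>R f w)"
      by (rule test_integral(1)[OF u u0])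
    then show ?thesis by (simp only: pd scaleR_minus_left Henstock_Kurzweil_Integration.integral_neg P_def)
  qed
  also have "(\<integral>w. pdy u w *\<^sub>R f w \<partial>lebesgue_on udisc) = - Q"
  proof -
    have "(\<integral>w. pdy u w *\<^sub>R f w \<partial>lebesgue_on udisc) = integral (cbox a b) (\<lambda>w. pdy u w *\<^sub>R f w)"
      by (rule test_integral(2)[OF u u0])
    then show ?thesis by (simp only: pd scaleR_minus_left Henstock_Kurzweil_Integration.integral_neg Q_def)
  qed
  finally have "P + \<i> * Q = 0" by (simp add: scaleR_conv_of_real field_simps)
  then have "\<i> * (P + \<i> * Q) = 0" by simp
  then have PQ: "Q = \<i> * P" by (simp add: algebra_simps)
  have "(I has_derivative (\<lambda>h. Re h *\<^sub>R P + Im h *\<^sub>R Q)) (at z)"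
    unfolding P_def Q_def by (rule I_has_derivative[OF z])
  also have "(\<lambda>h. Re h *\<^sub>R P + Im h *\<^sub>R Q) = (*) P"
  proof
    fix h
    have "P * h = P * (of_real (Re h) + \<i> * of_real (Im h))" by (simp only: complex_eq[symmetric])
    then show "Re h *\<^sub>R P + Im h *\<^sub>R Q = P * h" by (simp add: PQ scaleR_conv_of_real algebra_simps)
  qed
  finally have "(I has_field_derivative P) (at z)" by (simp only: has_field_derivative_def)
  then show "\<exists>f'. (I has_field_derivative f') (at z)" by blast
qed

definition mass :: real where "mass = integral UNIV (disc_bump e)"

lemma mass_eq:
  assumes z: "z \<in> ball z0 \<delta>"
  shows "integral (cbox a b) (\<lambda>w. disc_bump e (z - w)) = mass"
proof -
  have "integral (cbox a b) (\<lambda>w. disc_bump e (z - w)) = integral (cbox a b) (\<lambda>w. disc_bump e (w - z))"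
    by (intro integral_cong) (metis disc_bump_minus minus_diff_eq)
  also have "\<dots> = integral (cbox (a - z) (b - z)) (\<lambda>x. disc_bump e (x + z - z))"
    by (rule integral_shift_cbox[symmetric])
  also have "\<dots> = integral (cbox (a - z) (b - z)) (disc_bump e)" by simp
  also have "\<dots> = integral UNIV (\<lambda>x. if x \<in> cbox (a - z) (b - z) then disc_bump e x else 0)"
    by (rule Henstock_Kurzweil_Integration.integral_restrict_UNIV[symmetric])
  also have "(\<lambda>x. if x \<in> cbox (a - z) (b - z) then disc_bump e x else 0) = disc_bump e"
  proof
    fix x
    have "disc_bump e x = 0" if "x \<notin> cbox (a - z) (b - z)"
    proof -
      have "x + z \<notin> cbox a b" using that by (auto simp: in_cbox_complex_iff algebra_simps)
      from outside[OF z this] show ?thesis using e by (intro disc_bump_eq_0) (auto simp: norm_minus_commute)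
    qed
    then show "(if x \<in> cbox (a - z) (b - z) then disc_bump e x else 0) = disc_bump e x" by simp
  qed
  finally show ?thesis by (simp add: mass_def)
qed

lemma mass_pos:
  assumes "0 < \<delta>"
  shows "0 < mass"
proof -
  have z: "z0 \<in> ball z0 \<delta>" using assms by simp
  have c: "continuous_on (cbox a b) (\<lambda>w. disc_bump e (z0 - w))"
    by (rule smooth_fun_continuous[OF smooth_fun_disc_bump_diff])
  have "ball z0 (2 * \<delta>) \<subseteq> interior (cbox a b)"
    using box(1) ball_subset_cball[of z0 "2 * \<delta>"] by (intro interior_maximal) auto
  then have "box a b \<noteq> {}" using assms by auto
  then have "integral (cbox a b) (\<lambda>w. disc_bump e (z0 - w)) \<noteq> 0"
    using integral_cbox_eq_0_iff[OF c] disc_bump_nonneg disc_bump_0[OF e(1)] box(1) assms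
    by (metis diff_self mem_cball dist_self less_imp_le mult_pos_pos subsetD zero_less_numeral less_irrefl)
  moreover have "0 \<le> integral (cbox a b) (\<lambda>w. disc_bump e (z0 - w))"
    by (intro Henstock_Kurzweil_Integration.integral_nonneg integrable_continuous c disc_bump_nonneg)
  ultimately show ?thesis unfolding mass_eq[OF z] by simp
qed

lemma I_close:
  assumes z: "z \<in> ball z0 \<delta>" and \<delta>: "0 < \<delta>"
    and osc: "\<And>w. w \<in> cbox a b \<Longrightarrow> dist z w < e \<Longrightarrow> cmod (f w - f z) \<le> \<omega>" and \<omega>: "0 \<le> \<omega>"
  shows "cmod (I z / of_real mass - f z) \<le> \<omega>"
proof -
  let ?b = "disc_bump e"
  have c: "continuous_on (cbox a b) (\<lambda>w. ?b (z - w))"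
    by (rule smooth_fun_continuous[OF smooth_fun_disc_bump_diff])
  have c1: "continuous_on (cbox a b) (\<lambda>w. ?b (z - w) *\<^sub>R f w)" by (intro continuous_on_scaleR c cont_box)
  have c2: "continuous_on (cbox a b) (\<lambda>w. ?b (z - w) *\<^sub>R f z)" by (intro continuous_on_scaleR c continuous_on_const)
  have "integral (cbox a b) (\<lambda>w. ?b (z - w) *\<^sub>R f z) = mass *\<^sub>R f z"
    using integral_linear[OF integrable_continuous[OF c] bounded_linear_scaleR_left[of "f z"]] mass_eq[OF z]
    by (simp add: o_def)
  then have "I z - mass *\<^sub>R f z = integral (cbox a b) (\<lambda>w. ?b (z - w) *\<^sub>R f w - ?b (z - w) *\<^sub>R f z)"
    unfolding I_def by (simp add: Henstock_Kurzweil_Integration.integral_diff integrable_continuous c1 c2)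
  also have "cmod \<dots> \<le> integral (cbox a b) (\<lambda>w. ?b (z - w) * \<omega>)"
  proof (rule Henstock_Kurzweil_Integration.integral_norm_bound_integral)
    show "(\<lambda>w. ?b (z - w) *\<^sub>R f w - ?b (z - w) *\<^sub>R f z) integrable_on cbox a b"
      by (intro integrable_continuous continuous_on_diff c1 c2)
    show "(\<lambda>w. ?b (z - w) * \<omega>) integrable_on cbox a b"
      by (intro integrable_continuous continuous_on_mult c continuous_on_const)
    fix w assume w: "w \<in> cbox a b"
    show "cmod (?b (z - w) *\<^sub>R f w - ?b (z - w) *\<^sub>R f z) \<le> ?b (z - w) * \<omega>"
    proof (cases "dist z w < e")
      case True
      have "cmod (?b (z - w) *\<^sub>R f w - ?b (z - w) *\<^sub>R f z) = ?b (z - w) * cmod (f w - f z)"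
        using disc_bump_nonneg[of e "z - w"] by (simp add: scaleR_diff_right[symmetric])
      then show ?thesis using osc[OF w True] disc_bump_nonneg[of e "z - w"] by (simp add: mult_left_mono)
    next
      case False
      then have "?b (z - w) = 0" using e by (intro disc_bump_eq_0) (auto simp: dist_norm)
      then show ?thesis by simp
    qed
  qed
  also have "\<dots> = mass * \<omega>" by (simp add: mass_eq[OF z])
  finally have le: "cmod (I z - mass *\<^sub>R f z) \<le> mass * \<omega>" .
  have m: "0 < mass" by (rule mass_pos[OF \<delta>])
  have "I z / of_real mass - f z = (I z - mass *\<^sub>R f z) / of_real mass"
    using m by (simp add: scaleR_conv_of_real field_simps)
  then have "cmod (I z / of_real mass - f z) = cmod (I z - mass *\<^sub>R f z) / mass"
    using m by (simp add: norm_divide)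
  also have "\<dots> \<le> \<omega>" using le m by (simp add: divide_le_eq mult.commute)
  finally show ?thesis .
qed

end

text \<open>Mollifications are holomorphic near \<open>z0\<close> and converge uniformly there by
  uniform continuity on a closed box; a locally uniform limit of holomorphic functions is
  holomorphic.\<close>

theorem Weyl:
  assumes cont: "continuous_on udisc f" and f: "has_weak_dzstar f (\<lambda>_. 0)"
  shows "f holomorphic_on udisc"
proof -
  have "\<exists>d>0. f holomorphic_on ball z0 d" if z0: "z0 \<in> udisc" for z0
  proof -
    obtain r where r: "0 < r" "cball z0 r \<subseteq> udisc"
      using z0 open_contains_cball[of udisc] open_ball by blast
    \<comment> \<open>The square of half side 2\<open>\<delta>\<close> about \<open>z0\<close> has
      |Re| + |Im| at most 4\<open>\<delta>\<close> = r, so it stays in the closed disc of radius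
      r.\<close>
    define \<delta> where "\<delta> = r / 4"
    have \<delta>: "0 < \<delta>" using r by (simp add: \<delta>_def)
    define a where "a = z0 - Complex (2 * \<delta>) (2 * \<delta>)"
    define b where "b = z0 + Complex (2 * \<delta>) (2 * \<delta>)"
    have box1: "cball z0 (2 * \<delta>) \<subseteq> cbox a b"
    proof
      fix w assume "w \<in> cball z0 (2 * \<delta>)"
      then have "cmod (w - z0) \<le> 2 * \<delta>" by (simp add: dist_norm norm_minus_commute)
      then have "\<bar>Re w - Re z0\<bar> \<le> 2 * \<delta>" "\<bar>Im w - Im z0\<bar> \<le> 2 * \<delta>"
        using abs_Re_le_cmod[of "w - z0"] abs_Im_le_cmod[of "w - z0"] by auto
      then show "w \<in> cbox a b" by (auto simp: in_cbox_complex_iff a_def b_def)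
    qed
    have box2: "cbox a b \<subseteq> udisc"
    proof
      fix w assume "w \<in> cbox a b"
      then have "\<bar>Re (w - z0)\<bar> \<le> 2 * \<delta>" "\<bar>Im (w - z0)\<bar> \<le> 2 * \<delta>"
        by (auto simp: in_cbox_complex_iff a_def b_def)
      then have "cmod (w - z0) \<le> r" using cmod_le[of "w - z0"] by (simp add: \<delta>_def)
      then have "w \<in> cball z0 r" by (simp add: dist_norm norm_minus_commute)
      then show "w \<in> udisc" using r(2) by blast
    qed
    define e where "e = (\<lambda>n::nat. \<delta> / (real n + 1))"
    have e: "0 < e n" "e n \<le> \<delta>" for n using \<delta> by (auto simp: e_def divide_le_eq)
    have elim: "e \<longlonglongrightarrow> 0" unfolding e_def
      using tendsto_mult[OF tendsto_const[of \<delta>] LIMSEQ_inverse_real_of_nat] by (simp add: divide_inverse add.commute)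
    have M: "mollify f a b z0 \<delta> (e n)" for n
      by (unfold_locales) (use cont box1 box2 e in auto)
    define F where "F = (\<lambda>n z. mollify.I f a b (e n) z / of_real (mollify.mass (e n)))"
    have "f holomorphic_on ball z0 \<delta>"
    proof (rule holomorphic_uniform_sequence[OF open_ball])
      show "F n holomorphic_on ball z0 \<delta>" for n
        unfolding F_def using mollify.mass_pos[OF M \<delta>, of n]
        by (intro holomorphic_intros mollify.I_holomorphic[OF M f]) auto
      fix x assume x: "x \<in> ball z0 \<delta>"
      obtain d where d: "0 < d" "cball x d \<subseteq> ball z0 \<delta>"
        using x open_contains_cball[of "ball z0 \<delta>"] open_ball by blast
      have "uniform_limit (ball z0 \<delta>) F f sequentially"
      proof (rule uniform_limitI)
        fix \<epsilon> :: real assume \<epsilon>: "0 < \<epsilon>"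
        have uc: "uniformly_continuous_on (cbox a b) f"
          using cont box2 by (intro compact_uniformly_continuous compact_cbox) (rule continuous_on_subset)
        have "\<exists>\<eta>>0. \<forall>x\<in>cbox a b. \<forall>w\<in>cbox a b. dist w x < \<eta> \<longrightarrow> dist (f w) (f x) < \<epsilon> / 2"
          by (rule uc[unfolded uniformly_continuous_on_def, rule_format, OF half_gt_zero[OF \<epsilon>]])
        then obtain \<eta> where \<eta>: "0 < \<eta>" "\<And>x w. x \<in> cbox a b \<Longrightarrow> w \<in> cbox a b \<Longrightarrow> dist w x < \<eta> \<Longrightarrow> dist (f w) (f x) < \<epsilon> / 2"
          by blast
        have "\<forall>\<^sub>F n in sequentially. e n < \<eta>" using elim \<eta>(1) by (rule order_tendstoD)
        then show "\<forall>\<^sub>F n in sequentially. \<forall>z\<in>ball z0 \<delta>. dist (F n z) (f z) < \<epsilon>"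
        proof eventually_elim
          case (elim n)
          show ?case
          proof
            fix z assume z: "z \<in> ball z0 \<delta>"
            then have zb: "z \<in> cbox a b" using box1 \<delta> by auto
            have "cmod (f w - f z) \<le> \<epsilon> / 2" if "w \<in> cbox a b" "dist z w < e n" for w
            proof -
              have "dist w z < \<eta>" using that(2) elim by (simp add: dist_commute)
              from \<eta>(2)[OF zb that(1) this] show ?thesis by (simp add: dist_norm)
            qed
            from mollify.I_close[OF M z \<delta> this] have "cmod (F n z - f z) \<le> \<epsilon> / 2" using \<epsilon> by (simp add: F_def)
            then show "dist (F n z) (f z) < \<epsilon>" using \<epsilon> by (simp add: dist_norm)
          qed
        qed
      qed
      then show "\<exists>d>0. cball x d \<subseteq> ball z0 \<delta> \<and> uniform_limit (cball x d) F f sequentially"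
        using d uniform_limit_on_subset by blast
    qed
    then show ?thesis using \<delta> by blast
  qed
  then show ?thesis
    by (meson centre_in_ball holomorphic_on_imp_differentiable_at holomorphic_on_def open_ball
        field_differentiable_at_within)
qed

section \<open>Holomorphy of the idempotent components\<close>

lemma bplus_bj: "bplus (bj * w) = - \<i> * bplus w" and bminus_bj: "bminus (bj * w) = \<i> * bminus w"
  by (simp_all add: bplus_def bminus_def bj_def algebra_simps)

lemma bounded_linear_bplus: "bounded_linear bplus" and bounded_linear_bminus: "bounded_linear bminus"
proof -
  have "linear bplus" "linear bminus"
    by (rule linearI; simp add: bplus_def bminus_def algebra_simps)+
  then show "bounded_linear bplus" "bounded_linear bminus" by (simp_all only: linear_conv_bounded_linear)
qed

text \<open>\<open>bplus\<close> turns multiplication by \<open>bj\<close> into multiplication by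
  -i, so this component is antiholomorphic and must be conjugated; \<open>bminus\<close> turns it
  into i.\<close>

lemma Hol_bc_components:
  assumes "h \<in> Hol_bc"
  shows "(\<lambda>z. cnj (bplus (h z))) holomorphic_on udisc" "(\<lambda>z. bminus (h z)) holomorphic_on udisc"
proof -
  have h: "continuous_on udisc h" "has_weak_dbar h (\<lambda>_. 0)" using assms by (simp_all add: Hol_bc_def)
  have bl: "bounded_linear (\<lambda>w. cnj (bplus w))"
    using bounded_linear_compose[OF bounded_linear_cnj bounded_linear_bplus] .
  have "has_weak_dzstar (\<lambda>z. cnj (bplus (h z))) (\<lambda>z. cnj (bplus 0))"
    by (rule has_weak_CR_linear[OF bl _ h(2)]) (simp add: bplus_bj)
  moreover have "has_weak_dzstar (\<lambda>z. bminus (h z)) (\<lambda>z. bminus 0)"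
    by (rule has_weak_CR_linear[OF bounded_linear_bminus _ h(2)]) (simp add: bminus_bj)
  moreover have "bplus 0 = 0" "bminus 0 = 0" by (simp_all add: bplus_def bminus_def)
  ultimately show "(\<lambda>z. cnj (bplus (h z))) holomorphic_on udisc" "(\<lambda>z. bminus (h z)) holomorphic_on udisc"
    by (auto intro!: Weyl bounded_linear.continuous_on[OF bl] bounded_linear.continuous_on[OF bounded_linear_bminus] h)
qed

section \<open>A maximal inequality\<close>

text \<open>Comparable with the Poisson kernel at distance \<open>\<rho>\<close> from the circle
  when t is the chordal distance. It depends on t only, so the triangle inequality can act on
  it.\<close>

definition kern :: "real \<Rightarrow> real \<Rightarrow> real" where
  "kern \<rho> t = \<rho> / (\<rho>\<^sup>2 + t\<^sup>2)"

lemma kern_nonneg: "0 \<le> \<rho> \<Longrightarrow> 0 \<le> kern \<rho> t"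
  by (simp add: kern_def)

lemma kern_le_4:
  assumes "0 < \<rho>" "0 \<le> c" "c \<le> 2 * a"
  shows "kern \<rho> a \<le> 4 * kern \<rho> c"
proof -
  have "c\<^sup>2 \<le> (2 * a)\<^sup>2" using assms by (intro power_mono) auto
  moreover have "(2 * a)\<^sup>2 = 4 * a\<^sup>2" by (simp add: power2_eq_square)
  ultimately have "\<rho>\<^sup>2 + c\<^sup>2 \<le> 4 * (\<rho>\<^sup>2 + a\<^sup>2)"
    using zero_le_power2[of \<rho>] unfolding distrib_left by linarith
  moreover have "0 < \<rho>\<^sup>2 + c\<^sup>2" "0 < \<rho>\<^sup>2 + a\<^sup>2" using assms(1) by (simp_all add: add_pos_nonneg)
  ultimately have "1 / (\<rho>\<^sup>2 + a\<^sup>2) \<le> 4 / (\<rho>\<^sup>2 + c\<^sup>2)" by (simp add: divide_simps)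
  then have "\<rho> * (1 / (\<rho>\<^sup>2 + a\<^sup>2)) \<le> \<rho> * (4 / (\<rho>\<^sup>2 + c\<^sup>2))" using assms(1) by (intro mult_left_mono) auto
  then show ?thesis by (simp add: kern_def mult.commute)
qed

text \<open>If c is at most a + b, it is at most 2a or at most 2b, and in each case one of the two
  factors may be compared with its value at c. The cost 4 is the square of 2.\<close>

lemma kern_mult_kern_le:
  assumes "0 < \<rho>" "0 < \<tau>" "0 \<le> c" "c \<le> a + b"
  shows "kern \<rho> a * kern \<tau> b \<le> 4 * (kern \<rho> c * kern \<tau> b + kern \<rho> a * kern \<tau> c)"
proof (cases "c \<le> 2 * a")
  case True
  have "kern \<rho> a * kern \<tau> b \<le> (4 * kern \<rho> c) * kern \<tau> b"
    using assms by (intro mult_right_mono kern_le_4 kern_nonneg True) auto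
  moreover have "0 \<le> kern \<rho> a * kern \<tau> c" using assms by (intro mult_nonneg_nonneg kern_nonneg) auto
  ultimately show ?thesis by (simp add: distrib_left mult.assoc)
next
  case False
  then have "c \<le> 2 * b" using assms by simp
  then have "kern \<rho> a * kern \<tau> b \<le> kern \<rho> a * (4 * kern \<tau> c)"
    using assms by (intro mult_left_mono kern_le_4 kern_nonneg) auto
  moreover have "0 \<le> kern \<rho> c * kern \<tau> b" using assms by (intro mult_nonneg_nonneg kern_nonneg) auto
  ultimately show ?thesis by (simp add: distrib_left mult.assoc)
qed

text \<open>Used in place of Cauchy-Schwarz: after integration, the square of one factor is absorbed
  on the left.\<close>

lemma ennreal_two_mult_le: "2 * (a * b) \<le> a\<^sup>2 + (b::ennreal)\<^sup>2"
proof (cases "a = top \<or> b = top")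
  case True
  then show ?thesis by (auto simp: power2_eq_square ennreal_mult_top)
next
  case False
  then obtain x y where "a = ennreal x" "b = ennreal y" "0 \<le> x" "0 \<le> y"
    by (metis ennreal_cases)
  moreover have "2 * (x * y) \<le> x\<^sup>2 + y\<^sup>2" using sum_squares_bound[of x y] by (simp add: mult.assoc)
  ultimately show ?thesis
    by (simp add: ennreal_mult[symmetric] ennreal_power ennreal_plus[symmetric] ennreal_leI
        ennreal_numeral[symmetric] del: ennreal_plus ennreal_numeral)
qed

text \<open>A pseudo-metric is enough, as the angles 0 and 2 pi have chordal distance 0.
  \<open>D\<close> takes pairs so that joint measurability can be stated on the product.\<close>

locale metric_kernel = finite_measure M for M :: "'a measure" +
  fixes D :: "'a \<times> 'a \<Rightarrow> real" and C :: real
  assumes D_measurable [measurable]: "D \<in> borel_measurable (M \<Otimes>\<^sub>M M)"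
    and D_nonneg: "0 \<le> D (x, y)"
    and D_sym: "D (x, y) = D (y, x)"
    and D_triangle: "D (x, z) \<le> D (x, y) + D (y, z)"
    and C_pos: "0 < C"
    and kern_integral: "0 < \<rho> \<Longrightarrow> \<rho> \<le> 1 \<Longrightarrow> x \<in> space M \<Longrightarrow> (\<integral>\<^sup>+y. ennreal (kern \<rho> (D (x, y))) \<partial>M) \<le> ennreal C"
begin

definition average :: "('a \<Rightarrow> real) \<Rightarrow> real \<Rightarrow> 'a \<Rightarrow> ennreal" where
  "average u \<rho> x = (\<integral>\<^sup>+y. ennreal (kern \<rho> (D (x, y))) * ennreal (u y) \<partial>M)"

sublocale P: pair_sigma_finite M M ..

text \<open>The $TT^*$ argument: composing the linearised maximal operator with its adjoint gives a
  kernel that is again dominated by the operator and its adjoint.\<close>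

lemma linearized_maximal:
  assumes r[measurable]: "r \<in> borel_measurable M" and r0: "0 < \<rho>0" and rr: "\<And>x. \<rho>0 \<le> r x" "\<And>x. r x \<le> 1"
    and u[measurable]: "u \<in> borel_measurable M" and ub: "\<And>x. 0 \<le> u x" "\<And>x. u x \<le> b"
  shows "(\<integral>\<^sup>+x. (average u (r x) x)\<^sup>2 \<partial>M) \<le> ennreal ((8 * C)\<^sup>2) * (\<integral>\<^sup>+x. (ennreal (u x))\<^sup>2 \<partial>M)"
proof -
  define k where "k = (\<lambda>p. ennreal (kern (r (fst p)) (D p)))"
  have k[measurable]: "k \<in> borel_measurable (M \<Otimes>\<^sub>M M)"
    unfolding k_def kern_def by measurable
  have rpos: "0 < r x" for x using r0 rr(1)[of x] by linarith
  \<comment> \<open>\<open>S\<close> is the linearised operator with kernel \<open>k\<close> applied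
    to \<open>u\<close>; below, \<open>W\<close> is its adjoint applied to \<open>S\<close>.
    \<open>X\<close>, \<open>Y\<close> and \<open>Z\<close> are the squared L^2 norms of
    \<open>S\<close>, \<open>W\<close> and \<open>u\<close>.\<close>
  define S where "S = (\<lambda>x. \<integral>\<^sup>+y. k (x, y) * ennreal (u y) \<partial>M)"
  have S[measurable]: "S \<in> borel_measurable M" unfolding S_def by measurable
  define W where "W = (\<lambda>y. \<integral>\<^sup>+x. k (x, y) * S x \<partial>M)"
  have W[measurable]: "W \<in> borel_measurable M" unfolding W_def by measurable
  define X where "X = (\<integral>\<^sup>+x. (S x)\<^sup>2 \<partial>M)"
  define Y where "Y = (\<integral>\<^sup>+x. (W x)\<^sup>2 \<partial>M)"
  define Z where "Z = (\<integral>\<^sup>+x. (ennreal (u x))\<^sup>2 \<partial>M)"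
  define c where "c = ennreal (8 * C)"
  \<comment> \<open>The crude bounds through \<open>\<rho>0\<close> and \<open>b\<close> serve to
    make \<open>X\<close> and \<open>Y\<close> finite, so that they may be cancelled; neither number
    enters the final constant.\<close>
  have k_le: "k p \<le> ennreal (1 / \<rho>0)" for p
  proof -
    have "kern (r (fst p)) (D p) \<le> r (fst p) / (r (fst p))\<^sup>2"
      unfolding kern_def using rpos[of "fst p"] by (intro divide_left_mono mult_pos_pos) (auto simp: add_pos_nonneg)
    also have "\<dots> \<le> 1 / \<rho>0" using rpos[of "fst p"] rr(1)[of "fst p"] r0 by (simp add: power2_eq_square field_simps)
    finally show ?thesis unfolding k_def by (rule ennreal_leI)
  qed
  have S_le: "S x \<le> ennreal (1 / \<rho>0) * ennreal b * emeasure M (space M)" for x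
  proof -
    have "S x \<le> (\<integral>\<^sup>+y. ennreal (1 / \<rho>0) * ennreal b \<partial>M)"
      unfolding S_def by (intro nn_integral_mono mult_mono k_le ennreal_leI ub) auto
    then show ?thesis by simp
  qed
  have mfin: "emeasure M (space M) < top" by (simp add: top.not_eq_extremum[symmetric])
  let ?SB = "ennreal (1 / \<rho>0) * ennreal b * emeasure M (space M)"
  have SB: "?SB < top" by (simp add: ennreal_mult_less_top mfin)
  have W_le: "W y \<le> ennreal (1 / \<rho>0) * ?SB * emeasure M (space M)" for y
  proof -
    have "W y \<le> (\<integral>\<^sup>+x. ennreal (1 / \<rho>0) * ?SB \<partial>M)"
      unfolding W_def by (intro nn_integral_mono mult_mono k_le S_le) auto
    then show ?thesis by simp
  qed
  let ?WB = "ennreal (1 / \<rho>0) * ?SB * emeasure M (space M)"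
  have WB: "?WB < top" using SB by (simp add: ennreal_mult_less_top mfin)
  have "X \<le> (\<integral>\<^sup>+x. ?SB\<^sup>2 \<partial>M)" unfolding X_def by (intro nn_integral_mono power_mono S_le) auto
  also have "\<dots> < top" using SB by (simp add: ennreal_mult_less_top mfin power2_eq_square)
  finally have Xfin: "X \<noteq> top" by simp
  have "Y \<le> (\<integral>\<^sup>+x. ?WB\<^sup>2 \<partial>M)" unfolding Y_def by (intro nn_integral_mono power_mono W_le) auto
  also have "\<dots> < top" using WB by (simp add: ennreal_mult_less_top mfin power2_eq_square)
  finally have Yfin: "Y \<noteq> top" by simp
  \<comment> \<open>\<open>kern_mult_kern_le\<close> is applied with a and b the distances of y from
    x and x', and c the distance of x from x'; the remaining factor is integrated in y by
    \<open>kern_integral\<close>.\<close>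
  have kk: "(\<integral>\<^sup>+y. k (x, y) * k (x', y) \<partial>M) \<le> ennreal (4 * C) * (k (x, x') + k (x', x))"
    if xx: "x \<in> space M" "x' \<in> space M" for x x'
  proof -
    have [measurable]: "(\<lambda>y. D (x, y)) \<in> borel_measurable M" "(\<lambda>y. D (x', y)) \<in> borel_measurable M"
      using xx by (auto intro: measurable_compose[OF measurable_Pair1' D_measurable])
    have "(\<integral>\<^sup>+y. k (x, y) * k (x', y) \<partial>M) \<le>
        (\<integral>\<^sup>+y. 4 * (k (x, x') * ennreal (kern (r x') (D (x', y))) + k (x', x) * ennreal (kern (r x) (D (x, y)))) \<partial>M)"
    proof (intro nn_integral_mono)
      fix y
      have "D (x, x') \<le> D (x, y) + D (x', y)" using D_triangle[of x x' y] D_sym[of y x'] by simp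
      from kern_mult_kern_le[OF rpos[of x] rpos[of x'] D_nonneg this]
      have "kern (r x) (D (x, y)) * kern (r x') (D (x', y)) \<le>
          4 * (kern (r x) (D (x, x')) * kern (r x') (D (x', y)) + kern (r x') (D (x', x)) * kern (r x) (D (x, y)))"
        by (simp add: D_sym[of x' x] mult.commute)
      then show "k (x, y) * k (x', y) \<le>
        4 * (k (x, x') * ennreal (kern (r x') (D (x', y))) + k (x', x) * ennreal (kern (r x) (D (x, y))))"
        unfolding k_def fst_conv
        using rpos[THEN less_imp_le, THEN kern_nonneg]
        by (simp add: ennreal_mult[symmetric] ennreal_plus[symmetric] ennreal_leI
            ennreal_numeral[symmetric] del: ennreal_plus ennreal_numeral)
    qed
    also have "\<dots> = 4 * (k (x, x') * (\<integral>\<^sup>+y. ennreal (kern (r x') (D (x', y))) \<partial>M) +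
        k (x', x) * (\<integral>\<^sup>+y. ennreal (kern (r x) (D (x, y))) \<partial>M))"
    proof -
      have [measurable]: "(\<lambda>y. ennreal (kern (r x') (D (x', y)))) \<in> borel_measurable M"
        "(\<lambda>y. ennreal (kern (r x) (D (x, y)))) \<in> borel_measurable M"
        unfolding kern_def by measurable
      show ?thesis by (simp add: nn_integral_cmult nn_integral_add)
    qed
    also have "\<dots> \<le> 4 * (k (x, x') * ennreal C + k (x', x) * ennreal C)"
      by (intro mult_left_mono add_mono kern_integral rpos rr xx) auto
    also have "\<dots> = ennreal (4 * C) * (k (x, x') + k (x', x))"
      using C_pos by (simp add: ennreal_mult algebra_simps)
    finally show ?thesis .
  qed
  have "Y = (\<integral>\<^sup>+y. (\<integral>\<^sup>+x. (\<integral>\<^sup>+x'. (k (x, y) * S x) * (k (x', y) * S x') \<partial>M) \<partial>M) \<partial>M)"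
    unfolding Y_def
  proof (intro nn_integral_cong)
    fix y assume y: "y \<in> space M"
    have [measurable]: "(\<lambda>x. k (x, y)) \<in> borel_measurable M"
      using y by (intro measurable_compose[OF measurable_Pair2' k])
    have "(W y)\<^sup>2 = (\<integral>\<^sup>+x. k (x, y) * S x \<partial>M) * W y" by (simp add: W_def power2_eq_square)
    also have "\<dots> = (\<integral>\<^sup>+x. (k (x, y) * S x) * W y \<partial>M)" by (subst nn_integral_multc) measurable
    also have "\<dots> = (\<integral>\<^sup>+x. (\<integral>\<^sup>+x'. (k (x, y) * S x) * (k (x', y) * S x') \<partial>M) \<partial>M)"
      unfolding W_def by (intro nn_integral_cong, subst nn_integral_cmult) measurable
    finally show "(W y)\<^sup>2 = (\<integral>\<^sup>+x. (\<integral>\<^sup>+x'. (k (x, y) * S x) * (k (x', y) * S x') \<partial>M) \<partial>M)" .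
  qed
  also have "\<dots> = (\<integral>\<^sup>+x. (\<integral>\<^sup>+y. (\<integral>\<^sup>+x'. (k (x, y) * S x) * (k (x', y) * S x') \<partial>M) \<partial>M) \<partial>M)"
    by (rule P.Fubini') measurable
  also have "\<dots> = (\<integral>\<^sup>+x. (\<integral>\<^sup>+x'. (\<integral>\<^sup>+y. (k (x, y) * S x) * (k (x', y) * S x') \<partial>M) \<partial>M) \<partial>M)"
    by (intro nn_integral_cong P.Fubini') measurable
  also have "\<dots> \<le> (\<integral>\<^sup>+x. (\<integral>\<^sup>+x'. ennreal (4 * C) * (k (x, x') * S x * S x' + k (x', x) * S x' * S x) \<partial>M) \<partial>M)"
  proof (intro nn_integral_mono)
    fix x x' assume x: "x \<in> space M" and x': "x' \<in> space M"
    have [measurable]: "(\<lambda>y. k (x, y)) \<in> borel_measurable M" "(\<lambda>y. k (x', y)) \<in> borel_measurable M"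
      using x x' by (auto intro: measurable_compose[OF measurable_Pair1' k])
    have "(\<integral>\<^sup>+y. (k (x, y) * S x) * (k (x', y) * S x') \<partial>M) = (\<integral>\<^sup>+y. (S x * S x') * (k (x, y) * k (x', y)) \<partial>M)"
      by (intro nn_integral_cong) (simp add: mult_ac)
    also have "\<dots> = (S x * S x') * (\<integral>\<^sup>+y. k (x, y) * k (x', y) \<partial>M)"
      by (intro nn_integral_cmult) measurable
    also have "\<dots> \<le> (S x * S x') * (ennreal (4 * C) * (k (x, x') + k (x', x)))"
      by (intro mult_left_mono kk x x') auto
    also have "\<dots> = ennreal (4 * C) * (k (x, x') * S x * S x' + k (x', x) * S x' * S x)"
      by (simp add: algebra_simps)
    finally show "(\<integral>\<^sup>+y. (k (x, y) * S x) * (k (x', y) * S x') \<partial>M) \<le>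
        ennreal (4 * C) * (k (x, x') * S x * S x' + k (x', x) * S x' * S x)" .
  qed
  also have "\<dots> = ennreal (4 * C) * ((\<integral>\<^sup>+x. (\<integral>\<^sup>+x'. k (x, x') * S x * S x' \<partial>M) \<partial>M) +
      (\<integral>\<^sup>+x. (\<integral>\<^sup>+x'. k (x', x) * S x' * S x \<partial>M) \<partial>M))"
  proof -
    have "(\<integral>\<^sup>+x'. ennreal (4 * C) * (k (x, x') * S x * S x' + k (x', x) * S x' * S x) \<partial>M) =
        ennreal (4 * C) * ((\<integral>\<^sup>+x'. k (x, x') * S x * S x' \<partial>M) + (\<integral>\<^sup>+x'. k (x', x) * S x' * S x \<partial>M))"
      if x: "x \<in> space M" for x
    proof -
      have [measurable]: "(\<lambda>y. k (x, y)) \<in> borel_measurable M" "(\<lambda>y. k (y, x)) \<in> borel_measurable M"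
        using x by (auto intro: measurable_compose[OF measurable_Pair1' k] measurable_compose[OF measurable_Pair2' k])
      show ?thesis by (subst nn_integral_cmult, measurable, subst nn_integral_add) measurable
    qed
    then have "(\<integral>\<^sup>+x. (\<integral>\<^sup>+x'. ennreal (4 * C) * (k (x, x') * S x * S x' + k (x', x) * S x' * S x) \<partial>M) \<partial>M) =
      (\<integral>\<^sup>+x. ennreal (4 * C) * ((\<integral>\<^sup>+x'. k (x, x') * S x * S x' \<partial>M) + (\<integral>\<^sup>+x'. k (x', x) * S x' * S x \<partial>M)) \<partial>M)"
      by (rule nn_integral_cong)
    then show ?thesis by (simp add: nn_integral_cmult nn_integral_add)
  qed
  also have "(\<integral>\<^sup>+x. (\<integral>\<^sup>+x'. k (x, x') * S x * S x' \<partial>M) \<partial>M) = (\<integral>\<^sup>+x'. (\<integral>\<^sup>+x. k (x, x') * S x * S x' \<partial>M) \<partial>M)"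
    by (rule P.Fubini'[symmetric]) measurable
  also have "(\<integral>\<^sup>+x'. (\<integral>\<^sup>+x. k (x, x') * S x * S x' \<partial>M) \<partial>M) = (\<integral>\<^sup>+x'. W x' * S x' \<partial>M)"
    unfolding W_def by (intro nn_integral_cong, subst nn_integral_multc) measurable
  \<comment> \<open>Both double integrals equal the pairing of \<open>W\<close> with
    \<open>S\<close>, whence 4C doubles to 8C.\<close>
  also have "ennreal (4 * C) * ((\<integral>\<^sup>+x'. W x' * S x' \<partial>M) + (\<integral>\<^sup>+x'. W x' * S x' \<partial>M)) = c * (\<integral>\<^sup>+x. W x * S x \<partial>M)"
  proof -
    have "c = ennreal (4 * C) + ennreal (4 * C)"
      using C_pos by (simp add: c_def ennreal_plus[symmetric] del: ennreal_plus)
    then show ?thesis by (simp add: distrib_left distrib_right)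
  qed
  finally have Y1: "Y \<le> c * (\<integral>\<^sup>+x. W x * S x \<partial>M)" .
  \<comment> \<open>The inequality of means gives 2Y <= Y + c^2 X, and finite \<open>Y\<close>
    cancels.\<close>
  have Y2: "Y \<le> c\<^sup>2 * X"
  proof -
    have "2 * Y \<le> 2 * (c * (\<integral>\<^sup>+x. W x * S x \<partial>M))" by (intro mult_left_mono Y1) simp
    also have "\<dots> = (\<integral>\<^sup>+x. 2 * (W x * (c * S x)) \<partial>M)"
      by (simp add: nn_integral_cmult[symmetric] mult_ac)
    also have "\<dots> \<le> (\<integral>\<^sup>+x. (W x)\<^sup>2 + (c * S x)\<^sup>2 \<partial>M)" by (intro nn_integral_mono ennreal_two_mult_le)
    also have "\<dots> = Y + c\<^sup>2 * X"
      by (simp add: nn_integral_add power_mult_distrib nn_integral_cmult X_def Y_def)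
    finally have "Y + Y \<le> Y + c\<^sup>2 * X" by (simp add: mult_2)
    then show ?thesis using Yfin by (simp add: ennreal_add_left_cancel_le)
  qed
  have c0: "c \<noteq> 0" "c \<noteq> top" using C_pos by (auto simp: c_def)
  have "X = (\<integral>\<^sup>+x. (\<integral>\<^sup>+y. S x * (k (x, y) * ennreal (u y)) \<partial>M) \<partial>M)"
    unfolding X_def by (intro nn_integral_cong, subst nn_integral_cmult) (measurable, simp add: S_def power2_eq_square)
  also have "\<dots> = (\<integral>\<^sup>+y. (\<integral>\<^sup>+x. S x * (k (x, y) * ennreal (u y)) \<partial>M) \<partial>M)"
    by (rule P.Fubini'[symmetric]) measurable
  also have "\<dots> = (\<integral>\<^sup>+y. W y * ennreal (u y) \<partial>M)"
    unfolding W_def by (intro nn_integral_cong, subst nn_integral_multc[symmetric]) (measurable, simp add: mult_ac)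
  finally have X1: "X = (\<integral>\<^sup>+y. W y * ennreal (u y) \<partial>M)" .
  \<comment> \<open>\<open>X\<close> is also the pairing of \<open>W\<close> with \<open>u\<close>.
    The weight c^2 is chosen so that, after Y <= c^2 X, the same cancellation works once
    more.\<close>
  have "2 * (c\<^sup>2 * X) = (\<integral>\<^sup>+y. 2 * (W y * (c\<^sup>2 * ennreal (u y))) \<partial>M)"
    unfolding X1 by (simp add: nn_integral_cmult[symmetric] mult_ac)
  also have "\<dots> \<le> (\<integral>\<^sup>+y. (W y)\<^sup>2 + (c\<^sup>2 * ennreal (u y))\<^sup>2 \<partial>M)" by (intro nn_integral_mono ennreal_two_mult_le)
  also have "\<dots> = Y + (c\<^sup>2)\<^sup>2 * Z"
    by (simp add: nn_integral_add power_mult_distrib nn_integral_cmult Z_def Y_def)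
  also have "\<dots> \<le> c\<^sup>2 * X + (c\<^sup>2)\<^sup>2 * Z" using Y2 by (intro add_right_mono)
  finally have "c\<^sup>2 * X + c\<^sup>2 * X \<le> c\<^sup>2 * X + (c\<^sup>2)\<^sup>2 * Z" by (simp add: mult_2)
  moreover have "c\<^sup>2 * X \<noteq> top" using c0 Xfin by (simp add: ennreal_mult_eq_top_iff power_eq_top_ennreal)
  ultimately have "c\<^sup>2 * X \<le> c\<^sup>2 * (c\<^sup>2 * Z)" by (simp add: ennreal_add_left_cancel_le power2_eq_square mult_ac)
  then have "X \<le> c\<^sup>2 * Z"
    using c0 by (subst (asm) ennreal_mult_le_mult_iff) (auto simp: power_eq_top_ennreal)
  then show ?thesis
    using C_pos by (simp add: X_def Z_def c_def S_def k_def average_def ennreal_power)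
qed

lemma average_measurable:
  assumes [measurable]: "r \<in> borel_measurable M" "u \<in> borel_measurable M"
  shows "(\<lambda>x. average u (r x) x) \<in> borel_measurable M"
  unfolding average_def kern_def by measurable

text \<open>For each N the best radius among 1, 1/2, ..., 1/2^N is selected measurably by comparing
  one new radius at a time. The selected averages increase with N, and since the linearised bound
  does not depend on the selection it passes to the supremum by monotone convergence.\<close>

lemma maximal:
  assumes u: "u \<in> borel_measurable M" and ub: "\<And>x. 0 \<le> u x" "\<And>x. u x \<le> b"
  shows "\<exists>Q\<in>borel_measurable M. (\<forall>x m. (average u (1 / 2 ^ m) x)\<^sup>2 \<le> Q x) \<and>
    (\<integral>\<^sup>+x. Q x \<partial>M) \<le> ennreal ((8 * C)\<^sup>2) * (\<integral>\<^sup>+x. (ennreal (u x))\<^sup>2 \<partial>M)"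
proof -
  have "\<exists>r\<in>borel_measurable M. \<forall>x. (\<exists>m\<le>N. r x = 1 / 2 ^ m) \<and>
      (\<forall>m\<le>N. average u (1 / 2 ^ m) x \<le> average u (r x) x)" for N :: nat
  proof (induction N)
    case 0
    show ?case by (intro bexI[of _ "\<lambda>_. 1"]) auto
  next
    case (Suc N)
    then obtain r where r[measurable]: "r \<in> borel_measurable M"
      and r1: "\<And>x. \<exists>m\<le>N. r x = 1 / 2 ^ m"
      and r2: "\<And>x m. m \<le> N \<Longrightarrow> average u (1 / 2 ^ m) x \<le> average u (r x) x" by blast
    define r' where "r' = (\<lambda>x. if average u (r x) x < average u (1 / 2 ^ Suc N) x then 1 / 2 ^ Suc N else r x)"
    have [measurable]: "(\<lambda>x. average u (r x) x) \<in> borel_measurable M"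
      "(\<lambda>x. average u (1 / 2 ^ Suc N) x) \<in> borel_measurable M"
      by (intro average_measurable u r borel_measurable_const)+
    have "r' \<in> borel_measurable M" unfolding r'_def by measurable
    moreover have "\<exists>m\<le>Suc N. r' x = 1 / 2 ^ m" for x
      using r1[of x] unfolding r'_def by (metis le_Suc_eq)
    moreover have "average u (1 / 2 ^ m) x \<le> average u (r' x) x" if m: "m \<le> Suc N" for x m
    proof (cases "m = Suc N")
      case True
      then show ?thesis unfolding r'_def by (simp add: not_less)
    next
      case False
      then have "average u (1 / 2 ^ m) x \<le> average u (r x) x" using m r2 by simp
      then show ?thesis unfolding r'_def by (simp add: order.strict_implies_order order.strict_trans1)
    qed
    ultimately show ?case by blast
  qed
  then obtain r where r: "\<And>N. r N \<in> borel_measurable M"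
    and r1: "\<And>N x. \<exists>m\<le>N. r N x = 1 / 2 ^ m"
    and r2: "\<And>N x m. m \<le> N \<Longrightarrow> average u (1 / 2 ^ m) x \<le> average u (r N x) x"
    by metis
  define V where "V = (\<lambda>N x. average u (r N x) x)"
  have V[measurable]: "V N \<in> borel_measurable M" for N
    unfolding V_def by (intro average_measurable r u)
  have mono: "V N x \<le> V (Suc N) x" for N x
  proof -
    obtain m where "m \<le> N" "r N x = 1 / 2 ^ m" using r1 by blast
    then show ?thesis unfolding V_def using r2[of m "Suc N" x] by simp
  qed
  have inc: "incseq (\<lambda>N x. (V N x)\<^sup>2)"
    by (intro incseq_SucI le_funI power_mono mono) simp
  have "(\<integral>\<^sup>+x. (SUP N. (V N x)\<^sup>2) \<partial>M) = (SUP N. \<integral>\<^sup>+x. (V N x)\<^sup>2 \<partial>M)"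
    by (rule nn_integral_monotone_convergence_SUP[OF inc]) measurable
  also have "\<dots> \<le> ennreal ((8 * C)\<^sup>2) * (\<integral>\<^sup>+x. (ennreal (u x))\<^sup>2 \<partial>M)"
  proof (rule SUP_least)
    fix N
    have "1 / 2 ^ N \<le> r N x \<and> r N x \<le> 1" for x
    proof -
      obtain m where "m \<le> N" "r N x = 1 / 2 ^ m" using r1 by blast
      moreover have "1 / 2 ^ N \<le> 1 / (2::real) ^ m" using \<open>m \<le> N\<close>
        by (intro divide_left_mono power_increasing) auto
      ultimately show ?thesis by simp
    qed
    then show "(\<integral>\<^sup>+x. (V N x)\<^sup>2 \<partial>M) \<le> ennreal ((8 * C)\<^sup>2) * (\<integral>\<^sup>+x. (ennreal (u x))\<^sup>2 \<partial>M)"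
      unfolding V_def by (intro linearized_maximal[of _ "1 / 2 ^ N" _ b] r u ub) auto
  qed
  finally have int: "(\<integral>\<^sup>+x. (SUP N. (V N x)\<^sup>2) \<partial>M) \<le> ennreal ((8 * C)\<^sup>2) * (\<integral>\<^sup>+x. (ennreal (u x))\<^sup>2 \<partial>M)" .
  have "(average u (1 / 2 ^ m) x)\<^sup>2 \<le> (SUP N. (V N x)\<^sup>2)" for m x
  proof -
    have "(average u (1 / 2 ^ m) x)\<^sup>2 \<le> (V m x)\<^sup>2" unfolding V_def by (intro power_mono r2) auto
    also have "\<dots> \<le> (SUP N. (V N x)\<^sup>2)" by (rule SUP_upper) simp
    finally show ?thesis .
  qed
  then show ?thesis using int by (intro bexI[of _ "\<lambda>x. SUP N. (V N x)\<^sup>2"]) auto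
qed

end

section \<open>Nontangential limits of holomorphic functions\<close>

abbreviation circ :: "real measure" where "circ \<equiv> lebesgue_on {0..2*pi}"

text \<open>Cauchy's formula for F(w) (1 - |z|^2) / (1 - z* w), a holomorphic function of w with
  value F(z) at w = z. On the circle 1 - z* w equals w (w - z)*, which turns the Cauchy kernel into
  the Poisson kernel.\<close>

lemma Poisson_formula:
  assumes cont: "continuous_on (cball 0 1) F" and hol: "F holomorphic_on udisc" and z: "cmod z < 1"
  shows "((\<lambda>\<theta>. of_real ((1 - (cmod z)\<^sup>2) / (cmod (cis \<theta> - z))\<^sup>2) * F (cis \<theta>)) has_integral
    (2 * of_real pi * F z)) {0..2*pi}"
proof -
  define G where "G = (\<lambda>w. F w * (of_real (1 - (cmod z)\<^sup>2) / (1 - cnj z * w)))"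
  have nz: "1 - cnj z * w \<noteq> 0" if "cmod w \<le> 1" for w
  proof -
    have "cmod (cnj z * w) \<le> cmod z * 1" using that unfolding norm_mult complex_mod_cnj by (intro mult_left_mono) auto
    then show ?thesis using z by auto
  qed
  have zz: "1 - cnj z * z = of_real (1 - (cmod z)\<^sup>2)"
    by (simp add: complex_norm_square mult.commute del: of_real_power) 
  have "((\<lambda>u. G u / (u - z)) has_contour_integral (2 * of_real pi * \<i> * G z)) (circlepath 0 1)"
  proof (rule Cauchy_integral_circlepath)
    show "continuous_on (cball 0 1) G"
      unfolding G_def using nz by (intro continuous_intros cont) auto
    show "G holomorphic_on udisc"
      unfolding G_def using nz by (intro holomorphic_intros hol) auto
  qed (use z in simp)
  then have "((\<lambda>t. G (0 + of_real 1 * cis t) / (0 + of_real 1 * cis t - z) * of_real 1 * \<i> * cis t)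
      has_integral (2 * of_real pi * \<i> * G z)) {0..2*pi}"
    unfolding circlepath_def by (subst (asm) has_contour_integral_part_circlepath_iff) simp_all
  then have "((\<lambda>t. - \<i> * (G (cis t) / (cis t - z) * \<i> * cis t)) has_integral - \<i> * (2 * of_real pi * \<i> * G z)) {0..2*pi}"
    by (intro has_integral_mult_right) simp
  moreover have "- \<i> * (2 * of_real pi * \<i> * G z) = 2 * of_real pi * F z"
  proof -
    have "G z = F z" unfolding G_def zz[symmetric] using nz[of z] z by simp
    then show ?thesis by (simp add: algebra_simps)
  qed
  moreover have "- \<i> * (G (cis t) / (cis t - z) * \<i> * cis t) =
      of_real ((1 - (cmod z)\<^sup>2) / (cmod (cis t - z))\<^sup>2) * F (cis t)" for t
  proof -
    have c1: "cis t * cnj (cis t) = 1" by (simp add: complex_norm_square[symmetric])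
    have c2: "1 - cnj z * cis t = cis t * cnj (cis t - z)" using c1 by (simp add: algebra_simps)
    have c3: "cis t - z \<noteq> 0" using z norm_cis[of t] by (metis eq_iff_diff_eq_0 less_irrefl)
    have c4: "of_real ((cmod (cis t - z))\<^sup>2) = (cis t - z) * cnj (cis t - z)"
      by (simp add: complex_norm_square del: of_real_power)
    have c5: "cis t \<noteq> 0" by simp
    have c6: "cnj (cis t - z) \<noteq> 0" using c3 by (simp only: complex_cnj_zero_iff not_False_eq_True)
    have "- \<i> * (G (cis t) / (cis t - z) * \<i> * cis t) = G (cis t) * cis t / (cis t - z)"
      by (simp add: algebra_simps)
    also have "\<dots> = F (cis t) * of_real (1 - (cmod z)\<^sup>2) / ((cis t - z) * cnj (cis t - z))"
      unfolding G_def c2 using c3 c5 c6 by (simp add: divide_simps del: complex_cnj_diff)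
    also have "\<dots> = of_real ((1 - (cmod z)\<^sup>2) / (cmod (cis t - z))\<^sup>2) * F (cis t)"
      unfolding of_real_divide c4 by (simp add: mult.commute)
    finally show ?thesis .
  qed
  ultimately show ?thesis by (simp only:)
qed

lemma nn_integral_circ_eq:
  fixes f :: "real \<Rightarrow> real"
  assumes "(f has_integral I) {0..2*pi}" "\<And>x. 0 \<le> f x"
  shows "(\<integral>\<^sup>+\<theta>. ennreal (f \<theta>) \<partial>circ) = ennreal I"
proof -
  have "(\<integral>\<^sup>+\<theta>. ennreal (f \<theta>) \<partial>circ) = (\<integral>\<^sup>+\<theta>. ennreal (f \<theta>) * indicator {0..2*pi} \<theta> \<partial>lebesgue)"
    by (rule nn_integral_restrict_space) simp
  also have "\<dots> = (\<integral>\<^sup>+\<theta>. ennreal (f \<theta>) * indicator {0..2*pi} \<theta> \<partial>lborel)"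
    by (rule nn_integral_completion)
  also have "\<dots> = ennreal I" by (rule nn_integral_has_integral_lebesgue'[OF assms(2,1)])
  finally show ?thesis .
qed

lemma nn_integral_circ_continuous:
  fixes f :: "real \<Rightarrow> real"
  assumes "continuous_on {0..2*pi} f" "\<And>x. 0 \<le> f x"
  shows "(\<integral>\<^sup>+\<theta>. ennreal (f \<theta>) \<partial>circ) = ennreal (integral {0..2*pi} f)"
  by (intro nn_integral_circ_eq integrable_integral integrable_continuous_interval assms)

section \<open>The Poisson kernel compared with \<open>kern\<close>\<close>

definition poisson :: "complex \<Rightarrow> real \<Rightarrow> real" where
  "poisson z \<theta> = (1 - (cmod z)\<^sup>2) / (cmod (cis \<theta> - z))\<^sup>2"

lemma poisson_nonneg: "cmod z < 1 \<Longrightarrow> 0 \<le> poisson z \<theta>"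
  unfolding poisson_def by (intro divide_nonneg_nonneg) (auto simp: power_le_one)

lemma cis_neq: "cmod z < 1 \<Longrightarrow> cis \<theta> - z \<noteq> 0"
  using norm_cis[of \<theta>] by (metis eq_iff_diff_eq_0 less_irrefl)

lemma continuous_poisson: "cmod z < 1 \<Longrightarrow> continuous_on S (poisson z)"
  unfolding poisson_def using cis_neq by (intro continuous_intros) auto

lemma Poisson_inequality:
  assumes cont: "continuous_on (cball 0 1) F" and hol: "F holomorphic_on udisc" and z: "cmod z < 1"
  shows "ennreal (2 * pi * cmod (F z)) \<le> (\<integral>\<^sup>+\<theta>. ennreal (poisson z \<theta> * cmod (F (cis \<theta>))) \<partial>circ)"
proof -
  have cF: "continuous_on {0..2*pi} (\<lambda>\<theta>. F (cis \<theta>))"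
    by (rule continuous_on_compose2[OF cont]) (auto intro!: continuous_intros)
  have cP: "continuous_on {0..2*pi} (\<lambda>\<theta>. poisson z \<theta> * cmod (F (cis \<theta>)))"
    by (intro continuous_intros continuous_poisson z cF)
  have "cmod (2 * of_real pi * F z) \<le> integral {0..2*pi} (\<lambda>\<theta>. poisson z \<theta> * cmod (F (cis \<theta>)))"
  proof (rule integral_norm_bound_integral[THEN order_trans[rotated], OF _ _ _ eq_refl[OF arg_cong[of _ _ norm]]])
    show "2 * of_real pi * F z = integral {0..2*pi} (\<lambda>\<theta>. of_real (poisson z \<theta>) * F (cis \<theta>))"
      using Poisson_formula[OF assms] unfolding poisson_def by (rule integral_unique[symmetric])
    show "(\<lambda>\<theta>. of_real (poisson z \<theta>) * F (cis \<theta>)) integrable_on {0..2*pi}"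
      using Poisson_formula[OF assms] unfolding poisson_def by (rule has_integral_integrable)
    show "(\<lambda>\<theta>. poisson z \<theta> * cmod (F (cis \<theta>))) integrable_on {0..2*pi}"
      by (rule integrable_continuous_interval[OF cP])
    show "norm (of_real (poisson z \<theta>) * F (cis \<theta>)) \<le> poisson z \<theta> * cmod (F (cis \<theta>))" for \<theta>
      using poisson_nonneg[OF z] by (simp add: norm_mult)
  qed
  then show ?thesis
    by (subst nn_integral_circ_continuous[OF cP])
      (auto simp: norm_mult intro!: ennreal_leI mult_nonneg_nonneg poisson_nonneg z)
qed

text \<open>With d the chordal distance, the squared distance from e^(i\<open>\<phi>\<close>) to (1
  - \<open>\<rho>\<close>) e^(i\<open>\<theta>\<close>) is \<open>\<rho>\<close>^2 + (1 -
  \<open>\<rho>\<close>) d^2, at most \<open>\<rho>\<close>^2 + d^2. The uniform integral bound of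
  \<open>kern\<close> then comes from the Poisson formula for the constant 1.\<close>

lemma kern_le_poisson:
  assumes "0 < \<rho>" "\<rho> \<le> 1"
  shows "kern \<rho> (cmod (cis \<theta> - cis \<phi>)) \<le> poisson (of_real (1 - \<rho>) * cis \<theta>) \<phi>"
proof -
  let ?d = "cmod (cis \<theta> - cis \<phi>)" and ?z = "of_real (1 - \<rho>) * cis \<theta>"
  have nz: "cmod ?z = 1 - \<rho>" using assms by (simp add: norm_mult del: of_real_diff)
  have "(cmod (cis \<phi> - ?z))\<^sup>2 = \<rho>\<^sup>2 + (1 - \<rho>) * ?d\<^sup>2"
  proof -
    have "(cos \<phi> - (1 - \<rho>) * cos \<theta>)\<^sup>2 + (sin \<phi> - (1 - \<rho>) * sin \<theta>)\<^sup>2 =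
      \<rho>\<^sup>2 + (1 - \<rho>) * ((cos \<theta> - cos \<phi>)\<^sup>2 + (sin \<theta> - sin \<phi>)\<^sup>2)"
      using sin_cos_squared_add[of \<theta>] sin_cos_squared_add[of \<phi>] by algebra
    then show ?thesis by (simp add: cmod_power2)
  qed
  also have "\<dots> \<le> \<rho>\<^sup>2 + 1 * ?d\<^sup>2" using assms by (intro add_left_mono mult_right_mono) auto
  finally have le: "(cmod (cis \<phi> - ?z))\<^sup>2 \<le> \<rho>\<^sup>2 + ?d\<^sup>2" by simp
  have "cmod ?z < 1" using nz assms by simp
  then have pos: "0 < (cmod (cis \<phi> - ?z))\<^sup>2" using cis_neq[of ?z \<phi>] by simp
  have "kern \<rho> ?d \<le> \<rho> / (cmod (cis \<phi> - ?z))\<^sup>2"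
    unfolding kern_def using assms by (intro divide_left_mono le mult_pos_pos pos add_pos_nonneg) simp_all
  also have "\<dots> \<le> (1 - (cmod ?z)\<^sup>2) / (cmod (cis \<phi> - ?z))\<^sup>2"
  proof (intro divide_right_mono)
    have "\<rho> * \<rho> \<le> \<rho> * 1" using assms by (intro mult_left_mono) auto
    then show "\<rho> \<le> 1 - (cmod ?z)\<^sup>2" unfolding nz by (simp add: power2_eq_square algebra_simps)
  qed simp
  finally show ?thesis by (simp add: poisson_def)
qed

lemma kern_integral_circ:
  assumes "0 < \<rho>" "\<rho> \<le> 1"
  shows "(\<integral>\<^sup>+\<phi>. ennreal (kern \<rho> (cmod (cis \<theta> - cis \<phi>))) \<partial>circ) \<le> ennreal (2 * pi)"
proof -
  let ?z = "of_real (1 - \<rho>) * cis \<theta>"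
  have z: "cmod ?z < 1" using assms by (simp add: norm_mult del: of_real_diff)
  have "((\<lambda>\<phi>. of_real (poisson ?z \<phi>) * 1) has_integral (2 * of_real pi * (1::complex))) {0..2*pi}"
    using Poisson_formula[of "\<lambda>_. 1", OF _ _ z] unfolding poisson_def by simp
  from has_integral_Re[OF this] have "(poisson ?z has_integral (2 * pi)) {0..2*pi}" by simp
  then have P: "(\<integral>\<^sup>+\<phi>. ennreal (poisson ?z \<phi>) \<partial>circ) = ennreal (2 * pi)"
    by (rule nn_integral_circ_eq) (rule poisson_nonneg[OF z])
  have "(\<integral>\<^sup>+\<phi>. ennreal (kern \<rho> (cmod (cis \<theta> - cis \<phi>))) \<partial>circ) \<le> (\<integral>\<^sup>+\<phi>. ennreal (poisson ?z \<phi>) \<partial>circ)"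
    by (intro nn_integral_mono ennreal_leI kern_le_poisson assms)
  then show ?thesis unfolding P .
qed

lemma cis_measurable_circ [measurable]: "cis \<in> borel_measurable circ"
  by (rule continuous_imp_measurable_on_sets_lebesgue) (auto intro!: continuous_intros)

interpretation circ: metric_kernel circ "\<lambda>p. cmod (cis (fst p) - cis (snd p))" "2 * pi"
proof -
  interpret finite_measure circ by (rule finite_measure_lebesgue_on) simp
  show "metric_kernel circ (\<lambda>p. cmod (cis (fst p) - cis (snd p))) (2 * pi)"
  proof
    show "(\<lambda>p. cmod (cis (fst p) - cis (snd p))) \<in> borel_measurable (circ \<Otimes>\<^sub>M circ)" by measurable
    show "(\<integral>\<^sup>+y. ennreal (kern \<rho> (cmod (cis (fst (x, y)) - cis (snd (x, y))))) \<partial>circ) \<le> ennreal (2 * pi)"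
      if "0 < \<rho>" "\<rho> \<le> 1" for \<rho> x
      using kern_integral_circ[OF that, of x] by simp
    show "cmod (cis (fst (x, z)) - cis (snd (x, z))) \<le>
        cmod (cis (fst (x, y)) - cis (snd (x, y))) + cmod (cis (fst (y, z)) - cis (snd (y, z)))" for x y z
      using norm_triangle_ineq[of "cis x - cis y" "cis y - cis z"] by simp
  qed (simp_all add: norm_minus_commute)
qed

text \<open>The 4 bounds 1 - |z|^2 in units of a dyadic radius s, and 1 + (1 +
  \<open>\<alpha>\<close>)^2 bounds s^2 + d^2 by the squared distance from z to the point of the
  circle; d is the chordal distance of that point from the vertex.\<close>

definition stolz_const :: "real \<Rightarrow> real" where
  "stolz_const \<alpha> = 4 * (1 + (1 + \<alpha>)\<^sup>2)"

lemma stolz_const_pos: "0 < stolz_const \<alpha>"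
  by (simp add: stolz_const_def add_pos_nonneg)

lemma poisson_le_kern_stolz:
  assumes z: "z \<in> stolz \<alpha> (cis \<theta>)" and \<alpha>: "1 < \<alpha>"
  shows "\<exists>m. \<forall>\<phi>. poisson z \<phi> \<le> stolz_const \<alpha> * kern (1 / 2 ^ m) (cmod (cis \<theta> - cis \<phi>))"
proof -
  define \<rho> where "\<rho> = 1 - cmod z"
  have z1: "cmod z < 1" and zs: "cmod (z - cis \<theta>) < \<alpha> * \<rho>" using z by (auto simp: stolz_def \<rho>_def)
  have \<rho>: "0 < \<rho>" "\<rho> \<le> 1" using z1 by (auto simp: \<rho>_def)
  \<comment> \<open>A dyadic radius within a factor 2 of 1 - |z|, because the maximal function runs
    over the radii 1/2^m.\<close>
  obtain m where m: "1 / 2 ^ m \<le> \<rho>" "\<rho> \<le> 2 * (1 / 2 ^ m)"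
  proof -
    define m where "m = (LEAST m. (1/2::real) ^ m \<le> \<rho>)"
    have ex: "\<exists>m. (1/2::real) ^ m \<le> \<rho>" using real_arch_pow_inv[of \<rho> "1/2"] \<rho>(1) by (auto intro: less_imp_le)
    have 1: "(1/2) ^ m \<le> \<rho>" unfolding m_def by (rule LeastI_ex[OF ex])
    have 2: "\<rho> \<le> 2 * (1/2) ^ m"
    proof (cases m)
      case (Suc k)
      then have "\<not> (1/2) ^ k \<le> \<rho>" using not_less_Least[of k "\<lambda>m. (1/2::real) ^ m \<le> \<rho>"] unfolding m_def[symmetric] by simp
      then show ?thesis using Suc by simp
    qed (use \<rho> in simp)
    show ?thesis using that[of m] 1 2 by (simp add: power_one_over)
  qed
  define s :: real where "s = 1 / 2 ^ m"
  have s: "0 < s" "s \<le> \<rho>" "\<rho> \<le> 2 * s" using m by (auto simp: s_def)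
  show ?thesis
  proof (intro exI[of _ m] allI)
    fix \<phi>
    let ?d = "cmod (cis \<theta> - cis \<phi>)" and ?e = "cmod (cis \<phi> - z)"
    have \<rho>e: "\<rho> \<le> ?e" using norm_triangle_ineq2[of "cis \<phi>" z] by (simp add: \<rho>_def)
    then have e: "0 < ?e" using \<rho> by linarith
    have "?d \<le> cmod (z - cis \<theta>) + ?e"
      using norm_triangle_ineq[of "cis \<theta> - z" "z - cis \<phi>"] by (simp add: norm_minus_commute)
    also have "\<dots> \<le> \<alpha> * ?e + ?e" using zs \<alpha> mult_left_mono[OF \<rho>e, of \<alpha>] by linarith
    finally have "?d \<le> (1 + \<alpha>) * ?e" by (simp add: algebra_simps)
    then have "?d\<^sup>2 \<le> ((1 + \<alpha>) * ?e)\<^sup>2" by (rule power_mono) simp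
    then have "?d\<^sup>2 \<le> (1 + \<alpha>)\<^sup>2 * ?e\<^sup>2" by (simp only: power_mult_distrib)
    moreover have "s\<^sup>2 \<le> ?e\<^sup>2" using s \<rho>e by (intro power_mono) auto
    ultimately have le: "s\<^sup>2 + ?d\<^sup>2 \<le> (1 + (1 + \<alpha>)\<^sup>2) * ?e\<^sup>2"
      unfolding power_mult_distrib by (simp add: distrib_right)
    have pos: "0 < s\<^sup>2 + ?d\<^sup>2" using s by (simp add: add_pos_nonneg)
    have "1 - (cmod z)\<^sup>2 = (1 + cmod z) * \<rho>" by (simp add: \<rho>_def power2_eq_square algebra_simps)
    also have "\<dots> \<le> 2 * (2 * s)" using z1 s \<rho> by (intro mult_mono) auto
    finally have "poisson z \<phi> \<le> 4 * s / ?e\<^sup>2"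
      unfolding poisson_def by (intro divide_right_mono) auto
    also have "\<dots> \<le> 4 * s * ((1 + (1 + \<alpha>)\<^sup>2) / (s\<^sup>2 + ?d\<^sup>2))"
    proof -
      have "1 / ?e\<^sup>2 \<le> (1 + (1 + \<alpha>)\<^sup>2) / (s\<^sup>2 + ?d\<^sup>2)"
        using le pos e by (simp add: divide_simps mult.commute)
      then have "4 * s * (1 / ?e\<^sup>2) \<le> 4 * s * ((1 + (1 + \<alpha>)\<^sup>2) / (s\<^sup>2 + ?d\<^sup>2))"
        using s by (intro mult_left_mono) auto
      then show ?thesis by simp
    qed
    also have "\<dots> = stolz_const \<alpha> * kern s ?d" by (simp add: stolz_const_def kern_def)
    finally show "poisson z \<phi> \<le> stolz_const \<alpha> * kern (1 / 2 ^ m) ?d" by (simp add: s_def)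
  qed
qed

text \<open>On a Stolz angle the Poisson integral is at most \<open>stolz_const \<alpha>\<close>
  times an average at the vertex. Dividing by that constant lets a single \<open>Q\<close> serve all
  apertures.\<close>

lemma H2_maximal_closed_disc:
  assumes cont: "continuous_on (cball 0 1) F" and hol: "F holomorphic_on udisc"
  shows "\<exists>Q\<in>borel_measurable circ.
    (\<integral>\<^sup>+\<theta>. Q \<theta> \<partial>circ) \<le> ennreal ((8 * (2 * pi))\<^sup>2) * (\<integral>\<^sup>+\<theta>. (ennreal (cmod (F (cis \<theta>))))\<^sup>2 \<partial>circ) \<and>
    (\<forall>\<theta> \<alpha> z. 1 < \<alpha> \<longrightarrow> z \<in> stolz \<alpha> (cis \<theta>) \<longrightarrow> ennreal ((cmod (F z) / stolz_const \<alpha>)\<^sup>2) \<le> Q \<theta>)"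
proof -
  let ?u = "\<lambda>\<theta>. cmod (F (cis \<theta>))"
  have cu: "continuous_on UNIV (\<lambda>\<theta>. F (cis \<theta>))"
    by (rule continuous_on_compose2[OF cont]) (auto intro!: continuous_intros)
  have "compact (F ` cball 0 1)" by (intro compact_continuous_image cont) auto
  then obtain b where b: "\<And>w. w \<in> cball 0 1 \<Longrightarrow> cmod (F w) \<le> b"
    by (meson compact_imp_bounded bounded_iff image_eqI)
  have um: "?u \<in> borel_measurable circ"
    by (rule continuous_imp_measurable_on_sets_lebesgue)
      (auto intro!: continuous_on_norm continuous_on_subset[OF cu])
  obtain Q where Q: "Q \<in> borel_measurable circ" "\<And>x m. (circ.average ?u (1 / 2 ^ m) x)\<^sup>2 \<le> Q x"
    "(\<integral>\<^sup>+x. Q x \<partial>circ) \<le> ennreal ((8 * (2 * pi))\<^sup>2) * (\<integral>\<^sup>+x. (ennreal (?u x))\<^sup>2 \<partial>circ)"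
    using circ.maximal[OF um, of b] b by auto
  have "ennreal ((cmod (F z) / stolz_const \<alpha>)\<^sup>2) \<le> Q \<theta>" if \<alpha>: "1 < \<alpha>" and z: "z \<in> stolz \<alpha> (cis \<theta>)" for \<theta> \<alpha> z
  proof -
    have z1: "cmod z < 1" using z by (simp add: stolz_def)
    obtain m where m: "\<And>\<phi>. poisson z \<phi> \<le> stolz_const \<alpha> * kern (1 / 2 ^ m) (cmod (cis \<theta> - cis \<phi>))"
      using poisson_le_kern_stolz[OF z \<alpha>] by blast
    have km: "(\<lambda>\<phi>. kern (1 / 2 ^ m) (cmod (cis \<theta> - cis \<phi>))) \<in> borel_measurable circ"
      unfolding kern_def by measurable
    have "ennreal (cmod (F z)) \<le> ennreal (2 * pi * cmod (F z))"
      using pi_ge_two by (intro ennreal_leI) (simp add: mult_le_cancel_right1)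
    also have "\<dots> \<le> (\<integral>\<^sup>+\<phi>. ennreal (poisson z \<phi> * ?u \<phi>) \<partial>circ)" by (rule Poisson_inequality[OF cont hol z1])
    also have "\<dots> \<le> (\<integral>\<^sup>+\<phi>. ennreal (stolz_const \<alpha>) * (ennreal (kern (1 / 2 ^ m) (cmod (cis \<theta> - cis \<phi>))) * ennreal (?u \<phi>)) \<partial>circ)"
    proof (intro nn_integral_mono)
      fix \<phi>
      have "poisson z \<phi> * ?u \<phi> \<le> stolz_const \<alpha> * kern (1 / 2 ^ m) (cmod (cis \<theta> - cis \<phi>)) * ?u \<phi>"
        by (intro mult_right_mono m) simp
      then show "ennreal (poisson z \<phi> * ?u \<phi>) \<le>
          ennreal (stolz_const \<alpha>) * (ennreal (kern (1 / 2 ^ m) (cmod (cis \<theta> - cis \<phi>))) * ennreal (?u \<phi>))"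
        using stolz_const_pos[of \<alpha>] by (simp add: ennreal_mult[symmetric] kern_nonneg ennreal_leI mult.assoc)
    qed
    also have "\<dots> = ennreal (stolz_const \<alpha>) * circ.average ?u (1 / 2 ^ m) \<theta>"
      unfolding circ.average_def fst_conv snd_conv
      by (intro nn_integral_cmult borel_measurable_times_ennreal measurable_compose[OF km] measurable_compose[OF um]) simp_all
    finally have le: "ennreal (cmod (F z)) \<le> ennreal (stolz_const \<alpha>) * circ.average ?u (1 / 2 ^ m) \<theta>" .
    have "ennreal (cmod (F z) / stolz_const \<alpha>) \<le> circ.average ?u (1 / 2 ^ m) \<theta>"
    proof -
      have "ennreal (1 / stolz_const \<alpha>) * ennreal (cmod (F z)) \<le>
          ennreal (1 / stolz_const \<alpha>) * (ennreal (stolz_const \<alpha>) * circ.average ?u (1 / 2 ^ m) \<theta>)"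
        by (intro mult_left_mono le) simp
      also have "\<dots> = circ.average ?u (1 / 2 ^ m) \<theta>"
        using stolz_const_pos[of \<alpha>] by (simp add: mult.assoc[symmetric] ennreal_mult[symmetric])
      finally show ?thesis using stolz_const_pos[of \<alpha>] by (simp add: ennreal_mult[symmetric])
    qed
    then have "(ennreal (cmod (F z) / stolz_const \<alpha>))\<^sup>2 \<le> (circ.average ?u (1 / 2 ^ m) \<theta>)\<^sup>2"
      by (intro power_mono) auto
    also have "\<dots> \<le> Q \<theta>" by (rule Q(2))
    finally show ?thesis using stolz_const_pos[of \<alpha>] by (simp add: ennreal_power)
  qed
  then show ?thesis using Q by blast
qed

text \<open>The previous result applies to dilations. By Fatou's lemma the lower limit of their
  majorants keeps the integral bound, and the dilations converge pointwise to
  \<open>F\<close>.\<close>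

lemma H2_maximal:
  assumes hol: "F holomorphic_on udisc"
    and K: "\<And>r. 0 < r \<Longrightarrow> r < 1 \<Longrightarrow> (\<integral>\<^sup>+\<theta>. (ennreal (cmod (F (of_real r * cis \<theta>))))\<^sup>2 \<partial>circ) \<le> K"
  shows "\<exists>Q\<in>borel_measurable circ. (\<integral>\<^sup>+\<theta>. Q \<theta> \<partial>circ) \<le> ennreal ((8 * (2 * pi))\<^sup>2) * K \<and>
    (\<forall>\<theta> \<alpha> z. 1 < \<alpha> \<longrightarrow> z \<in> stolz \<alpha> (cis \<theta>) \<longrightarrow> ennreal ((cmod (F z) / stolz_const \<alpha>)\<^sup>2) \<le> Q \<theta>)"
proof -
  define R where "R = (\<lambda>j::nat. 1 - 1 / (real j + 2))"
  have R: "0 < R j" "R j < 1" for j by (auto simp: R_def field_simps)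
  have Rlim: "R \<longlonglongrightarrow> 1" unfolding R_def by real_asymp
  have contF: "continuous_on udisc F" using hol by (rule holomorphic_on_imp_continuous_on)
  have sub: "of_real (R j) * w \<in> udisc" if "cmod w \<le> 1" for j w
  proof -
    have "R j * cmod w \<le> R j * 1" using that R[of j] by (intro mult_left_mono) auto
    then have "cmod (of_real (R j) * w) < 1" using R[of j] unfolding norm_mult norm_of_real by linarith
    then show ?thesis by simp
  qed
  have "\<exists>Q\<in>borel_measurable circ. (\<integral>\<^sup>+\<theta>. Q \<theta> \<partial>circ) \<le> ennreal ((8 * (2 * pi))\<^sup>2) * K \<and>
    (\<forall>\<theta> \<alpha> z. 1 < \<alpha> \<longrightarrow> z \<in> stolz \<alpha> (cis \<theta>) \<longrightarrow> ennreal ((cmod (F (of_real (R j) * z)) / stolz_const \<alpha>)\<^sup>2) \<le> Q \<theta>)" for j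
  proof -
    have c: "continuous_on (cball 0 1) (\<lambda>w. F (of_real (R j) * w))"
      by (rule continuous_on_compose2[OF contF]) (use sub in \<open>auto intro!: continuous_intros\<close>)
    have h: "(\<lambda>w. F (of_real (R j) * w)) holomorphic_on udisc"
      by (rule holomorphic_on_compose_gen[OF _ hol, unfolded o_def, of "\<lambda>w. of_real (R j) * w"])
        (use sub in \<open>auto intro!: holomorphic_intros\<close>)
    obtain Q where "Q \<in> borel_measurable circ"
      "(\<integral>\<^sup>+\<theta>. Q \<theta> \<partial>circ) \<le> ennreal ((8 * (2 * pi))\<^sup>2) * (\<integral>\<^sup>+\<theta>. (ennreal (cmod (F (of_real (R j) * cis \<theta>))))\<^sup>2 \<partial>circ)"
      "\<And>\<theta> \<alpha> z. 1 < \<alpha> \<Longrightarrow> z \<in> stolz \<alpha> (cis \<theta>) \<Longrightarrow> ennreal ((cmod (F (of_real (R j) * z)) / stolz_const \<alpha>)\<^sup>2) \<le> Q \<theta>"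
      using H2_maximal_closed_disc[OF c h] by blast
    moreover have "ennreal ((8 * (2 * pi))\<^sup>2) * (\<integral>\<^sup>+\<theta>. (ennreal (cmod (F (of_real (R j) * cis \<theta>))))\<^sup>2 \<partial>circ) \<le>
        ennreal ((8 * (2 * pi))\<^sup>2) * K"
      by (intro mult_left_mono K R) simp
    ultimately show ?thesis by (meson order_trans)
  qed
  then obtain Q where Q: "\<And>j. Q j \<in> borel_measurable circ"
    "\<And>j. (\<integral>\<^sup>+\<theta>. Q j \<theta> \<partial>circ) \<le> ennreal ((8 * (2 * pi))\<^sup>2) * K"
    "\<And>j \<theta> \<alpha> z. 1 < \<alpha> \<Longrightarrow> z \<in> stolz \<alpha> (cis \<theta>) \<Longrightarrow> ennreal ((cmod (F (of_real (R j) * z)) / stolz_const \<alpha>)\<^sup>2) \<le> Q j \<theta>"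
    by metis
  have [measurable]: "Q j \<in> borel_measurable circ" for j by (rule Q(1))
  show ?thesis
  proof (intro bexI[of _ "\<lambda>\<theta>. liminf (\<lambda>j. Q j \<theta>)"] conjI allI impI)
    show "(\<lambda>\<theta>. liminf (\<lambda>j. Q j \<theta>)) \<in> borel_measurable circ" by measurable
    have "(\<integral>\<^sup>+\<theta>. liminf (\<lambda>j. Q j \<theta>) \<partial>circ) \<le> liminf (\<lambda>j. \<integral>\<^sup>+\<theta>. Q j \<theta> \<partial>circ)"
      by (rule nn_integral_liminf) measurable
    also have "\<dots> \<le> liminf (\<lambda>j::nat. ennreal ((8 * (2 * pi))\<^sup>2) * K)"
      by (intro Liminf_mono always_eventually allI Q(2))
    finally show "(\<integral>\<^sup>+\<theta>. liminf (\<lambda>j. Q j \<theta>) \<partial>circ) \<le> ennreal ((8 * (2 * pi))\<^sup>2) * K"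
      by (simp add: Liminf_const)
    fix \<theta> \<alpha> z assume \<alpha>: "1 < \<alpha>" and z: "z \<in> stolz \<alpha> (cis \<theta>)"
    have z1: "z \<in> udisc" using z by (simp add: stolz_def)
    have "(\<lambda>j. of_real (R j) * z) \<longlonglongrightarrow> of_real 1 * z"
      by (intro tendsto_intros Rlim)
    then have "(\<lambda>j. F (of_real (R j) * z)) \<longlonglongrightarrow> F z"
      using z1 sub[of z] by (intro continuous_on_tendsto_compose[OF contF]) auto
    then have "(\<lambda>j. ennreal ((cmod (F (of_real (R j) * z)) / stolz_const \<alpha>)\<^sup>2)) \<longlonglongrightarrow> ennreal ((cmod (F z) / stolz_const \<alpha>)\<^sup>2)"
      using stolz_const_pos[of \<alpha>] by (intro tendsto_ennrealI tendsto_intros) auto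
    then have "ennreal ((cmod (F z) / stolz_const \<alpha>)\<^sup>2) = liminf (\<lambda>j. ennreal ((cmod (F (of_real (R j) * z)) / stolz_const \<alpha>)\<^sup>2))"
      by (intro lim_imp_Liminf[symmetric]) auto
    also have "\<dots> \<le> liminf (\<lambda>j. Q j \<theta>)"
      by (intro Liminf_mono always_eventually allI Q(3) \<alpha> z)
    finally show "ennreal ((cmod (F z) / stolz_const \<alpha>)\<^sup>2) \<le> liminf (\<lambda>j. Q j \<theta>)" .
  qed
qed

section \<open>Parseval's identity on circles and convergence of dilations\<close>

lemma has_integral_cis:
  "((\<lambda>\<theta>. cis (of_int k * \<theta>)) has_integral (if k = 0 then of_real (2 * pi) else 0)) {0..2*pi}"
proof (cases "k = 0")
  case True
  then show ?thesis
    using has_integral_const_real[of "1::complex" 0 "2*pi"] by (simp add: scaleR_conv_of_real)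
next
  case False
  let ?G = "\<lambda>\<theta>. cis (of_int k * \<theta>) / (\<i> * of_int k)"
  have "((\<lambda>\<theta>. cis (of_int k * \<theta>)) has_integral (?G (2 * pi) - ?G 0)) {0..2*pi}"
  proof (rule fundamental_theorem_of_calculus)
    fix \<theta>
    show "(?G has_vector_derivative cis (of_int k * \<theta>)) (at \<theta> within {0..2*pi})"
    proof -
      have "((\<lambda>z. exp (\<i> * of_int k * z) / (\<i> * of_int k)) has_field_derivative
          exp (\<i> * of_int k * of_real \<theta>)) (at (of_real \<theta>))"
        using False by (auto intro!: derivative_eq_intros)
      from has_vector_derivative_real_field[OF this]
      show ?thesis by (simp add: cis_conv_exp mult.assoc)
    qed
  qed simp
  moreover have "cis (of_int k * (2 * pi)) = 1"
    using cis_multiple_2pi[of "of_int k"] by (simp add: mult_ac)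
  ultimately show ?thesis using False by simp
qed

lemma polynomial_circle_L2:
  "((\<lambda>\<theta>. (cmod (\<Sum>n<N. b n * cis \<theta> ^ n))\<^sup>2) has_integral (2 * pi * (\<Sum>n<N. (cmod (b n))\<^sup>2))) {0..2*pi}"
proof -
  have "((\<lambda>\<theta>. \<Sum>m<N. \<Sum>n<N. b m * cnj (b n) * cis (of_int (int m - int n) * \<theta>)) has_integral
      (\<Sum>m<N. \<Sum>n<N. b m * cnj (b n) * (if int m - int n = 0 then of_real (2 * pi) else 0))) {0..2*pi}"
    by (intro has_integral_sum finite_lessThan has_integral_mult_right has_integral_cis)
  also have "(\<Sum>m<N. \<Sum>n<N. b m * cnj (b n) * (if int m - int n = 0 then of_real (2 * pi) else 0)) =
      (\<Sum>m<N. b m * cnj (b m) * of_real (2 * pi))"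
  proof (intro sum.cong refl)
    fix m assume "m \<in> {..<N}"
    have "(\<Sum>n<N. b m * cnj (b n) * (if int m - int n = 0 then of_real (2 * pi) else 0)) =
        (\<Sum>n<N. if m = n then b m * cnj (b n) * of_real (2 * pi) else 0)"
      by (intro sum.cong) auto
    then show "(\<Sum>n<N. b m * cnj (b n) * (if int m - int n = 0 then of_real (2 * pi) else 0)) =
        b m * cnj (b m) * of_real (2 * pi)"
      using \<open>m \<in> {..<N}\<close> by (simp only: sum.delta'[OF finite_lessThan] if_True)
  qed
  also have "\<dots> = of_real (2 * pi * (\<Sum>n<N. (cmod (b n))\<^sup>2))"
    by (simp add: complex_norm_square[symmetric] sum_distrib_left mult_ac)
  also have "(\<lambda>\<theta>. \<Sum>m<N. \<Sum>n<N. b m * cnj (b n) * cis (of_int (int m - int n) * \<theta>)) =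
      (\<lambda>\<theta>. of_real ((cmod (\<Sum>n<N. b n * cis \<theta> ^ n))\<^sup>2))"
  proof
    fix \<theta>
    have "of_real ((cmod (\<Sum>n<N. b n * cis \<theta> ^ n))\<^sup>2) =
        (\<Sum>m<N. b m * cis \<theta> ^ m) * (\<Sum>n<N. cnj (b n) * cnj (cis \<theta>) ^ n)"
      by (simp add: complex_norm_square cnj_sum del: of_real_power)
    also have "\<dots> = (\<Sum>m<N. \<Sum>n<N. b m * cnj (b n) * cis (of_int (int m - int n) * \<theta>))"
      unfolding sum_product
    proof (intro sum.cong refl)
      fix m n
      have "cis (of_int (int m - int n) * \<theta>) = cis (real m * \<theta>) * cis (- (real n * \<theta>))"
        by (simp add: cis_mult algebra_simps)
      also have "\<dots> = cis \<theta> ^ m * cnj (cis \<theta>) ^ n"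
        unfolding cis_cnj Complex.DeMoivre by simp
      finally show "b m * cis \<theta> ^ m * (cnj (b n) * cnj (cis \<theta>) ^ n) =
          b m * cnj (b n) * cis (of_int (int m - int n) * \<theta>)" by (simp add: mult_ac)
    qed
    finally show "(\<Sum>m<N. \<Sum>n<N. b m * cnj (b n) * cis (of_int (int m - int n) * \<theta>)) =
      of_real ((cmod (\<Sum>n<N. b n * cis \<theta> ^ n))\<^sup>2)" by simp
  qed
  finally have "((\<lambda>\<theta>. Re (of_real ((cmod (\<Sum>n<N. b n * cis \<theta> ^ n))\<^sup>2))) has_integral
      Re (of_real (2 * pi * (\<Sum>n<N. (cmod (b n))\<^sup>2)))) {0..2*pi}" by (rule has_integral_Re)
  then show ?thesis by simp
qed

definition circle_sq :: "(complex \<Rightarrow> complex) \<Rightarrow> real \<Rightarrow> ennreal" where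
  "circle_sq F r = (\<integral>\<^sup>+\<theta>. (ennreal (cmod (F (of_real r * cis \<theta>))))\<^sup>2 \<partial>circ)"

lemma circle_sq_polynomial:
  "circle_sq (\<lambda>z. \<Sum>n<N. a n * z ^ n) r = ennreal (2 * pi * (\<Sum>n<N. (cmod (a n) * \<bar>r\<bar> ^ n)\<^sup>2))"
proof -
  have "(\<integral>\<^sup>+\<theta>. ennreal ((cmod (\<Sum>n<N. (a n * of_real r ^ n) * cis \<theta> ^ n))\<^sup>2) \<partial>circ) =
      ennreal (2 * pi * (\<Sum>n<N. (cmod (a n * of_real r ^ n))\<^sup>2))"
    by (rule nn_integral_circ_eq[OF polynomial_circle_L2]) simp
  then show ?thesis
    by (simp add: circle_sq_def ennreal_power power_mult_distrib norm_mult norm_power mult.assoc)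
qed

lemma circle_sq_power_series:
  assumes a: "\<And>z. z \<in> udisc \<Longrightarrow> (\<lambda>n. a n * z ^ n) sums F z" and r: "0 \<le> r" "r < 1"
  shows "(\<lambda>N. ennreal (2 * pi * (\<Sum>n<N. (cmod (a n) * r ^ n)\<^sup>2))) \<longlonglongrightarrow> circle_sq F r"
proof -
  \<comment> \<open>A radius between r and 1 gives absolute convergence on the circle of radius r,
    hence a constant dominating function for the partial sums.\<close>
  define s where "s = (1 + r) / 2"
  have s: "r < s" "s < 1" "0 < s" using r by (auto simp: s_def)
  have "summable (\<lambda>n. a n * of_real s ^ n)"
    using a[of "of_real s"] s by (auto intro: sums_summable)
  then have sm: "summable (\<lambda>n. norm (a n * of_real r ^ n))"
    by (rule powser_insidea) (use r s in simp)
  let ?B = "\<Sum>n. norm (a n * of_real r ^ n)"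
  have "(\<lambda>N. \<integral>\<^sup>+\<theta>. (ennreal (cmod (\<Sum>n<N. a n * (of_real r * cis \<theta>) ^ n)))\<^sup>2 \<partial>circ) \<longlonglongrightarrow>
      (\<integral>\<^sup>+\<theta>. (ennreal (cmod (F (of_real r * cis \<theta>))))\<^sup>2 \<partial>circ)"
  proof (rule nn_integral_dominated_convergence[where w = "\<lambda>_. ennreal (?B\<^sup>2)"])
    have lim: "(\<lambda>N. \<Sum>n<N. a n * (of_real r * cis \<theta>) ^ n) \<longlonglongrightarrow> F (of_real r * cis \<theta>)" for \<theta>
      using a[OF circle_in_disc[OF r]] by (simp add: sums_def)
    have m: "(\<lambda>\<theta>. \<Sum>n<N. a n * (of_real r * cis \<theta>) ^ n) \<in> borel_measurable circ" for N
      by measurable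
    show "(\<lambda>\<theta>. (ennreal (cmod (\<Sum>n<N. a n * (of_real r * cis \<theta>) ^ n)))\<^sup>2) \<in> borel_measurable circ" for N
      using m[of N] by measurable
    have "(\<lambda>\<theta>. F (of_real r * cis \<theta>)) \<in> borel_measurable circ"
      by (rule borel_measurable_LIMSEQ_metric[OF m]) (rule lim)
    then show "(\<lambda>\<theta>. (ennreal (cmod (F (of_real r * cis \<theta>))))\<^sup>2) \<in> borel_measurable circ"
      by measurable
    show "AE \<theta> in circ. (ennreal (cmod (\<Sum>n<N. a n * (of_real r * cis \<theta>) ^ n)))\<^sup>2 \<le> ennreal (?B\<^sup>2)" for N
    proof (intro AE_I2)
      fix \<theta>
      have "cmod (\<Sum>n<N. a n * (of_real r * cis \<theta>) ^ n) \<le> (\<Sum>n<N. norm (a n * (of_real r * cis \<theta>) ^ n))"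
        by (rule norm_sum)
      also have "\<dots> = (\<Sum>n<N. norm (a n * of_real r ^ n))"
        by (simp add: norm_mult norm_power)
      also have "\<dots> \<le> ?B" by (intro sum_le_suminf sm) auto
      finally have "(cmod (\<Sum>n<N. a n * (of_real r * cis \<theta>) ^ n))\<^sup>2 \<le> ?B\<^sup>2" by (rule power_mono) simp
      then show "(ennreal (cmod (\<Sum>n<N. a n * (of_real r * cis \<theta>) ^ n)))\<^sup>2 \<le> ennreal (?B\<^sup>2)"
        by (simp add: ennreal_power ennreal_leI)
    qed
    show "(\<lambda>_. ennreal (?B\<^sup>2)) \<in> borel_measurable circ" by (rule borel_measurable_const)
    have "emeasure circ {0..2*pi} < top"
      by (simp add: emeasure_restrict_space)
    then show "(\<integral>\<^sup>+\<theta>. ennreal (?B\<^sup>2) \<partial>circ) < \<infinity>" by (simp add: ennreal_mult_less_top)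
    show "AE \<theta> in circ. (\<lambda>N. (ennreal (cmod (\<Sum>n<N. a n * (of_real r * cis \<theta>) ^ n)))\<^sup>2) \<longlonglongrightarrow>
        (ennreal (cmod (F (of_real r * cis \<theta>))))\<^sup>2"
      unfolding ennreal_power[OF norm_ge_zero]
      by (intro AE_I2 tendsto_ennrealI tendsto_intros lim)
  qed
  then show ?thesis
    using circle_sq_polynomial[where a = a and r = r] r by (simp add: circle_sq_def)
qed

lemma circle_sq_le_coeffs:
  assumes a: "\<And>z. z \<in> udisc \<Longrightarrow> (\<lambda>n. a n * z ^ n) sums F z" and r: "0 \<le> r" "r < 1"
    and sm: "summable (\<lambda>n. (cmod (a n))\<^sup>2)"
  shows "circle_sq F r \<le> ennreal (2 * pi * (\<Sum>n. (cmod (a n))\<^sup>2))"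
proof (rule LIMSEQ_le_const2[OF circle_sq_power_series[OF a r]])
  have "(\<Sum>n<N. (cmod (a n) * r ^ n)\<^sup>2) \<le> (\<Sum>n. (cmod (a n))\<^sup>2)" for N
  proof -
    have "(\<Sum>n<N. (cmod (a n) * r ^ n)\<^sup>2) \<le> (\<Sum>n<N. (cmod (a n))\<^sup>2)"
      using r by (intro sum_mono power_mono mult_left_le) (auto simp: power_le_one)
    also have "\<dots> \<le> (\<Sum>n. (cmod (a n))\<^sup>2)" by (intro sum_le_suminf sm) auto
    finally show ?thesis .
  qed
  then show "\<exists>N. \<forall>n\<ge>N. ennreal (2 * pi * (\<Sum>n<n. (cmod (a n) * r ^ n)\<^sup>2)) \<le> ennreal (2 * pi * (\<Sum>n. (cmod (a n))\<^sup>2))"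
    by (intro exI[of _ 0] allI impI ennreal_leI mult_left_mono) auto
qed

text \<open>Each partial sum with weights r^n is below the square mean on the circle of radius r; a
  finite sum is continuous in r, so r may tend to 1.\<close>

lemma coeffs_summable_if_circle_sq_bounded:
  assumes a: "\<And>z. z \<in> udisc \<Longrightarrow> (\<lambda>n. a n * z ^ n) sums F z"
    and K: "\<And>r. 0 < r \<Longrightarrow> r < 1 \<Longrightarrow> circle_sq F r \<le> ennreal K"
  shows "summable (\<lambda>n. (cmod (a n))\<^sup>2)"
proof (rule summableI_nonneg_bounded)
  fix N
  have bound: "2 * pi * (\<Sum>n<N. (cmod (a n) * r ^ n)\<^sup>2) \<le> max 0 K" if r: "0 < r" "r < 1" for r
  proof -
    have "ennreal (2 * pi * (\<Sum>n<N. (cmod (a n) * r ^ n)\<^sup>2)) \<le> circle_sq F r"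
    proof (rule LIMSEQ_le_const[OF circle_sq_power_series[OF a]])
      show "\<exists>M. \<forall>n\<ge>M. ennreal (2 * pi * (\<Sum>n<N. (cmod (a n) * r ^ n)\<^sup>2)) \<le> ennreal (2 * pi * (\<Sum>n<n. (cmod (a n) * r ^ n)\<^sup>2))"
        by (intro exI[of _ N] allI impI ennreal_leI mult_left_mono sum_mono2) auto
    qed (use r in auto)
    also have "\<dots> \<le> ennreal (max 0 K)" using K[OF r] by (rule order_trans) (simp add: ennreal_leI)
    finally show ?thesis by (subst (asm) ennreal_le_iff) auto
  qed
  have "((\<lambda>r. 2 * pi * (\<Sum>n<N. (cmod (a n) * r ^ n)\<^sup>2)) \<longlongrightarrow> 2 * pi * (\<Sum>n<N. (cmod (a n) * 1 ^ n)\<^sup>2)) (at_left 1)"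
    by (intro tendsto_intros)
  moreover have "\<forall>\<^sub>F r in at_left 1. 2 * pi * (\<Sum>n<N. (cmod (a n) * r ^ n)\<^sup>2) \<le> max 0 K"
    using eventually_at_left_real[OF zero_less_one] by (rule eventually_mono) (use bound in auto)
  ultimately have "2 * pi * (\<Sum>n<N. (cmod (a n) * 1 ^ n)\<^sup>2) \<le> max 0 K"
    by (rule tendsto_upperbound) (simp add: trivial_limit_at_left_real)
  then show "(\<Sum>n<N. (cmod (a n))\<^sup>2) \<le> max 0 K / (2 * pi)" by (simp add: field_simps)
qed simp

text \<open>The difference has the coefficients a_n (1 - R^n), dominated by a_n: the tail is small
  uniformly in R, and the finitely many other terms vanish as R tends to 1.\<close>

lemma circle_sq_dilation:
  assumes hol: "F holomorphic_on udisc"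
    and K: "\<And>r. 0 < r \<Longrightarrow> r < 1 \<Longrightarrow> circle_sq F r \<le> ennreal K" and e: "0 < e"
  shows "\<exists>R. 0 < R \<and> R < 1 \<and> (\<forall>r. 0 < r \<longrightarrow> r < 1 \<longrightarrow> circle_sq (\<lambda>z. F z - F (of_real R * z)) r \<le> ennreal e)"
proof -
  define a where "a = (\<lambda>n. (deriv ^^ n) F 0 / fact n)"
  have a: "(\<lambda>n. a n * z ^ n) sums F z" if "z \<in> udisc" for z
    using holomorphic_power_series[OF hol that] by (simp add: a_def)
  have sm: "summable (\<lambda>n. (cmod (a n))\<^sup>2)"
    by (rule coeffs_summable_if_circle_sq_bounded[OF a K])
  \<comment> \<open>Tail and head contribute e' each, and 2 pi times 2 e' is e.\<close>
  define e' where "e' = e / (4 * pi)"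
  have e': "0 < e'" using e by (simp add: e'_def)
  have "(\<lambda>N. \<Sum>n. (cmod (a (n + N)))\<^sup>2) \<longlonglongrightarrow> 0"
    using suminf_exist_split2[OF sm] .
  then have "\<forall>\<^sub>F N in sequentially. (\<Sum>n. (cmod (a (n + N)))\<^sup>2) < e'"
    using e' by (rule order_tendstoD)
  then obtain N where N: "(\<Sum>n. (cmod (a (n + N)))\<^sup>2) < e'"
    by (meson eventually_sequentially order_refl)
  have "((\<lambda>R. \<Sum>n<N. (cmod (a n) * (1 - R ^ n))\<^sup>2) \<longlongrightarrow> (\<Sum>n<N. (cmod (a n) * (1 - 1 ^ n))\<^sup>2)) (at_left 1)"
    by (intro tendsto_intros)
  then have "\<forall>\<^sub>F R in at_left 1. (\<Sum>n<N. (cmod (a n) * (1 - R ^ n))\<^sup>2) < e'"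
    using e' by (intro order_tendstoD) auto
  then have "\<forall>\<^sub>F R in at_left 1. 0 < R \<and> R < 1 \<and> (\<Sum>n<N. (cmod (a n) * (1 - R ^ n))\<^sup>2) < e'"
    using eventually_at_left_real[OF zero_less_one] by (rule eventually_elim2) simp
  then obtain R where R: "0 < R" "R < 1" "(\<Sum>n<N. (cmod (a n) * (1 - R ^ n))\<^sup>2) < e'"
    using eventually_happens'[OF trivial_limit_at_left_real] by blast
  define b where "b = (\<lambda>n. a n * of_real (1 - R ^ n))"
  have b: "(\<lambda>n. b n * z ^ n) sums (F z - F (of_real R * z))" if z: "z \<in> udisc" for z
  proof -
    have "cmod (of_real R * z) < 1"
      using R z mult_strict_mono[of R 1 "cmod z" 1] by (simp add: norm_mult)
    then have "(\<lambda>n. a n * z ^ n - a n * (of_real R * z) ^ n) sums (F z - F (of_real R * z))"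
      using z by (intro sums_diff a) auto
    then show ?thesis by (simp add: b_def algebra_simps)
  qed
  have bn: "(cmod (b n))\<^sup>2 = (cmod (a n) * (1 - R ^ n))\<^sup>2" for n
  proof -
    have "cmod (of_real (1 - R ^ n)) = 1 - R ^ n" using R by (simp add: power_le_one del: of_real_diff)
    then show ?thesis unfolding b_def norm_mult by simp
  qed
  have ble: "(cmod (b n))\<^sup>2 \<le> (cmod (a n))\<^sup>2" for n
    unfolding bn using R by (intro power_mono mult_left_le) (auto simp: power_le_one)
  have smb: "summable (\<lambda>n. (cmod (b n))\<^sup>2)"
    by (rule summable_comparison_test'[OF sm]) (use ble in simp)
  have "(\<Sum>n. (cmod (b n))\<^sup>2) = (\<Sum>n. (cmod (b (n + N)))\<^sup>2) + (\<Sum>n<N. (cmod (b n))\<^sup>2)"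
    by (rule suminf_split_initial_segment[OF smb])
  also have "(\<Sum>n. (cmod (b (n + N)))\<^sup>2) \<le> (\<Sum>n. (cmod (a (n + N)))\<^sup>2)"
    by (intro suminf_le ble summable_ignore_initial_segment smb sm)
  also have "(\<Sum>n<N. (cmod (b n))\<^sup>2) < e'" using R(3) by (simp add: bn)
  finally have "(\<Sum>n. (cmod (b n))\<^sup>2) \<le> 2 * e'" using N by linarith
  then have le: "2 * pi * (\<Sum>n. (cmod (b n))\<^sup>2) \<le> e" by (simp add: e'_def field_simps)
  have "circle_sq (\<lambda>z. F z - F (of_real R * z)) r \<le> ennreal e" if "0 < r" "r < 1" for r
    using circle_sq_le_coeffs[OF b _ _ smb, of r] that le by (meson ennreal_leI less_imp_le order_trans)
  then show ?thesis using R by blast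
qed

section \<open>Nontangential limits from bounded square means\<close>

lemma stolz_mono: "\<alpha> \<le> \<beta> \<Longrightarrow> stolz \<alpha> \<zeta> \<subseteq> stolz \<beta> \<zeta>"
  unfolding stolz_def by (force intro: less_le_trans mult_right_mono)

lemma radial_in_stolz:
  assumes "0 \<le> s" "s < 1" "1 < \<alpha>"
  shows "of_real s * cis \<theta> \<in> stolz \<alpha> (cis \<theta>)"
proof -
  have "of_real s * cis \<theta> - cis \<theta> = of_real (s - 1) * cis \<theta>" by (simp add: algebra_simps)
  then have "cmod (of_real s * cis \<theta> - cis \<theta>) = 1 - s"
    using assms by (simp add: norm_mult del: of_real_diff)
  moreover have "1 * (1 - s) < \<alpha> * (1 - s)" using assms by (intro mult_strict_right_mono) auto
  ultimately show ?thesis using assms by (simp add: stolz_def norm_mult)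
qed

text \<open>The limit is taken along a radial sequence, which lies in every Stolz angle; this makes
  \<open>c\<close> common to all apertures although the centre \<open>a\<close> may depend on the
  aperture and on \<open>e\<close>.\<close>

lemma stolz_limit_exists:
  fixes F :: "complex \<Rightarrow> 'a::complete_space"
  assumes osc: "\<And>\<alpha> e. 1 < \<alpha> \<Longrightarrow> 0 < e \<Longrightarrow>
    \<exists>a \<delta>. 0 < \<delta> \<and> (\<forall>z\<in>stolz \<alpha> (cis \<theta>). dist z (cis \<theta>) < \<delta> \<longrightarrow> dist (F z) a \<le> e)"
  shows "\<exists>c. \<forall>\<alpha>>1. (F \<longlongrightarrow> c) (at (cis \<theta>) within stolz \<alpha> (cis \<theta>))"
proof -
  define s where "s = (\<lambda>i::nat. 1 - 1 / (real i + 2))"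
  have s: "0 < s i" "s i < 1" for i by (auto simp: s_def field_simps)
  have "s \<longlonglongrightarrow> 1" unfolding s_def by real_asymp
  then have "(\<lambda>i. of_real (s i) * cis \<theta>) \<longlonglongrightarrow> of_real 1 * cis \<theta>" by (intro tendsto_intros)
  then have near: "\<forall>\<^sub>F i in sequentially. dist (of_real (s i) * cis \<theta>) (cis \<theta>) < \<delta>" if "0 < \<delta>" for \<delta>
    using that by (auto dest: tendstoD)
  have st: "of_real (s i) * cis \<theta> \<in> stolz \<alpha> (cis \<theta>)" if "1 < \<alpha>" for i \<alpha>
    using s[of i] that by (intro radial_in_stolz) auto
  define x where "x = (\<lambda>i. F (of_real (s i) * cis \<theta>))"
  have "Cauchy x"
  proof (rule metric_CauchyI)
    fix e :: real assume e: "0 < e"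
    obtain a \<delta> where a: "0 < \<delta>" "\<And>z. z \<in> stolz 2 (cis \<theta>) \<Longrightarrow> dist z (cis \<theta>) < \<delta> \<Longrightarrow> dist (F z) a \<le> e / 3"
      using osc[of 2 "e / 3"] e by auto
    obtain N where N: "\<And>i. N \<le> i \<Longrightarrow> dist (of_real (s i) * cis \<theta>) (cis \<theta>) < \<delta>"
      using near[OF a(1)] unfolding eventually_sequentially by blast
    have xa: "dist (x i) a \<le> e / 3" if "N \<le> i" for i
      unfolding x_def by (rule a(2)[OF st N[OF that]]) simp
    show "\<exists>M. \<forall>m\<ge>M. \<forall>n\<ge>M. dist (x m) (x n) < e"
    proof (intro exI[of _ N] allI impI)
      fix m n assume "N \<le> m" "N \<le> n"
      then show "dist (x m) (x n) < e"
        using xa[of m] xa[of n] dist_triangle2[of "x m" "x n" a] e by linarith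
    qed
  qed
  then obtain c where c: "x \<longlonglongrightarrow> c" using Cauchy_convergent convergent_def by blast
  have "(F \<longlongrightarrow> c) (at (cis \<theta>) within stolz \<alpha> (cis \<theta>))" if \<alpha>: "1 < \<alpha>" for \<alpha>
  proof (rule tendstoI)
    fix e :: real assume e: "0 < e"
    obtain a \<delta> where a: "0 < \<delta>" "\<And>z. z \<in> stolz \<alpha> (cis \<theta>) \<Longrightarrow> dist z (cis \<theta>) < \<delta> \<Longrightarrow> dist (F z) a \<le> e / 3"
      using osc[OF \<alpha>, of "e / 3"] e by auto
    have "\<forall>\<^sub>F i in sequentially. dist (x i) a \<le> e / 3"
      using near[OF a(1)] by eventually_elim (unfold x_def, rule a(2)[OF st[OF \<alpha>]])
    then have ca: "dist c a \<le> e / 3"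
      by (intro tendsto_upperbound[OF tendsto_dist[OF c tendsto_const]]) auto
    show "\<forall>\<^sub>F z in at (cis \<theta>) within stolz \<alpha> (cis \<theta>). dist (F z) c < e"
      unfolding eventually_at
    proof (intro exI[of _ \<delta>] conjI ballI impI a(1))
      fix z assume "z \<in> stolz \<alpha> (cis \<theta>)" "z \<noteq> cis \<theta> \<and> dist z (cis \<theta>) < \<delta>"
      then show "dist (F z) c < e"
        using a(2)[of z] ca dist_triangle2[of "F z" c a] e by linarith
    qed
  qed
  then show ?thesis by blast
qed

definition has_nt_limit :: "(complex \<Rightarrow> 'a::topological_space) \<Rightarrow> real \<Rightarrow> 'a \<Rightarrow> bool" where
  "has_nt_limit F \<theta> c \<longleftrightarrow> (\<forall>\<alpha>>1. (F \<longlongrightarrow> c) (at (cis \<theta>) within stolz \<alpha> (cis \<theta>)))"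

text \<open>The difference between \<open>F\<close> and a dilation has a nontangential majorant
  \<open>Q j\<close> with integrals tending to 0, so at almost every vertex some \<open>Q j\<close>
  is as small as desired. There \<open>F\<close> is uniformly close, on the whole Stolz angle, to a
  function continuous up to the boundary.\<close>

theorem H2_nt_limit:
  assumes hol: "F holomorphic_on udisc"
    and K: "\<And>r. 0 < r \<Longrightarrow> r < 1 \<Longrightarrow> circle_sq F r \<le> ennreal K"
  shows "AE \<theta> in circ. \<exists>c. has_nt_limit F \<theta> c"
proof -
  let ?C = "ennreal ((8 * (2 * pi))\<^sup>2)"
  have "\<exists>R. 0 < R \<and> R < 1 \<and> (\<forall>r. 0 < r \<longrightarrow> r < 1 \<longrightarrow> circle_sq (\<lambda>z. F z - F (of_real R * z)) r \<le> ennreal (1 / 2 ^ j))" for j :: nat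
    by (rule circle_sq_dilation[OF hol K]) simp_all
  then obtain R where R: "\<And>j::nat. 0 < R j" "\<And>j. R j < 1"
    "\<And>j r. 0 < r \<Longrightarrow> r < 1 \<Longrightarrow> circle_sq (\<lambda>z. F z - F (of_real (R j) * z)) r \<le> ennreal (1 / 2 ^ j)"
    by metis
  have contF: "continuous_on udisc F" using hol by (rule holomorphic_on_imp_continuous_on)
  have sub: "of_real (R j) * w \<in> udisc" if "cmod w \<le> 1" for j w
  proof -
    have "R j * cmod w \<le> R j * 1" using that R(1)[of j] by (intro mult_left_mono) auto
    then have "cmod (of_real (R j) * w) < 1" using R(1,2)[of j] unfolding norm_mult norm_of_real by linarith
    then show ?thesis by simp
  qed
  have h: "(\<lambda>z. F z - F (of_real (R j) * z)) holomorphic_on udisc" for j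
    by (intro holomorphic_on_diff hol holomorphic_on_compose_gen[OF _ hol, unfolded o_def, of "\<lambda>w. of_real (R j) * w"])
      (use sub in \<open>auto intro!: holomorphic_intros\<close>)
  have "\<exists>Q\<in>borel_measurable circ. (\<integral>\<^sup>+\<theta>. Q \<theta> \<partial>circ) \<le> ?C * ennreal (1 / 2 ^ j) \<and>
    (\<forall>\<theta> \<alpha> z. 1 < \<alpha> \<longrightarrow> z \<in> stolz \<alpha> (cis \<theta>) \<longrightarrow>
      ennreal ((cmod (F z - F (of_real (R j) * z)) / stolz_const \<alpha>)\<^sup>2) \<le> Q \<theta>)" for j
    using H2_maximal[OF h R(3)[unfolded circle_sq_def]] by blast
  then obtain Q where Q: "\<And>j. Q j \<in> borel_measurable circ"
    "\<And>j. (\<integral>\<^sup>+\<theta>. Q j \<theta> \<partial>circ) \<le> ?C * ennreal (1 / 2 ^ j)"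
    "\<And>j \<theta> \<alpha> z. 1 < \<alpha> \<Longrightarrow> z \<in> stolz \<alpha> (cis \<theta>) \<Longrightarrow>
      ennreal ((cmod (F z - F (of_real (R j) * z)) / stolz_const \<alpha>)\<^sup>2) \<le> Q j \<theta>"
    by metis
  have [measurable]: "Q j \<in> borel_measurable circ" for j by (rule Q(1))
  have "(\<integral>\<^sup>+\<theta>. liminf (\<lambda>j. Q j \<theta>) \<partial>circ) \<le> liminf (\<lambda>j. \<integral>\<^sup>+\<theta>. Q j \<theta> \<partial>circ)"
    by (rule nn_integral_liminf) measurable
  also have "\<dots> \<le> liminf (\<lambda>j. ?C * ennreal (1 / 2 ^ j))"
    by (intro Liminf_mono always_eventually allI Q(2))
  also have "\<dots> = 0"
  proof -
    have "(\<lambda>j. (8 * (2 * pi))\<^sup>2 * (1 / 2 ^ j)) \<longlonglongrightarrow> (0::real)" by real_asymp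
    then have "(\<lambda>j. ennreal ((8 * (2 * pi))\<^sup>2 * (1 / 2 ^ j))) \<longlonglongrightarrow> ennreal 0" by (rule tendsto_ennrealI)
    then have "(\<lambda>j. ?C * ennreal (1 / 2 ^ j)) \<longlonglongrightarrow> ennreal 0"
      by (subst ennreal_mult[symmetric]) simp_all
    then have "(\<lambda>j. ?C * ennreal (1 / 2 ^ j)) \<longlonglongrightarrow> 0" by (simp only: ennreal_0)
    then show ?thesis by (intro lim_imp_Liminf) auto
  qed
  finally have "(\<integral>\<^sup>+\<theta>. liminf (\<lambda>j. Q j \<theta>) \<partial>circ) = 0" by simp
  then have "AE \<theta> in circ. liminf (\<lambda>j. Q j \<theta>) = 0"
    by (subst (asm) nn_integral_0_iff_AE) measurable
  then show ?thesis
  proof eventually_elim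
    case (elim \<theta>)
    show ?case
      unfolding has_nt_limit_def
    proof (rule stolz_limit_exists)
      fix \<alpha> e :: real assume \<alpha>: "1 < \<alpha>" and e: "0 < e"
      \<comment> \<open>The threshold is such that \<open>Q j \<theta> < q\<close> forces
        \<open>F\<close> to be within e/2 of its dilation on the whole angle.\<close>
      define q where "q = (e / 2 / stolz_const \<alpha>)\<^sup>2"
      have q: "0 < q" using e stolz_const_pos[of \<alpha>] by (simp add: q_def)
      have "\<not> (\<forall>j. ennreal q \<le> Q j \<theta>)"
      proof
        assume "\<forall>j. ennreal q \<le> Q j \<theta>"
        then have "ennreal q \<le> liminf (\<lambda>j. Q j \<theta>)" by (intro Liminf_bounded always_eventually)
        then show False using elim q by simp
      qed
      then obtain j where "\<not> ennreal q \<le> Q j \<theta>" by blast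
      then have j: "Q j \<theta> < ennreal q" by (simp only: not_le)
      have close: "cmod (F z - F (of_real (R j) * z)) \<le> e / 2" if z: "z \<in> stolz \<alpha> (cis \<theta>)" for z
      proof -
        have "ennreal ((cmod (F z - F (of_real (R j) * z)) / stolz_const \<alpha>)\<^sup>2) < ennreal q"
          using Q(3)[OF \<alpha> z] j by (rule le_less_trans)
        then have "(cmod (F z - F (of_real (R j) * z)) / stolz_const \<alpha>)\<^sup>2 < (e / 2 / stolz_const \<alpha>)\<^sup>2"
          unfolding q_def using ennreal_less_iff[OF zero_le_power2] by blast
        then have "cmod (F z - F (of_real (R j) * z)) / stolz_const \<alpha> < e / 2 / stolz_const \<alpha>"
          by (rule power2_less_imp_less) (intro divide_nonneg_pos stolz_const_pos, use e in simp_all)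
        then show ?thesis using stolz_const_pos[of \<alpha>] unfolding divide_less_cancel by linarith
      qed
      have "continuous_on (cball 0 1) (\<lambda>z. F (of_real (R j) * z))"
        by (rule continuous_on_compose2[OF contF]) (use sub in \<open>auto intro!: continuous_intros\<close>)
      then have "\<exists>\<delta>>0. \<forall>z\<in>cball 0 1. dist z (cis \<theta>) < \<delta> \<longrightarrow>
          dist (F (of_real (R j) * z)) (F (of_real (R j) * cis \<theta>)) < e / 2"
        unfolding continuous_on_iff using e by (elim ballE[of _ _ "cis \<theta>"] allE[of _ "e / 2"]) simp_all
      then obtain \<delta> where \<delta>: "0 < \<delta>" "\<And>z. z \<in> cball 0 1 \<Longrightarrow> dist z (cis \<theta>) < \<delta> \<Longrightarrow>
          dist (F (of_real (R j) * z)) (F (of_real (R j) * cis \<theta>)) < e / 2" by blast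
      show "\<exists>a \<delta>. 0 < \<delta> \<and> (\<forall>z\<in>stolz \<alpha> (cis \<theta>). dist z (cis \<theta>) < \<delta> \<longrightarrow> dist (F z) a \<le> e)"
      proof (intro exI conjI ballI impI)
        fix z assume z: "z \<in> stolz \<alpha> (cis \<theta>)" and d: "dist z (cis \<theta>) < \<delta>"
        have "z \<in> cball 0 1" using z by (simp add: stolz_def)
        from \<delta>(2)[OF this d] close[OF z] show "dist (F z) (F (of_real (R j) * cis \<theta>)) \<le> e"
          using dist_triangle[of "F z" "F (of_real (R j) * cis \<theta>)" "F (of_real (R j) * z)"]
          by (simp add: dist_norm)
      qed (rule \<delta>(1))
    qed
  qed
qed

section \<open>Approximation on the circle by real parts of polynomials\<close>

lemma Re_poly_mult_cnj_poly:
  fixes p q :: "complex poly"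
  shows "\<exists>s. \<forall>w\<in>sphere 0 1. Re (poly p w * cnj (poly q w)) = Re (poly s w)"
proof (induction p arbitrary: q)
  case 0
  show ?case by (intro exI[of _ 0]) simp
next
  case (pCons a p)
  obtain b q' where q: "q = pCons b q'" by (cases q)
  obtain s where s: "\<And>w. w \<in> sphere 0 1 \<Longrightarrow> Re (poly p w * cnj (poly q' w)) = Re (poly s w)"
    using pCons.IH by blast
  have "Re (poly (pCons a p) w * cnj (poly q w)) =
      Re (poly (smult (cnj a) q + smult (cnj b) (pCons 0 p) + s) w)" if w: "w \<in> sphere 0 1" for w
  proof -
    have ww: "w * cnj w = 1" using w by (simp add: complex_norm_square[symmetric])
    \<comment> \<open>With p and q split as a + w p and b + w q', the relation w w* = 1 reduces the
      last term to the shorter pair p, q' of the induction; the other two terms have the real parts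
      of polynomials.\<close>
    have "poly (pCons a p) w * cnj (poly q w) =
        a * cnj (poly q w) + cnj b * (w * poly p w) + (w * cnj w) * (poly p w * cnj (poly q' w))"
      by (simp add: q algebra_simps)
    then have "Re (poly (pCons a p) w * cnj (poly q w)) =
        Re (a * cnj (poly q w)) + Re (cnj b * (w * poly p w)) + Re (poly s w)"
      using s[OF w] by (simp only: ww mult_1 plus_complex.sel)
    moreover have "Re (a * cnj (poly q w)) = Re (cnj a * poly q w)" by simp
    ultimately show ?thesis by (simp only: poly_add poly_smult poly_pCons add_0 plus_complex.sel)
  qed
  then show ?case by blast
qed

lemma real_polynomial_function_circle:
  assumes "real_polynomial_function g"
  shows "\<exists>s :: complex poly. \<forall>w\<in>sphere 0 1. g w = Re (poly s w)"
  using assms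
proof (induction g rule: real_polynomial_function.induct)
  case (linear f)
  interpret bounded_linear f by fact
  have "f w = Re (poly [:0, of_real (f 1) - \<i> * of_real (f \<i>):] w)" for w
  proof -
    have "w = Re w *\<^sub>R 1 + Im w *\<^sub>R \<i>" by (simp add: complex_eq_iff)
    then have "f w = Re w * f 1 + Im w * f \<i>" by (metis add scaleR real_scaleR_def)
    then show ?thesis by simp
  qed
  then show ?case by blast
next
  case (const c)
  show ?case by (intro exI[of _ "[:of_real c:]"]) simp
next
  case (add f g)
  then obtain s t where "\<forall>w\<in>sphere 0 1. f w = Re (poly s w)" "\<forall>w\<in>sphere 0 1. g w = Re (poly t w)" by blast
  then show ?case by (intro exI[of _ "s + t"]) simp
next
  case (mult f g)
  then obtain s t where st: "\<forall>w\<in>sphere 0 1. f w = Re (poly s w)" "\<forall>w\<in>sphere 0 1. g w = Re (poly t w)" by blast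
  obtain u where u: "\<forall>w\<in>sphere 0 1. Re (poly s w * cnj (poly t w)) = Re (poly u w)"
    using Re_poly_mult_cnj_poly[of s t] by blast
  have "f w * g w = Re (poly (smult (1/2) (s * t + u)) w)" if w: "w \<in> sphere 0 1" for w
  proof -
    have "f w * g w = (Re (poly s w * poly t w) + Re (poly s w * cnj (poly t w))) / 2"
      using st w by simp
    also have "\<dots> = (Re (poly s w * poly t w) + Re (poly u w)) / 2" using u w by simp
    finally show ?thesis by simp
  qed
  then show ?case by blast
qed

text \<open>On the unit circle a real polynomial in x and y is the real part of a holomorphic
  polynomial, so Stone-Weierstrass supplies a harmonic extension together with its
  conjugate.\<close>

lemma circle_approx_Re_poly:
  assumes "continuous_on (sphere 0 1) u" "0 < e"
  shows "\<exists>s :: complex poly. \<forall>w\<in>sphere 0 1. \<bar>u w - Re (poly s w)\<bar> < e"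
proof -
  obtain g where g: "real_polynomial_function g" "\<And>w. w \<in> sphere 0 1 \<Longrightarrow> \<bar>u w - g w\<bar> < e"
    using Stone_Weierstrass_real_polynomial_function[OF compact_sphere assms] by blast
  obtain s where "\<forall>w\<in>sphere 0 1. g w = Re (poly s w)"
    using real_polynomial_function_circle[OF g(1)] by blast
  then show ?thesis using g(2) by (intro exI[of _ s]) auto
qed

text \<open>A local branch of F^a, rotated to be positive at \<open>z0\<close>, has modulus |F|^a,
  so its real part is a harmonic minorant that touches at \<open>z0\<close>; at a zero of
  \<open>F\<close> the constant 0 does. This encodes the subharmonicity of |F|^a.\<close>

lemma holomorphic_powr_minorant:
  assumes hol: "F holomorphic_on udisc" and z0: "z0 \<in> udisc" and a: "0 < a"
  shows "\<exists>\<epsilon> g. 0 < \<epsilon> \<and> ball z0 \<epsilon> \<subseteq> udisc \<and> g holomorphic_on ball z0 \<epsilon> \<and>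
    (\<forall>z\<in>ball z0 \<epsilon>. Re (g z) \<le> cmod (F z) powr a) \<and> Re (g z0) = cmod (F z0) powr a"
proof -
  obtain \<epsilon>0 where e0: "0 < \<epsilon>0" "ball z0 \<epsilon>0 \<subseteq> udisc"
    using z0 open_ball openE by blast
  show ?thesis
  proof (cases "F z0 = 0")
    case True
    then show ?thesis using e0 a by (intro exI[of _ \<epsilon>0] exI[of _ "\<lambda>_. 0"]) auto
  next
    case False
    define G where "G = (\<lambda>z. F z / F z0)"
    have holG: "G holomorphic_on udisc" unfolding G_def using False by (intro holomorphic_intros hol) auto
    have "continuous_on udisc G" using holG by (rule holomorphic_on_imp_continuous_on)
    then have "open (udisc \<inter> G -` ball 1 1)" by (intro continuous_open_preimage) auto
    moreover have "z0 \<in> udisc \<inter> G -` ball 1 1" using z0 False by (simp add: G_def)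
    ultimately obtain \<epsilon> where e: "0 < \<epsilon>" "ball z0 \<epsilon> \<subseteq> udisc \<inter> G -` ball 1 1"
      using openE by blast
    have ReG: "0 < Re (G z)" if "z \<in> ball z0 \<epsilon>" for z
    proof -
      have "cmod (1 - G z) < 1" using e(2) that by (auto simp: dist_norm)
      moreover have "\<bar>Re (1 - G z)\<bar> \<le> cmod (1 - G z)" by (rule abs_Re_le_cmod)
      ultimately show ?thesis by simp
    qed
    define g where "g = (\<lambda>z. of_real (cmod (F z0) powr a) * exp (of_real a * Ln (G z)))"
    have "g holomorphic_on ball z0 \<epsilon>"
      unfolding g_def
    proof (intro holomorphic_intros holomorphic_on_Ln')
      show "G holomorphic_on ball z0 \<epsilon>" using holG e(2) by (auto intro: holomorphic_on_subset)
      show "G z \<notin> \<real>\<^sub>\<le>\<^sub>0" if "z \<in> ball z0 \<epsilon>" for z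
        using ReG[OF that] by (auto simp: complex_nonpos_Reals_iff)
    qed
    moreover have ng: "cmod (g z) = cmod (F z) powr a" if z: "z \<in> ball z0 \<epsilon>" for z
    proof -
      have nz: "G z \<noteq> 0" using ReG[OF z] by auto
      have "cmod (exp (of_real a * Ln (G z))) = exp (a * ln (cmod (G z)))"
        using nz by (simp add: norm_exp_eq_Re Re_Ln)
      also have "\<dots> = cmod (G z) powr a" using nz by (simp add: powr_def)
      finally have "cmod (g z) = (cmod (F z0) * cmod (G z)) powr a"
        by (simp add: g_def norm_mult powr_mult)
      then show ?thesis using False by (simp add: G_def norm_divide)
    qed
    moreover have "Re (g z0) = cmod (F z0) powr a" using False by (simp add: g_def G_def)
    moreover have "Re (g z) \<le> cmod (F z) powr a" if "z \<in> ball z0 \<epsilon>" for z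
      using complex_Re_le_cmod[of "g z"] ng[OF that] by simp
    ultimately show ?thesis using e by (intro exI[of _ \<epsilon>] exI[of _ g]) blast
  qed
qed

text \<open>If the difference of the two sides had a positive maximum, take a maximum point of
  largest modulus. There the touching minorant minus \<open>H\<close> has constant exponential by
  the maximum modulus principle, so the difference is maximal on a whole disc, which reaches points
  of larger modulus.\<close>

lemma powr_subharmonic_maximum:
  assumes F: "continuous_on (cball 0 1) F" "F holomorphic_on udisc"
    and H: "continuous_on (cball 0 1) H" "H holomorphic_on udisc" and a: "0 < a"
    and bd: "\<And>z. z \<in> sphere 0 1 \<Longrightarrow> cmod (F z) powr a \<le> Re (H z)"
    and z: "z \<in> cball 0 1"
  shows "cmod (F z) powr a \<le> Re (H z)"
proof (rule ccontr)
  assume neg: "\<not> cmod (F z) powr a \<le> Re (H z)"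
  define w where "w = (\<lambda>z. cmod (F z) powr a - Re (H z))"
  have cw: "continuous_on (cball 0 1) w"
    unfolding w_def by (intro continuous_intros continuous_on_powr' F H) (use a in auto)
  obtain zm where zm: "zm \<in> cball 0 1" "\<And>y. y \<in> cball 0 1 \<Longrightarrow> w y \<le> w zm"
    using continuous_attains_sup[OF compact_cball _ cw] by auto
  define m where "m = w zm"
  have m: "0 < m" using zm(2)[OF z] neg by (simp add: m_def w_def)
  define S where "S = cball 0 1 \<inter> w -` {m}"
  have "closed S" unfolding S_def by (intro continuous_closed_preimage cw) auto
  then have cS: "compact S" unfolding S_def using compact_Int_closed[OF compact_cball, of S 0 1] S_def by (simp add: inf_commute Int_absorb1)
  have "S \<noteq> {}" using zm(1) by (auto simp: S_def m_def)
  then obtain z0 where z0: "z0 \<in> S" "\<And>y. y \<in> S \<Longrightarrow> cmod y \<le> cmod z0"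
    using continuous_attains_sup[OF cS _ continuous_on_norm_id] by auto
  have "z0 \<notin> sphere 0 1" using z0(1) bd[of z0] m by (auto simp: S_def w_def)
  then have z0d: "z0 \<in> udisc" using z0(1) by (auto simp: S_def)
  obtain \<epsilon> g where e: "0 < \<epsilon>" "ball z0 \<epsilon> \<subseteq> udisc" and g: "g holomorphic_on ball z0 \<epsilon>"
    "\<And>z. z \<in> ball z0 \<epsilon> \<Longrightarrow> Re (g z) \<le> cmod (F z) powr a" "Re (g z0) = cmod (F z0) powr a"
    using holomorphic_powr_minorant[OF F(2) z0d a] by blast
  define k where "k = (\<lambda>z. g z - H z)"
  have k: "k holomorphic_on ball z0 \<epsilon>"
    unfolding k_def using H(2) e(2) by (intro holomorphic_on_diff g(1)) (rule holomorphic_on_subset)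
  have wm: "w y \<le> m" if "y \<in> ball z0 \<epsilon>" for y
    using zm(2)[of y] e(2) that by (auto simp: m_def)
  have kw: "Re (k y) \<le> w y" if "y \<in> ball z0 \<epsilon>" for y
    using g(2)[OF that] by (simp add: k_def w_def)
  have k0: "Re (k z0) = m" using g(3) z0(1) by (simp add: k_def S_def w_def)
  have "(\<lambda>z. exp (k z)) constant_on ball z0 \<epsilon>"
  proof (rule maximum_modulus_principle[where U = "ball z0 \<epsilon>" and \<xi> = z0])
    show "(\<lambda>z. exp (k z)) holomorphic_on ball z0 \<epsilon>" by (intro holomorphic_intros k)
    show "norm (exp (k y)) \<le> norm (exp (k z0))" if "y \<in> ball z0 \<epsilon>" for y
      using kw[OF that] wm[OF that] k0 by (simp add: norm_exp_eq_Re)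
  qed (use e in auto)
  then obtain c where c: "\<And>y. y \<in> ball z0 \<epsilon> \<Longrightarrow> exp (k y) = c" by (auto simp: constant_on_def)
  have wS: "y \<in> S" if y: "y \<in> ball z0 \<epsilon>" for y
  proof -
    have "exp (k y) = exp (k z0)" using c[OF y] c[of z0] e by simp
    then have "exp (Re (k y)) = exp (Re (k z0))" by (metis norm_exp_eq_Re)
    then have "Re (k y) = m" using k0 by simp
    then have "w y = m" using kw[OF y] wm[OF y] by linarith
    then show ?thesis using e(2) y by (auto simp: S_def)
  qed
  \<comment> \<open>A unit vector pointing away from 0; at the centre any direction will do.\<close>
  define v where "v = (if z0 = 0 then 1 else sgn z0)"
  have v: "cmod v = 1" "z0 = of_real (cmod z0) * v"
    by (auto simp: v_def norm_sgn) (simp add: sgn_eq)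
  define y where "y = z0 + of_real (\<epsilon> / 2) * v"
  have "y \<in> ball z0 \<epsilon>" using e v(1) by (simp add: y_def dist_norm norm_mult)
  moreover have "cmod y = cmod z0 + \<epsilon> / 2"
  proof -
    have "y = of_real (cmod z0 + \<epsilon> / 2) * v" unfolding y_def by (subst v(2)) (simp add: algebra_simps)
    then have "cmod y = \<bar>cmod z0 + \<epsilon> / 2\<bar> * cmod v" by (simp only: norm_mult norm_of_real)
    then show ?thesis using v e by simp
  qed
  ultimately show False using z0(2)[OF wS] e by fastforce
qed

section \<open>A majorant with bounded square means, and the passage to H^p\<close>

lemma circle_sq_poly_le:
  assumes "0 < r" "r < 1"
  shows "circle_sq (poly p) r \<le> circle_sq (poly p) 1"
proof -
  have eq: "poly p = (\<lambda>z. \<Sum>n<Suc (degree p). coeff p n * z ^ n)"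
    by (rule ext) (simp add: poly_altdef lessThan_Suc_atMost)
  show ?thesis
    unfolding eq circle_sq_polynomial
    using assms by (intro ennreal_leI mult_left_mono sum_mono power_mono) (auto simp: power_le_one)
qed

text \<open>By the mean value property of the squared polynomial, the integrals of Re^2 and Im^2
  differ by 2 pi times the real part of its value at 0. This is nonnegative when
  \<open>poly s 0\<close> is real, so the conjugate function costs only a factor 2.\<close>

lemma circle_sq_le_Re:
  assumes im0: "Im (poly s 0) = 0"
  shows "circle_sq (poly s) 1 \<le> 2 * (\<integral>\<^sup>+\<theta>. (ennreal \<bar>Re (poly s (cis \<theta>))\<bar>)\<^sup>2 \<partial>circ)"
proof -
  let ?H = "\<lambda>\<theta>. poly s (cis \<theta>)"
  have cH: "continuous_on S ?H" for S by (intro continuous_intros)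
  have "((\<lambda>\<theta>. of_real ((1 - (cmod 0)\<^sup>2) / (cmod (cis \<theta> - 0))\<^sup>2) * (?H \<theta>)\<^sup>2) has_integral
    (2 * of_real pi * (poly s 0)\<^sup>2)) {0..2*pi}"
    by (rule Poisson_formula) (auto intro!: continuous_intros holomorphic_intros)
  then have "((\<lambda>\<theta>. (?H \<theta>)\<^sup>2) has_integral (2 * of_real pi * (poly s 0)\<^sup>2)) {0..2*pi}" by simp
  from has_integral_Re[OF this]
  have "((\<lambda>\<theta>. (Re (?H \<theta>))\<^sup>2 - (Im (?H \<theta>))\<^sup>2) has_integral (2 * pi * (Re (poly s 0))\<^sup>2)) {0..2*pi}"
    using im0 by (simp add: power2_eq_square)
  then have i1: "integral {0..2*pi} (\<lambda>\<theta>. (Re (?H \<theta>))\<^sup>2 - (Im (?H \<theta>))\<^sup>2) = 2 * pi * (Re (poly s 0))\<^sup>2"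
    by (rule integral_unique)
  have cR: "continuous_on {0..2*pi} (\<lambda>\<theta>. (Re (?H \<theta>))\<^sup>2)" and cI: "continuous_on {0..2*pi} (\<lambda>\<theta>. (Im (?H \<theta>))\<^sup>2)"
    by (intro continuous_intros cH)+
  have i2: "integral {0..2*pi} (\<lambda>\<theta>. (Re (?H \<theta>))\<^sup>2 - (Im (?H \<theta>))\<^sup>2) =
      integral {0..2*pi} (\<lambda>\<theta>. (Re (?H \<theta>))\<^sup>2) - integral {0..2*pi} (\<lambda>\<theta>. (Im (?H \<theta>))\<^sup>2)"
    by (intro integral_diff integrable_continuous_interval cR cI)
  then have IR: "integral {0..2*pi} (\<lambda>\<theta>. (Im (?H \<theta>))\<^sup>2) \<le> integral {0..2*pi} (\<lambda>\<theta>. (Re (?H \<theta>))\<^sup>2)"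
  proof -
    have "0 \<le> 2 * pi * (Re (poly s 0))\<^sup>2" by simp
    then show ?thesis using i1 i2 by linarith
  qed
  have "circle_sq (poly s) 1 = (\<integral>\<^sup>+\<theta>. ennreal ((Re (?H \<theta>))\<^sup>2 + (Im (?H \<theta>))\<^sup>2) \<partial>circ)"
    by (simp add: circle_sq_def ennreal_power cmod_power2)
  also have "\<dots> = ennreal (integral {0..2*pi} (\<lambda>\<theta>. (Re (?H \<theta>))\<^sup>2 + (Im (?H \<theta>))\<^sup>2))"
    by (intro nn_integral_circ_continuous continuous_on_add cR cI) simp
  also have "integral {0..2*pi} (\<lambda>\<theta>. (Re (?H \<theta>))\<^sup>2 + (Im (?H \<theta>))\<^sup>2) =
      integral {0..2*pi} (\<lambda>\<theta>. (Re (?H \<theta>))\<^sup>2) + integral {0..2*pi} (\<lambda>\<theta>. (Im (?H \<theta>))\<^sup>2)"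
    by (intro Henstock_Kurzweil_Integration.integral_add integrable_continuous_interval cR cI)
  also have "ennreal \<dots> \<le> ennreal (2 * integral {0..2*pi} (\<lambda>\<theta>. (Re (?H \<theta>))\<^sup>2))"
    using IR by (intro ennreal_leI) simp
  also have "\<dots> = 2 * ennreal (integral {0..2*pi} (\<lambda>\<theta>. (Re (?H \<theta>))\<^sup>2))"
    by (subst ennreal_mult') auto
  also have "ennreal (integral {0..2*pi} (\<lambda>\<theta>. (Re (?H \<theta>))\<^sup>2)) = (\<integral>\<^sup>+\<theta>. ennreal ((Re (?H \<theta>))\<^sup>2) \<partial>circ)"
    by (intro nn_integral_circ_continuous[symmetric] cR) simp
  finally show ?thesis by (simp add: ennreal_power)
qed

lemma emeasure_circ: "emeasure circ {0..2*pi} = ennreal (2 * pi)"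
  by (simp add: emeasure_restrict_space)

text \<open>A rough locally uniform bound, made for Montel's theorem; x <= 1 + x^2 passes from the
  Poisson integral to the square mean.\<close>

lemma H2_pointwise:
  assumes cont: "continuous_on (cball 0 1) F" and hol: "F holomorphic_on udisc" and z: "z \<in> udisc"
    and K: "circle_sq F 1 \<le> ennreal K" "0 \<le> K"
  shows "cmod (F z) \<le> 2 / (1 - cmod z) * (2 * pi + K)"
proof -
  have z1: "cmod z < 1" using z by simp
  have cF: "continuous_on {0..2*pi} (\<lambda>\<theta>. F (cis \<theta>))"
    by (rule continuous_on_compose2[OF cont]) (auto intro!: continuous_intros)
  have [measurable]: "(\<lambda>\<theta>. F (cis \<theta>)) \<in> borel_measurable circ"
    by (intro continuous_imp_measurable_on_sets_lebesgue cF) simp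
  let ?P = "2 / (1 - cmod z)"
  have P: "0 \<le> ?P" using z1 by simp
  have Ple: "poisson z \<theta> \<le> ?P" for \<theta>
  proof -
    have e: "1 - cmod z \<le> cmod (cis \<theta> - z)" using norm_triangle_ineq2[of "cis \<theta>" z] by simp
    have "poisson z \<theta> \<le> (1 - (cmod z)\<^sup>2) / (1 - cmod z)\<^sup>2"
      unfolding poisson_def using z1 e
      by (intro divide_left_mono power_mono mult_pos_pos zero_less_power) (auto simp: power_le_one)
    also have "\<dots> = (1 + cmod z) / (1 - cmod z)" using z1 by (simp add: power2_eq_square divide_simps) (simp add: algebra_simps)
    also have "\<dots> \<le> ?P" using z1 by (intro divide_right_mono) auto
    finally show ?thesis .
  qed
  have "ennreal (cmod (F z)) \<le> ennreal (2 * pi * cmod (F z))"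
    using pi_ge_two by (intro ennreal_leI) (simp add: mult_le_cancel_right1)
  also have "\<dots> \<le> (\<integral>\<^sup>+\<theta>. ennreal (poisson z \<theta> * cmod (F (cis \<theta>))) \<partial>circ)"
    by (rule Poisson_inequality[OF cont hol z1])
  also have "\<dots> \<le> (\<integral>\<^sup>+\<theta>. ennreal ?P * (1 + (ennreal (cmod (F (cis \<theta>))))\<^sup>2) \<partial>circ)"
  proof (intro nn_integral_mono)
    fix \<theta>
    let ?x = "cmod (F (cis \<theta>))"
    have "2 * ?x \<le> 1 + ?x\<^sup>2" using sum_squares_bound[of 1 ?x] by simp
    then have "?x \<le> 1 + ?x\<^sup>2" using norm_ge_zero[of "F (cis \<theta>)"] by linarith
    then have "poisson z \<theta> * ?x \<le> ?P * (1 + ?x\<^sup>2)" by (intro mult_mono Ple P) auto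
    then have "ennreal (poisson z \<theta> * ?x) \<le> ennreal (?P * (1 + ?x\<^sup>2))" by (rule ennreal_leI)
    also have "\<dots> = ennreal ?P * (1 + (ennreal ?x)\<^sup>2)"
      using P by (simp only: ennreal_mult'[OF P] ennreal_plus[OF zero_le_one zero_le_power2] ennreal_1 ennreal_power[OF norm_ge_zero])
    finally show "ennreal (poisson z \<theta> * ?x) \<le> ennreal ?P * (1 + (ennreal ?x)\<^sup>2)" .
  qed
  also have "\<dots> = ennreal ?P * ((\<integral>\<^sup>+\<theta>. 1 \<partial>circ) + (\<integral>\<^sup>+\<theta>. (ennreal (cmod (F (cis \<theta>))))\<^sup>2 \<partial>circ))"
    by (subst nn_integral_cmult, measurable, subst nn_integral_add) measurable
  also have "\<dots> \<le> ennreal ?P * (ennreal (2 * pi) + ennreal K)"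
    using K(1) by (intro mult_left_mono add_mono) (simp_all add: emeasure_circ circle_sq_def)
  also have "\<dots> = ennreal (?P * (2 * pi + K))"
    using K(2) P by (simp only: ennreal_mult'[OF P]) (simp add: ennreal_plus)
  finally show ?thesis using P K(2) by (subst (asm) ennreal_le_iff) auto
qed

text \<open>Approximating 2 + |F|^(p/2) within 1 puts Re s between 1 + |F|^(p/2) and 3 + |F|^(p/2)
  on the circle. The lower bound spreads inside by the maximum principle, the upper one controls the
  square mean. The summand 1 later keeps the majorant off the branch cut of the logarithm.\<close>

lemma Hp_majorant_polynomial:
  assumes cont: "continuous_on (cball 0 1) F" and hol: "F holomorphic_on udisc" and p: "0 < p"
    and K: "(\<integral>\<^sup>+\<theta>. ennreal (cmod (F (cis \<theta>)) powr p) \<partial>circ) \<le> ennreal K" "0 \<le> K"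
  shows "\<exists>s. circle_sq (poly s) 1 \<le> ennreal (4 * (18 * pi + K)) \<and>
    (\<forall>z\<in>cball 0 1. 1 + cmod (F z) powr (p / 2) \<le> Re (poly s z))"
proof -
  let ?v = "\<lambda>z. cmod (F z) powr (p / 2)"
  have cv: "continuous_on (cball 0 1) ?v"
    by (intro continuous_on_powr' continuous_intros cont) (use p in auto)
  have "continuous_on (sphere 0 1) (\<lambda>z. 2 + ?v z)"
    by (intro continuous_intros continuous_on_subset[OF cv]) auto
  then obtain s0 where s0: "\<And>w. w \<in> sphere 0 1 \<Longrightarrow> \<bar>2 + ?v w - Re (poly s0 w)\<bar> < 1"
    using circle_approx_Re_poly[of "\<lambda>z. 2 + ?v z" 1] zero_less_one by blast
  \<comment> \<open>Removing an imaginary constant leaves the real part alone and makes the value at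
    0 real, as \<open>circle_sq_le_Re\<close> requires.\<close>
  define s where "s = s0 - [:\<i> * of_real (Im (poly s0 0)):]"
  have Res: "Re (poly s w) = Re (poly s0 w)" for w by (simp add: s_def)
  have Ims: "Im (poly s 0) = 0" by (simp add: s_def)
  have lo: "1 + ?v w \<le> Re (poly s w)" and hi: "Re (poly s w) \<le> 3 + ?v w" if "w \<in> sphere 0 1" for w
    using s0[OF that] unfolding Res by linarith+
  have "1 + ?v z \<le> Re (poly s z)" if z: "z \<in> cball 0 1" for z
  proof -
    have "?v z \<le> Re (poly s z - 1)"
    proof (rule powr_subharmonic_maximum[OF cont hol _ _ _ _ z])
      show "?v w \<le> Re (poly s w - 1)" if "w \<in> sphere 0 1" for w using lo[OF that] by simp
    qed (use p in \<open>auto intro!: continuous_intros holomorphic_intros\<close>)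
    then show ?thesis by simp
  qed
  moreover have "circle_sq (poly s) 1 \<le> ennreal (4 * (18 * pi + K))"
  proof -
    have vm: "(\<lambda>\<theta>. cmod (F (cis \<theta>)) powr p) \<in> borel_measurable circ"
      by (intro continuous_imp_measurable_on_sets_lebesgue continuous_on_powr' continuous_intros
          continuous_on_compose2[OF cont]) (use p in auto)
    have "circle_sq (poly s) 1 \<le> 2 * (\<integral>\<^sup>+\<theta>. (ennreal \<bar>Re (poly s (cis \<theta>))\<bar>)\<^sup>2 \<partial>circ)"
      by (rule circle_sq_le_Re[OF Ims])
    \<comment> \<open>With v = |F|^(p/2), (3 + v)^2 is at most 2 (9 + v^2). Together with the factor
      in front this yields 4 (9 * 2 pi + K).\<close>
    also have "\<dots> \<le> 2 * (\<integral>\<^sup>+\<theta>. 2 * (9 + ennreal (cmod (F (cis \<theta>)) powr p)) \<partial>circ)"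
    proof (intro mult_left_mono nn_integral_mono)
      fix \<theta>
      have v0: "0 \<le> ?v (cis \<theta>)" by simp
      have cs: "cis \<theta> \<in> sphere 0 1" by simp
      have "0 \<le> Re (poly s (cis \<theta>))" "Re (poly s (cis \<theta>)) \<le> 3 + ?v (cis \<theta>)"
        using lo[OF cs] hi[OF cs] v0 by linarith+
      then have "(Re (poly s (cis \<theta>)))\<^sup>2 \<le> (3 + ?v (cis \<theta>))\<^sup>2" by (intro power_mono)
      also have "\<dots> \<le> 2 * (9 + (?v (cis \<theta>))\<^sup>2)"
        using sum_squares_bound[of 3 "?v (cis \<theta>)"] by (simp add: power2_eq_square algebra_simps)
      also have "(?v (cis \<theta>))\<^sup>2 = cmod (F (cis \<theta>)) powr p"
        by (simp add: power2_eq_square powr_add[symmetric])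
      finally have "ennreal ((Re (poly s (cis \<theta>)))\<^sup>2) \<le> ennreal (2 * (9 + cmod (F (cis \<theta>)) powr p))"
        by (rule ennreal_leI)
      also have "\<dots> = 2 * (9 + ennreal (cmod (F (cis \<theta>)) powr p))"
        by (simp add: ennreal_mult' ennreal_plus)
      finally show "(ennreal \<bar>Re (poly s (cis \<theta>))\<bar>)\<^sup>2 \<le> 2 * (9 + ennreal (cmod (F (cis \<theta>)) powr p))"
        by (simp add: ennreal_power)
    qed simp
    also have "\<dots> = 4 * (9 * ennreal (2 * pi) + (\<integral>\<^sup>+\<theta>. ennreal (cmod (F (cis \<theta>)) powr p) \<partial>circ))"
      using vm by (simp add: nn_integral_cmult nn_integral_add emeasure_circ mult.assoc[symmetric])
    also have "\<dots> \<le> 4 * (9 * ennreal (2 * pi) + ennreal K)"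
      by (intro mult_left_mono add_left_mono K) auto
    also have "\<dots> = ennreal (4 * (18 * pi + K))"
    proof -
      have "9 * ennreal (2 * pi) = ennreal (18 * pi)" by (simp add: ennreal_mult'[symmetric] ennreal_numeral[symmetric] del: ennreal_numeral)
      then show ?thesis using K(2)
        by (simp add: ennreal_mult'[symmetric] ennreal_plus[symmetric] ennreal_numeral[symmetric] del: ennreal_numeral ennreal_plus)
    qed
    finally show ?thesis .
  qed
  ultimately show ?thesis by blast
qed

text \<open>The polynomial majorants of the dilations have uniformly bounded square means and so
  form a normal family. A Montel limit inherits the square mean bound by Fatou's lemma and the lower
  bound pointwise.\<close>

theorem Hp_majorant:
  assumes hol: "F holomorphic_on udisc" and p: "0 < p" and K: "0 \<le> K"
    and bd: "\<And>r. 0 < r \<Longrightarrow> r < 1 \<Longrightarrow> (\<integral>\<^sup>+\<theta>. ennreal (cmod (F (of_real r * cis \<theta>)) powr p) \<partial>circ) \<le> ennreal K"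
  shows "\<exists>H. H holomorphic_on udisc \<and>
    (\<forall>r. 0 < r \<longrightarrow> r < 1 \<longrightarrow> circle_sq H r \<le> ennreal (4 * (18 * pi + K))) \<and>
    (\<forall>z\<in>udisc. 1 + cmod (F z) powr (p / 2) \<le> Re (H z))"
proof -
  let ?K = "4 * (18 * pi + K)"
  have K0: "0 \<le> ?K" using K by simp
  define R where "R = (\<lambda>j::nat. 1 - 1 / (real j + 2))"
  have R: "0 < R j" "R j < 1" for j by (auto simp: R_def field_simps)
  have Rlim: "R \<longlonglongrightarrow> 1" unfolding R_def by real_asymp
  have contF: "continuous_on udisc F" using hol by (rule holomorphic_on_imp_continuous_on)
  have sub: "of_real (R j) * w \<in> udisc" if "cmod w \<le> 1" for j w
  proof -
    have "R j * cmod w \<le> R j * 1" using that R(1)[of j] by (intro mult_left_mono) auto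
    then have "cmod (of_real (R j) * w) < 1" using R[of j] unfolding norm_mult norm_of_real by linarith
    then show ?thesis by simp
  qed
  have "\<exists>s. circle_sq (poly s) 1 \<le> ennreal ?K \<and>
    (\<forall>z\<in>cball 0 1. 1 + cmod (F (of_real (R j) * z)) powr (p / 2) \<le> Re (poly s z))" for j
  proof (rule Hp_majorant_polynomial[OF _ _ p bd[OF R] K])
    show "continuous_on (cball 0 1) (\<lambda>z. F (of_real (R j) * z))"
      by (rule continuous_on_compose2[OF contF]) (use sub in \<open>auto intro!: continuous_intros\<close>)
    show "(\<lambda>z. F (of_real (R j) * z)) holomorphic_on udisc"
      by (rule holomorphic_on_compose_gen[OF _ hol, unfolded o_def, of "\<lambda>w. of_real (R j) * w"])
        (use sub in \<open>auto intro!: holomorphic_intros\<close>)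
  qed
  then obtain s where s1: "\<And>j. circle_sq (poly (s j)) 1 \<le> ennreal ?K"
    and s2: "\<And>j z. z \<in> cball 0 1 \<Longrightarrow> 1 + cmod (F (of_real (R j) * z)) powr (p / 2) \<le> Re (poly (s j) z)"
    by metis
  define \<H> where "\<H> = {h. h holomorphic_on udisc \<and> (\<forall>z\<in>udisc. cmod (h z) \<le> 2 / (1 - cmod z) * (2 * pi + ?K))}"
  have s\<H>: "poly (s j) \<in> \<H>" for j
  proof -
    have c: "continuous_on (cball 0 1) (poly (s j))" and h: "poly (s j) holomorphic_on udisc"
      by (intro continuous_intros holomorphic_intros)+
    show ?thesis unfolding \<H>_def using H2_pointwise[OF c h _ s1 K0] h by blast
  qed
  obtain H k where H: "H holomorphic_on udisc" "strict_mono (k :: nat \<Rightarrow> nat)"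
    "\<And>z. z \<in> udisc \<Longrightarrow> (\<lambda>n. poly (s (k n)) z) \<longlonglongrightarrow> H z"
  proof (rule Montel[of udisc \<H> "\<lambda>j. poly (s j)"])
    show "h holomorphic_on udisc" if "h \<in> \<H>" for h using that by (simp add: \<H>_def)
    show "\<exists>B. \<forall>h\<in>\<H>. \<forall>z\<in>L. norm (h z) \<le> B" if L: "compact L" "L \<subseteq> udisc" for L
    proof (cases "L = {}")
      case False
      obtain z0 where z0: "z0 \<in> L" "\<And>y. y \<in> L \<Longrightarrow> cmod y \<le> cmod z0"
        using continuous_attains_sup[OF L(1) False continuous_on_norm_id] by auto
      have z01: "cmod z0 < 1" using z0(1) L(2) by auto
      have "norm (h z) \<le> 2 / (1 - cmod z0) * (2 * pi + ?K)" if h: "h \<in> \<H>" and z: "z \<in> L" for h z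
      proof -
        have "norm (h z) \<le> 2 / (1 - cmod z) * (2 * pi + ?K)" using h z L(2) by (auto simp: \<H>_def)
        also have "\<dots> \<le> 2 / (1 - cmod z0) * (2 * pi + ?K)"
        proof (rule mult_right_mono)
          show "2 / (1 - cmod z) \<le> 2 / (1 - cmod z0)"
            using z0(2)[OF z] z01 by (intro divide_left_mono mult_pos_pos) auto
          show "0 \<le> 2 * pi + ?K" using K0 pi_ge_zero by linarith
        qed
        finally show ?thesis .
      qed
      then show ?thesis by blast
    qed simp
    show "range (\<lambda>j. poly (s j)) \<subseteq> \<H>" using s\<H> by auto
  qed (use that in auto)
  have "circle_sq H r \<le> ennreal ?K" if r: "0 < r" "r < 1" for r
  proof -
    have rd: "of_real r * cis \<theta> \<in> udisc" for \<theta> using r by (intro circle_in_disc) auto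
    have "circle_sq H r = (\<integral>\<^sup>+\<theta>. liminf (\<lambda>n. (ennreal (cmod (poly (s (k n)) (of_real r * cis \<theta>))))\<^sup>2) \<partial>circ)"
      unfolding circle_sq_def
    proof (intro nn_integral_cong lim_imp_Liminf[symmetric])
      show "(\<lambda>n. (ennreal (cmod (poly (s (k n)) (of_real r * cis \<theta>))))\<^sup>2) \<longlonglongrightarrow> (ennreal (cmod (H (of_real r * cis \<theta>))))\<^sup>2" for \<theta>
        unfolding ennreal_power[OF norm_ge_zero] by (intro tendsto_ennrealI tendsto_intros H(3) rd)
    qed simp
    also have "\<dots> \<le> liminf (\<lambda>n. \<integral>\<^sup>+\<theta>. (ennreal (cmod (poly (s (k n)) (of_real r * cis \<theta>))))\<^sup>2 \<partial>circ)"
    proof (rule nn_integral_liminf)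
      have [measurable]: "(\<lambda>\<theta>. poly (s (k n)) (of_real r * cis \<theta>)) \<in> borel_measurable circ" for n
        by (intro continuous_imp_measurable_on_sets_lebesgue continuous_intros) simp
      show "(\<lambda>\<theta>. (ennreal (cmod (poly (s (k n)) (of_real r * cis \<theta>))))\<^sup>2) \<in> borel_measurable circ" for n
        by measurable
    qed
    also have "\<dots> \<le> liminf (\<lambda>n::nat. ennreal ?K)"
      using order_trans[OF circle_sq_poly_le[OF r] s1]
      by (intro Liminf_mono always_eventually allI) (simp only: circle_sq_def)
    finally show ?thesis by (simp add: Liminf_const)
  qed
  moreover have "1 + cmod (F z) powr (p / 2) \<le> Re (H z)" if z: "z \<in> udisc" for z
  proof (rule LIMSEQ_le)
    have "(\<lambda>n. of_real (R (k n)) * z) \<longlonglongrightarrow> of_real 1 * z"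
      by (intro tendsto_intros LIMSEQ_subseq_LIMSEQ[OF Rlim H(2), unfolded o_def])
    then have "(\<lambda>n. F (of_real (R (k n)) * z)) \<longlonglongrightarrow> F z"
      using z sub[of z] by (intro continuous_on_tendsto_compose[OF contF]) auto
    then show "(\<lambda>n. 1 + cmod (F (of_real (R (k n)) * z)) powr (p / 2)) \<longlonglongrightarrow> 1 + cmod (F z) powr (p / 2)"
      by (intro tendsto_intros tendsto_powr') (use p in auto)
    show "(\<lambda>n. Re (poly (s (k n)) z)) \<longlonglongrightarrow> Re (H z)"
      by (intro tendsto_intros H(3) z)
    show "\<exists>N. \<forall>n\<ge>N. 1 + cmod (F (of_real (R (k n)) * z)) powr (p / 2) \<le> Re (poly (s (k n)) z)"
      using s2 z by auto
  qed
  ultimately show ?thesis using H(1) by blast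
qed

text \<open>\<open>F\<close> is written as G H^(2/p) with \<open>H\<close> the majorant and |G| <=
  1. Both \<open>G\<close> and \<open>H\<close> have bounded square means, hence nontangential
  limits almost everywhere, and the majorant of |H|^2 is one of |F|^p.\<close>

theorem Hp_boundary:
  assumes hol: "F holomorphic_on udisc" and p: "0 < p" and K: "0 \<le> K"
    and bd: "\<And>r. 0 < r \<Longrightarrow> r < 1 \<Longrightarrow> (\<integral>\<^sup>+\<theta>. ennreal (cmod (F (of_real r * cis \<theta>)) powr p) \<partial>circ) \<le> ennreal K"
  shows "AE \<theta> in circ. \<exists>c. has_nt_limit F \<theta> c"
    and "\<exists>Q\<in>borel_measurable circ. (\<integral>\<^sup>+\<theta>. Q \<theta> \<partial>circ) < top \<and>
      (\<forall>\<theta> \<alpha> z. 1 < \<alpha> \<longrightarrow> z \<in> stolz \<alpha> (cis \<theta>) \<longrightarrow> ennreal (cmod (F z) powr p / (stolz_const \<alpha>)\<^sup>2) \<le> Q \<theta>)"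
proof -
  obtain H where H: "H holomorphic_on udisc"
    "\<And>r. 0 < r \<Longrightarrow> r < 1 \<Longrightarrow> circle_sq H r \<le> ennreal (4 * (18 * pi + K))"
    "\<And>z. z \<in> udisc \<Longrightarrow> 1 + cmod (F z) powr (p / 2) \<le> Re (H z)"
    using Hp_majorant[OF assms] by blast
  have FH: "cmod (F z) powr (p / 2) \<le> cmod (H z)" and ReH: "1 \<le> Re (H z)" if "z \<in> udisc" for z
    using H(3)[OF that] complex_Re_le_cmod[of "H z"] powr_ge_zero[of "cmod (F z)" "p / 2"] by linarith+
  obtain Q where Q: "Q \<in> borel_measurable circ" "(\<integral>\<^sup>+\<theta>. Q \<theta> \<partial>circ) \<le> ennreal ((8 * (2 * pi))\<^sup>2) * ennreal (4 * (18 * pi + K))"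
    "\<And>\<theta> \<alpha> z. 1 < \<alpha> \<Longrightarrow> z \<in> stolz \<alpha> (cis \<theta>) \<Longrightarrow> ennreal ((cmod (H z) / stolz_const \<alpha>)\<^sup>2) \<le> Q \<theta>"
    using H2_maximal[OF H(1) H(2)[unfolded circle_sq_def]] by blast
  show "\<exists>Q\<in>borel_measurable circ. (\<integral>\<^sup>+\<theta>. Q \<theta> \<partial>circ) < top \<and>
      (\<forall>\<theta> \<alpha> z. 1 < \<alpha> \<longrightarrow> z \<in> stolz \<alpha> (cis \<theta>) \<longrightarrow> ennreal (cmod (F z) powr p / (stolz_const \<alpha>)\<^sup>2) \<le> Q \<theta>)"
  proof (intro bexI[of _ Q] conjI allI impI Q(1))
    show "(\<integral>\<^sup>+\<theta>. Q \<theta> \<partial>circ) < top"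
      using Q(2) by (rule le_less_trans) (simp add: ennreal_mult_less_top)
    fix \<theta> \<alpha> z assume \<alpha>: "1 < \<alpha>" and z: "z \<in> stolz \<alpha> (cis \<theta>)"
    have zd: "z \<in> udisc" using z by (simp add: stolz_def)
    have "cmod (F z) powr p = (cmod (F z) powr (p / 2))\<^sup>2"
      by (simp add: power2_eq_square powr_add[symmetric])
    also have "\<dots> \<le> (cmod (H z))\<^sup>2" by (intro power_mono FH zd) simp
    finally have "cmod (F z) powr p / (stolz_const \<alpha>)\<^sup>2 \<le> (cmod (H z) / stolz_const \<alpha>)\<^sup>2"
      unfolding power_divide by (intro divide_right_mono) auto
    then show "ennreal (cmod (F z) powr p / (stolz_const \<alpha>)\<^sup>2) \<le> Q \<theta>"
      using Q(3)[OF \<alpha> z] by (meson ennreal_leI order_trans)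
  qed
  define G where "G = (\<lambda>z. F z * exp (- (of_real (2 / p) * Ln (H z))))"
  have npos: "H z \<notin> \<real>\<^sub>\<le>\<^sub>0" if "z \<in> udisc" for z
    using ReH[OF that] by (auto simp: complex_nonpos_Reals_iff)
  have holG: "G holomorphic_on udisc"
    unfolding G_def by (intro holomorphic_intros hol holomorphic_on_Ln' H(1) npos)
  have G1: "cmod (G z) \<le> 1" if z: "z \<in> udisc" for z
  proof -
    have H0: "H z \<noteq> 0" using ReH[OF z] by auto
    have Hpos: "0 < cmod (H z)" using H0 by simp
    have "cmod (F z) = (cmod (F z) powr (p / 2)) powr (2 / p)"
      using p by (simp add: powr_powr)
    also have "\<dots> \<le> cmod (H z) powr (2 / p)"
      using p by (intro powr_mono2 FH z) auto
    finally have le: "cmod (F z) \<le> cmod (H z) powr (2 / p)" .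
    have "cmod (exp (- (of_real (2 / p) * Ln (H z)))) = exp (- (2 / p * ln (cmod (H z))))"
      using H0 by (simp add: norm_exp_eq_Re Re_Ln del: of_real_divide)
    also have "\<dots> = 1 / cmod (H z) powr (2 / p)"
      using H0 by (simp add: powr_def exp_minus field_simps)
    finally have "cmod (G z) = cmod (F z) / cmod (H z) powr (2 / p)" by (simp add: G_def norm_mult)
    also have "\<dots> \<le> 1" using le Hpos by (simp add: divide_le_eq_1)
    finally show ?thesis .
  qed
  have "circle_sq G r \<le> ennreal (2 * pi)" if r: "0 < r" "r < 1" for r
  proof -
    have "circle_sq G r \<le> (\<integral>\<^sup>+\<theta>. 1 \<partial>circ)"
      unfolding circle_sq_def
    proof (intro nn_integral_mono)
      fix \<theta>
      have "cmod (G (of_real r * cis \<theta>)) \<le> 1" using r by (intro G1 circle_in_disc) auto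
      then have "(cmod (G (of_real r * cis \<theta>)))\<^sup>2 \<le> 1" by (simp add: power_le_one)
      then show "(ennreal (cmod (G (of_real r * cis \<theta>))))\<^sup>2 \<le> 1"
        unfolding ennreal_power[OF norm_ge_zero] by (metis ennreal_1 ennreal_leI)
    qed
    then show ?thesis by (simp add: emeasure_circ)
  qed
  then have aeG: "AE \<theta> in circ. \<exists>c. has_nt_limit G \<theta> c" by (rule H2_nt_limit[OF holG])
  have aeH: "AE \<theta> in circ. \<exists>c. has_nt_limit H \<theta> c" by (rule H2_nt_limit[OF H(1,2)])
  show "AE \<theta> in circ. \<exists>c. has_nt_limit F \<theta> c"
    using aeG aeH
  proof eventually_elim
    case (elim \<theta>)
    then obtain g c where g: "has_nt_limit G \<theta> g" and c: "has_nt_limit H \<theta> c" by blast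
    have "(F \<longlongrightarrow> g * exp (of_real (2 / p) * Ln c)) (at (cis \<theta>) within stolz \<alpha> (cis \<theta>))" if \<alpha>: "1 < \<alpha>" for \<alpha>
    proof (cases "at (cis \<theta>) within stolz \<alpha> (cis \<theta>) = bot")
      case False
      let ?A = "at (cis \<theta>) within stolz \<alpha> (cis \<theta>)"
      have in_st: "\<forall>\<^sub>F z in ?A. z \<in> udisc"
        unfolding eventually_at_filter by (intro always_eventually) (simp add: stolz_def)
      have Hc: "(H \<longlongrightarrow> c) ?A" and Gg: "(G \<longlongrightarrow> g) ?A" using g c \<alpha> by (auto simp: has_nt_limit_def)
      \<comment> \<open>The bound Re H >= 1 survives in the limit and keeps \<open>c\<close> off the
        branch cut, so the logarithm is continuous there.\<close>
      have "1 \<le> Re c"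
        by (rule tendsto_lowerbound[OF tendsto_Re[OF Hc] eventually_mono[OF in_st ReH] False])
      then have "c \<notin> \<real>\<^sub>\<le>\<^sub>0" by (auto simp: complex_nonpos_Reals_iff)
      then have "((\<lambda>z. G z * exp (of_real (2 / p) * Ln (H z))) \<longlongrightarrow> g * exp (of_real (2 / p) * Ln c)) ?A"
        by (intro tendsto_intros Gg Hc tendsto_Ln)
      moreover have "\<forall>\<^sub>F z in ?A. G z * exp (of_real (2 / p) * Ln (H z)) = F z"
        by (intro always_eventually allI) (simp add: G_def mult.assoc exp_add[symmetric])
      ultimately show ?thesis by (rule Lim_transform_eventually)
    qed simp
    then show ?case unfolding has_nt_limit_def by blast
  qed
qed

section \<open>The potential with kernel $1/|z|$\<close>

text \<open>Dyadic layers B/2^(k+1) < d <= B/2^k: on each the integrand is at most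
  \<open>c k\<close>, and the layer has measure at most C times the m-th power of
  \<open>t k\<close>. The result is a geometric series of ratio 2^(\<open>\<beta>\<close> - m) <
  1.\<close>

lemma nn_integral_powr_neg_le:
  fixes d :: "'a \<Rightarrow> real"
  assumes [measurable]: "d \<in> borel_measurable M" and d0: "\<And>x. 0 \<le> d x"
    and meas: "\<And>t. 0 < t \<Longrightarrow> emeasure M {x \<in> space M. d x < t} \<le> ennreal (C * t powr m)"
    and \<beta>: "0 \<le> \<beta>" "\<beta> < m" and B: "0 < B" and C: "0 \<le> C"
  shows "(\<integral>\<^sup>+x. indicator {x. d x \<le> B} x * ennreal (d x powr (- \<beta>)) \<partial>M) \<le>
    ennreal (C * (2 powr (\<beta> + m) / (1 - 2 powr (\<beta> - m))) * B powr (m - \<beta>))"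
proof -
  define c where "c = (\<lambda>k::nat. (B / 2 ^ Suc k) powr (- \<beta>))"
  \<comment> \<open>Twice the outer radius of the layer, because the measure hypothesis is about the
    strict inequality d < t.\<close>
  define t where "t = (\<lambda>k::nat. 2 * B / 2 ^ k)"
  have t: "0 < t k" for k using B by (simp add: t_def)
  have pw: "indicator {x. d x \<le> B} x * ennreal (d x powr (- \<beta>)) \<le>
      (\<Sum>k. ennreal (c k) * indicator {x \<in> space M. d x < t k} x)" if x: "x \<in> space M" for x
  proof (cases "0 < d x \<and> d x \<le> B")
    case True
    define k where "k = (LEAST k. B / 2 ^ Suc k < d x)"
    have "\<exists>k. B / 2 ^ Suc k < d x"
    proof -
      obtain n where "(1/2) ^ n < d x / B" using real_arch_pow_inv[of "d x / B" "1/2"] True B by auto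
      then have "B / 2 ^ n < d x" using B by (simp add: power_one_over field_simps)
      moreover have "B / 2 ^ Suc n \<le> B / 2 ^ n" using B by (intro divide_left_mono) auto
      ultimately show ?thesis by (intro exI[of _ n]) linarith
    qed
    then have k1: "B / 2 ^ Suc k < d x" unfolding k_def by (rule LeastI_ex)
    have k2: "d x \<le> B / 2 ^ k"
    proof (cases k)
      case (Suc j)
      then have "\<not> B / 2 ^ Suc j < d x" using not_less_Least[of j "\<lambda>k. B / 2 ^ Suc k < d x"] unfolding k_def[symmetric] by simp
      then show ?thesis using Suc by simp
    qed (use True in simp)
    have "d x < t k" using k2 B by (simp add: t_def field_simps)
    have "d x powr (- \<beta>) \<le> c k"
      unfolding c_def using k1 B \<beta> by (intro powr_mono2') auto
    then have "indicator {x. d x \<le> B} x * ennreal (d x powr (- \<beta>)) \<le> ennreal (c k) * indicator {x \<in> space M. d x < t k} x"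
      using True \<open>d x < t k\<close> x by (simp add: ennreal_leI)
    also have "\<dots> \<le> (\<Sum>k. ennreal (c k) * indicator {x \<in> space M. d x < t k} x)"
      by (rule sum_le_suminf[of _ "{k}", simplified]) auto
    finally show ?thesis .
  next
    case False
    \<comment> \<open>Where d vanishes the integrand is 0, since \<open>0 powr y\<close> is 0 by
      convention.\<close>
    then have "d x = 0 \<or> \<not> d x \<le> B" using d0[of x] by linarith
    then show ?thesis by auto
  qed
  define q where "q = 2 powr (\<beta> - m)"
  have q: "0 < q" "q < 1" using \<beta> by (auto simp: q_def powr_less_one)
  have trm: "c k * (C * t k powr m) = C * 2 powr (\<beta> + m) * B powr (m - \<beta>) * q ^ k" for k
  proof -
    have e1: "c k = B powr (- \<beta>) * 2 powr (\<beta> * (1 + real k))"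
    proof -
      have "(2::real) powr (1 + real k) = 2 ^ Suc k" by (simp add: powr_add powr_realpow)
      then have "B / 2 ^ Suc k = B * 2 powr (- (1 + real k))" unfolding powr_minus by (simp only: divide_inverse)
      then have "c k = B powr (- \<beta>) * 2 powr (- (1 + real k) * - \<beta>)"
        unfolding c_def using B by (simp only: powr_mult powr_powr)
      also have "- (1 + real k) * - \<beta> = \<beta> * (1 + real k)" by (simp add: algebra_simps)
      finally show ?thesis .
    qed
    have e2: "t k powr m = B powr m * 2 powr (m * (1 - real k))"
    proof -
      have "(2::real) powr (1 - real k) = 2 / 2 ^ k" by (simp add: powr_diff powr_realpow)
      then have "t k = B * 2 powr (1 - real k)" by (simp add: t_def)
      then have "t k powr m = B powr m * 2 powr ((1 - real k) * m)" using B by (simp only: powr_mult powr_powr)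
      then show ?thesis by (simp only: mult.commute)
    qed
    have "c k * (C * t k powr m) = C * (B powr (- \<beta>) * B powr m) * (2 powr (\<beta> * (1 + real k)) * 2 powr (m * (1 - real k)))"
      unfolding e1 e2 by (simp only: mult_ac)
    also have "B powr (- \<beta>) * B powr m = B powr (m - \<beta>)" by (simp add: powr_add[symmetric])
    also have "2 powr (\<beta> * (1 + real k)) * 2 powr (m * (1 - real k)) = 2 powr ((\<beta> + m) + (\<beta> - m) * real k)"
      by (simp add: powr_add[symmetric] algebra_simps)
    also have "\<dots> = 2 powr (\<beta> + m) * q ^ k"
      unfolding powr_add q_def by (simp add: powr_powr[symmetric] powr_realpow)
    finally show ?thesis by (simp only: mult_ac)
  qed
  have "(\<integral>\<^sup>+x. indicator {x. d x \<le> B} x * ennreal (d x powr (- \<beta>)) \<partial>M) \<le>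
      (\<integral>\<^sup>+x. (\<Sum>k. ennreal (c k) * indicator {x \<in> space M. d x < t k} x) \<partial>M)"
    by (intro nn_integral_mono pw)
  also have "\<dots> = (\<Sum>k. ennreal (c k) * emeasure M {x \<in> space M. d x < t k})"
    by (subst nn_integral_suminf) (simp_all add: nn_integral_cmult_indicator)
  also have "\<dots> \<le> (\<Sum>k. ennreal (c k * (C * t k powr m)))"
  proof (intro suminf_le summableI)
    fix k
    have "0 \<le> c k" by (simp add: c_def)
    then show "ennreal (c k) * emeasure M {x \<in> space M. d x < t k} \<le> ennreal (c k * (C * t k powr m))"
      unfolding ennreal_mult'[OF \<open>0 \<le> c k\<close>] by (intro mult_left_mono meas t) simp
  qed
  also have "\<dots> = (\<Sum>k. ennreal (C * 2 powr (\<beta> + m) * B powr (m - \<beta>) * q ^ k))" by (simp only: trm)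
  also have "\<dots> = ennreal (\<Sum>k. C * 2 powr (\<beta> + m) * B powr (m - \<beta>) * q ^ k)"
    using q C by (intro suminf_ennreal2 summable_mult summable_geometric) auto
  also have "(\<Sum>k. C * 2 powr (\<beta> + m) * B powr (m - \<beta>) * q ^ k) = C * (2 powr (\<beta> + m) / (1 - q)) * B powr (m - \<beta>)"
  proof -
    have "(\<Sum>k. C * 2 powr (\<beta> + m) * B powr (m - \<beta>) * q ^ k) = C * 2 powr (\<beta> + m) * B powr (m - \<beta>) * (\<Sum>k. q ^ k)"
      using q by (intro suminf_mult summable_geometric) simp
    also have "(\<Sum>k. q ^ k) = 1 / (1 - q)" using q by (intro suminf_geometric) simp
    finally show ?thesis by simp
  qed
  finally show ?thesis by (simp only: q_def)
qed

section \<open>Integrals of the kernel over the disc and along circles\<close>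

abbreviation disc :: "complex measure" where "disc \<equiv> lebesgue_on udisc"

lemma disc_measurable_borel: "f \<in> borel_measurable borel \<Longrightarrow> f \<in> borel_measurable disc"
  by (simp add: measurable_restrict_space1 measurable_completion)

lemma id_measurable_disc [measurable]: "(\<lambda>x. x) \<in> borel_measurable disc"
  by (rule disc_measurable_borel) simp

lemma kernel_integral_disc:
  assumes \<beta>: "0 \<le> \<beta>" "\<beta> < 2" and B: "0 < B"
  shows "(\<integral>\<^sup>+\<zeta>. indicator (cball w B) \<zeta> * ennreal (cmod (\<zeta> - w) powr (- \<beta>)) \<partial>disc) \<le>
    ennreal (pi * (2 powr (\<beta> + 2) / (1 - 2 powr (\<beta> - 2))) * B powr (2 - \<beta>))"
proof -
  have "(\<integral>\<^sup>+\<zeta>. indicator {\<zeta>. cmod (\<zeta> - w) \<le> B} \<zeta> * ennreal (cmod (\<zeta> - w) powr (- \<beta>)) \<partial>disc) \<le>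
    ennreal (pi * (2 powr (\<beta> + 2) / (1 - 2 powr (\<beta> - 2))) * B powr (2 - \<beta>))"
  proof (rule nn_integral_powr_neg_le[OF _ _ _ \<beta> B])
    fix t :: real assume t: "0 < t"
    have "emeasure disc {\<zeta> \<in> space disc. cmod (\<zeta> - w) < t} = emeasure lebesgue {\<zeta> \<in> udisc. cmod (\<zeta> - w) < t}"
      by (subst emeasure_restrict_space) auto
    also have "\<dots> \<le> emeasure lebesgue (ball w t)"
      by (intro emeasure_mono) (auto simp: dist_norm norm_minus_commute)
    also have "\<dots> = emeasure lborel (ball w t)" by simp
    also have "\<dots> = ennreal (pi * t\<^sup>2)" using t by (subst emeasure_ball) (simp_all add: unit_ball_vol_2)
    also have "t\<^sup>2 = t powr 2" using t by (simp add: powr_numeral)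
    finally show "emeasure disc {\<zeta> \<in> space disc. cmod (\<zeta> - w) < t} \<le> ennreal (pi * t powr 2)" .
  qed simp_all
  moreover have "{\<zeta>. cmod (\<zeta> - w) \<le> B} = cball w B" by (auto simp: dist_norm norm_minus_commute)
  ultimately show ?thesis by simp
qed

text \<open>Any two points of the set have chordal distance below 4t, since r is at least 1/2. Hence
  8t times \<open>kern (4 * t)\<close>, centred at one of them, is at least 1 on the set, and the
  integral of \<open>kern\<close> gives 8t * 2 pi. For 4t > 1 the length of the full circle is
  already below the bound.\<close>

lemma circ_arc_measure:
  assumes t: "0 < t" and r: "1/2 \<le> r"
  shows "emeasure circ {\<theta> \<in> space circ. cmod (\<zeta> - of_real r * cis \<theta>) < t} \<le> ennreal (16 * pi * t powr 1)"
proof (cases "\<exists>\<theta>0. cmod (\<zeta> - of_real r * cis \<theta>0) < t")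
  case False
  then have "{\<theta> \<in> space circ. cmod (\<zeta> - of_real r * cis \<theta>) < t} = {}" by blast
  then show ?thesis by (simp only: emeasure_empty zero_le)
next
  case True
  then obtain \<theta>0 where \<theta>0: "cmod (\<zeta> - of_real r * cis \<theta>0) < t" by blast
  let ?A = "{\<theta> \<in> space circ. cmod (\<zeta> - of_real r * cis \<theta>) < t}"
  have A: "?A \<in> sets circ" by measurable
  show ?thesis
  proof (cases "4 * t \<le> 1")
    case False
    have "emeasure circ ?A \<le> emeasure circ (space circ)" by (rule emeasure_space)
    also have "\<dots> = ennreal (2 * pi)" by (simp add: emeasure_circ)
    also have "\<dots> \<le> ennreal (16 * pi * t powr 1)" using False t by (intro ennreal_leI) simp
    finally show ?thesis .
  next
    case True
    let ?\<rho> = "4 * t"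
    have "indicator ?A \<theta> \<le> ennreal (2 * ?\<rho>) * ennreal (kern ?\<rho> (cmod (cis \<theta>0 - cis \<theta>)))" for \<theta>
    proof (cases "\<theta> \<in> ?A")
      case True
      then have "cmod (of_real r * (cis \<theta>0 - cis \<theta>)) < 2 * t"
        using \<theta>0 norm_triangle_ineq4[of "\<zeta> - of_real r * cis \<theta>" "\<zeta> - of_real r * cis \<theta>0"]
        by (simp add: algebra_simps)
      then have rd: "r * cmod (cis \<theta>0 - cis \<theta>) < 2 * t" using r by (simp add: norm_mult)
      have "1/2 * cmod (cis \<theta>0 - cis \<theta>) \<le> r * cmod (cis \<theta>0 - cis \<theta>)" using r by (intro mult_right_mono) auto
      then have d: "cmod (cis \<theta>0 - cis \<theta>) \<le> ?\<rho>" using rd by linarith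
      then have "(cmod (cis \<theta>0 - cis \<theta>))\<^sup>2 \<le> ?\<rho>\<^sup>2" by (intro power_mono) auto
      then have "1 \<le> 2 * ?\<rho> * kern ?\<rho> (cmod (cis \<theta>0 - cis \<theta>))"
      proof -
        assume le: "(cmod (cis \<theta>0 - cis \<theta>))\<^sup>2 \<le> ?\<rho>\<^sup>2"
        have pos: "0 < ?\<rho>\<^sup>2 + (cmod (cis \<theta>0 - cis \<theta>))\<^sup>2" using t by (intro add_pos_nonneg) auto
        have "2 * ?\<rho> * kern ?\<rho> (cmod (cis \<theta>0 - cis \<theta>)) = (2 * ?\<rho>\<^sup>2) / (?\<rho>\<^sup>2 + (cmod (cis \<theta>0 - cis \<theta>))\<^sup>2)"
          by (simp add: kern_def power2_eq_square)
        then show ?thesis using pos le by (simp only: le_divide_eq_1_pos)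
      qed
      then have "ennreal 1 \<le> ennreal (2 * ?\<rho> * kern ?\<rho> (cmod (cis \<theta>0 - cis \<theta>)))" by (rule ennreal_leI)
      then show ?thesis using True t by (simp add: ennreal_mult')
    qed simp
    then have "emeasure circ ?A \<le> (\<integral>\<^sup>+\<theta>. ennreal (2 * ?\<rho>) * ennreal (kern ?\<rho> (cmod (cis \<theta>0 - cis \<theta>))) \<partial>circ)"
      unfolding nn_integral_indicator[OF A, symmetric] by (rule nn_integral_mono)
    also have "\<dots> = ennreal (2 * ?\<rho>) * (\<integral>\<^sup>+\<theta>. ennreal (kern ?\<rho> (cmod (cis \<theta>0 - cis \<theta>))) \<partial>circ)"
      by (intro nn_integral_cmult) (unfold kern_def, measurable)
    also have "\<dots> \<le> ennreal (2 * ?\<rho>) * ennreal (2 * pi)"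
      using t True by (intro mult_left_mono kern_integral_circ) auto
    also have "\<dots> = ennreal (16 * pi * t powr 1)"
      using t by (simp add: ennreal_mult'[symmetric] mult_ac)
    finally show ?thesis .
  qed
qed

lemma kernel_integral_circ:
  assumes \<beta>: "0 \<le> \<beta>" "\<beta> < 1" and r: "1/2 \<le> r" "r \<le> 1" and \<zeta>: "\<zeta> \<in> udisc"
  shows "(\<integral>\<^sup>+\<theta>. ennreal (cmod (\<zeta> - of_real r * cis \<theta>) powr (- \<beta>)) \<partial>circ) \<le>
    ennreal (16 * pi * (2 powr (\<beta> + 1) / (1 - 2 powr (\<beta> - 1))) * 2 powr (1 - \<beta>))"
proof -
  have "(\<integral>\<^sup>+\<theta>. indicator {\<theta>. cmod (\<zeta> - of_real r * cis \<theta>) \<le> 2} \<theta> * ennreal (cmod (\<zeta> - of_real r * cis \<theta>) powr (- \<beta>)) \<partial>circ) \<le>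
    ennreal (16 * pi * (2 powr (\<beta> + 1) / (1 - 2 powr (\<beta> - 1))) * 2 powr (1 - \<beta>))"
    by (rule nn_integral_powr_neg_le[OF _ _ circ_arc_measure[OF _ r(1)] \<beta>]) simp_all
  moreover have "cmod (\<zeta> - of_real r * cis \<theta>) \<le> 2" for \<theta>
  proof -
    have "cmod (\<zeta> - of_real r * cis \<theta>) \<le> cmod \<zeta> + r"
      using norm_triangle_ineq4[of \<zeta> "of_real r * cis \<theta>"] r by (simp add: norm_mult)
    then show ?thesis using \<zeta> r by simp
  qed
  ultimately show ?thesis by simp
qed

text \<open>Valued in \<open>ennreal\<close> because it is also taken at points of the circle, where
  it may be infinite.\<close>

definition potential :: "(complex \<Rightarrow> real) \<Rightarrow> complex \<Rightarrow> ennreal" where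
  "potential g w = (\<integral>\<^sup>+\<zeta>. ennreal (g \<zeta> / cmod (\<zeta> - w)) \<partial>disc)"

text \<open>The free scale \<open>l\<close> is chosen after integration, which then does the work of
  Hoelder's inequality.\<close>

lemma Young_scaled:
  fixes a b l :: real
  assumes "0 \<le> a" "0 \<le> b" "0 < l" "1 < P" "1 < P'" "1 / P + 1 / P' = 1"
  shows "a * b \<le> l powr P * a powr P + l powr (- P') * b powr P'"
proof -
  have "a * b = (l * a) * (b / l)" using assms by simp
  also have "\<dots> \<le> (l * a) powr P / P + (b / l) powr P' / P'"
    using assms by (intro Youngs_inequality) auto
  also have "\<dots> \<le> (l * a) powr P / 1 + (b / l) powr P' / 1"
    using assms by (intro add_mono divide_left_mono) auto
  also have "\<dots> = l powr P * a powr P + l powr (- P') * b powr P'"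
    using assms by (simp add: powr_mult powr_minus divide_inverse inverse_powr mult.commute)
  finally show ?thesis .
qed

lemma powr_interpolation_le:
  fixes X Y :: real
  assumes "0 \<le> X" "0 \<le> Y" "0 \<le> c" "0 \<le> d" "c + d = 1"
  shows "X powr c * Y powr d \<le> X + Y"
proof (cases "X = 0 \<or> Y = 0")
  case False
  then have pos: "0 < X" "0 < Y" using assms by auto
  have "X powr c * Y powr d \<le> max X Y powr c * max X Y powr d"
    using assms pos by (intro mult_mono powr_mono2) auto
  also have "\<dots> = max X Y" using assms(5) pos by (simp add: powr_add[symmetric])
  finally show ?thesis using pos by linarith
qed (use assms in auto)

text \<open>The exponent q' conjugate to q is below 2, so |z|^(-q') is integrable over area, and
  over a disc of radius \<open>\<rho>\<close> its integral is of order \<open>\<rho>\<close>^(2 -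
  q'), uniformly in the centre.\<close>

lemma small_ball_potential:
  assumes am: "a \<in> borel_measurable disc" and a0: "\<And>\<zeta>. 0 \<le> a \<zeta>" and q: "2 < q"
    and fin: "(\<integral>\<^sup>+\<zeta>. ennreal (a \<zeta> powr q) \<partial>disc) < top" and e: "0 < e"
  shows "\<exists>\<rho>0>0. \<forall>w \<rho>. 0 < \<rho> \<longrightarrow> \<rho> \<le> \<rho>0 \<longrightarrow>
    (\<integral>\<^sup>+\<zeta>. indicator (ball w \<rho>) \<zeta> * ennreal (a \<zeta> / cmod (\<zeta> - w)) \<partial>disc) \<le> ennreal e"
proof -
  define q' where "q' = q / (q - 1)"
  have q': "1 < q'" "q' < 2" "1 / q + 1 / q' = 1" using q by (auto simp: q'_def field_simps)
  define A where "A = enn2real (\<integral>\<^sup>+\<zeta>. ennreal (a \<zeta> powr q) \<partial>disc)"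
  have A: "(\<integral>\<^sup>+\<zeta>. ennreal (a \<zeta> powr q) \<partial>disc) = ennreal A" "0 \<le> A" using fin by (auto simp: A_def)
  \<comment> \<open>This scale makes l^q A at most e/2; the added 1 covers A = 0. The choice of the
    radius takes care of the other half.\<close>
  define l where "l = (e / (2 * (A + 1))) powr (1 / q)"
  have l: "0 < l" using e A by (simp add: l_def)
  have lq: "l powr q = e / (2 * (A + 1))" using q e A by (simp add: l_def powr_powr)
  define K where "K = l powr (- q') * (pi * (2 powr (q' + 2) / (1 - 2 powr (q' - 2))))"
  have "((\<lambda>\<rho>. K * \<rho> powr (2 - q')) \<longlongrightarrow> K * 0 powr (2 - q')) (at_right 0)"
    using q' by (intro tendsto_intros tendsto_powr') (auto simp: eventually_at_right_less intro: eventually_at_right_less[THEN eventually_mono])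
  then have "\<forall>\<^sub>F \<rho> in at_right 0. K * \<rho> powr (2 - q') < e / 2" using e by (intro order_tendstoD) auto
  then obtain \<rho>0 where \<rho>0: "0 < \<rho>0" "\<And>\<rho>. 0 < \<rho> \<Longrightarrow> \<rho> < \<rho>0 \<Longrightarrow> K * \<rho> powr (2 - q') < e / 2"
    unfolding eventually_at_right_field by auto
  have "(\<integral>\<^sup>+\<zeta>. indicator (ball w \<rho>) \<zeta> * ennreal (a \<zeta> / cmod (\<zeta> - w)) \<partial>disc) \<le> ennreal e"
    if \<rho>: "0 < \<rho>" "\<rho> \<le> \<rho>0 / 2" for w \<rho>
  proof -
    have "(\<integral>\<^sup>+\<zeta>. indicator (ball w \<rho>) \<zeta> * ennreal (a \<zeta> / cmod (\<zeta> - w)) \<partial>disc) \<le>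
      (\<integral>\<^sup>+\<zeta>. ennreal (l powr q) * ennreal (a \<zeta> powr q) +
        ennreal (l powr (- q')) * (indicator (cball w \<rho>) \<zeta> * ennreal (cmod (\<zeta> - w) powr (- q'))) \<partial>disc)"
    proof (intro nn_integral_mono)
      fix \<zeta>
      have "a \<zeta> * (1 / cmod (\<zeta> - w)) \<le> l powr q * a \<zeta> powr q + l powr (- q') * (1 / cmod (\<zeta> - w)) powr q'"
        using q q' by (intro Young_scaled a0 l) auto
      also have "(1 / cmod (\<zeta> - w)) powr q' = cmod (\<zeta> - w) powr (- q')"
        by (simp add: powr_minus divide_inverse inverse_powr)
      finally have "ennreal (a \<zeta> / cmod (\<zeta> - w)) \<le>
          ennreal (l powr q) * ennreal (a \<zeta> powr q) + ennreal (l powr (- q')) * ennreal (cmod (\<zeta> - w) powr (- q'))"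
        by (simp add: ennreal_mult'[symmetric] ennreal_plus[symmetric] ennreal_leI del: ennreal_plus)
      then show "indicator (ball w \<rho>) \<zeta> * ennreal (a \<zeta> / cmod (\<zeta> - w)) \<le> ennreal (l powr q) * ennreal (a \<zeta> powr q) +
        ennreal (l powr (- q')) * (indicator (cball w \<rho>) \<zeta> * ennreal (cmod (\<zeta> - w) powr (- q')))"
        by (auto simp: indicator_def)
    qed
    also have "\<dots> = ennreal (l powr q) * ennreal A + ennreal (l powr (- q')) *
        (\<integral>\<^sup>+\<zeta>. indicator (cball w \<rho>) \<zeta> * ennreal (cmod (\<zeta> - w) powr (- q')) \<partial>disc)"
    proof -
      have [measurable]: "a \<in> borel_measurable disc" by (rule am)
      have [measurable]: "indicator (cball w \<rho>) \<in> borel_measurable disc" by (intro disc_measurable_borel borel_measurable_indicator) simp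
      show ?thesis unfolding A(1)[symmetric] by (simp add: nn_integral_add nn_integral_cmult)
    qed
    also have "\<dots> \<le> ennreal (l powr q) * ennreal A + ennreal (l powr (- q')) *
        ennreal (pi * (2 powr (q' + 2) / (1 - 2 powr (q' - 2))) * \<rho> powr (2 - q'))"
      using q' \<rho> by (intro add_left_mono mult_left_mono kernel_integral_disc) auto
    also have "\<dots> = ennreal (l powr q * A + K * \<rho> powr (2 - q'))"
    proof -
      define T where "T = pi * (2 powr (q' + 2) / (1 - 2 powr (q' - 2))) * \<rho> powr (2 - q')"
      have "2 powr (q' - 2) \<le> 2 powr (0::real)" using q' by (intro powr_mono) auto
      then have T: "0 \<le> T" by (simp add: T_def)
      have KT: "K * \<rho> powr (2 - q') = l powr (- q') * T" by (simp only: K_def T_def mult.assoc)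
      show ?thesis
        unfolding KT T_def[symmetric] ennreal_mult'[OF powr_ge_zero, symmetric]
        using T A(2) by (intro ennreal_plus[symmetric]) auto
    qed
    also have "\<dots> \<le> ennreal e"
    proof (rule ennreal_leI)
      have "l powr q * A \<le> e / 2" unfolding lq using A(2) e by (simp add: field_simps)
      moreover have "K * \<rho> powr (2 - q') < e / 2" using \<rho> \<rho>0(1) by (intro \<rho>0(2)) auto
      ultimately show "l powr q * A + K * \<rho> powr (2 - q') \<le> e" by linarith
    qed
    finally show ?thesis .
  qed
  then show ?thesis using \<rho>0(1) by (intro exI[of _ "\<rho>0 / 2"]) auto
qed

text \<open>A three-factor Hoelder inequality before integration. The product is split into g^(s/P)
  \<open>\<kappa>\<close>^x and g^(1 - s/P) \<open>\<kappa>\<close>^(1 - x), to which Young's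
  inequality with P and P' applies. The P'-th power of the second factor is a geometric mean of g^s
  and \<open>\<kappa>\<close>^((1 - x) s'), with weights \<open>c\<close> and \<open>d\<close> of
  sum 1.\<close>

lemma Holder_kernel_pointwise:
  fixes g \<kappa> :: real
  assumes "0 \<le> g" "0 \<le> \<kappa>" "0 < l" and s: "1 < s" "s \<le> P" and x: "x \<le> 1"
  shows "g * \<kappa> \<le> l powr P * (g powr s * \<kappa> powr (x * P)) +
    l powr (- (P / (P - 1))) * (g powr s + \<kappa> powr ((1 - x) * (s / (s - 1))))"
proof -
  define P' where "P' = P / (P - 1)"
  define s' where "s' = s / (s - 1)"
  have P: "1 < P" "0 < P" "P \<noteq> 0" using s by auto
  have P': "1 < P'" "1 / P + 1 / P' = 1" using P by (auto simp: P'_def field_simps)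
  have s': "1 < s'" "1 / s + 1 / s' = 1" using s by (auto simp: s'_def field_simps)
  define a where "a = g powr (s / P) * \<kappa> powr x"
  define b where "b = g powr (1 - s / P) * \<kappa> powr (1 - x)"
  define c where "c = (1 / s - 1 / P) * P'"
  define d where "d = P' / s'"
  have cd: "0 \<le> c" "0 \<le> d" using s P P' s' by (auto simp: c_def d_def intro!: mult_nonneg_nonneg divide_left_mono)
  have "c + d = (1 / s + 1 / s' - 1 / P) * P'" by (simp add: c_def d_def algebra_simps)
  also have "1 / s + 1 / s' - 1 / P = 1 / P'" using s'(2) P'(2) by linarith
  also have "1 / P' * P' = 1" using P' by simp
  finally have cd1: "c + d = 1" .
  have "a * b = (g powr (s / P) * g powr (1 - s / P)) * (\<kappa> powr x * \<kappa> powr (1 - x))"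
    by (simp only: a_def b_def mult_ac)
  also have "\<dots> = g * \<kappa>" using assms(1,2) by (simp add: powr_add[symmetric])
  finally have "g * \<kappa> = a * b" by simp
  also have "\<dots> \<le> l powr P * a powr P + l powr (- P') * b powr P'"
    by (rule Young_scaled) (use P P' assms in \<open>auto simp: a_def b_def\<close>)
  also have "a powr P = g powr s * \<kappa> powr (x * P)"
    using P assms by (simp add: a_def powr_mult powr_powr)
  also have "b powr P' = (g powr s) powr c * (\<kappa> powr ((1 - x) * s')) powr d"
  proof -
    have "(1 - s / P) * P' = s * c" using s P by (simp add: c_def field_simps)
    moreover have "(1 - x) * P' = (1 - x) * s' * d" using s' by (simp add: d_def)
    moreover have "b powr P' = (g powr (1 - s / P)) powr P' * (\<kappa> powr (1 - x)) powr P'"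
      by (simp add: b_def powr_mult)
    ultimately show ?thesis by (simp only: powr_powr)
  qed
  also have "l powr (- P') * \<dots> \<le> l powr (- P') * (g powr s + \<kappa> powr ((1 - x) * s'))"
    by (intro mult_left_mono powr_interpolation_le cd cd1) auto
  finally show ?thesis by (simp add: P'_def s'_def)
qed

text \<open>The kernel power x P must be below 1 for circles, and (1 - x) s' below 2 for area, where
  s' is conjugate to s. This says 2/s - 1 < x < 1/P, an interval that is nonempty exactly when P (2
  - s) < s; x is its midpoint. If p <= s, then P = s qualifies because s > 1.\<close>

lemma exponent_choice:
  fixes p s :: real
  assumes "1 < s" "s \<le> 2" "0 < p" "p * (2 - s) < s"
  shows "\<exists>P x. p \<le> P \<and> s \<le> P \<and> 0 \<le> x \<and> x \<le> 1 \<and> x * P < 1 \<and> (1 - x) * (s / (s - 1)) < 2"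
proof -
  have "\<exists>P. p \<le> P \<and> s \<le> P \<and> P * (2 - s) < s"
  proof (cases "p \<le> s")
    case True
    have "s * (2 - s) < s * 1" using assms by (intro mult_strict_left_mono) auto
    then show ?thesis using True by (intro exI[of _ s]) auto
  qed (use assms in \<open>intro exI[of _ p], auto\<close>)
  then obtain P where P: "p \<le> P" "s \<le> P" "P * (2 - s) < s" by blast
  define x where "x = (2 / s - 1 + 1 / P) / 2"
  have P0: "1 < P" using P assms by simp
  have "2 / s - 1 < 1 / P" using P P0 assms by (simp add: field_simps)
  then have x: "2 / s - 1 < x" "x < 1 / P" by (auto simp: x_def)
  have "0 \<le> 2 / s - 1" using assms by (simp add: field_simps)
  then have "0 \<le> x" using x by simp
  moreover have "x * P < 1" using x P0 by (simp add: field_simps)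
  moreover have "x \<le> 1"
  proof -
    have "1 / P \<le> 1" using P0 by simp
    then show ?thesis using x by linarith
  qed
  moreover have "(1 - x) * (s / (s - 1)) < 2"
  proof -
    have "1 - x < 2 * ((s - 1) / s)" using x assms by (simp add: field_simps)
    then have "(1 - x) * (s / (s - 1)) < 2 * ((s - 1) / s) * (s / (s - 1))"
      using assms by (intro mult_strict_right_mono) auto
    moreover have "2 * ((s - 1) / s) * (s / (s - 1)) = 2"
    proof -
      have "(s - 1) / s * (s / (s - 1)) = 1"
        unfolding times_divide_times_eq using assms by (simp only: mult.commute[of s "s - 1"]) simp
      then show ?thesis by (simp only: mult.assoc mult_1_right)
    qed
    ultimately show ?thesis by linarith
  qed
  ultimately show ?thesis using P by blast
qed

text \<open>The power of the potential is expressed through the reals below it, so that the value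
  infinity is covered. The bound is uniform in r and includes r = 1: the radii below 1 serve the
  p-means of \<open>h\<close>, and r = 1 serves finiteness at almost every vertex.\<close>

lemma potential_Lp:
  assumes gm: "g \<in> borel_measurable disc" and g0: "\<And>\<zeta>. 0 \<le> g \<zeta>" and s: "1 < s" "s \<le> 2"
    and fin: "(\<integral>\<^sup>+\<zeta>. ennreal (g \<zeta> powr s) \<partial>disc) < top" and p: "0 < p" "p * (2 - s) < s"
  shows "\<exists>V C. \<forall>r\<in>{1/2..1}. V r \<in> borel_measurable circ \<and> (\<integral>\<^sup>+\<theta>. V r \<theta> \<partial>circ) \<le> ennreal C \<and>
    (\<forall>\<theta> i. 0 \<le> i \<longrightarrow> ennreal i \<le> potential g (of_real r * cis \<theta>) \<longrightarrow> ennreal (i powr p) \<le> V r \<theta>)"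
proof -
  have [measurable]: "g \<in> borel_measurable disc" by (rule gm)
  obtain P x where P: "p \<le> P" "s \<le> P" and x: "0 \<le> x" "x \<le> 1" "x * P < 1" "(1 - x) * (s / (s - 1)) < 2"
    using exponent_choice[OF s p] by blast
  define P' where "P' = P / (P - 1)"
  define \<beta> where "\<beta> = (1 - x) * (s / (s - 1))"
  have P1: "1 < P" using P s by simp
  have P': "0 < P'" "1 / P + 1 / P' = 1" using P1 by (auto simp: P'_def field_simps)
  have \<beta>: "0 \<le> \<beta>" "\<beta> < 2" using x s by (auto simp: \<beta>_def)
  define G where "G = enn2real (\<integral>\<^sup>+\<zeta>. ennreal (g \<zeta> powr s) \<partial>disc)"
  have G: "(\<integral>\<^sup>+\<zeta>. ennreal (g \<zeta> powr s) \<partial>disc) = ennreal G" "0 \<le> G" using fin by (auto simp: G_def)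
  define K2 where "K2 = pi * (2 powr (\<beta> + 2) / (1 - 2 powr (\<beta> - 2))) * 2 powr (2 - \<beta>)"
  define K1 where "K1 = 16 * pi * (2 powr (x * P + 1) / (1 - 2 powr (x * P - 1))) * 2 powr (1 - x * P)"
  have K2: "0 \<le> K2"
  proof -
    have "2 powr (\<beta> - 2) \<le> 2 powr (0::real)" using \<beta> by (intro powr_mono) auto
    then show ?thesis by (simp add: K2_def)
  qed
  have K1: "0 \<le> K1"
  proof -
    have "2 powr (x * P - 1) \<le> 2 powr (0::real)" using x by (intro powr_mono) auto
    then show ?thesis by (simp add: K1_def)
  qed
  define L where "L = G + K2"
  have L: "0 \<le> L" using G K2 by (simp add: L_def)
  define U where "U = (\<lambda>r \<theta>. \<integral>\<^sup>+\<zeta>. ennreal (g \<zeta> powr s) * ennreal (cmod (\<zeta> - of_real r * cis \<theta>) powr (- (x * P))) \<partial>disc)"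
  \<comment> \<open>The leading 1 pays for the passage from the exponent P to p <= P, as i^p is at
    most 1 + i^P.\<close>
  define V where "V = (\<lambda>r \<theta>. 1 + ennreal ((1 + L) powr P) * (1 + U r \<theta>))"
  interpret PS: pair_sigma_finite circ disc
  proof -
    have "finite_measure circ" "finite_measure disc" by (intro finite_measure_lebesgue_on; simp)+
    then show "pair_sigma_finite circ disc"
      by (simp add: pair_sigma_finite_def finite_measure_def)
  qed
  have Um [measurable]: "U r \<in> borel_measurable circ" for r
    unfolding U_def by measurable
  have Vm [measurable]: "V r \<in> borel_measurable circ" for r
    unfolding V_def by measurable
  have inv: "(1 / y) powr t = y powr (- t)" if "0 \<le> y" for y t :: real
    using that by (simp add: powr_minus divide_inverse inverse_powr)
  have young: "potential g w \<le> ennreal (l powr P) * (\<integral>\<^sup>+\<zeta>. ennreal (g \<zeta> powr s) * ennreal (cmod (\<zeta> - w) powr (- (x * P))) \<partial>disc) +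
      ennreal (l powr (- P')) * ennreal L" if l: "0 < l" and w: "cmod w \<le> 1" for l w
  proof -
    have "potential g w \<le> (\<integral>\<^sup>+\<zeta>. ennreal (l powr P) * (ennreal (g \<zeta> powr s) * ennreal (cmod (\<zeta> - w) powr (- (x * P)))) +
        ennreal (l powr (- P')) * (ennreal (g \<zeta> powr s) + indicator (cball w 2) \<zeta> * ennreal (cmod (\<zeta> - w) powr (- \<beta>))) \<partial>disc)"
      unfolding potential_def
    proof (intro nn_integral_mono)
      fix \<zeta> assume \<zeta>: "\<zeta> \<in> space disc"
      have "dist w \<zeta> \<le> cmod w + cmod \<zeta>" unfolding dist_norm by (rule norm_triangle_ineq4)
      then have in2: "\<zeta> \<in> cball w 2" using w \<zeta> by simp
      have "g \<zeta> * (1 / cmod (\<zeta> - w)) \<le> l powr P * (g \<zeta> powr s * (1 / cmod (\<zeta> - w)) powr (x * P)) +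
          l powr (- P') * (g \<zeta> powr s + (1 / cmod (\<zeta> - w)) powr \<beta>)"
        unfolding P'_def \<beta>_def using s P x l by (intro Holder_kernel_pointwise g0) auto
      then have "g \<zeta> / cmod (\<zeta> - w) \<le> l powr P * (g \<zeta> powr s * cmod (\<zeta> - w) powr (- (x * P))) +
          l powr (- P') * (g \<zeta> powr s + cmod (\<zeta> - w) powr (- \<beta>))"
        by (simp only: inv[OF norm_ge_zero] mult_1_right times_divide_eq_right)
      then have "ennreal (g \<zeta> / cmod (\<zeta> - w)) \<le> ennreal (l powr P * (g \<zeta> powr s * cmod (\<zeta> - w) powr (- (x * P))) +
          l powr (- P') * (g \<zeta> powr s + cmod (\<zeta> - w) powr (- \<beta>)))" by (rule ennreal_leI)
      also have "\<dots> = ennreal (l powr P) * (ennreal (g \<zeta> powr s) * ennreal (cmod (\<zeta> - w) powr (- (x * P)))) +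
          ennreal (l powr (- P')) * (ennreal (g \<zeta> powr s) + ennreal (cmod (\<zeta> - w) powr (- \<beta>)))"
        by (simp add: ennreal_mult'[symmetric] ennreal_plus[symmetric] del: ennreal_plus)
      finally show "ennreal (g \<zeta> / cmod (\<zeta> - w)) \<le> ennreal (l powr P) * (ennreal (g \<zeta> powr s) * ennreal (cmod (\<zeta> - w) powr (- (x * P)))) +
          ennreal (l powr (- P')) * (ennreal (g \<zeta> powr s) + indicator (cball w 2) \<zeta> * ennreal (cmod (\<zeta> - w) powr (- \<beta>)))"
        using in2 by simp
    qed
    also have "\<dots> = ennreal (l powr P) * (\<integral>\<^sup>+\<zeta>. ennreal (g \<zeta> powr s) * ennreal (cmod (\<zeta> - w) powr (- (x * P))) \<partial>disc) +
        ennreal (l powr (- P')) * (ennreal G + (\<integral>\<^sup>+\<zeta>. indicator (cball w 2) \<zeta> * ennreal (cmod (\<zeta> - w) powr (- \<beta>)) \<partial>disc))"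
    proof -
      have [measurable]: "indicator (cball w 2) \<in> borel_measurable disc" by (intro disc_measurable_borel borel_measurable_indicator) simp
      show ?thesis unfolding G(1)[symmetric] by (simp add: nn_integral_add nn_integral_cmult)
    qed
    also have "\<dots> \<le> ennreal (l powr P) * (\<integral>\<^sup>+\<zeta>. ennreal (g \<zeta> powr s) * ennreal (cmod (\<zeta> - w) powr (- (x * P))) \<partial>disc) +
        ennreal (l powr (- P')) * (ennreal G + ennreal K2)"
      unfolding K2_def using \<beta> by (intro add_left_mono mult_left_mono kernel_integral_disc) auto
    finally show ?thesis using G(2) K2 by (simp add: L_def)
  qed
  have main: "ennreal (i powr p) \<le> V r \<theta>"
    if r: "r \<in> {1/2..1}" and i: "0 \<le> i" "ennreal i \<le> potential g (of_real r * cis \<theta>)" for r \<theta> i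
  proof (cases "U r \<theta> = top")
    case True
    have "0 < (1 + L) powr P" using L by simp
    then have "V r \<theta> = top" using True by (simp add: V_def ennreal_mult_top)
    then show ?thesis by simp
  next
    case False
    then obtain u where u: "U r \<theta> = ennreal u" "0 \<le> u" by (metis ennreal_cases)
    define m where "m = 1 + u"
    have m: "1 \<le> m" "u \<le> m" using u by (auto simp: m_def)
    \<comment> \<open>Balances the two terms: l^P m and l^(-P') both equal m^(1/P).\<close>
    define l where "l = m powr (- (1 / (P * P')))"
    have l: "0 < l" using m by (simp add: l_def)
    have "cmod (of_real r * cis \<theta>) \<le> 1" using r by (simp add: norm_mult)
    from order_trans[OF i(2) young[OF l this]]
    have "ennreal i \<le> ennreal (l powr P) * ennreal u + ennreal (l powr (- P')) * ennreal L"
      using u(1) by (simp only: U_def)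
    also have "\<dots> = ennreal (l powr P * u + l powr (- P') * L)"
      using u L by (simp add: ennreal_mult'[symmetric] ennreal_plus[symmetric] del: ennreal_plus)
    finally have "i \<le> l powr P * u + l powr (- P') * L"
      using u L by (subst (asm) ennreal_le_iff) auto
    also have "\<dots> \<le> l powr P * m + l powr (- P') * L"
      using m by (intro add_right_mono mult_left_mono) auto
    also have "l powr P * m = m powr (1 / P)"
    proof -
      have "l powr P * m = m powr (- (1 / P')) * m powr 1"
        using P1 P' m by (simp add: l_def powr_powr)
      also have "\<dots> = m powr (- (1 / P') + 1)" by (simp only: powr_add)
      also have "- (1 / P') + 1 = 1 / P" using P'(2) by linarith
      finally show ?thesis .
    qed
    also have "l powr (- P') = m powr (1 / P)" using P1 P' by (simp add: l_def powr_powr)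
    finally have "i \<le> m powr (1 / P) * (1 + L)" by (simp add: algebra_simps)
    then have "i powr P \<le> (m powr (1 / P) * (1 + L)) powr P" using i P1 by (intro powr_mono2) auto
    also have "\<dots> = (1 + L) powr P * m" using P1 L m by (simp add: powr_mult powr_powr)
    finally have iP: "i powr P \<le> (1 + L) powr P * (1 + u)" by (simp add: m_def)
    have "i powr p \<le> 1 + i powr P"
    proof (cases "i \<le> 1")
      case True
      have "i powr p \<le> 1 powr p" using True i p by (intro powr_mono2) auto
      then show ?thesis by (simp add: add_increasing2)
    next
      case False
      then have "i powr p \<le> i powr P" using P by (intro powr_mono) auto
      then show ?thesis by simp
    qed
    then have "i powr p \<le> 1 + (1 + L) powr P * (1 + u)" using iP by linarith
    then have "ennreal (i powr p) \<le> ennreal (1 + (1 + L) powr P * (1 + u))" by (rule ennreal_leI)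
    also have "\<dots> = V r \<theta>" using u by (simp add: V_def ennreal_mult')
    finally show ?thesis .
  qed
  have int: "(\<integral>\<^sup>+\<theta>. V r \<theta> \<partial>circ) \<le> ennreal (2 * pi + (1 + L) powr P * (2 * pi + G * K1))"
    if r: "r \<in> {1/2..1}" for r
  proof -
    have "(\<integral>\<^sup>+\<theta>. U r \<theta> \<partial>circ) =
        (\<integral>\<^sup>+\<zeta>. (\<integral>\<^sup>+\<theta>. ennreal (g \<zeta> powr s) * ennreal (cmod (\<zeta> - of_real r * cis \<theta>) powr (- (x * P))) \<partial>circ) \<partial>disc)"
      unfolding U_def by (rule PS.Fubini'[symmetric]) measurable
    also have "\<dots> = (\<integral>\<^sup>+\<zeta>. ennreal (g \<zeta> powr s) * (\<integral>\<^sup>+\<theta>. ennreal (cmod (\<zeta> - of_real r * cis \<theta>) powr (- (x * P))) \<partial>circ) \<partial>disc)"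
      by (intro nn_integral_cong nn_integral_cmult) measurable
    also have "\<dots> \<le> (\<integral>\<^sup>+\<zeta>. ennreal (g \<zeta> powr s) * ennreal K1 \<partial>disc)"
      unfolding K1_def using x r P1
      by (intro nn_integral_mono mult_left_mono kernel_integral_circ) auto
    also have "\<dots> = ennreal (G * K1)"
      using G K1 by (simp add: nn_integral_multc ennreal_mult'')
    finally have Ule: "(\<integral>\<^sup>+\<theta>. U r \<theta> \<partial>circ) \<le> ennreal (G * K1)" .
    have "(\<integral>\<^sup>+\<theta>. V r \<theta> \<partial>circ) = ennreal (2 * pi) + ennreal ((1 + L) powr P) * (ennreal (2 * pi) + (\<integral>\<^sup>+\<theta>. U r \<theta> \<partial>circ))"
      unfolding V_def by (simp add: nn_integral_add nn_integral_cmult emeasure_circ)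
    also have "\<dots> \<le> ennreal (2 * pi) + ennreal ((1 + L) powr P) * (ennreal (2 * pi) + ennreal (G * K1))"
      by (intro add_left_mono mult_left_mono Ule) simp
    also have "\<dots> = ennreal (2 * pi + (1 + L) powr P * (2 * pi + G * K1))"
      using G K1 by (simp add: ennreal_mult'[symmetric] ennreal_plus[symmetric] del: ennreal_plus)
    finally show ?thesis .
  qed
  show ?thesis
    by (intro exI[of _ V] exI ballI conjI allI impI) (use Vm main int in auto)
qed

section \<open>The Theodorescu operator on Stolz angles\<close>

lemma norm_bicomplex_sq: "(norm w)\<^sup>2 = ((cmod (bplus w))\<^sup>2 + (cmod (bminus w))\<^sup>2) / 2"
  by (simp add: norm_bicomplex_def)

lemma cmod_bplus_le: "cmod (bplus w) \<le> 2 * norm w" and cmod_bminus_le: "cmod (bminus w) \<le> 2 * norm w"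
proof -
  have "(cmod (bplus w))\<^sup>2 \<le> (2 * norm w)\<^sup>2" "(cmod (bminus w))\<^sup>2 \<le> (2 * norm w)\<^sup>2"
    unfolding power_mult_distrib norm_bicomplex_sq by simp_all
  then show "cmod (bplus w) \<le> 2 * norm w" "cmod (bminus w) \<le> 2 * norm w"
    by (auto intro: power2_le_imp_le)
qed

lemma norm_bicomplex_le: "norm w \<le> cmod (bplus w) + cmod (bminus w)"
proof (rule power2_le_imp_le)
  show "(norm w)\<^sup>2 \<le> (cmod (bplus w) + cmod (bminus w))\<^sup>2"
    unfolding norm_bicomplex_sq power2_sum by simp
qed simp

lemma norm_bicomplex_le_bc: "norm w \<le> cmod (bc1 w) + cmod (bc2 w)"
proof (rule power2_le_imp_le)
  have "(norm w)\<^sup>2 = (cmod (bc1 w))\<^sup>2 + (cmod (bc2 w))\<^sup>2"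
    unfolding norm_bicomplex_sq bicomplex_norm_aux by (simp add: power2_norm_eq_inner)
  then show "(norm w)\<^sup>2 \<le> (cmod (bc1 w) + cmod (bc2 w))\<^sup>2"
    unfolding power2_sum by simp
qed simp

lemma bplus_mult: "bplus (x * y) = bplus x * bplus y" and bminus_mult: "bminus (x * y) = bminus x * bminus y"
  by (simp_all add: bplus_def bminus_def algebra_simps)

lemma bplus_add: "bplus (x + y) = bplus x + bplus y" and bminus_add: "bminus (x + y) = bminus x + bminus y"
  by (simp_all add: bplus_def bminus_def algebra_simps)

lemma norm_bicomplex_mult_le: "norm (x * y) \<le> 8 * (norm x * norm (y::bicomplex))"
proof -
  have "norm (x * y) \<le> cmod (bplus x) * cmod (bplus y) + cmod (bminus x) * cmod (bminus y)"
    using norm_bicomplex_le[of "x * y"] by (simp add: bplus_mult bminus_mult norm_mult)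
  also have "\<dots> \<le> (2 * norm x) * (2 * norm y) + (2 * norm x) * (2 * norm y)"
    by (intro add_mono mult_mono cmod_bplus_le cmod_bminus_le) auto
  finally show ?thesis by simp
qed

lemma norm_bconj: "norm (bconj w) = norm w"
proof -
  have "bplus (bconj w) = bminus w" "bminus (bconj w) = bplus w"
    by (simp_all add: bplus_def bminus_def bconj_def)
  then show ?thesis by (simp add: norm_bicomplex_def add.commute)
qed

lemma idempotent_components:
  "bplus (p_plus * bc_of_complex u + p_minus * bc_of_complex v) = u"
  "bminus (p_plus * bc_of_complex u + p_minus * bc_of_complex v) = v"
  by (simp_all add: bplus_def bminus_def p_plus_def p_minus_def bc_of_complex_def bj_def algebra_simps)

lemma tendsto_bicomplex:
  assumes "((\<lambda>z. bplus (f z)) \<longlongrightarrow> u) A" "((\<lambda>z. bminus (f z)) \<longlongrightarrow> v) A"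
  shows "(f \<longlongrightarrow> p_plus * bc_of_complex u + p_minus * bc_of_complex v) A"
proof -
  let ?c = "p_plus * bc_of_complex u + p_minus * bc_of_complex v"
  have d: "bplus (x - y) = bplus x - bplus y" "bminus (x - y) = bminus x - bminus y" for x y
    by (simp_all add: bplus_def bminus_def algebra_simps)
  have "((\<lambda>z. cmod (bplus (f z) - u) + cmod (bminus (f z) - v)) \<longlongrightarrow> cmod (u - u) + cmod (v - v)) A"
    by (intro tendsto_intros assms)
  then have "((\<lambda>z. cmod (bplus (f z) - u) + cmod (bminus (f z) - v)) \<longlongrightarrow> 0) A" by simp
  then have "((\<lambda>z. f z - ?c) \<longlongrightarrow> 0) A"
    by (rule Lim_null_comparison[rotated])
      (intro always_eventually allI order_trans[OF norm_bicomplex_le], simp only: d idempotent_components order_refl)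
  then show ?thesis by (simp only: LIM_zero_iff)
qed

lemma theodorescu_components:
  "bplus (theodorescu g z) = - 1 / of_real pi * (\<integral>\<zeta>. bplus (g \<zeta>) / (cnj \<zeta> - cnj z) \<partial>disc)"
  "bminus (theodorescu g z) = - 1 / of_real pi * (\<integral>\<zeta>. bminus (g \<zeta>) / (\<zeta> - z) \<partial>disc)"
  unfolding theodorescu_def by (rule idempotent_components)+

text \<open>Without integrability the Bochner integral is 0 by convention, so the inequality is
  unconditional.\<close>

lemma Bochner_norm_le_nn:
  fixes f :: "'a \<Rightarrow> complex"
  shows "ennreal (cmod (\<integral>x. f x \<partial>M)) \<le> (\<integral>\<^sup>+x. ennreal (cmod (f x)) \<partial>M)"
  by (cases "integrable M f") (simp_all add: integral_norm_bound_ennreal not_integrable_integral_eq)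

lemma norm_theodorescu_le:
  assumes [measurable]: "g \<in> borel_measurable disc"
  shows "ennreal (norm (theodorescu g z)) \<le> 4 * potential (\<lambda>\<zeta>. norm (g \<zeta>)) z"
proof -
  have half: "ennreal (cmod (- 1 / of_real pi * (\<integral>\<zeta>. F \<zeta> \<partial>disc))) \<le> 2 * potential (\<lambda>\<zeta>. norm (g \<zeta>)) z"
    if F: "\<And>\<zeta>. cmod (F \<zeta>) \<le> 2 * (norm (g \<zeta>) / cmod (\<zeta> - z))" for F :: "complex \<Rightarrow> complex"
  proof -
    have "cmod (- 1 / of_real pi * (\<integral>\<zeta>. F \<zeta> \<partial>disc)) \<le> 1 * cmod (\<integral>\<zeta>. F \<zeta> \<partial>disc)"
      using pi_ge_two unfolding norm_mult by (intro mult_right_mono) (auto simp: norm_divide)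
    then have "ennreal (cmod (- 1 / of_real pi * (\<integral>\<zeta>. F \<zeta> \<partial>disc))) \<le> ennreal (cmod (\<integral>\<zeta>. F \<zeta> \<partial>disc))"
      by (simp only: mult_1 ennreal_leI)
    also have "\<dots> \<le> (\<integral>\<^sup>+\<zeta>. ennreal (cmod (F \<zeta>)) \<partial>disc)" by (rule Bochner_norm_le_nn)
    also have "\<dots> \<le> (\<integral>\<^sup>+\<zeta>. 2 * ennreal (norm (g \<zeta>) / cmod (\<zeta> - z)) \<partial>disc)"
    proof (intro nn_integral_mono)
      fix \<zeta>
      have "ennreal (cmod (F \<zeta>)) \<le> ennreal (2 * (norm (g \<zeta>) / cmod (\<zeta> - z)))" by (intro ennreal_leI F)
      also have "\<dots> = 2 * ennreal (norm (g \<zeta>) / cmod (\<zeta> - z))" by (subst ennreal_mult') simp_all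
      finally show "ennreal (cmod (F \<zeta>)) \<le> 2 * ennreal (norm (g \<zeta>) / cmod (\<zeta> - z))" .
    qed
    also have "\<dots> = 2 * potential (\<lambda>\<zeta>. norm (g \<zeta>)) z"
      unfolding potential_def by (rule nn_integral_cmult) measurable
    finally show ?thesis .
  qed
  have "ennreal (norm (theodorescu g z)) \<le> ennreal (cmod (bplus (theodorescu g z)) + cmod (bminus (theodorescu g z)))"
    by (intro ennreal_leI norm_bicomplex_le)
  also have "\<dots> = ennreal (cmod (bplus (theodorescu g z))) + ennreal (cmod (bminus (theodorescu g z)))"
    by (rule ennreal_plus) simp_all
  also have "\<dots> \<le> 2 * potential (\<lambda>\<zeta>. norm (g \<zeta>)) z + 2 * potential (\<lambda>\<zeta>. norm (g \<zeta>)) z"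
    unfolding theodorescu_components
  proof (intro add_mono half)
    fix \<zeta>
    have "cmod (cnj \<zeta> - cnj z) = cmod (\<zeta> - z)" by (metis complex_cnj_diff complex_mod_cnj)
    then show "cmod (bplus (g \<zeta>) / (cnj \<zeta> - cnj z)) \<le> 2 * (norm (g \<zeta>) / cmod (\<zeta> - z))"
      using divide_right_mono[OF cmod_bplus_le[of "g \<zeta>"], of "cmod (\<zeta> - z)"] by (simp add: norm_divide)
    show "cmod (bminus (g \<zeta>) / (\<zeta> - z)) \<le> 2 * (norm (g \<zeta>) / cmod (\<zeta> - z))"
      using divide_right_mono[OF cmod_bminus_le[of "g \<zeta>"], of "cmod (\<zeta> - z)"] by (simp add: norm_divide)
  qed
  also have "\<dots> = 4 * potential (\<lambda>\<zeta>. norm (g \<zeta>)) z"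
    by (simp add: distrib_right[symmetric])
  finally show ?thesis .
qed

text \<open>In the disc of radius (1 - |z|)/2 about z the boundary distance drops by at most a
  factor 2, so a wider aperture suffices.\<close>

lemma ball_in_stolz:
  assumes z: "z \<in> stolz \<alpha> (cis \<theta>)" and w: "w \<in> ball z ((1 - cmod z) / 2)" and \<alpha>: "1 < \<alpha>"
  shows "w \<in> stolz (2 * \<alpha> + 2) (cis \<theta>)"
proof -
  let ?\<rho> = "(1 - cmod z) / 2"
  have z1: "cmod z < 1" and zs: "cmod (z - cis \<theta>) < \<alpha> * (1 - cmod z)" using z by (auto simp: stolz_def)
  have wz: "cmod (w - z) < ?\<rho>" using w by (simp add: dist_norm norm_minus_commute)
  have w1: "?\<rho> < 1 - cmod w" using norm_triangle_ineq[of "w - z" z] wz by simp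
  have "cmod (w - cis \<theta>) \<le> cmod (w - z) + cmod (z - cis \<theta>)"
    using norm_triangle_ineq[of "w - z" "z - cis \<theta>"] by simp
  also have "\<dots> < ?\<rho> + 2 * \<alpha> * ?\<rho>"
  proof -
    have "2 * \<alpha> * ?\<rho> = \<alpha> * (1 - cmod z)" by simp
    then show ?thesis using wz zs by linarith
  qed
  also have "\<dots> = (2 * \<alpha> + 1) * ?\<rho>"
  proof -
    have *: "x + 2 * \<alpha> * x = (2 * \<alpha> + 1) * x" for x :: real by (simp add: algebra_simps)
    show ?thesis by (rule *)
  qed
  also have "\<dots> \<le> (2 * \<alpha> + 2) * (1 - cmod w)" using w1 z1 \<alpha> by (intro mult_mono) auto
  finally show ?thesis using w1 z1 by (simp add: stolz_def)
qed

text \<open>With \<open>?\<rho>\<close> the radius (1 - |z|)/2, the vertex is within (1 +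
  2\<open>\<alpha>\<close>)\<open>?\<rho>\<close> of w, and \<open>?\<rho>\<close> is at most
  |\<open>\<zeta>\<close> - w| \<open>?\<rho>\<close>/\<open>\<tau>\<close>. A singularity at w is
  thus exchanged for the fixed one at the vertex, at the price
  \<open>?\<rho>\<close>/\<open>\<tau>\<close>.\<close>

lemma outer_kernel_le:
  assumes z: "z \<in> stolz \<alpha> (cis \<theta>)" and \<alpha>: "1 < \<alpha>"
    and w: "cmod (w - z) \<le> (1 - cmod z) / 2" and \<tau>: "0 < \<tau>" "\<tau> \<le> (1 - cmod z) / 2" and far: "\<tau> \<le> cmod (\<zeta> - w)"
    and \<zeta>: "\<zeta> \<in> udisc"
  shows "1 / cmod (\<zeta> - w) \<le> (2 * \<alpha> + 2) * (((1 - cmod z) / 2) / \<tau>) * (1 / cmod (\<zeta> - cis \<theta>))"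
proof -
  let ?\<rho> = "(1 - cmod z) / 2"
  have zs: "cmod (z - cis \<theta>) < \<alpha> * (1 - cmod z)" using z by (auto simp: stolz_def)
  have \<rho>: "0 < ?\<rho>" using \<tau> by linarith
  have f0: "0 < cmod (\<zeta> - w)" using \<tau> far by linarith
  have c0: "0 < cmod (\<zeta> - cis \<theta>)"
    using \<zeta> norm_cis[of \<theta>] by (metis eq_iff_diff_eq_0 less_irrefl mem_ball_0 zero_less_norm_iff)
  have "cmod (\<zeta> - cis \<theta>) \<le> cmod (\<zeta> - w) + (cmod (w - z) + cmod (z - cis \<theta>))"
    using norm_triangle_ineq[of "\<zeta> - w" "w - cis \<theta>"] norm_triangle_ineq[of "w - z" "z - cis \<theta>"] by simp
  also have "\<dots> \<le> cmod (\<zeta> - w) + (1 + 2 * \<alpha>) * ?\<rho>" using w zs by (simp add: algebra_simps)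
  also have "\<dots> \<le> cmod (\<zeta> - w) * (?\<rho> / \<tau>) + (1 + 2 * \<alpha>) * (cmod (\<zeta> - w) * (?\<rho> / \<tau>))"
  proof (intro add_mono mult_left_mono)
    have r1: "1 \<le> ?\<rho> / \<tau>" using \<tau> by (simp add: le_divide_eq_1_pos)
    have "cmod (\<zeta> - w) * 1 \<le> cmod (\<zeta> - w) * (?\<rho> / \<tau>)" using r1 by (intro mult_left_mono) auto
    then show "cmod (\<zeta> - w) \<le> cmod (\<zeta> - w) * (?\<rho> / \<tau>)" by simp
    have "\<tau> * (?\<rho> / \<tau>) \<le> cmod (\<zeta> - w) * (?\<rho> / \<tau>)" using far r1 by (intro mult_right_mono) auto
    moreover have "\<tau> * (?\<rho> / \<tau>) = ?\<rho>" using \<tau> by simp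
    ultimately show "?\<rho> \<le> cmod (\<zeta> - w) * (?\<rho> / \<tau>)" by linarith
  qed (use \<alpha> in simp)
  also have "\<dots> = ((2 * \<alpha> + 2) * (?\<rho> / \<tau>)) * cmod (\<zeta> - w)"
  proof -
    have *: "x + (1 + 2 * \<alpha>) * x = (2 * \<alpha> + 2) * x" for x :: real by (simp add: algebra_simps)
    show ?thesis by (rule trans[OF *]) (simp only: mult_ac)
  qed
  finally have "cmod (\<zeta> - cis \<theta>) \<le> ((2 * \<alpha> + 2) * (?\<rho> / \<tau>)) * cmod (\<zeta> - w)" .
  then have "cmod (\<zeta> - cis \<theta>) / (cmod (\<zeta> - w) * cmod (\<zeta> - cis \<theta>)) \<le>
      (((2 * \<alpha> + 2) * (?\<rho> / \<tau>)) * cmod (\<zeta> - w)) / (cmod (\<zeta> - w) * cmod (\<zeta> - cis \<theta>))"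
    using f0 c0 by (intro divide_right_mono) auto
  then show ?thesis using f0 c0 by simp
qed

text \<open>A weighted supremum over a Whitney disc absorbs the part of the potential near the singularity,
  whose mass is small because the coefficients lie in $L^q$ with $q > 2$.\<close>

lemma local_bound:
  fixes \<phi> h g :: "complex \<Rightarrow> bicomplex"
  assumes cont: "continuous_on udisc \<phi>" and gm: "g \<in> borel_measurable disc"
    and am: "a \<in> borel_measurable disc" and a0: "\<And>\<zeta>. 0 \<le> a \<zeta>"
    and ga: "\<And>\<zeta>. \<zeta> \<in> udisc \<Longrightarrow> norm (g \<zeta>) \<le> a \<zeta> * norm (\<phi> \<zeta>)"
    and rep: "\<And>z. z \<in> udisc \<Longrightarrow> \<phi> z = h z + theodorescu g z"
    and small: "\<And>w \<rho>. 0 < \<rho> \<Longrightarrow> \<rho> \<le> \<rho>0 \<Longrightarrow>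
      (\<integral>\<^sup>+\<zeta>. indicator (ball w \<rho>) \<zeta> * ennreal (a \<zeta> / cmod (\<zeta> - w)) \<partial>disc) \<le> ennreal (1 / 16)"
    and \<alpha>: "1 < \<alpha>" and I: "potential (\<lambda>\<zeta>. norm (g \<zeta>)) (cis \<theta>) \<le> ennreal I" "0 \<le> I"
    and Hb: "\<And>w. w \<in> stolz (2 * \<alpha> + 2) (cis \<theta>) \<Longrightarrow> norm (h w) \<le> b"
    and z: "z \<in> stolz \<alpha> (cis \<theta>)" and near: "(1 - cmod z) / 2 \<le> \<rho>0"
  shows "norm (\<phi> z) \<le> 2 * b + (32 * \<alpha> + 32) * I"
proof -
  have [measurable]: "g \<in> borel_measurable disc" "a \<in> borel_measurable disc" by (rule gm, rule am)
  define \<rho> where "\<rho> = (1 - cmod z) / 2"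
  have z1: "cmod z < 1" using z by (simp add: stolz_def)
  have \<rho>: "0 < \<rho>" using z1 by (simp add: \<rho>_def)
  have sub: "cball z \<rho> \<subseteq> udisc"
  proof
    fix w assume "w \<in> cball z \<rho>"
    then have "cmod (w - z) \<le> \<rho>" by (simp add: dist_norm norm_minus_commute)
    then have "cmod w < 1" using norm_triangle_ineq[of "w - z" z] z1 unfolding \<rho>_def by simp
    then show "w \<in> udisc" by simp
  qed
  \<comment> \<open>A weight that vanishes on the rim, so a nonzero maximum is attained inside. Half
    the distance to the rim is small enough for the ball of radius \<open>\<tau> w\<close> about w
    to stay in the Whitney disc.\<close>
  define \<tau> where "\<tau> = (\<lambda>w. (\<rho> - cmod (w - z)) / 2)"
  have c: "continuous_on (cball z \<rho>) (\<lambda>w. \<tau> w * norm (\<phi> w))"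
    unfolding \<tau>_def by (intro continuous_intros continuous_on_subset[OF cont sub]) auto
  obtain w where w: "w \<in> cball z \<rho>" "\<And>y. y \<in> cball z \<rho> \<Longrightarrow> \<tau> y * norm (\<phi> y) \<le> \<tau> w * norm (\<phi> w)"
    using continuous_attains_sup[OF compact_cball _ c] \<rho> by auto
  define M where "M = \<tau> w * norm (\<phi> w)"
  have Mz: "\<rho> / 2 * norm (\<phi> z) \<le> M" using w(2)[of z] \<rho> by (simp add: M_def \<tau>_def)
  have b0: "0 \<le> b"
  proof -
    have "z \<in> stolz (2 * \<alpha> + 2) (cis \<theta>)" using stolz_mono[of \<alpha> "2 * \<alpha> + 2"] z \<alpha> by auto
    then show ?thesis using Hb[of z] norm_ge_zero[of "h z"] by linarith
  qed
  show ?thesis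
  proof (cases "0 < \<tau> w")
    case False
    then have "M \<le> 0" unfolding M_def by (intro mult_nonpos_nonneg) auto
    then have "\<rho> / 2 * norm (\<phi> z) \<le> 0" using Mz by linarith
    then have "norm (\<phi> z) \<le> 0" using \<rho> by (simp add: mult_le_0_iff)
    then show ?thesis using b0 I(2) \<alpha> by (intro order_trans[OF _ add_nonneg_nonneg]) auto
  next
    case True
    let ?t = "\<tau> w"
    have wz: "cmod (w - z) < \<rho>" using True by (simp add: \<tau>_def)
    have t\<rho>: "?t \<le> \<rho> / 2" by (simp add: \<tau>_def)
    have wd: "w \<in> udisc" using w(1) sub by blast
    have M0: "0 \<le> M" unfolding M_def using True by (intro mult_nonneg_nonneg) auto
    \<comment> \<open>On this ball the weight is at least half of its value at w, so the maximality
      of \<open>M\<close> bounds \<open>\<phi>\<close> there.\<close>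
    have inball: "norm (\<phi> y) \<le> 2 * M / ?t" if y: "y \<in> ball w ?t" for y
    proof -
      have yw: "cmod (y - w) < ?t" using y by (simp add: dist_norm norm_minus_commute)
      have yz: "cmod (y - z) \<le> cmod (y - w) + cmod (w - z)" using norm_triangle_ineq[of "y - w" "w - z"] by simp
      then have ty: "?t / 2 \<le> \<tau> y" using yw by (simp add: \<tau>_def)
      then have "y \<in> cball z \<rho>" using True by (simp add: \<tau>_def dist_norm norm_minus_commute)
      from w(2)[OF this] have "\<tau> y * norm (\<phi> y) \<le> M" by (simp add: M_def)
      moreover have "?t / 2 * norm (\<phi> y) \<le> \<tau> y * norm (\<phi> y)" using ty by (intro mult_right_mono) auto
      ultimately have "?t / 2 * norm (\<phi> y) \<le> M" by linarith
      then show ?thesis using True by (simp add: field_simps)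
    qed
    have "potential (\<lambda>\<zeta>. norm (g \<zeta>)) w \<le>
        (\<integral>\<^sup>+\<zeta>. ennreal (2 * M / ?t) * (indicator (ball w ?t) \<zeta> * ennreal (a \<zeta> / cmod (\<zeta> - w))) +
          ennreal ((2 * \<alpha> + 2) * (\<rho> / ?t)) * ennreal (norm (g \<zeta>) / cmod (\<zeta> - cis \<theta>)) \<partial>disc)"
      unfolding potential_def
    proof (intro nn_integral_mono)
      fix \<zeta> assume "\<zeta> \<in> space disc"
      then have \<zeta>: "\<zeta> \<in> udisc" by simp
      show "ennreal (norm (g \<zeta>) / cmod (\<zeta> - w)) \<le>
        ennreal (2 * M / ?t) * (indicator (ball w ?t) \<zeta> * ennreal (a \<zeta> / cmod (\<zeta> - w))) +
          ennreal ((2 * \<alpha> + 2) * (\<rho> / ?t)) * ennreal (norm (g \<zeta>) / cmod (\<zeta> - cis \<theta>))"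
      proof (cases "\<zeta> \<in> ball w ?t")
        case b: True
        have "norm (g \<zeta>) \<le> a \<zeta> * (2 * M / ?t)"
          using ga[OF \<zeta>] mult_left_mono[OF inball[OF b] a0[of \<zeta>]] by linarith
        then have "norm (g \<zeta>) / cmod (\<zeta> - w) \<le> (a \<zeta> * (2 * M / ?t)) / cmod (\<zeta> - w)"
          by (intro divide_right_mono) auto
        then have "ennreal (norm (g \<zeta>) / cmod (\<zeta> - w)) \<le> ennreal ((2 * M / ?t) * (a \<zeta> / cmod (\<zeta> - w)))"
          by (intro ennreal_leI) (simp add: mult.commute)
        also have "\<dots> = ennreal (2 * M / ?t) * (indicator (ball w ?t) \<zeta> * ennreal (a \<zeta> / cmod (\<zeta> - w)))"
          using b M0 True by (subst ennreal_mult') simp_all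
        finally show ?thesis by (rule order_trans) simp
      next
        case b: False
        then have far: "?t \<le> cmod (\<zeta> - w)" by (simp add: dist_norm norm_minus_commute)
        have "norm (g \<zeta>) * (1 / cmod (\<zeta> - w)) \<le> norm (g \<zeta>) * ((2 * \<alpha> + 2) * (\<rho> / ?t) * (1 / cmod (\<zeta> - cis \<theta>)))"
          unfolding \<rho>_def
          by (intro mult_left_mono outer_kernel_le[OF z \<alpha> _ True _ far \<zeta>])
            (use wz t\<rho> \<rho> in \<open>simp_all add: \<rho>_def[symmetric]\<close>)
        then have "ennreal (norm (g \<zeta>) / cmod (\<zeta> - w)) \<le> ennreal ((2 * \<alpha> + 2) * (\<rho> / ?t) * (norm (g \<zeta>) / cmod (\<zeta> - cis \<theta>)))"
          by (intro ennreal_leI) (simp add: mult_ac)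
        also have "\<dots> = ennreal ((2 * \<alpha> + 2) * (\<rho> / ?t)) * ennreal (norm (g \<zeta>) / cmod (\<zeta> - cis \<theta>))"
          using \<alpha> \<rho> True by (intro ennreal_mult') (intro mult_nonneg_nonneg divide_nonneg_pos, simp_all)
        finally show ?thesis by (rule order_trans) simp
      qed
    qed
    also have "\<dots> = ennreal (2 * M / ?t) * (\<integral>\<^sup>+\<zeta>. indicator (ball w ?t) \<zeta> * ennreal (a \<zeta> / cmod (\<zeta> - w)) \<partial>disc) +
          ennreal ((2 * \<alpha> + 2) * (\<rho> / ?t)) * potential (\<lambda>\<zeta>. norm (g \<zeta>)) (cis \<theta>)"
    proof -
      have [measurable]: "indicator (ball w ?t) \<in> borel_measurable disc"
        by (intro disc_measurable_borel borel_measurable_indicator) simp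
      show ?thesis unfolding potential_def by (simp add: nn_integral_add nn_integral_cmult)
    qed
    also have "\<dots> \<le> ennreal (2 * M / ?t) * ennreal (1 / 16) + ennreal ((2 * \<alpha> + 2) * (\<rho> / ?t)) * ennreal I"
      using True t\<rho> \<rho> near
      by (intro add_mono mult_left_mono I small) (simp_all add: \<rho>_def[symmetric])
    also have "\<dots> = ennreal ((2 * M / ?t) * (1 / 16) + ((2 * \<alpha> + 2) * (\<rho> / ?t)) * I)"
    proof -
      have n1: "0 \<le> 2 * M / ?t" using M0 True by simp
      have n2: "0 \<le> (2 * \<alpha> + 2) * (\<rho> / ?t)" using \<alpha> \<rho> True by (intro mult_nonneg_nonneg divide_nonneg_pos) simp_all
      show ?thesis unfolding ennreal_mult'[OF n1, symmetric] ennreal_mult'[OF n2, symmetric]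
        using I(2) by (intro ennreal_plus[symmetric] mult_nonneg_nonneg[OF n1] mult_nonneg_nonneg[OF n2]) auto
    qed
    finally have pot: "potential (\<lambda>\<zeta>. norm (g \<zeta>)) w \<le> ennreal ((2 * M / ?t) * (1 / 16) + ((2 * \<alpha> + 2) * (\<rho> / ?t)) * I)" .
    let ?R = "(2 * M / ?t) * (1 / 16) + ((2 * \<alpha> + 2) * (\<rho> / ?t)) * I"
    have R0: "0 \<le> ?R"
      using M0 True \<alpha> \<rho> I(2) by (intro add_nonneg_nonneg mult_nonneg_nonneg divide_nonneg_pos) simp_all
    have "ennreal (norm (theodorescu g w)) \<le> 4 * ennreal ?R"
      using norm_theodorescu_le[OF gm, of w] mult_left_mono[OF pot, of 4] by (rule order_trans) simp
    also have "\<dots> = ennreal (4 * ?R)" by (subst ennreal_mult') simp_all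
    finally have T: "norm (theodorescu g w) \<le> 4 * ?R" using R0 by (subst (asm) ennreal_le_iff) simp_all
    have "w \<in> stolz (2 * \<alpha> + 2) (cis \<theta>)"
      using wz by (intro ball_in_stolz[OF z _ \<alpha>]) (simp add: \<rho>_def dist_norm norm_minus_commute)
    then have "norm (\<phi> w) \<le> b + 4 * ?R"
      using rep[OF wd] Hb[of w] T norm_triangle_ineq[of "h w" "theodorescu g w"] by simp
    then have "?t * norm (\<phi> w) \<le> ?t * (b + 4 * ?R)" using True by (intro mult_left_mono) auto
    \<comment> \<open>The 1/16 was made for this place: the 4 of \<open>norm_theodorescu_le\<close>
      times 2M/16 leaves M/2, which the left-hand side absorbs.\<close>
    also have "\<dots> = ?t * b + M / 2 + 4 * (2 * \<alpha> + 2) * \<rho> * I"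
      using True by (simp add: field_simps)
    also have "\<dots> \<le> \<rho> / 2 * b + M / 2 + 4 * (2 * \<alpha> + 2) * \<rho> * I"
      using t\<rho> b0 by (intro add_right_mono mult_right_mono) auto
    finally have "M \<le> \<rho> * b + 2 * (4 * (2 * \<alpha> + 2) * \<rho> * I)" unfolding M_def by linarith
    then have "\<rho> / 2 * norm (\<phi> z) \<le> \<rho> / 2 * (2 * b + (32 * \<alpha> + 32) * I)"
      using Mz by (simp add: algebra_simps)
    then show ?thesis using \<rho> by (simp only: mult_le_cancel_left_pos half_gt_zero)
  qed
qed

text \<open>Split at the Whitney disc of \<open>Z n\<close>. Outside, \<open>outer_kernel_le\<close>
  with \<open>\<tau>\<close> the radius of that disc dominates the integrand by a multiple of
  \<open>\<gamma>\<close> over the distance to the vertex, integrable by \<open>pot\<close>; the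
  part inside tends to 0 by \<open>inner\<close>.\<close>

lemma Cauchy_integral_tendsto:
  fixes G :: "complex \<Rightarrow> complex" and \<gamma> :: "complex \<Rightarrow> real" and Z :: "nat \<Rightarrow> complex"
  assumes Gm: "G \<in> borel_measurable disc" and \<gamma>m: "\<gamma> \<in> borel_measurable disc"
    and G\<gamma>: "\<And>\<zeta>. cmod (G \<zeta>) \<le> \<gamma> \<zeta>"
    and pot: "potential \<gamma> (cis \<theta>) < top" and \<alpha>: "1 < \<alpha>"
    and Z: "\<And>n. Z n \<in> stolz \<alpha> (cis \<theta>)" and Zlim: "Z \<longlonglongrightarrow> cis \<theta>"
    and inner: "\<And>e. 0 < e \<Longrightarrow> \<forall>\<^sub>F n in sequentially.
      (\<integral>\<^sup>+\<zeta>. indicator (ball (Z n) ((1 - cmod (Z n)) / 2)) \<zeta> * ennreal (\<gamma> \<zeta> / cmod (\<zeta> - Z n)) \<partial>disc) \<le> ennreal e"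
  shows "(\<lambda>n. \<integral>\<zeta>. G \<zeta> / (\<zeta> - Z n) \<partial>disc) \<longlonglongrightarrow> (\<integral>\<zeta>. G \<zeta> / (\<zeta> - cis \<theta>) \<partial>disc)"
proof -
  have [measurable]: "G \<in> borel_measurable disc" "\<gamma> \<in> borel_measurable disc" by (rule Gm, rule \<gamma>m)
  have \<gamma>0: "0 \<le> \<gamma> \<zeta>" for \<zeta> using G\<gamma>[of \<zeta>] norm_ge_zero[of "G \<zeta>"] by linarith
  define \<rho> where "\<rho> = (\<lambda>n. (1 - cmod (Z n)) / 2)"
  define B where "B = (\<lambda>n. ball (Z n) (\<rho> n))"
  have [measurable]: "indicat_real (B n) \<in> borel_measurable disc" for n
    unfolding B_def by (intro disc_measurable_borel borel_measurable_indicator) simp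
  have Z1: "cmod (Z n) < 1" for n using Z[of n] by (simp add: stolz_def)
  have \<rho>0: "0 < \<rho> n" for n using Z1 by (simp add: \<rho>_def)
  have "(\<lambda>n. (1 - cmod (Z n)) / 2) \<longlonglongrightarrow> (1 - cmod (cis \<theta>)) / 2" by (intro tendsto_intros Zlim) simp
  then have \<rho>lim: "\<rho> \<longlonglongrightarrow> 0" by (simp add: \<rho>_def)
  define In where "In = (\<lambda>n \<zeta>. indicat_real (B n) \<zeta> *\<^sub>R (G \<zeta> / (\<zeta> - Z n)))"
  define Out where "Out = (\<lambda>n \<zeta>. (1 - indicat_real (B n) \<zeta>) *\<^sub>R (G \<zeta> / (\<zeta> - Z n)))"
  have Inm [measurable]: "In n \<in> borel_measurable disc" for n unfolding In_def by measurable
  have Outm [measurable]: "Out n \<in> borel_measurable disc" for n unfolding Out_def by measurable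
  have dom: "integrable disc (\<lambda>\<zeta>. (2 * \<alpha> + 2) * (\<gamma> \<zeta> / cmod (\<zeta> - cis \<theta>)))"
  proof (intro integrable_mult_right integrableI_bounded)
    show "(\<lambda>\<zeta>. \<gamma> \<zeta> / cmod (\<zeta> - cis \<theta>)) \<in> borel_measurable disc" by measurable
    show "(\<integral>\<^sup>+\<zeta>. ennreal (norm (\<gamma> \<zeta> / cmod (\<zeta> - cis \<theta>))) \<partial>disc) < \<infinity>"
      using pot \<gamma>0 by (simp add: potential_def)
  qed
  have Outle: "cmod (Out n \<zeta>) \<le> (2 * \<alpha> + 2) * (\<gamma> \<zeta> / cmod (\<zeta> - cis \<theta>))" if \<zeta>: "\<zeta> \<in> udisc" for n \<zeta>
  proof (cases "\<zeta> \<in> B n")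
    case True
    then show ?thesis using \<gamma>0[of \<zeta>] \<alpha> by (simp add: Out_def)
  next
    case False
    then have far: "\<rho> n \<le> cmod (\<zeta> - Z n)" by (simp add: B_def dist_norm norm_minus_commute)
    have "1 / cmod (\<zeta> - Z n) \<le> (2 * \<alpha> + 2) * ((1 - cmod (Z n)) / 2 / \<rho> n) * (1 / cmod (\<zeta> - cis \<theta>))"
      using \<rho>0[of n] far \<zeta> by (intro outer_kernel_le[OF Z \<alpha>]) (simp_all add: \<rho>_def)
    also have "(1 - cmod (Z n)) / 2 / \<rho> n = 1" using \<rho>0[of n] by (simp add: \<rho>_def)
    finally have k: "1 / cmod (\<zeta> - Z n) \<le> (2 * \<alpha> + 2) * (1 / cmod (\<zeta> - cis \<theta>))" by simp
    have "cmod (Out n \<zeta>) = cmod (G \<zeta>) * (1 / cmod (\<zeta> - Z n))" using False by (simp add: Out_def norm_divide)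
    also have "\<dots> \<le> \<gamma> \<zeta> * ((2 * \<alpha> + 2) * (1 / cmod (\<zeta> - cis \<theta>)))"
      by (intro mult_mono G\<gamma> k \<gamma>0) auto
    finally show ?thesis by (simp add: mult_ac)
  qed
  have Outint: "integrable disc (Out n)" for n
  proof (rule Bochner_Integration.integrable_bound[OF dom Outm], rule AE_I2)
    fix \<zeta> assume "\<zeta> \<in> space disc"
    then have "\<zeta> \<in> udisc" by simp
    then show "norm (Out n \<zeta>) \<le> norm ((2 * \<alpha> + 2) * (\<gamma> \<zeta> / cmod (\<zeta> - cis \<theta>)))"
      unfolding real_norm_def by (rule order_trans[OF Outle abs_ge_self])
  qed
  have Outlim: "(\<lambda>n. \<integral>\<zeta>. Out n \<zeta> \<partial>disc) \<longlonglongrightarrow> (\<integral>\<zeta>. G \<zeta> / (\<zeta> - cis \<theta>) \<partial>disc)"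
  proof (rule integral_dominated_convergence[OF _ Outm dom])
    show "(\<lambda>\<zeta>. G \<zeta> / (\<zeta> - cis \<theta>)) \<in> borel_measurable disc" by measurable
    show "AE \<zeta> in disc. norm (Out n \<zeta>) \<le> (2 * \<alpha> + 2) * (\<gamma> \<zeta> / cmod (\<zeta> - cis \<theta>))" for n
    proof (rule AE_I2)
      fix \<zeta> assume "\<zeta> \<in> space disc"
      then have "\<zeta> \<in> udisc" by simp
      then show "norm (Out n \<zeta>) \<le> (2 * \<alpha> + 2) * (\<gamma> \<zeta> / cmod (\<zeta> - cis \<theta>))" by (rule Outle)
    qed
    show "AE \<zeta> in disc. (\<lambda>n. Out n \<zeta>) \<longlonglongrightarrow> G \<zeta> / (\<zeta> - cis \<theta>)"
    proof (rule AE_I2)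
      fix \<zeta> assume "\<zeta> \<in> space disc"
      then have z1: "cmod \<zeta> < 1" by simp
      then have nz: "\<zeta> - cis \<theta> \<noteq> 0" using cis_neq[OF z1, of \<theta>] by auto
      \<comment> \<open>The Whitney discs shrink to the vertex, so a fixed \<open>\<zeta>\<close> in
        the open disc is eventually outside them.\<close>
      have l1: "(\<lambda>n. cmod (\<zeta> - Z n) - \<rho> n) \<longlonglongrightarrow> cmod (\<zeta> - cis \<theta>) - 0"
        by (intro tendsto_intros Zlim \<rho>lim)
      have "\<forall>\<^sub>F n in sequentially. 0 < cmod (\<zeta> - Z n) - \<rho> n"
        by (rule order_tendstoD(1)[OF l1]) (use nz in simp)
      then have "\<forall>\<^sub>F n in sequentially. G \<zeta> / (\<zeta> - Z n) = Out n \<zeta>"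
        by (rule eventually_mono) (simp add: Out_def B_def dist_norm norm_minus_commute)
      moreover have "(\<lambda>n. G \<zeta> / (\<zeta> - Z n)) \<longlonglongrightarrow> G \<zeta> / (\<zeta> - cis \<theta>)"
        by (intro tendsto_intros Zlim nz)
      ultimately show "(\<lambda>n. Out n \<zeta>) \<longlonglongrightarrow> G \<zeta> / (\<zeta> - cis \<theta>)" by (rule Lim_transform_eventually[rotated])
    qed
  qed
  have Inle: "(\<integral>\<^sup>+\<zeta>. ennreal (cmod (In n \<zeta>)) \<partial>disc) \<le>
      (\<integral>\<^sup>+\<zeta>. indicator (ball (Z n) ((1 - cmod (Z n)) / 2)) \<zeta> * ennreal (\<gamma> \<zeta> / cmod (\<zeta> - Z n)) \<partial>disc)" for n
  proof (intro nn_integral_mono)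
    fix \<zeta>
    have "cmod (G \<zeta>) / cmod (\<zeta> - Z n) \<le> \<gamma> \<zeta> / cmod (\<zeta> - Z n)" by (intro divide_right_mono G\<gamma>) simp
    then show "ennreal (cmod (In n \<zeta>)) \<le>
        indicator (ball (Z n) ((1 - cmod (Z n)) / 2)) \<zeta> * ennreal (\<gamma> \<zeta> / cmod (\<zeta> - Z n))"
      unfolding In_def B_def \<rho>_def
      by (cases "\<zeta> \<in> ball (Z n) ((1 - cmod (Z n)) / 2)") (simp_all add: norm_divide ennreal_leI del: mem_ball)
  qed
  have Inint: "\<forall>\<^sub>F n in sequentially. integrable disc (In n)"
    using inner[OF zero_less_one]
  proof (rule eventually_mono)
    fix n assume "(\<integral>\<^sup>+\<zeta>. indicator (ball (Z n) ((1 - cmod (Z n)) / 2)) \<zeta> * ennreal (\<gamma> \<zeta> / cmod (\<zeta> - Z n)) \<partial>disc) \<le> ennreal 1"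
    with Inle[of n] have "(\<integral>\<^sup>+\<zeta>. ennreal (cmod (In n \<zeta>)) \<partial>disc) \<le> ennreal 1" by (rule order_trans)
    then have "(\<integral>\<^sup>+\<zeta>. ennreal (cmod (In n \<zeta>)) \<partial>disc) < \<infinity>"
      unfolding infinity_ennreal_def by (rule le_less_trans[OF _ ennreal_less_top])
    then show "integrable disc (In n)" by (intro integrableI_bounded Inm)
  qed
  have Inlim: "(\<lambda>n. \<integral>\<zeta>. In n \<zeta> \<partial>disc) \<longlonglongrightarrow> 0"
  proof (rule tendstoI)
    fix e :: real assume e: "0 < e"
    show "\<forall>\<^sub>F n in sequentially. dist (\<integral>\<zeta>. In n \<zeta> \<partial>disc) 0 < e"
      using inner[OF half_gt_zero[OF e]]
    proof (rule eventually_mono)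
      fix n assume *: "(\<integral>\<^sup>+\<zeta>. indicator (ball (Z n) ((1 - cmod (Z n)) / 2)) \<zeta> * ennreal (\<gamma> \<zeta> / cmod (\<zeta> - Z n)) \<partial>disc) \<le> ennreal (e / 2)"
      have "ennreal (cmod (\<integral>\<zeta>. In n \<zeta> \<partial>disc)) \<le> ennreal (e / 2)"
        by (rule order_trans[OF Bochner_norm_le_nn order_trans[OF Inle *]])
      then have "cmod (\<integral>\<zeta>. In n \<zeta> \<partial>disc) \<le> e / 2" using e by (subst (asm) ennreal_le_iff) auto
      then show "dist (\<integral>\<zeta>. In n \<zeta> \<partial>disc) 0 < e" using e by simp
    qed
  qed
  have "\<forall>\<^sub>F n in sequentially. (\<integral>\<zeta>. In n \<zeta> \<partial>disc) + (\<integral>\<zeta>. Out n \<zeta> \<partial>disc) = (\<integral>\<zeta>. G \<zeta> / (\<zeta> - Z n) \<partial>disc)"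
    using Inint
  proof (rule eventually_mono)
    fix n assume "integrable disc (In n)"
    then have "(\<integral>\<zeta>. In n \<zeta> \<partial>disc) + (\<integral>\<zeta>. Out n \<zeta> \<partial>disc) = (\<integral>\<zeta>. In n \<zeta> + Out n \<zeta> \<partial>disc)"
      by (intro Bochner_Integration.integral_add[symmetric] Outint)
    also have "(\<lambda>\<zeta>. In n \<zeta> + Out n \<zeta>) = (\<lambda>\<zeta>. G \<zeta> / (\<zeta> - Z n))"
      unfolding In_def Out_def scaleR_add_left[symmetric] by simp
    finally show "(\<integral>\<zeta>. In n \<zeta> \<partial>disc) + (\<integral>\<zeta>. Out n \<zeta> \<partial>disc) = (\<integral>\<zeta>. G \<zeta> / (\<zeta> - Z n) \<partial>disc)" .
  qed
  moreover have "(\<lambda>n. (\<integral>\<zeta>. In n \<zeta> \<partial>disc) + (\<integral>\<zeta>. Out n \<zeta> \<partial>disc)) \<longlonglongrightarrow> 0 + (\<integral>\<zeta>. G \<zeta> / (\<zeta> - cis \<theta>) \<partial>disc)"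
    by (intro tendsto_add Inlim Outlim)
  ultimately show ?thesis unfolding add_0 by (rule Lim_transform_eventually[rotated])
qed

section \<open>Measurability, exponents and p-means on the disc\<close>

lemma loc_integrable_imp_measurable:
  fixes f :: "complex \<Rightarrow> 'a::euclidean_space"
  assumes "loc_integrable f"
  shows "f \<in> borel_measurable disc"
proof (rule measurable_piecewise_restrict[where C = "range (\<lambda>n::nat. cball 0 (1 - 1 / (real n + 1)))"])
  have sub: "cball (0::complex) (1 - 1 / (real n + 1)) \<subseteq> udisc" for n
    by auto (smt (verit) divide_pos_pos of_nat_0_le_iff)
  show "space disc \<subseteq> \<Union>(range (\<lambda>n::nat. cball 0 (1 - 1 / (real n + 1))))"
  proof
    fix z assume "z \<in> space disc"
    then have "0 < 1 - cmod z" by simp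
    then obtain n where "inverse (real (Suc n)) < 1 - cmod z" using reals_Archimedean by blast
    then have "z \<in> cball 0 (1 - 1 / (real n + 1))" by (simp add: inverse_eq_divide add.commute)
    then show "z \<in> \<Union>(range (\<lambda>n::nat. cball 0 (1 - 1 / (real n + 1))))" by blast
  qed
  show "\<Omega> \<inter> space disc \<in> sets disc" if \<Omega>: "\<Omega> \<in> range (\<lambda>n::nat. cball 0 (1 - 1 / (real n + 1)))" for \<Omega>
  proof -
    obtain n where n: "\<Omega> = cball 0 (1 - 1 / (real n + 1))" using \<Omega> by blast
    have "\<Omega> \<inter> udisc \<in> sets lebesgue" unfolding n by simp
    then show ?thesis by (simp add: sets_restrict_space_iff)
  qed
  show "f \<in> borel_measurable (restrict_space disc \<Omega>)"
    if \<Omega>: "\<Omega> \<in> range (\<lambda>n::nat. cball 0 (1 - 1 / (real n + 1)))" for \<Omega>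
  proof -
    obtain n where n: "\<Omega> = cball 0 (1 - 1 / (real n + 1))" using \<Omega> by blast
    have "integrable (lebesgue_on \<Omega>) f"
      using assms sub[of n] unfolding loc_integrable_def n by (meson compact_cball)
    then have "f \<in> borel_measurable (lebesgue_on \<Omega>)" by (rule borel_measurable_integrable)
    moreover have "restrict_space disc \<Omega> = lebesgue_on \<Omega>"
    proof -
      have "udisc \<inter> \<Omega> = \<Omega>" using sub[of n] n by blast
      then show ?thesis by (subst restrict_restrict_space) (simp_all add: n)
    qed
    ultimately show ?thesis by simp
  qed
qed simp

lemma emeasure_disc_finite: "emeasure disc (space disc) < top"
proof -
  have "udisc \<in> lmeasurable" by simp
  then interpret finite_measure disc by (rule finite_measure_lebesgue_on)
  show ?thesis using emeasure_finite by (simp add: top.not_eq_extremum[symmetric])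
qed

lemma nn_integral_powr_lower_exponent:
  fixes f :: "complex \<Rightarrow> real"
  assumes "0 < s" "s \<le> t" and f: "f \<in> borel_measurable disc" "\<And>z. 0 \<le> f z"
    and fin: "(\<integral>\<^sup>+z. ennreal (f z powr t) \<partial>disc) < top"
  shows "(\<integral>\<^sup>+z. ennreal (f z powr s) \<partial>disc) < top"
proof -
  have [measurable]: "f \<in> borel_measurable disc" by (rule f(1))
  have "(\<integral>\<^sup>+z. ennreal (f z powr s) \<partial>disc) \<le> (\<integral>\<^sup>+z. 1 + ennreal (f z powr t) \<partial>disc)"
  proof (intro nn_integral_mono)
    fix z
    have "f z powr s \<le> 1 + f z powr t"
    proof (cases "f z \<le> 1")
      case True
      then have "f z powr s \<le> 1 powr s" using f(2)[of z] assms(1) by (intro powr_mono2) auto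
      then show ?thesis by (simp add: add_increasing2)
    next
      case False
      then have "f z powr s \<le> f z powr t" using assms(2) by (intro powr_mono) auto
      then show ?thesis by simp
    qed
    then have "ennreal (f z powr s) \<le> ennreal (1 + f z powr t)" by (rule ennreal_leI)
    then show "ennreal (f z powr s) \<le> 1 + ennreal (f z powr t)" by simp
  qed
  also have "\<dots> = emeasure disc (space disc) + (\<integral>\<^sup>+z. ennreal (f z powr t) \<partial>disc)"
    by (subst nn_integral_add) simp_all
  also have "\<dots> < top" using fin emeasure_disc_finite by simp
  finally show ?thesis .
qed

lemma Lspace_nn_integral:
  assumes "f \<in> Lspace q udisc"
  shows "f \<in> borel_measurable disc" "(\<integral>\<^sup>+z. ennreal (norm (f z) powr q) \<partial>disc) < top"
proof -
  have "integrable disc (\<lambda>z. norm (f z) powr q)" using assms by (simp add: Lspace_def)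
  then have "(\<integral>\<^sup>+z. ennreal (norm (norm (f z) powr q)) \<partial>disc) < \<infinity>" unfolding integrable_iff_bounded by blast
  then show "(\<integral>\<^sup>+z. ennreal (norm (f z) powr q) \<partial>disc) < top" by simp
  show "f \<in> borel_measurable disc" using assms by (simp add: Lspace_def)
qed

lemma nn_integral_powr_add_finite:
  fixes f g :: "complex \<Rightarrow> real"
  assumes [measurable]: "f \<in> borel_measurable disc" "g \<in> borel_measurable disc"
    and f: "\<And>z. 0 \<le> f z" "(\<integral>\<^sup>+z. ennreal (f z powr q) \<partial>disc) < top"
    and g: "\<And>z. 0 \<le> g z" "(\<integral>\<^sup>+z. ennreal (g z powr q) \<partial>disc) < top" and q: "0 \<le> q"
  shows "(\<integral>\<^sup>+z. ennreal ((f z + g z) powr q) \<partial>disc) < top"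
proof -
  have "(\<integral>\<^sup>+z. ennreal ((f z + g z) powr q) \<partial>disc) \<le>
      (\<integral>\<^sup>+z. ennreal (2 powr q) * (ennreal (f z powr q) + ennreal (g z powr q)) \<partial>disc)"
  proof (intro nn_integral_mono)
    fix z
    have "ennreal ((f z + g z) powr q) \<le> ennreal (2 powr q * (f z powr q + g z powr q))"
      by (intro ennreal_leI powr_add_le f g q)
    then show "ennreal ((f z + g z) powr q) \<le> ennreal (2 powr q) * (ennreal (f z powr q) + ennreal (g z powr q))"
      by (simp add: ennreal_mult')
  qed
  also have "\<dots> = ennreal (2 powr q) * ((\<integral>\<^sup>+z. ennreal (f z powr q) \<partial>disc) + (\<integral>\<^sup>+z. ennreal (g z powr q) \<partial>disc))"
    by (simp add: nn_integral_cmult nn_integral_add)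
  also have "\<dots> < top" using f(2) g(2) by (simp add: ennreal_mult_less_top)
  finally show ?thesis .
qed

text \<open>Potential estimates start at radius 1/2; below it, \<open>F\<close> is bounded on a
  compact disc.\<close>

lemma holomorphic_circle_bounded_from_half:
  assumes hol: "F holomorphic_on udisc" and p: "0 < p"
    and C: "\<And>r. r \<in> {1/2..<1} \<Longrightarrow> (\<integral>\<^sup>+\<theta>. ennreal (cmod (F (of_real r * cis \<theta>)) powr p) \<partial>circ) \<le> ennreal C"
  shows "\<exists>K\<ge>0. \<forall>r. 0 < r \<longrightarrow> r < 1 \<longrightarrow> (\<integral>\<^sup>+\<theta>. ennreal (cmod (F (of_real r * cis \<theta>)) powr p) \<partial>circ) \<le> ennreal K"
proof -
  have "continuous_on (cball 0 (1/2)) F"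
    using hol by (intro holomorphic_on_imp_continuous_on) (rule holomorphic_on_subset, auto)
  then have "compact (F ` cball 0 (1/2))" by (intro compact_continuous_image) auto
  then obtain b where b: "\<And>z. z \<in> cball 0 (1/2) \<Longrightarrow> cmod (F z) \<le> b"
    by (meson compact_imp_bounded bounded_iff image_eqI)
  define K where "K = max (max 0 C) (2 * pi * b powr p)"
  have "(\<integral>\<^sup>+\<theta>. ennreal (cmod (F (of_real r * cis \<theta>)) powr p) \<partial>circ) \<le> ennreal K" if r: "0 < r" "r < 1" for r
  proof (cases "r < 1/2")
    case False
    then have "(\<integral>\<^sup>+\<theta>. ennreal (cmod (F (of_real r * cis \<theta>)) powr p) \<partial>circ) \<le> ennreal C" using r by (intro C) auto
    also have "\<dots> \<le> ennreal K" by (intro ennreal_leI) (simp add: K_def)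
    finally show ?thesis .
  next
    case True
    have "(\<integral>\<^sup>+\<theta>. ennreal (cmod (F (of_real r * cis \<theta>)) powr p) \<partial>circ) \<le> (\<integral>\<^sup>+\<theta>. ennreal (b powr p) \<partial>circ)"
      using r True p by (intro nn_integral_mono ennreal_leI powr_mono2 b) (auto simp: norm_mult)
    also have "\<dots> = ennreal (b powr p) * ennreal (2 * pi)" using emeasure_circ by simp
    also have "\<dots> = ennreal (2 * pi * b powr p)" by (simp add: ennreal_mult'[symmetric] mult.commute)
    also have "\<dots> \<le> ennreal K" by (intro ennreal_leI) (simp add: K_def)
    finally show ?thesis .
  qed
  then show ?thesis by (intro exI[of _ K]) (auto simp: K_def)
qed

text \<open>The data of one component: \<open>a\<close> dominates the coefficients and
  \<open>s\<close> is an integrability exponent of \<open>g\<close>, capped at 2. The product form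
  of p < s/(2 - s) covers s = 2 as well.\<close>

locale vekua_boundary =
  fixes \<phi> h g :: "complex \<Rightarrow> bicomplex" and a :: "complex \<Rightarrow> real" and p q s :: real
  assumes cont: "continuous_on udisc \<phi>" and gm: "g \<in> borel_measurable disc"
    and am: "a \<in> borel_measurable disc" and a0: "\<And>\<zeta>. 0 \<le> a \<zeta>"
    and q: "2 < q" and aq: "(\<integral>\<^sup>+\<zeta>. ennreal (a \<zeta> powr q) \<partial>disc) < top"
    and ga: "\<And>\<zeta>. \<zeta> \<in> udisc \<Longrightarrow> norm (g \<zeta>) \<le> a \<zeta> * norm (\<phi> \<zeta>)"
    and s: "1 < s" "s \<le> 2" and gs: "(\<integral>\<^sup>+\<zeta>. ennreal (norm (g \<zeta>) powr s) \<partial>disc) < top"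
    and p: "0 < p" "p * (2 - s) < s"
    and rep: "\<And>z. z \<in> udisc \<Longrightarrow> \<phi> z = h z + theodorescu g z"
    and bd: "circle_bounded p \<phi>"
    and hol1: "(\<lambda>z. cnj (bplus (h z))) holomorphic_on udisc"
    and hol2: "(\<lambda>z. bminus (h z)) holomorphic_on udisc"
begin

abbreviation pot :: "complex \<Rightarrow> ennreal" where "pot \<equiv> potential (\<lambda>\<zeta>. norm (g \<zeta>))"

lemma ngm [measurable]: "(\<lambda>\<zeta>. norm (g \<zeta>)) \<in> borel_measurable disc"
  using gm by measurable

lemma theodorescu_powr_le:
  assumes V: "\<And>i. 0 \<le> i \<Longrightarrow> ennreal i \<le> pot z \<Longrightarrow> ennreal (i powr p) \<le> V"
  shows "ennreal (norm (theodorescu g z) powr p) \<le> ennreal (4 powr p) * V"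
proof -
  define i where "i = norm (theodorescu g z) / 4"
  have i: "0 \<le> i" "norm (theodorescu g z) = 4 * i" by (simp_all add: i_def)
  have "ennreal (4 * i) \<le> 4 * pot z" using norm_theodorescu_le[OF gm, of z] i by simp
  then have "4 * ennreal i \<le> 4 * pot z" by (simp add: ennreal_mult')
  then have "ennreal i \<le> pot z" by (subst (asm) ennreal_mult_le_mult_iff) simp_all
  then have "ennreal (i powr p) \<le> V" by (rule V[OF i(1)])
  then have "ennreal (4 powr p) * ennreal (i powr p) \<le> ennreal (4 powr p) * V" by (intro mult_left_mono) auto
  then show ?thesis using i by (simp add: powr_mult ennreal_mult')
qed

text \<open>\<open>h\<close> is \<open>\<phi>\<close> minus the Theodorescu term, and both have
  bounded p-means from radius 1/2 on. It is stated for any holomorphic \<open>F\<close> below 2 |h|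
  so as to serve both idempotent components.\<close>

lemma component_bounded:
  assumes hol: "F holomorphic_on udisc" and F: "\<And>z. z \<in> udisc \<Longrightarrow> cmod (F z) \<le> 2 * norm (h z)"
  shows "\<exists>K\<ge>0. \<forall>r. 0 < r \<longrightarrow> r < 1 \<longrightarrow> (\<integral>\<^sup>+\<theta>. ennreal (cmod (F (of_real r * cis \<theta>)) powr p) \<partial>circ) \<le> ennreal K"
proof -
  obtain V C where V: "\<And>r. r \<in> {1/2..1} \<Longrightarrow> V r \<in> borel_measurable circ"
    "\<And>r. r \<in> {1/2..1} \<Longrightarrow> (\<integral>\<^sup>+\<theta>. V r \<theta> \<partial>circ) \<le> ennreal C"
    "\<And>r \<theta> i. r \<in> {1/2..1} \<Longrightarrow> 0 \<le> i \<Longrightarrow> ennreal i \<le> pot (of_real r * cis \<theta>) \<Longrightarrow> ennreal (i powr p) \<le> V r \<theta>"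
    using potential_Lp[OF ngm norm_ge_zero s gs p] by blast
  obtain D where D: "\<And>r. r \<in> {0<..<1} \<Longrightarrow> (\<integral>\<^sup>+\<theta>. ennreal (norm (\<phi> (of_real r * cis \<theta>)) powr p) \<partial>circ) \<le> ennreal D"
    using bd unfolding circle_bounded_def by blast
  show ?thesis
  proof (rule holomorphic_circle_bounded_from_half[OF hol p(1)])
    fix r :: real assume r: "r \<in> {1/2..<1}"
    have [measurable]: "V r \<in> borel_measurable circ" "(\<lambda>\<theta>. \<phi> (of_real r * cis \<theta>)) \<in> borel_measurable circ"
      using r by (auto intro!: V continuous_borel_measurable_circle cont)
    have "(\<integral>\<^sup>+\<theta>. ennreal (cmod (F (of_real r * cis \<theta>)) powr p) \<partial>circ) \<le>
        (\<integral>\<^sup>+\<theta>. ennreal (4 powr p) * (ennreal (norm (\<phi> (of_real r * cis \<theta>)) powr p) + ennreal (4 powr p) * V r \<theta>) \<partial>circ)"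
    proof (intro nn_integral_mono)
      fix \<theta>
      let ?z = "of_real r * cis \<theta>"
      have z: "?z \<in> udisc" using r by (intro circle_in_disc) auto
      have "norm (h ?z) \<le> norm (\<phi> ?z) + norm (theodorescu g ?z)"
        using norm_triangle_ineq4[of "\<phi> ?z" "theodorescu g ?z"] rep[OF z] by simp
      then have "2 * norm (h ?z) \<le> 2 * (norm (\<phi> ?z) + norm (theodorescu g ?z))" by (rule mult_left_mono) simp
      with F[OF z] have "cmod (F ?z) \<le> 2 * (norm (\<phi> ?z) + norm (theodorescu g ?z))" by (rule order_trans)
      then have "cmod (F ?z) powr p \<le> (2 * (norm (\<phi> ?z) + norm (theodorescu g ?z))) powr p"
        using p by (intro powr_mono2) auto
      also have "\<dots> = 2 powr p * (norm (\<phi> ?z) + norm (theodorescu g ?z)) powr p" by (rule powr_mult)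
      also have "\<dots> \<le> 2 powr p * (2 powr p * (norm (\<phi> ?z) powr p + norm (theodorescu g ?z) powr p))"
        using p by (intro mult_left_mono powr_add_le) auto
      also have "\<dots> = 4 powr p * (norm (\<phi> ?z) powr p + norm (theodorescu g ?z) powr p)"
      proof -
        have "(4::real) powr p = 2 powr p * 2 powr p" using powr_mult[of 2 2 p] by simp
        then show ?thesis by simp
      qed
      finally have "ennreal (cmod (F ?z) powr p) \<le> ennreal (4 powr p * (norm (\<phi> ?z) powr p + norm (theodorescu g ?z) powr p))"
        by (rule ennreal_leI)
      also have "\<dots> = ennreal (4 powr p) * (ennreal (norm (\<phi> ?z) powr p) + ennreal (norm (theodorescu g ?z) powr p))"
        by (simp add: ennreal_mult')
      also have "\<dots> \<le> ennreal (4 powr p) * (ennreal (norm (\<phi> ?z) powr p) + ennreal (4 powr p) * V r \<theta>)"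
        using r by (intro mult_left_mono add_left_mono theodorescu_powr_le V(3)) auto
      finally show "ennreal (cmod (F ?z) powr p) \<le> ennreal (4 powr p) * (ennreal (norm (\<phi> ?z) powr p) + ennreal (4 powr p) * V r \<theta>)" .
    qed
    also have "\<dots> = ennreal (4 powr p) * ((\<integral>\<^sup>+\<theta>. ennreal (norm (\<phi> (of_real r * cis \<theta>)) powr p) \<partial>circ) +
        ennreal (4 powr p) * (\<integral>\<^sup>+\<theta>. V r \<theta> \<partial>circ))"
      by (simp add: nn_integral_cmult nn_integral_add)
    also have "\<dots> \<le> ennreal (4 powr p) * (ennreal (max 0 D) + ennreal (4 powr p) * ennreal (max 0 C))"
      using r by (intro mult_left_mono add_mono order_trans[OF D] order_trans[OF V(2)] ennreal_leI) auto
    also have "\<dots> = ennreal (4 powr p * (max 0 D + 4 powr p * max 0 C))"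
      by (simp add: ennreal_mult'[symmetric] ennreal_plus[symmetric] del: ennreal_plus)
    finally show "(\<integral>\<^sup>+\<theta>. ennreal (cmod (F (of_real r * cis \<theta>)) powr p) \<partial>circ) \<le>
        ennreal (4 powr p * (max 0 D + 4 powr p * max 0 C))" .
  qed
qed

lemma small:
  assumes "0 < e"
  obtains \<rho>0 where "0 < \<rho>0" "\<And>w \<rho>. 0 < \<rho> \<Longrightarrow> \<rho> \<le> \<rho>0 \<Longrightarrow>
    (\<integral>\<^sup>+\<zeta>. indicator (ball w \<rho>) \<zeta> * ennreal (a \<zeta> / cmod (\<zeta> - w)) \<partial>disc) \<le> ennreal e"
  using small_ball_potential[OF am a0 q aq assms] by blast

text \<open>At a vertex of finite potential, \<open>local_bound\<close> bounds \<open>\<phi>\<close>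
  by some L on a wider Stolz angle near the boundary. There |g| is at most a L, and
  \<open>small_ball_potential\<close> turns this into the hypothesis \<open>inner\<close> of
  \<open>Cauchy_integral_tendsto\<close>.\<close>

lemma nt_limit:
  assumes fin: "pot (cis \<theta>) < top"
    and hb: "\<And>\<alpha>. 1 < \<alpha> \<Longrightarrow> \<exists>b. \<forall>w\<in>stolz \<alpha> (cis \<theta>). norm (h w) \<le> b"
    and l1: "has_nt_limit (\<lambda>z. cnj (bplus (h z))) \<theta> c1" and l2: "has_nt_limit (\<lambda>z. bminus (h z)) \<theta> c2"
  shows "\<exists>c. has_nt_limit \<phi> \<theta> c"
proof -
  obtain I where I: "pot (cis \<theta>) \<le> ennreal I" "0 \<le> I"
    using fin by (metis ennreal_cases less_irrefl order_refl)
  obtain \<rho>0 where \<rho>0: "0 < \<rho>0" "\<And>w \<rho>. 0 < \<rho> \<Longrightarrow> \<rho> \<le> \<rho>0 \<Longrightarrow>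
    (\<integral>\<^sup>+\<zeta>. indicator (ball w \<rho>) \<zeta> * ennreal (a \<zeta> / cmod (\<zeta> - w)) \<partial>disc) \<le> ennreal (1 / 16)"
    using small[of "1 / 16"] by auto
  define u where "u = cnj c1 + - 1 / of_real pi * (\<integral>\<zeta>. bplus (g \<zeta>) / (cnj \<zeta> - cnj (cis \<theta>)) \<partial>disc)"
  define v where "v = c2 + - 1 / of_real pi * (\<integral>\<zeta>. bminus (g \<zeta>) / (\<zeta> - cis \<theta>) \<partial>disc)"
  have "((\<lambda>z. bplus (\<phi> z)) \<longlongrightarrow> u) (at (cis \<theta>) within stolz \<alpha> (cis \<theta>)) \<and>
        ((\<lambda>z. bminus (\<phi> z)) \<longlongrightarrow> v) (at (cis \<theta>) within stolz \<alpha> (cis \<theta>))" if \<alpha>: "1 < \<alpha>" for \<alpha>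
  proof -
    \<comment> \<open>Whitney discs of points in aperture \<open>\<alpha>\<close> lie in aperture
      \<open>\<beta>\<close>; \<open>local_bound\<close> at aperture \<open>\<beta>\<close> in turn
      asks for \<open>h\<close> on aperture 2\<open>\<beta>\<close> + 2.\<close>
    define \<beta> where "\<beta> = 2 * \<alpha> + 2"
    have \<beta>: "1 < \<beta>" "1 < 2 * \<beta> + 2" using \<alpha> by (simp_all add: \<beta>_def)
    obtain b where b: "\<And>w. w \<in> stolz (2 * \<beta> + 2) (cis \<theta>) \<Longrightarrow> norm (h w) \<le> b" using hb[OF \<beta>(2)] by blast
    define L where "L = max 0 (2 * b + (32 * \<beta> + 32) * I)"
    have \<phi>L: "norm (\<phi> z) \<le> L" if "z \<in> stolz \<beta> (cis \<theta>)" "(1 - cmod z) / 2 \<le> \<rho>0" for z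
      using local_bound[OF cont gm am a0 ga rep \<rho>0(2) \<beta>(1) I b that] by (simp add: L_def)
    have key: "(\<lambda>n. bplus (\<phi> (Z n))) \<longlonglongrightarrow> u \<and> (\<lambda>n. bminus (\<phi> (Z n))) \<longlonglongrightarrow> v"
      if Z: "\<And>n. Z n \<in> stolz \<alpha> (cis \<theta>)" and Zlim: "Z \<longlonglongrightarrow> cis \<theta>" for Z
    proof -
      have Zd: "Z n \<in> udisc" for n using Z[of n] by (simp add: stolz_def)
      let ?\<rho> = "\<lambda>n. (1 - cmod (Z n)) / 2"
      have "?\<rho> \<longlonglongrightarrow> (1 - cmod (cis \<theta>)) / 2" by (intro tendsto_intros Zlim) simp
      then have \<rho>lim: "?\<rho> \<longlonglongrightarrow> 0" by simp
      have inner: "\<forall>\<^sub>F n in sequentially. (\<integral>\<^sup>+\<zeta>. indicator (ball (Z n) (?\<rho> n)) \<zeta> *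
          ennreal (2 * norm (g \<zeta>) / cmod (\<zeta> - Z n)) \<partial>disc) \<le> ennreal e" if e: "0 < e" for e
      proof -
        \<comment> \<open>The added 1 keeps the divisor positive when L = 0.\<close>
        have L1: "0 < 2 * (L + 1)" by (simp add: L_def add_nonneg_pos)
        then have e': "0 < e / (2 * (L + 1))" by (rule divide_pos_pos[OF e])
        obtain \<rho>1 where \<rho>1: "0 < \<rho>1" "\<And>w \<rho>. 0 < \<rho> \<Longrightarrow> \<rho> \<le> \<rho>1 \<Longrightarrow>
          (\<integral>\<^sup>+\<zeta>. indicator (ball w \<rho>) \<zeta> * ennreal (a \<zeta> / cmod (\<zeta> - w)) \<partial>disc) \<le> ennreal (e / (2 * (L + 1)))"
          using small_ball_potential[OF am a0 q aq e'] by blast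
        have "\<forall>\<^sub>F n in sequentially. ?\<rho> n < min \<rho>1 (\<rho>0 / 2)"
          using \<rho>lim by (rule order_tendstoD) (use \<rho>1(1) \<rho>0(1) in simp)
        then show ?thesis
        proof (rule eventually_mono)
          fix n assume n: "?\<rho> n < min \<rho>1 (\<rho>0 / 2)"
          have \<rho>n: "0 < ?\<rho> n" using Zd[of n] by simp
          have "(\<integral>\<^sup>+\<zeta>. indicator (ball (Z n) (?\<rho> n)) \<zeta> * ennreal (2 * norm (g \<zeta>) / cmod (\<zeta> - Z n)) \<partial>disc) \<le>
              (\<integral>\<^sup>+\<zeta>. ennreal (2 * (L + 1)) * (indicator (ball (Z n) (?\<rho> n)) \<zeta> * ennreal (a \<zeta> / cmod (\<zeta> - Z n))) \<partial>disc)"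
          proof (intro nn_integral_mono)
            fix \<zeta> assume "\<zeta> \<in> space disc"
            then have \<zeta>: "\<zeta> \<in> udisc" by simp
            show "indicator (ball (Z n) (?\<rho> n)) \<zeta> * ennreal (2 * norm (g \<zeta>) / cmod (\<zeta> - Z n)) \<le>
                ennreal (2 * (L + 1)) * (indicator (ball (Z n) (?\<rho> n)) \<zeta> * ennreal (a \<zeta> / cmod (\<zeta> - Z n)))"
            proof (cases "\<zeta> \<in> ball (Z n) (?\<rho> n)")
              case True
              have st: "\<zeta> \<in> stolz \<beta> (cis \<theta>)" unfolding \<beta>_def by (rule ball_in_stolz[OF Z True \<alpha>])
              have "cmod (Z n - \<zeta>) < ?\<rho> n" using True by (simp add: dist_norm)
              \<comment> \<open>Two radii for the centre and one for the disc. Together with a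
                radius below \<open>\<rho>0\<close>/2 this keeps \<open>\<zeta>\<close> in the range
                of the local bound.\<close>
              then have "1 - cmod \<zeta> < 3 * ?\<rho> n" using norm_triangle_ineq[of "Z n - \<zeta>" \<zeta>] by simp
              moreover have "?\<rho> n < \<rho>0 / 2" using n by (rule less_le_trans) (rule min.cobounded2)
              ultimately have "(1 - cmod \<zeta>) / 2 \<le> \<rho>0" using \<rho>0(1) by argo
              from \<phi>L[OF st this] have "norm (\<phi> \<zeta>) \<le> L + 1" by simp
              then have "norm (g \<zeta>) \<le> a \<zeta> * (L + 1)"
                by (rule order_trans[OF ga[OF \<zeta>] mult_left_mono[OF _ a0]])
              then have "2 * norm (g \<zeta>) / cmod (\<zeta> - Z n) \<le> (2 * (a \<zeta> * (L + 1))) / cmod (\<zeta> - Z n)"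
                by (intro divide_right_mono) auto
              then have "ennreal (2 * norm (g \<zeta>) / cmod (\<zeta> - Z n)) \<le> ennreal ((2 * (L + 1)) * (a \<zeta> / cmod (\<zeta> - Z n)))"
                by (intro ennreal_leI) (simp add: mult_ac)
              also have "\<dots> = ennreal (2 * (L + 1)) * ennreal (a \<zeta> / cmod (\<zeta> - Z n))"
                by (rule ennreal_mult'[OF less_imp_le[OF L1]])
              finally show ?thesis using True by (simp del: mem_ball)
            qed simp
          qed
          also have "\<dots> = ennreal (2 * (L + 1)) * (\<integral>\<^sup>+\<zeta>. indicator (ball (Z n) (?\<rho> n)) \<zeta> * ennreal (a \<zeta> / cmod (\<zeta> - Z n)) \<partial>disc)"
          proof (intro nn_integral_cmult)
            have [measurable]: "a \<in> borel_measurable disc" by (rule am)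
            have [measurable]: "indicator (ball (Z n) (?\<rho> n)) \<in> borel_measurable disc"
              by (intro disc_measurable_borel borel_measurable_indicator) simp
            show "(\<lambda>\<zeta>. indicator (ball (Z n) (?\<rho> n)) \<zeta> * ennreal (a \<zeta> / cmod (\<zeta> - Z n))) \<in> borel_measurable disc"
              by measurable
          qed
          also have "\<dots> \<le> ennreal (2 * (L + 1)) * ennreal (e / (2 * (L + 1)))"
            using n \<rho>n by (intro mult_left_mono \<rho>1(2)) auto
          also have "\<dots> = ennreal e" using L1 by (subst ennreal_mult'[symmetric]) auto
          finally show "(\<integral>\<^sup>+\<zeta>. indicator (ball (Z n) (?\<rho> n)) \<zeta> * ennreal (2 * norm (g \<zeta>) / cmod (\<zeta> - Z n)) \<partial>disc) \<le> ennreal e" .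
        qed
      qed
      have pot2: "potential (\<lambda>\<zeta>. 2 * norm (g \<zeta>)) (cis \<theta>) < top"
      proof -
        have "potential (\<lambda>\<zeta>. 2 * norm (g \<zeta>)) (cis \<theta>) = (\<integral>\<^sup>+\<zeta>. 2 * ennreal (norm (g \<zeta>) / cmod (\<zeta> - cis \<theta>)) \<partial>disc)"
          unfolding potential_def by (intro nn_integral_cong) (simp add: ennreal_mult'[symmetric] ennreal_numeral[symmetric] del: ennreal_numeral)
        also have "\<dots> = 2 * pot (cis \<theta>)" unfolding potential_def by (rule nn_integral_cmult) measurable
        finally show ?thesis using fin by (simp add: ennreal_mult_less_top)
      qed
      have m2: "(\<lambda>\<zeta>. 2 * norm (g \<zeta>)) \<in> borel_measurable disc" by measurable
      have bm: "(\<lambda>\<zeta>. bminus (g \<zeta>)) \<in> borel_measurable disc" "(\<lambda>\<zeta>. cnj (bplus (g \<zeta>))) \<in> borel_measurable disc"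
        using gm borel_measurable_continuous_onI[OF linear_continuous_on[OF bounded_linear_bminus]]
          borel_measurable_continuous_onI[OF linear_continuous_on[OF bounded_linear_compose[OF bounded_linear_cnj bounded_linear_bplus]]]
        by (auto intro: measurable_compose)
      have J2: "(\<lambda>n. \<integral>\<zeta>. bminus (g \<zeta>) / (\<zeta> - Z n) \<partial>disc) \<longlonglongrightarrow> (\<integral>\<zeta>. bminus (g \<zeta>) / (\<zeta> - cis \<theta>) \<partial>disc)"
        by (rule Cauchy_integral_tendsto[OF bm(1) m2 cmod_bminus_le pot2 \<alpha> Z Zlim inner])
      have cb: "cmod (cnj (bplus (g \<zeta>))) \<le> 2 * norm (g \<zeta>)" for \<zeta> using cmod_bplus_le by simp
      \<comment> \<open>The plus component has the conjugate kernel, so it is treated as the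
        conjugate of an ordinary Cauchy integral.\<close>
      have J1': "(\<lambda>n. \<integral>\<zeta>. cnj (bplus (g \<zeta>)) / (\<zeta> - Z n) \<partial>disc) \<longlonglongrightarrow> (\<integral>\<zeta>. cnj (bplus (g \<zeta>)) / (\<zeta> - cis \<theta>) \<partial>disc)"
        by (rule Cauchy_integral_tendsto[OF bm(2) m2 cb pot2 \<alpha> Z Zlim inner])
      have cnjI: "cnj (\<integral>\<zeta>. cnj (bplus (g \<zeta>)) / (\<zeta> - w) \<partial>disc) = (\<integral>\<zeta>. bplus (g \<zeta>) / (cnj \<zeta> - cnj w) \<partial>disc)" for w
        by (subst Bochner_Integration.integral_cnj[symmetric]) simp
      have J1: "(\<lambda>n. \<integral>\<zeta>. bplus (g \<zeta>) / (cnj \<zeta> - cnj (Z n)) \<partial>disc) \<longlonglongrightarrow> (\<integral>\<zeta>. bplus (g \<zeta>) / (cnj \<zeta> - cnj (cis \<theta>)) \<partial>disc)"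
        using tendsto_cnj[OF J1'] unfolding cnjI .
      have ne: "Z n \<noteq> cis \<theta>" for n using Zd[of n] by auto
      have hlim: "(\<lambda>n. F (Z n)) \<longlonglongrightarrow> c" if "has_nt_limit F \<theta> c" for F :: "complex \<Rightarrow> complex" and c
        using that \<alpha> Z Zlim ne unfolding has_nt_limit_def tendsto_at_iff_sequentially o_def by blast
      have h1: "(\<lambda>n. bplus (h (Z n))) \<longlonglongrightarrow> cnj c1" using tendsto_cnj[OF hlim[OF l1]] by simp
      have h2: "(\<lambda>n. bminus (h (Z n))) \<longlonglongrightarrow> c2" by (rule hlim[OF l2])
      have e1: "bplus (\<phi> (Z n)) = bplus (h (Z n)) + - 1 / of_real pi * (\<integral>\<zeta>. bplus (g \<zeta>) / (cnj \<zeta> - cnj (Z n)) \<partial>disc)"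
        and e2: "bminus (\<phi> (Z n)) = bminus (h (Z n)) + - 1 / of_real pi * (\<integral>\<zeta>. bminus (g \<zeta>) / (\<zeta> - Z n) \<partial>disc)" for n
        unfolding rep[OF Zd] bplus_add bminus_add theodorescu_components by (rule refl)+
      show ?thesis
        unfolding e1 e2 u_def v_def by (intro conjI tendsto_intros h1 h2 J1 J2)
    qed
    show ?thesis
      unfolding tendsto_at_iff_sequentially o_def using key by auto
  qed
  then show ?thesis
    unfolding has_nt_limit_def using tendsto_bicomplex by blast
qed

end

text \<open>Were x infinite, i = (t + 1)^(1/p) would be admissible for v = t, and its p-th power
  exceeds t.\<close>

lemma powr_all_le_imp_finite:
  fixes x v :: ennreal
  assumes le: "\<And>i. 0 \<le> i \<Longrightarrow> ennreal i \<le> x \<Longrightarrow> ennreal (i powr p) \<le> v" and p: "0 < p" and v: "v < top"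
  shows "x < top"
proof (rule ccontr)
  assume "\<not> x < top"
  then have x: "x = top" by (simp add: less_top[symmetric])
  obtain t where t: "v = ennreal t" "0 \<le> t" using v by (cases v) auto
  have "ennreal (((t + 1) powr (1 / p)) powr p) \<le> v" by (rule le) (simp_all add: x)
  then have "ennreal (t + 1) \<le> ennreal t" using p t by (simp add: powr_powr)
  then show False using t by (simp add: ennreal_le_iff2)
qed

context vekua_boundary
begin

text \<open>The nontangential majorants \<open>Q1\<close>, \<open>Q2\<close> of the components of
  \<open>h\<close> and the majorant \<open>V\<close> of the potential on the unit circle are finite
  almost everywhere. At such a vertex \<open>nt_limit\<close> applies, and
  \<open>local_bound\<close> along the radius gives a dominating function made of the same
  three.\<close>

lemma boundary:
  shows "AE \<theta> in circ. \<exists>c. has_nt_limit \<phi> \<theta> c"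
    and "\<exists>W\<in>borel_measurable circ. (\<integral>\<^sup>+\<theta>. W \<theta> \<partial>circ) < top \<and>
      (AE \<theta> in circ. \<forall>r. 0 < r \<longrightarrow> r < 1 \<longrightarrow> ennreal (norm (\<phi> (of_real r * cis \<theta>)) powr p) \<le> W \<theta>)"
proof -
  let ?F1 = "\<lambda>z. cnj (bplus (h z))" and ?F2 = "\<lambda>z. bminus (h z)"
  have c1: "cmod (?F1 z) \<le> 2 * norm (h z)" and c2: "cmod (?F2 z) \<le> 2 * norm (h z)" for z
    by (simp_all add: cmod_bplus_le cmod_bminus_le)
  obtain K1 where K1: "0 \<le> K1" "\<And>r. 0 < r \<Longrightarrow> r < 1 \<Longrightarrow> (\<integral>\<^sup>+\<theta>. ennreal (cmod (?F1 (of_real r * cis \<theta>)) powr p) \<partial>circ) \<le> ennreal K1"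
    using component_bounded[OF hol1 c1] by blast
  obtain K2 where K2: "0 \<le> K2" "\<And>r. 0 < r \<Longrightarrow> r < 1 \<Longrightarrow> (\<integral>\<^sup>+\<theta>. ennreal (cmod (?F2 (of_real r * cis \<theta>)) powr p) \<partial>circ) \<le> ennreal K2"
    using component_bounded[OF hol2 c2] by blast
  obtain Q1 where Q1 [measurable]: "Q1 \<in> borel_measurable circ" and Q1f: "(\<integral>\<^sup>+\<theta>. Q1 \<theta> \<partial>circ) < top"
    and Q1b: "\<And>\<theta> \<alpha> z. 1 < \<alpha> \<Longrightarrow> z \<in> stolz \<alpha> (cis \<theta>) \<Longrightarrow> ennreal (cmod (?F1 z) powr p / (stolz_const \<alpha>)\<^sup>2) \<le> Q1 \<theta>"
    using Hp_boundary(2)[OF hol1 p(1) K1] by blast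
  obtain Q2 where Q2 [measurable]: "Q2 \<in> borel_measurable circ" and Q2f: "(\<integral>\<^sup>+\<theta>. Q2 \<theta> \<partial>circ) < top"
    and Q2b: "\<And>\<theta> \<alpha> z. 1 < \<alpha> \<Longrightarrow> z \<in> stolz \<alpha> (cis \<theta>) \<Longrightarrow> ennreal (cmod (?F2 z) powr p / (stolz_const \<alpha>)\<^sup>2) \<le> Q2 \<theta>"
    using Hp_boundary(2)[OF hol2 p(1) K2] by blast
  obtain V' C where V': "\<And>r. r \<in> {1/2..1} \<Longrightarrow> V' r \<in> borel_measurable circ"
    "\<And>r. r \<in> {1/2..1} \<Longrightarrow> (\<integral>\<^sup>+\<theta>. V' r \<theta> \<partial>circ) \<le> ennreal C"
    "\<And>r \<theta> i. r \<in> {1/2..1} \<Longrightarrow> 0 \<le> i \<Longrightarrow> ennreal i \<le> pot (of_real r * cis \<theta>) \<Longrightarrow> ennreal (i powr p) \<le> V' r \<theta>"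
    using potential_Lp[OF ngm norm_ge_zero s gs p] by blast
  define V where "V = V' 1"
  have V [measurable]: "V \<in> borel_measurable circ" unfolding V_def by (rule V') simp
  have "(\<integral>\<^sup>+\<theta>. V \<theta> \<partial>circ) \<le> ennreal C" unfolding V_def by (rule V') simp
  then have Vf: "(\<integral>\<^sup>+\<theta>. V \<theta> \<partial>circ) < top" by (rule le_less_trans) simp
  have Vb: "ennreal (i powr p) \<le> V \<theta>" if "0 \<le> i" "ennreal i \<le> pot (cis \<theta>)" for i \<theta>
    using V'(3)[of 1 i \<theta>] that by (simp add: V_def)
  have aefin: "AE \<theta> in circ. U \<theta> \<noteq> top" if "U \<in> borel_measurable circ" "(\<integral>\<^sup>+\<theta>. U \<theta> \<partial>circ) < top" for U
    using nn_integral_PInf_AE[OF that(1)] that(2) by (simp add: infinity_ennreal_def less_top)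
  have potfin: "pot (cis \<theta>) < top" if "V \<theta> \<noteq> top" for \<theta>
    using powr_all_le_imp_finite[OF Vb p(1)] that by (simp add: less_top)
  have Fbound: "cmod y \<le> ((stolz_const \<alpha>)\<^sup>2 * enn2real q) powr (1 / p)"
    if "ennreal (cmod y powr p / (stolz_const \<alpha>)\<^sup>2) \<le> q" "q \<noteq> top" for y :: complex and \<alpha> q
  proof -
    have S: "0 < (stolz_const \<alpha>)\<^sup>2" using stolz_const_pos[of \<alpha>] by simp
    have "q = ennreal (enn2real q)" using that(2) by (simp add: less_top)
    with that(1) have "ennreal (cmod y powr p / (stolz_const \<alpha>)\<^sup>2) \<le> ennreal (enn2real q)" by simp
    then have "cmod y powr p / (stolz_const \<alpha>)\<^sup>2 \<le> enn2real q" by (simp add: ennreal_le_iff)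
    then have "cmod y powr p \<le> (stolz_const \<alpha>)\<^sup>2 * enn2real q" using S by (simp add: pos_divide_le_eq mult.commute)
    then have "(cmod y powr p) powr (1 / p) \<le> ((stolz_const \<alpha>)\<^sup>2 * enn2real q) powr (1 / p)"
      using p(1) by (intro powr_mono2) auto
    then show ?thesis using p(1) by (simp add: powr_powr)
  qed
  have hbound: "norm (h z) \<le> ((stolz_const \<alpha>)\<^sup>2 * enn2real (Q1 \<theta>)) powr (1 / p) + ((stolz_const \<alpha>)\<^sup>2 * enn2real (Q2 \<theta>)) powr (1 / p)"
    if "Q1 \<theta> \<noteq> top" "Q2 \<theta> \<noteq> top" "1 < \<alpha>" "z \<in> stolz \<alpha> (cis \<theta>)" for z \<alpha> \<theta>
  proof -
    have "norm (h z) \<le> cmod (?F1 z) + cmod (?F2 z)" using norm_bicomplex_le[of "h z"] by simp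
    also have "\<dots> \<le> ((stolz_const \<alpha>)\<^sup>2 * enn2real (Q1 \<theta>)) powr (1 / p) + ((stolz_const \<alpha>)\<^sup>2 * enn2real (Q2 \<theta>)) powr (1 / p)"
      by (rule add_mono[OF Fbound[OF Q1b[OF that(3,4)] that(1)] Fbound[OF Q2b[OF that(3,4)] that(2)]])
    finally show ?thesis .
  qed
  have l1: "AE \<theta> in circ. \<exists>c. has_nt_limit ?F1 \<theta> c" by (rule Hp_boundary(1)[OF hol1 p(1) K1])
  have l2: "AE \<theta> in circ. \<exists>c. has_nt_limit ?F2 \<theta> c" by (rule Hp_boundary(1)[OF hol2 p(1) K2])
  show "AE \<theta> in circ. \<exists>c. has_nt_limit \<phi> \<theta> c"
    using l1 l2 aefin[OF Q1 Q1f] aefin[OF Q2 Q2f] aefin[OF V Vf]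
  proof eventually_elim
    fix \<theta> assume 1: "\<exists>c. has_nt_limit ?F1 \<theta> c" and 2: "\<exists>c. has_nt_limit ?F2 \<theta> c"
      and 3: "Q1 \<theta> \<noteq> top" "Q2 \<theta> \<noteq> top" "V \<theta> \<noteq> top"
    obtain d1 d2 where d: "has_nt_limit ?F1 \<theta> d1" "has_nt_limit ?F2 \<theta> d2" using 1 2 by blast
    show "\<exists>c. has_nt_limit \<phi> \<theta> c"
    proof (rule nt_limit[OF potfin[OF 3(3)] _ d])
      fix \<alpha> :: real assume "1 < \<alpha>"
      then show "\<exists>b. \<forall>w\<in>stolz \<alpha> (cis \<theta>). norm (h w) \<le> b" using hbound[OF 3(1,2)] by blast
    qed
  qed
  obtain \<rho>0 where \<rho>0: "0 < \<rho>0" "\<And>w \<rho>. 0 < \<rho> \<Longrightarrow> \<rho> \<le> \<rho>0 \<Longrightarrow>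
    (\<integral>\<^sup>+\<zeta>. indicator (ball w \<rho>) \<zeta> * ennreal (a \<zeta> / cmod (\<zeta> - w)) \<partial>disc) \<le> ennreal (1 / 16)"
    using small[of "1 / 16"] by auto
  \<comment> \<open>Beyond radius \<open>R\<close> the nearness condition of
    \<open>local_bound\<close> holds; up to \<open>R\<close> the function is bounded on a compact,
    possibly empty disc.\<close>
  define R where "R = 1 - 2 * \<rho>0"
  have "compact (\<phi> ` cball 0 R)"
    using \<rho>0(1) by (intro compact_continuous_image continuous_on_subset[OF cont]) (auto simp: R_def)
  then obtain M where M: "\<And>z. z \<in> cball 0 R \<Longrightarrow> norm (\<phi> z) \<le> M"
    by (meson compact_imp_bounded bounded_iff image_eqI)
  \<comment> \<open>Radii lie in aperture 2, and \<open>local_bound\<close> there asks for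
    \<open>h\<close> on aperture 2 * 2 + 2.\<close>
  define S where "S = (stolz_const (2 * 2 + 2))\<^sup>2"
  have S: "0 \<le> S" by (simp add: S_def)
  \<comment> \<open>Collects the losses of \<open>powr_add_le\<close>, applied once to 2b + 96I,
    where 96 is 32 * 2 + 32, and once to the two p-th roots that make up b.\<close>
  define e1 where "e1 = 2 powr p * (2 powr p * 2 powr p * S)"
  define e2 where "e2 = 2 powr p * 96 powr p"
  have e: "0 \<le> e1" "0 \<le> e2" using S by (simp_all add: e1_def e2_def)
  define W where "W \<theta> = ennreal (M powr p) + (ennreal e1 * (Q1 \<theta> + Q2 \<theta>) + ennreal e2 * V \<theta>)" for \<theta>
  have "(\<integral>\<^sup>+\<theta>. W \<theta> \<partial>circ) = ennreal (M powr p) * emeasure circ (space circ) +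
      (ennreal e1 * ((\<integral>\<^sup>+\<theta>. Q1 \<theta> \<partial>circ) + (\<integral>\<^sup>+\<theta>. Q2 \<theta> \<partial>circ)) + ennreal e2 * (\<integral>\<^sup>+\<theta>. V \<theta> \<partial>circ))"
    unfolding W_def by (simp add: nn_integral_add nn_integral_cmult)
  also have "\<dots> < top" using Q1f Q2f Vf emeasure_circ by (simp add: ennreal_mult_less_top)
  finally have Wf: "(\<integral>\<^sup>+\<theta>. W \<theta> \<partial>circ) < top" .
  have Wb: "AE \<theta> in circ. \<forall>r. 0 < r \<longrightarrow> r < 1 \<longrightarrow> ennreal (norm (\<phi> (of_real r * cis \<theta>)) powr p) \<le> W \<theta>"
    using aefin[OF Q1 Q1f] aefin[OF Q2 Q2f] aefin[OF V Vf]
  proof eventually_elim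
    fix \<theta> assume fin: "Q1 \<theta> \<noteq> top" "Q2 \<theta> \<noteq> top" "V \<theta> \<noteq> top"
    define q1 where "q1 = enn2real (Q1 \<theta>)"
    define q2 where "q2 = enn2real (Q2 \<theta>)"
    define v where "v = enn2real (V \<theta>)"
    define I where "I = enn2real (pot (cis \<theta>))"
    have qv: "Q1 \<theta> = ennreal q1" "Q2 \<theta> = ennreal q2" "V \<theta> = ennreal v" "0 \<le> q1" "0 \<le> q2" "0 \<le> v"
      using fin by (simp_all add: q1_def q2_def v_def less_top)
    have I: "pot (cis \<theta>) = ennreal I" "0 \<le> I" using potfin[OF fin(3)] by (simp_all add: I_def)
    have "ennreal (I powr p) \<le> ennreal v" using Vb[OF I(2), of \<theta>] unfolding I(1) qv(3) by simp
    then have Iv: "I powr p \<le> v" using qv by simp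
    define b where "b = (S * q1) powr (1 / p) + (S * q2) powr (1 / p)"
    have b0: "0 \<le> b" by (simp add: b_def)
    have "b powr p \<le> 2 powr p * (((S * q1) powr (1 / p)) powr p + ((S * q2) powr (1 / p)) powr p)"
      unfolding b_def using p(1) by (intro powr_add_le) auto
    also have "\<dots> = 2 powr p * (S * q1 + S * q2)" using p(1) S qv by (simp add: powr_powr)
    finally have bp: "b powr p \<le> 2 powr p * (S * q1 + S * q2)" .
    have W: "W \<theta> = ennreal (M powr p + (e1 * (q1 + q2) + e2 * v))"
    proof -
      have "ennreal (M powr p + (e1 * (q1 + q2) + e2 * v)) = ennreal (M powr p) + ennreal (e1 * (q1 + q2) + e2 * v)"
        using e qv by (intro ennreal_plus) auto
      also have "ennreal (e1 * (q1 + q2) + e2 * v) = ennreal (e1 * (q1 + q2)) + ennreal (e2 * v)"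
        using e qv by (intro ennreal_plus) auto
      also have "\<dots> = ennreal e1 * (ennreal q1 + ennreal q2) + ennreal e2 * ennreal v"
        using e qv by (simp add: ennreal_mult' ennreal_plus)
      finally show ?thesis by (simp add: W_def qv)
    qed
    show "\<forall>r. 0 < r \<longrightarrow> r < 1 \<longrightarrow> ennreal (norm (\<phi> (of_real r * cis \<theta>)) powr p) \<le> W \<theta>"
    proof (intro allI impI)
      fix r :: real assume r: "0 < r" "r < 1"
      let ?z = "of_real r * cis \<theta>"
      have cz: "cmod ?z = r" using r by (simp add: norm_mult)
      have "norm (\<phi> ?z) powr p \<le> M powr p + (e1 * (q1 + q2) + e2 * v)"
      proof (cases "r \<le> R")
        case True
        then have "norm (\<phi> ?z) \<le> M" using cz by (intro M) simp
        then have "norm (\<phi> ?z) powr p \<le> M powr p" using p(1) by (intro powr_mono2) auto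
        moreover have "0 \<le> e1 * (q1 + q2) + e2 * v" using e qv by simp
        ultimately show ?thesis by linarith
      next
        case False
        have st: "?z \<in> stolz 2 (cis \<theta>)" using r by (intro radial_in_stolz) auto
        have near: "(1 - cmod ?z) / 2 \<le> \<rho>0" unfolding cz using False by (simp add: R_def)
        have hb: "norm (h w) \<le> b" if "w \<in> stolz (2 * 2 + 2) (cis \<theta>)" for w
          using hbound[OF fin(1,2) _ that] by (simp add: b_def S_def q1_def q2_def)
        have "norm (\<phi> ?z) \<le> 2 * b + (32 * 2 + 32) * I"
          by (rule local_bound[OF cont gm am a0 ga rep \<rho>0(2) _ _ I(2) hb st near]) (simp_all add: I(1))
        then have "norm (\<phi> ?z) \<le> 2 * b + 96 * I" by simp
        then have "norm (\<phi> ?z) powr p \<le> (2 * b + 96 * I) powr p" using p(1) by (intro powr_mono2) auto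
        also have "\<dots> \<le> 2 powr p * ((2 * b) powr p + (96 * I) powr p)" using p(1) b0 I by (intro powr_add_le) auto
        also have "\<dots> = 2 powr p * (2 powr p * b powr p + 96 powr p * I powr p)" by (simp only: powr_mult)
        also have "\<dots> \<le> 2 powr p * (2 powr p * (2 powr p * (S * q1 + S * q2)) + 96 powr p * v)"
          using bp Iv by (intro mult_left_mono add_mono) auto
        also have "\<dots> = e1 * (q1 + q2) + e2 * v" by (simp add: e1_def e2_def algebra_simps)
        finally show ?thesis using powr_ge_zero[of M p] by linarith
      qed
      then show "ennreal (norm (\<phi> ?z) powr p) \<le> W \<theta>" unfolding W by (rule ennreal_leI)
    qed
  qed
  have "W \<in> borel_measurable circ" unfolding W_def by measurable
  then show "\<exists>W\<in>borel_measurable circ. (\<integral>\<^sup>+\<theta>. W \<theta> \<partial>circ) < top \<and>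
      (AE \<theta> in circ. \<forall>r. 0 < r \<longrightarrow> r < 1 \<longrightarrow> ennreal (norm (\<phi> (of_real r * cis \<theta>)) powr p) \<le> W \<theta>)"
    using Wf Wb by blast
qed

end

section \<open>Boundary values\<close>

lemma has_nt_limit_radial:
  assumes "has_nt_limit f \<theta> c"
  shows "((\<lambda>r. f (of_real r * cis \<theta>)) \<longlongrightarrow> c) (at_left 1)"
proof -
  have f: "(f \<longlongrightarrow> c) (at (cis \<theta>) within stolz 2 (cis \<theta>))" using assms by (simp add: has_nt_limit_def)
  have ev: "\<forall>\<^sub>F r in at_left (1::real). of_real r * cis \<theta> \<in> stolz 2 (cis \<theta>) \<and> of_real r * cis \<theta> \<noteq> cis \<theta>"
    unfolding eventually_at_left_field
  proof (intro exI[of _ 0] conjI allI impI)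
    fix r :: real assume r: "0 < r" "r < 1"
    then show "of_real r * cis \<theta> \<in> stolz 2 (cis \<theta>)" by (intro radial_in_stolz) auto
    show "of_real r * cis \<theta> \<noteq> cis \<theta>" using r by simp
  qed simp
  have "((\<lambda>r. of_real r * cis \<theta>) \<longlongrightarrow> of_real 1 * cis \<theta>) (at_left (1::real))"
    by (intro tendsto_intros)
  then have "filterlim (\<lambda>r. of_real r * cis \<theta>) (at (cis \<theta>) within stolz 2 (cis \<theta>)) (at_left (1::real))"
    unfolding filterlim_at using ev by simp
  with f show ?thesis by (rule filterlim_compose)
qed

text \<open>Radii are Stolz approaches, so the nontangential limit gives pointwise convergence along
  every sequence of radii tending to 1. The limit inherits the bound \<open>W\<close>, and 2^p (W +
  W) dominates the differences.\<close>

lemma boundary_value_of_dominated_nt_limit: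
  fixes f :: "complex \<Rightarrow> bicomplex"
  assumes cont: "continuous_on udisc f" and p: "0 < p"
    and nt: "AE \<theta> in circ. \<exists>c. has_nt_limit f \<theta> c"
    and W: "W \<in> borel_measurable circ" "(\<integral>\<^sup>+\<theta>. W \<theta> \<partial>circ) < top"
    and dom: "AE \<theta> in circ. \<forall>r. 0 < r \<longrightarrow> r < 1 \<longrightarrow> ennreal (norm (f (of_real r * cis \<theta>)) powr p) \<le> W \<theta>"
  shows "\<exists>fnt. nt_boundary_value f fnt \<and> fnt \<in> Lp_circle p \<and>
    ((\<lambda>r. \<integral>\<^sup>+\<theta>. ennreal (norm (fnt (cis \<theta>) - f (of_real r * cis \<theta>)) powr p) \<partial>circ) \<longlongrightarrow> 0) (at_left 1)"
proof -
  have [measurable]: "W \<in> borel_measurable circ" by (rule W(1))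
  define R where "R m = 1 - 1 / (real m + 2)" for m
  have R: "0 < R m" "R m < 1" for m by (simp_all add: R_def)
  have Rlim: "R \<longlonglongrightarrow> 1" unfolding R_def by real_asymp
  have Rat: "filterlim R (at_left 1) sequentially"
    unfolding filterlim_at using Rlim R by (auto simp: less_imp_neq)
  \<comment> \<open>The limit along one fixed sequence of radii is measurable, and it agrees with
    the nontangential limit wherever that exists.\<close>
  define fnt where "fnt \<zeta> = lim (\<lambda>m. f (of_real (R m) * \<zeta>))" for \<zeta>
  have fm: "(\<lambda>\<theta>. f (of_real r * cis \<theta>)) \<in> borel_measurable circ" if "0 < r" "r < 1" for r
    using that by (intro continuous_borel_measurable_circle cont) auto
  have fntm [measurable]: "(\<lambda>\<theta>. fnt (cis \<theta>)) \<in> borel_measurable circ"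
    unfolding fnt_def by (intro borel_measurable_lim_metric fm R)
  have limit: "AE \<theta> in circ. has_nt_limit f \<theta> (fnt (cis \<theta>))"
    using nt
  proof (rule eventually_mono)
    fix \<theta> assume "\<exists>c. has_nt_limit f \<theta> c"
    then obtain c where c: "has_nt_limit f \<theta> c" by blast
    have "(\<lambda>m. f (of_real (R m) * cis \<theta>)) \<longlonglongrightarrow> c"
      by (rule filterlim_compose[OF has_nt_limit_radial[OF c] Rat])
    then have "fnt (cis \<theta>) = c" unfolding fnt_def by (rule limI)
    with c show "has_nt_limit f \<theta> (fnt (cis \<theta>))" by simp
  qed
  have fntW: "AE \<theta> in circ. ennreal (norm (fnt (cis \<theta>)) powr p) \<le> W \<theta>"
    using limit dom
  proof eventually_elim
    fix \<theta> assume l: "has_nt_limit f \<theta> (fnt (cis \<theta>))"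
      and d: "\<forall>r. 0 < r \<longrightarrow> r < 1 \<longrightarrow> ennreal (norm (f (of_real r * cis \<theta>)) powr p) \<le> W \<theta>"
    have "(\<lambda>m. norm (f (of_real (R m) * cis \<theta>)) powr p) \<longlonglongrightarrow> norm (fnt (cis \<theta>)) powr p"
      using p by (intro tendsto_powr' tendsto_norm tendsto_const filterlim_compose[OF has_nt_limit_radial[OF l] Rat]) auto
    then have "(\<lambda>m. ennreal (norm (f (of_real (R m) * cis \<theta>)) powr p)) \<longlonglongrightarrow> ennreal (norm (fnt (cis \<theta>)) powr p)"
      by (rule tendsto_ennrealI)
    then show "ennreal (norm (fnt (cis \<theta>)) powr p) \<le> W \<theta>"
      by (rule LIMSEQ_le_const2) (use d R in blast)
  qed
  have "nt_boundary_value f fnt"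
    unfolding nt_boundary_value_def using limit unfolding has_nt_limit_def .
  moreover have "fnt \<in> Lp_circle p"
  proof -
    have "(\<integral>\<^sup>+\<theta>. ennreal (norm (fnt (cis \<theta>)) powr p) \<partial>circ) \<le> (\<integral>\<^sup>+\<theta>. W \<theta> \<partial>circ)"
      by (rule nn_integral_mono_AE[OF fntW])
    also have "\<dots> < top" by (rule W(2))
    finally have "integrable circ (\<lambda>\<theta>. norm (fnt (cis \<theta>)) powr p)"
      by (intro integrableI_bounded) simp_all
    then show ?thesis using fntm by (simp add: Lp_circle_def Lspace_def)
  qed
  moreover have "((\<lambda>r. \<integral>\<^sup>+\<theta>. ennreal (norm (fnt (cis \<theta>) - f (of_real r * cis \<theta>)) powr p) \<partial>circ) \<longlongrightarrow> 0) (at_left 1)"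
  proof (rule tendsto_at_left_sequentially[of 0])
    fix S :: "nat \<Rightarrow> real" assume S: "\<And>m. S m < 1" "\<And>m. 0 < S m" and Slim: "S \<longlonglongrightarrow> 1"
    have Sat: "filterlim S (at_left 1) sequentially"
      unfolding filterlim_at using Slim S by (auto simp: less_imp_neq)
    have [measurable]: "(\<lambda>\<theta>. f (of_real (S m) * cis \<theta>)) \<in> borel_measurable circ" for m
      by (intro fm S)
    have "(\<lambda>m. \<integral>\<^sup>+\<theta>. ennreal (norm (fnt (cis \<theta>) - f (of_real (S m) * cis \<theta>)) powr p) \<partial>circ) \<longlonglongrightarrow> (\<integral>\<^sup>+\<theta>. 0 \<partial>circ)"
    proof (rule nn_integral_dominated_convergence[where w = "\<lambda>\<theta>. ennreal (2 powr p) * (W \<theta> + W \<theta>)"])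
      show "(\<integral>\<^sup>+\<theta>. ennreal (2 powr p) * (W \<theta> + W \<theta>) \<partial>circ) < \<infinity>"
        using W(2) by (simp add: nn_integral_cmult nn_integral_add ennreal_mult_less_top)
      show "AE \<theta> in circ. ennreal (norm (fnt (cis \<theta>) - f (of_real (S m) * cis \<theta>)) powr p) \<le> ennreal (2 powr p) * (W \<theta> + W \<theta>)" for m
        using fntW dom
      proof eventually_elim
        fix \<theta> assume 1: "ennreal (norm (fnt (cis \<theta>)) powr p) \<le> W \<theta>"
          and d: "\<forall>r. 0 < r \<longrightarrow> r < 1 \<longrightarrow> ennreal (norm (f (of_real r * cis \<theta>)) powr p) \<le> W \<theta>"
        have 2: "ennreal (norm (f (of_real (S m) * cis \<theta>)) powr p) \<le> W \<theta>" using d S by blast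
        have "norm (fnt (cis \<theta>) - f (of_real (S m) * cis \<theta>)) powr p \<le>
            (norm (fnt (cis \<theta>)) + norm (f (of_real (S m) * cis \<theta>))) powr p"
          using p by (intro powr_mono2 norm_triangle_ineq4) auto
        also have "\<dots> \<le> 2 powr p * (norm (fnt (cis \<theta>)) powr p + norm (f (of_real (S m) * cis \<theta>)) powr p)"
          using p by (intro powr_add_le) auto
        finally have "ennreal (norm (fnt (cis \<theta>) - f (of_real (S m) * cis \<theta>)) powr p) \<le>
            ennreal (2 powr p * (norm (fnt (cis \<theta>)) powr p + norm (f (of_real (S m) * cis \<theta>)) powr p))"
          by (rule ennreal_leI)
        also have "\<dots> = ennreal (2 powr p) * (ennreal (norm (fnt (cis \<theta>)) powr p) + ennreal (norm (f (of_real (S m) * cis \<theta>)) powr p))"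
          by (simp add: ennreal_mult')
        also have "\<dots> \<le> ennreal (2 powr p) * (W \<theta> + W \<theta>)" by (intro mult_left_mono add_mono 1 2) simp
        finally show "ennreal (norm (fnt (cis \<theta>) - f (of_real (S m) * cis \<theta>)) powr p) \<le> ennreal (2 powr p) * (W \<theta> + W \<theta>)" .
      qed
      show "AE \<theta> in circ. (\<lambda>m. ennreal (norm (fnt (cis \<theta>) - f (of_real (S m) * cis \<theta>)) powr p)) \<longlonglongrightarrow> 0"
        using limit
      proof (rule eventually_mono)
        fix \<theta> assume l: "has_nt_limit f \<theta> (fnt (cis \<theta>))"
        have "(\<lambda>m. norm (fnt (cis \<theta>) - f (of_real (S m) * cis \<theta>))) \<longlonglongrightarrow> norm (fnt (cis \<theta>) - fnt (cis \<theta>))"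
          by (intro tendsto_intros filterlim_compose[OF has_nt_limit_radial[OF l] Sat])
        then have "(\<lambda>m. norm (fnt (cis \<theta>) - f (of_real (S m) * cis \<theta>))) \<longlonglongrightarrow> 0" by simp
        then have "(\<lambda>m. norm (fnt (cis \<theta>) - f (of_real (S m) * cis \<theta>)) powr p) \<longlonglongrightarrow> 0"
          by (rule tendsto_zero_powrI[OF _ tendsto_const]) (use p in simp_all)
        then show "(\<lambda>m. ennreal (norm (fnt (cis \<theta>) - f (of_real (S m) * cis \<theta>)) powr p)) \<longlonglongrightarrow> 0"
          using tendsto_ennrealI by fastforce
      qed
    qed measurable
    then show "(\<lambda>m. \<integral>\<^sup>+\<theta>. ennreal (norm (fnt (cis \<theta>) - f (of_real (S m) * cis \<theta>)) powr p) \<partial>circ) \<longlonglongrightarrow> 0"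
      by simp
  qed simp
  ultimately show ?thesis by blast
qed

section \<open>From the hypotheses of the theorem to the single components and back to the
  sum\<close>

lemma Sobolev_bc_norm_powr:
  assumes "A \<in> Sobolev_bc m q" and q: "0 \<le> q"
  defines "N \<equiv> \<lambda>z. cmod (bc1 (A z)) + cmod (bc2 (A z))"
  shows "N \<in> borel_measurable disc" "(\<integral>\<^sup>+z. ennreal (N z powr q) \<partial>disc) < top"
proof -
  have L: "(\<lambda>z. bc1 (A z)) \<in> Lspace q udisc" "(\<lambda>z. bc2 (A z)) \<in> Lspace q udisc"
    using assms(1) by (simp_all add: Sobolev_bc_def Sobolev_def)
  note M = L[THEN Lspace_nn_integral(1)]
  have cM: "(\<lambda>z. cmod (bc1 (A z))) \<in> borel_measurable disc" "(\<lambda>z. cmod (bc2 (A z))) \<in> borel_measurable disc"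
    using M by measurable
  then show "N \<in> borel_measurable disc" unfolding N_def by measurable
  show "(\<integral>\<^sup>+z. ennreal (N z powr q) \<partial>disc) < top"
    unfolding N_def
    by (rule nn_integral_powr_add_finite[OF cM norm_ge_zero L(1)[THEN Lspace_nn_integral(2)] norm_ge_zero L(2)[THEN Lspace_nn_integral(2)] q])
qed

lemma vekua_component_boundary:
  assumes A: "A \<in> Sobolev_bc m q" and B: "B \<in> Sobolev_bc m q" and q: "2 < q"
    and \<phi>: "\<phi> \<in> H_AB A B" and bd: "circle_bounded p \<phi>" and p: "0 < p"
    and d: "has_weak_dbar \<phi> d" "d \<in> Lspace t udisc"
    and t: "2 < t \<or> (1 < t \<and> t \<le> 2 \<and> ereal p < crit_exponent t)"
    and h: "h \<in> Hol_bc"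
    and rep: "\<And>z. z \<in> udisc \<Longrightarrow> \<phi> z = h z + theodorescu (\<lambda>\<zeta>. A \<zeta> * \<phi> \<zeta> + B \<zeta> * bconj (\<phi> \<zeta>)) z"
  shows "AE \<theta> in circ. \<exists>c. has_nt_limit \<phi> \<theta> c"
    and "\<exists>W\<in>borel_measurable circ. (\<integral>\<^sup>+\<theta>. W \<theta> \<partial>circ) < top \<and>
      (AE \<theta> in circ. \<forall>r. 0 < r \<longrightarrow> r < 1 \<longrightarrow> ennreal (norm (\<phi> (of_real r * cis \<theta>)) powr p) \<le> W \<theta>)"
proof -
  define g where "g = (\<lambda>\<zeta>. A \<zeta> * \<phi> \<zeta> + B \<zeta> * bconj (\<phi> \<zeta>))"
  define N where "N C z = cmod (bc1 (C z)) + cmod (bc2 (C z))" for C and z :: complex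
  \<comment> \<open>The 8 is the constant of \<open>norm_bicomplex_mult_le\<close>.\<close>
  define a where "a = (\<lambda>z. 8 * (N A z + N B z))"
  \<comment> \<open>On a set of finite measure L^t lies in L^s. For t >= 2 the exponent becomes 2,
    where the condition on p reads 0 < 2.\<close>
  define s where "s = min t 2"
  have cont: "continuous_on udisc \<phi>" and g: "has_weak_dbar \<phi> g"
    using \<phi> by (simp_all add: H_AB_def g_def)
  have gm: "g \<in> borel_measurable disc" by (rule loc_integrable_imp_measurable[OF has_weak_CR_D(2)[OF g]])
  have Nm: "N A \<in> borel_measurable disc" "N B \<in> borel_measurable disc"
    and Nf: "(\<integral>\<^sup>+z. ennreal (N A z powr q) \<partial>disc) < top" "(\<integral>\<^sup>+z. ennreal (N B z powr q) \<partial>disc) < top"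
    using Sobolev_bc_norm_powr[OF A] Sobolev_bc_norm_powr[OF B] q by (simp_all add: N_def[abs_def])
  have N0: "0 \<le> N C z" for C z by (simp add: N_def)
  have am: "a \<in> borel_measurable disc" unfolding a_def using Nm by measurable
  have aq: "(\<integral>\<^sup>+z. ennreal (a z powr q) \<partial>disc) < top"
  proof -
    have [measurable]: "N A \<in> borel_measurable disc" "N B \<in> borel_measurable disc" by (rule Nm)+
    have "(\<integral>\<^sup>+z. ennreal (a z powr q) \<partial>disc) = (\<integral>\<^sup>+z. ennreal (8 powr q) * ennreal ((N A z + N B z) powr q) \<partial>disc)"
      unfolding a_def powr_mult by (intro nn_integral_cong ennreal_mult') simp
    also have "\<dots> = ennreal (8 powr q) * (\<integral>\<^sup>+z. ennreal ((N A z + N B z) powr q) \<partial>disc)"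
      by (rule nn_integral_cmult) measurable
    also have "\<dots> < top"
      using nn_integral_powr_add_finite[OF Nm(1) Nm(2) N0 Nf(1) N0 Nf(2)] q by (simp add: ennreal_mult_less_top)
    finally show ?thesis .
  qed
  have ga: "norm (g \<zeta>) \<le> a \<zeta> * norm (\<phi> \<zeta>)" for \<zeta>
  proof -
    have nN: "norm (C \<zeta>) \<le> N C \<zeta>" for C unfolding N_def by (rule norm_bicomplex_le_bc)
    have "norm (A \<zeta> * \<phi> \<zeta>) \<le> 8 * (N A \<zeta> * norm (\<phi> \<zeta>))"
      by (rule order_trans[OF norm_bicomplex_mult_le]) (intro mult_left_mono mult_right_mono nN, simp_all)
    moreover have "norm (B \<zeta> * bconj (\<phi> \<zeta>)) \<le> 8 * (N B \<zeta> * norm (\<phi> \<zeta>))"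
      unfolding norm_bconj[of "\<phi> \<zeta>", symmetric]
      by (rule order_trans[OF norm_bicomplex_mult_le]) (intro mult_left_mono mult_right_mono nN, simp_all)
    ultimately have "norm (g \<zeta>) \<le> 8 * (N A \<zeta> * norm (\<phi> \<zeta>)) + 8 * (N B \<zeta> * norm (\<phi> \<zeta>))"
      unfolding g_def by (rule norm_triangle_mono)
    then show ?thesis by (simp add: a_def algebra_simps)
  qed
  have s: "1 < s" "s \<le> 2" "s \<le> t" using t by (auto simp: s_def)
  have ps: "p * (2 - s) < s"
  proof (cases "t < 2")
    case True
    then have "ereal p < ereal (t / (2 - t))" using t by (simp add: crit_exponent_def)
    then have "p < t / (2 - t)" by simp
    then have "p * (2 - t) < t" using True by (simp add: pos_less_divide_eq)
    then show ?thesis using True by (simp add: s_def)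
  qed (simp add: s_def)
  have gs: "(\<integral>\<^sup>+\<zeta>. ennreal (norm (g \<zeta>) powr s) \<partial>disc) < top"
  proof -
    have dm: "d \<in> borel_measurable disc" and df: "(\<integral>\<^sup>+z. ennreal (norm (d z) powr t) \<partial>disc) < top"
      by (rule Lspace_nn_integral[OF d(2)])+
    \<comment> \<open>\<open>g\<close> is the weak derivative prescribed by the equation and
      \<open>d\<close> the one assumed in L^t; uniqueness transfers the integrability.\<close>
    have "AE z in disc. g z = d z" by (rule has_weak_CR_unique[OF g d(1)])
    then have "AE z in disc. ennreal (norm (g z) powr s) = ennreal (norm (d z) powr s)"
      by (rule eventually_mono) simp
    then have "(\<integral>\<^sup>+z. ennreal (norm (g z) powr s) \<partial>disc) = (\<integral>\<^sup>+z. ennreal (norm (d z) powr s) \<partial>disc)"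
      by (rule nn_integral_cong_AE)
    also have "\<dots> < top"
      by (rule nn_integral_powr_lower_exponent[OF _ s(3) measurable_compose[OF dm borel_measurable_norm] norm_ge_zero df]) (use s in simp)
    finally show ?thesis .
  qed
  interpret vekua_boundary \<phi> h g a p q s
    by unfold_locales
      (rule cont gm am q aq ga s gs p ps bd Hol_bc_components[OF h] rep[folded g_def]
        | simp add: a_def N0 | assumption)+
  show "AE \<theta> in circ. \<exists>c. has_nt_limit \<phi> \<theta> c"
    "\<exists>W\<in>borel_measurable circ. (\<integral>\<^sup>+\<theta>. W \<theta> \<partial>circ) < top \<and>
      (AE \<theta> in circ. \<forall>r. 0 < r \<longrightarrow> r < 1 \<longrightarrow> ennreal (norm (\<phi> (of_real r * cis \<theta>)) powr p) \<le> W \<theta>)"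
    by (rule boundary)+
qed

text \<open>Comparison with the largest summand, which works for p < 1 too.\<close>

lemma norm_sum_powr_le:
  fixes x :: "nat \<Rightarrow> 'a::real_normed_vector"
  assumes p: "0 < p" and n: "0 < n"
  shows "norm (\<Sum>k<n. x k) powr p \<le> real n powr p * (\<Sum>k<n. norm (x k) powr p)"
proof -
  let ?X = "(\<lambda>k. norm (x k)) ` {..<n}"
  have "Max ?X \<in> ?X" by (rule Max_in) (use n in auto)
  then obtain j where j: "j < n" "Max ?X = norm (x j)" by auto
  have m: "norm (x k) \<le> norm (x j)" if "k < n" for k
    unfolding j(2)[symmetric] using that by (intro Max_ge) auto
  have "norm (\<Sum>k<n. x k) \<le> (\<Sum>k<n. norm (x j))" by (rule order_trans[OF norm_sum sum_mono]) (simp add: m)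
  then have "norm (\<Sum>k<n. x k) \<le> real n * norm (x j)" by simp
  then have "norm (\<Sum>k<n. x k) powr p \<le> (real n * norm (x j)) powr p" using p by (intro powr_mono2) auto
  also have "\<dots> = real n powr p * norm (x j) powr p" by (rule powr_mult)
  also have "\<dots> \<le> real n powr p * (\<Sum>k<n. norm (x k) powr p)"
    by (intro mult_left_mono member_le_sum[of j "{..<n}" "\<lambda>k. norm (x k) powr p"]) (use j in auto)
  finally show ?thesis .
qed

theorem theorem6p11:
  fixes n :: nat and p q :: real
    and A B f :: "complex \<Rightarrow> bicomplex"
    and \<phi> h :: "nat \<Rightarrow> complex \<Rightarrow> bicomplex"
    and \<gamma> :: "nat \<Rightarrow> complex \<Rightarrow> complex"
    and qs \<sigma> :: "nat \<Rightarrow> real"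
  assumes "n \<ge> 1" and "0 < p" and "q > 2"
    and "A \<in> Sobolev_bc (n - 1) q" and "B \<in> Sobolev_bc (n - 1) q"
    and "f \<in> V_AB n p A B"
    and "\<And>z. z \<in> udisc \<Longrightarrow> f z = (\<Sum>k<n. (bchat (cnj z) + bchat z) ^ k * \<phi> k z)"
    and "\<And>k. k < n \<Longrightarrow> \<phi> k \<in> H_AB A B"
    and "\<And>k. k < n \<Longrightarrow> \<exists>d. has_weak_dbar (\<phi> k) d \<and> d \<in> Lspace (qs k) udisc"
    and "\<And>k. k < n \<Longrightarrow> 2 < qs k \<or> (1 < qs k \<and> qs k \<le> 2 \<and> ereal p < crit_exponent (qs k))"
    and "\<And>k. k < n \<Longrightarrow> h k \<in> Hol_bc"
    and "\<And>k z. k < n \<Longrightarrow> z \<in> udisc \<Longrightarrow>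
           \<phi> k z = h k z + theodorescu (\<lambda>\<zeta>. A \<zeta> * \<phi> k \<zeta> + B \<zeta> * bconj (\<phi> k \<zeta>)) z"
    and "\<And>k. k < n \<Longrightarrow> \<gamma> k \<in> Lspace (\<sigma> k) udisc"
    and "\<And>k. k < n \<Longrightarrow> 2 < \<sigma> k \<or> (1 < \<sigma> k \<and> \<sigma> k \<le> 2 \<and> ereal p < crit_exponent (\<sigma> k))"
    and "\<And>k. k < n \<Longrightarrow> (\<lambda>z. bplus (h k z)) \<in> H_gamma p (\<gamma> k)"
  shows "\<exists>fnt. nt_boundary_value f fnt \<and> fnt \<in> Lp_circle p \<and>
    ((\<lambda>r. \<integral>\<^sup>+\<theta>. ennreal (norm (fnt (cis \<theta>) - f (of_real r * cis \<theta>)) powr p)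
             \<partial>lebesgue_on {0..2*pi}) \<longlongrightarrow> 0) (at_left 1)"
proof -
  note n = \<open>n \<ge> 1\<close> and p = \<open>0 < p\<close>
  have f: "f z = (\<Sum>k<n. (2 * Re z) ^ k *\<^sub>R \<phi> k z)" if "z \<in> udisc" for z
    using assms(7)[OF that] by (simp only: bchat_add_bchat_cnj of_real_power_mult)
  have bd: "circle_bounded p (\<phi> k)" if "k < n" for k
    by (rule V_AB_components_circle_bounded[OF assms(6) p assms(7,8) that])
  have nt: "AE \<theta> in circ. \<exists>c. has_nt_limit (\<phi> k) \<theta> c"
    and dom: "\<exists>W\<in>borel_measurable circ. (\<integral>\<^sup>+\<theta>. W \<theta> \<partial>circ) < top \<and>
      (AE \<theta> in circ. \<forall>r. 0 < r \<longrightarrow> r < 1 \<longrightarrow> ennreal (norm (\<phi> k (of_real r * cis \<theta>)) powr p) \<le> W \<theta>)"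
    if k: "k < n" for k
  proof -
    obtain d where d: "has_weak_dbar (\<phi> k) d" "d \<in> Lspace (qs k) udisc" using assms(9)[OF k] by blast
    show "AE \<theta> in circ. \<exists>c. has_nt_limit (\<phi> k) \<theta> c"
      by (rule vekua_component_boundary(1)[OF assms(4,5,3) assms(8)[OF k] bd[OF k] p d assms(10)[OF k] assms(11)[OF k] assms(12)[OF k]])
    show "\<exists>W\<in>borel_measurable circ. (\<integral>\<^sup>+\<theta>. W \<theta> \<partial>circ) < top \<and>
      (AE \<theta> in circ. \<forall>r. 0 < r \<longrightarrow> r < 1 \<longrightarrow> ennreal (norm (\<phi> k (of_real r * cis \<theta>)) powr p) \<le> W \<theta>)"
      by (rule vekua_component_boundary(2)[OF assms(4,5,3) assms(8)[OF k] bd[OF k] p d assms(10)[OF k] assms(11)[OF k] assms(12)[OF k]])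
  qed
  have contf: "continuous_on udisc f"
  proof -
    have "continuous_on udisc (\<phi> k)" if "k < n" for k using assms(8)[OF that] by (simp add: H_AB_def)
    then have "continuous_on udisc (\<lambda>z. \<Sum>k<n. (2 * Re z) ^ k *\<^sub>R \<phi> k z)" by (intro continuous_intros) auto
    then show ?thesis by (rule continuous_on_eq) (rule f[symmetric])
  qed
  have ntf: "AE \<theta> in circ. \<exists>c. has_nt_limit f \<theta> c"
  proof -
    have "AE \<theta> in circ. \<forall>k\<in>{..<n}. \<exists>c. has_nt_limit (\<phi> k) \<theta> c"
      by (rule AE_finite_allI) (simp_all add: nt)
    then show ?thesis
    proof (rule eventually_mono)
      fix \<theta> assume "\<forall>k\<in>{..<n}. \<exists>c. has_nt_limit (\<phi> k) \<theta> c"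
      then obtain c where c: "\<And>k. k < n \<Longrightarrow> has_nt_limit (\<phi> k) \<theta> (c k)" by (metis lessThan_iff)
      have "has_nt_limit f \<theta> (\<Sum>k<n. (2 * Re (cis \<theta>)) ^ k *\<^sub>R c k)"
        unfolding has_nt_limit_def
      proof (intro allI impI)
        fix \<alpha> :: real assume \<alpha>: "1 < \<alpha>"
        have c': "(\<phi> k \<longlongrightarrow> c k) (at (cis \<theta>) within stolz \<alpha> (cis \<theta>))" if "k < n" for k
          using c[OF that] \<alpha> by (simp add: has_nt_limit_def)
        have "((\<lambda>z. \<Sum>k<n. (2 * Re z) ^ k *\<^sub>R \<phi> k z) \<longlongrightarrow> (\<Sum>k<n. (2 * Re (cis \<theta>)) ^ k *\<^sub>R c k))
            (at (cis \<theta>) within stolz \<alpha> (cis \<theta>))"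
          by (intro tendsto_sum tendsto_scaleR tendsto_power tendsto_mult tendsto_const tendsto_Re tendsto_ident_at c') simp
        moreover have "\<forall>\<^sub>F z in at (cis \<theta>) within stolz \<alpha> (cis \<theta>). (\<Sum>k<n. (2 * Re z) ^ k *\<^sub>R \<phi> k z) = f z"
          unfolding eventually_at_filter by (rule always_eventually) (simp add: stolz_def f)
        ultimately show "(f \<longlongrightarrow> (\<Sum>k<n. (2 * Re (cis \<theta>)) ^ k *\<^sub>R c k)) (at (cis \<theta>) within stolz \<alpha> (cis \<theta>))"
          by (rule Lim_transform_eventually)
      qed
      then show "\<exists>c. has_nt_limit f \<theta> c" by blast
    qed
  qed
  obtain W where W: "\<And>k. k < n \<Longrightarrow> W k \<in> borel_measurable circ" "\<And>k. k < n \<Longrightarrow> (\<integral>\<^sup>+\<theta>. W k \<theta> \<partial>circ) < top"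
    "\<And>k. k < n \<Longrightarrow> AE \<theta> in circ. \<forall>r. 0 < r \<longrightarrow> r < 1 \<longrightarrow> ennreal (norm (\<phi> k (of_real r * cis \<theta>)) powr p) \<le> W k \<theta>"
  proof -
    have "\<forall>k\<in>{..<n}. \<exists>W. W \<in> borel_measurable circ \<and> (\<integral>\<^sup>+\<theta>. W \<theta> \<partial>circ) < top \<and>
      (AE \<theta> in circ. \<forall>r. 0 < r \<longrightarrow> r < 1 \<longrightarrow> ennreal (norm (\<phi> k (of_real r * cis \<theta>)) powr p) \<le> W \<theta>)"
      using dom by (simp add: Bex_def)
    from bchoice[OF this] show thesis using that by auto
  qed
  \<comment> \<open>On the disc |2 Re z| is at most 2, whence the factors (2^k)^p; the factor n^p
    comes from \<open>norm_sum_powr_le\<close>.\<close>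
  define U where "U \<theta> = ennreal (real n powr p) * (\<Sum>k<n. ennreal ((2 ^ k) powr p) * W k \<theta>)" for \<theta>
  have Um: "U \<in> borel_measurable circ"
    unfolding U_def by (intro borel_measurable_times_ennreal borel_measurable_sum borel_measurable_const W(1)) simp
  have Uf: "(\<integral>\<^sup>+\<theta>. U \<theta> \<partial>circ) < top"
  proof -
    have "(\<integral>\<^sup>+\<theta>. U \<theta> \<partial>circ) = ennreal (real n powr p) * (\<integral>\<^sup>+\<theta>. (\<Sum>k<n. ennreal ((2 ^ k) powr p) * W k \<theta>) \<partial>circ)"
      unfolding U_def
      by (intro nn_integral_cmult borel_measurable_sum borel_measurable_times_ennreal borel_measurable_const W(1)) simp
    also have "(\<integral>\<^sup>+\<theta>. (\<Sum>k<n. ennreal ((2 ^ k) powr p) * W k \<theta>) \<partial>circ) = (\<Sum>k<n. \<integral>\<^sup>+\<theta>. ennreal ((2 ^ k) powr p) * W k \<theta> \<partial>circ)"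
      by (intro nn_integral_sum borel_measurable_times_ennreal borel_measurable_const W(1)) simp
    also have "\<dots> = (\<Sum>k<n. ennreal ((2 ^ k) powr p) * (\<integral>\<^sup>+\<theta>. W k \<theta> \<partial>circ))"
      by (intro sum.cong refl nn_integral_cmult W(1)) simp
    also have "ennreal (real n powr p) * \<dots> < top"
      using W(2) by (simp add: ennreal_mult_less_top)
    finally show ?thesis .
  qed
  have Ub: "AE \<theta> in circ. \<forall>r. 0 < r \<longrightarrow> r < 1 \<longrightarrow> ennreal (norm (f (of_real r * cis \<theta>)) powr p) \<le> U \<theta>"
  proof -
    have "AE \<theta> in circ. \<forall>k\<in>{..<n}. \<forall>r. 0 < r \<longrightarrow> r < 1 \<longrightarrow> ennreal (norm (\<phi> k (of_real r * cis \<theta>)) powr p) \<le> W k \<theta>"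
      by (rule AE_finite_allI) (simp_all add: W(3))
    then show ?thesis
    proof (rule eventually_mono, intro allI impI)
      fix \<theta> r :: real
      assume *: "\<forall>k\<in>{..<n}. \<forall>r. 0 < r \<longrightarrow> r < 1 \<longrightarrow> ennreal (norm (\<phi> k (of_real r * cis \<theta>)) powr p) \<le> W k \<theta>"
        and r: "0 < r" "r < 1"
      let ?z = "of_real r * cis \<theta>"
      have zd: "?z \<in> udisc" using r by (intro circle_in_disc) auto
      have "norm (f ?z) powr p \<le> real n powr p * (\<Sum>k<n. norm ((2 * Re ?z) ^ k *\<^sub>R \<phi> k ?z) powr p)"
        unfolding f[OF zd] using n by (intro norm_sum_powr_le p) simp
      also have "\<dots> \<le> real n powr p * (\<Sum>k<n. (2 ^ k) powr p * norm (\<phi> k ?z) powr p)"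
      proof (intro mult_left_mono sum_mono)
        fix k
        have "\<bar>2 * Re ?z\<bar> \<le> 2" using abs_Re_le_cmod[of ?z] zd by simp
        then have "\<bar>2 * Re ?z\<bar> ^ k \<le> 2 ^ k" by (rule power_mono) simp
        then have "norm ((2 * Re ?z) ^ k *\<^sub>R \<phi> k ?z) \<le> 2 ^ k * norm (\<phi> k ?z)"
          unfolding norm_scaleR power_abs by (rule mult_right_mono) simp
        then have "norm ((2 * Re ?z) ^ k *\<^sub>R \<phi> k ?z) powr p \<le> (2 ^ k * norm (\<phi> k ?z)) powr p"
          using p by (intro powr_mono2) auto
        then show "norm ((2 * Re ?z) ^ k *\<^sub>R \<phi> k ?z) powr p \<le> (2 ^ k) powr p * norm (\<phi> k ?z) powr p"
          by (simp only: powr_mult)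
      qed simp
      finally have "ennreal (norm (f ?z) powr p) \<le> ennreal (real n powr p * (\<Sum>k<n. (2 ^ k) powr p * norm (\<phi> k ?z) powr p))"
        by (rule ennreal_leI)
      also have "\<dots> = ennreal (real n powr p) * (\<Sum>k<n. ennreal ((2 ^ k) powr p) * ennreal (norm (\<phi> k ?z) powr p))"
        by (simp add: ennreal_mult' sum_nonneg sum_ennreal[symmetric])
      also have "\<dots> \<le> U \<theta>"
        unfolding U_def using * r by (intro mult_left_mono sum_mono) auto
      finally show "ennreal (norm (f ?z) powr p) \<le> U \<theta>" .
    qed
  qed
  show ?thesis
    by (rule boundary_value_of_dominated_nt_limit[OF contf p ntf Um Uf Ub])
qed

end
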